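(* Let $\mathfrak g=\mathfrak{osp}(m|2n)$ with $m-2n>2$, and let $\mathfrak K\subset\mathcal U(\mathfrak g)$ be a two-sided ideal of infinite codimension whose associated graded ideal $\mathrm{gr}(\mathfrak K)\subset S(\mathfrak g)=\odot\mathfrak g$ satisfies $$\big(\mathrm{gr}(\mathfrak K)\cap\odot^2\mathfrak g\big)\oplus(\mathfrak g\circledcirc_1\mathfrak g)=\odot^2\mathfrak g.$$ Then $\mathfrak K=\mathfrak J^1$, the Joseph ideal of $\mathfrak{osp}(m|2n)$.
   Context: Conventions: $\mathbb C^{m|2n}$ with parity $[a]=0$ for $a\le m$, $[a]=1$ otherwise; orthosymplectic metric $g_{ab}$ (invertible, $g_{ab}=0$ if $[a]\ne[b]$, $g_{ba}=(-1)^{[a][b]}g_{ab}$), $g^{ab}=g_{ab}$, indices raised/lowered by $V_a=\sum_bg_{ab}V^b$, $V^c=\sum_ag^{ac}V_a$; $M=m-2n$; standing assumption $m>4$, $n>1$. $\mathfrak g=\mathfrak{osp}(m|2n)$ is identified with tensors $A^{ab}=-(-1)^{[a][b]}A^{ba}$ with invariant form $\langle U,V\rangle=\sum_{a,b}U_{ab}V^{ba}$; $\mathfrak g\otimes\mathfrak g$ with tensors $T^{abcd}$ super-antisymmetric in $(a,b)$ and $(c,d)$; $\odot^2\mathfrak g=\mathfrak g\odot\mathfrak g$ (resp. $\mathfrak g\wedge\mathfrak g$) are those with $T^{abcd}=\pm(-1)^{([a]+[b])([c]+[d])}T^{cdab}$. Define $q(V)^{abcd}=\frac13\big(V^{abcd}+(-1)^{[a]([b]+[c])}V^{bcad}-(-1)^{[b][c]}V^{acbd}\big)$,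 $\phi(X)^{abcd}=\frac14\big(g^{bc}X^{ad}-(-1)^{[a][b]}g^{ac}X^{bd}-(-1)^{[c][d]}g^{bd}X^{ac}+(-1)^{[a][b]+[c][d]}g^{ad}X^{bc}\big)$. The first Cartan product is $\mathfrak g\circledcirc_1\mathfrak g=\{V\in\mathfrak g\odot\mathfrak g:\sum_{b,c}g_{bc}V^{acbd}=0,\ q(V)=0\}$, and $\mathfrak g\otimes\mathfrak g=(\mathfrak g\circledcirc_1\mathfrak g)\oplus\mathrm{Im}(q)\oplus\phi(\mathbb C^{m|2n}\odot\mathbb C^{m|2n})\oplus(\mathfrak g\wedge\mathfrak g)$; $X\circledcirc_1Y$ is the component of $X\otimes Y$ in the first summand. The Joseph ideal $\mathfrak J^1\subset\mathcal U(\mathfrak g)$ is the two-sided ideal generated by $XY+(-1)^{|X||Y|}YX-2X\circledcirc_1Y-2\lambda\langle X,Y\rangle$, $X,Y\in\mathfrak g$, with $\lambda=-\frac{M-4}{4(M-1)}$. $\mathrm{gr}(\mathfrak K)$ is taken with respect to the PBW filtration, identifying $\mathrm{gr}\,\mathcal U(\mathfrak g)$ with the supersymmetric algebra $S(\mathfrak g)$. *)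

theory Defs
  imports Complex_Main
begin

text \<open>
Conventions.  Indices of the super vector space C^(m|2n) are 0,...,N-1 with N = m + 2n
(a 0-based shift of the paper's 1,...,m+2n); index a is even iff a < m.
Tensors are functions nat => ... => complex, required to vanish outside indices < N.
\<close>

definition dimN :: "nat \<Rightarrow> nat \<Rightarrow> nat" where
  "dimN m n = m + 2 * n"

definition par :: "nat \<Rightarrow> nat \<Rightarrow> bool" where
  "par m a = (m \<le> a)"

definition sgn_b :: "bool \<Rightarrow> complex" where
  "sgn_b p = (if p then -1 else 1)"

type_synonym tensor2 = "nat \<Rightarrow> nat \<Rightarrow> complex"
type_synonym tensor4 = "nat \<Rightarrow> nat \<Rightarrow> nat \<Rightarrow> nat \<Rightarrow> complex"

definition supp2 :: "nat \<Rightarrow> tensor2 \<Rightarrow> bool" where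
  "supp2 N A = (\<forall>a b. (N \<le> a \<or> N \<le> b) \<longrightarrow> A a b = 0)"

definition supp4 :: "nat \<Rightarrow> tensor4 \<Rightarrow> bool" where
  "supp4 N T = (\<forall>a b c d. (N \<le> a \<or> N \<le> b \<or> N \<le> c \<or> N \<le> d) \<longrightarrow> T a b c d = 0)"

text \<open>Orthosymplectic metric: even, super-symmetric, and g^{ab} = g_{ab} is the inverse
  used for raising indices, i.e. sum_a g_{ac} g_{ab} = delta_{bc}.\<close>
definition osp_metric :: "nat \<Rightarrow> nat \<Rightarrow> tensor2 \<Rightarrow> bool" where
  "osp_metric m n gm \<longleftrightarrow>
     supp2 (dimN m n) gm \<and>
     (\<forall>a b. par m a \<noteq> par m b \<longrightarrow> gm a b = 0) \<and>
     (\<forall>a b. gm b a = sgn_b (par m a \<and> par m b) * gm a b) \<and>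
     (\<forall>b c. b < dimN m n \<longrightarrow> c < dimN m n \<longrightarrow>
        (\<Sum>a<dimN m n. gm a c * gm a b) = (if b = c then 1 else 0))"

definition osp :: "nat \<Rightarrow> nat \<Rightarrow> tensor2 set" where
  "osp m n = {A. supp2 (dimN m n) A \<and>
     (\<forall>a b. A a b = - sgn_b (par m a \<and> par m b) * A b a)}"

definition homog :: "nat \<Rightarrow> tensor2 \<Rightarrow> bool \<Rightarrow> bool" where
  "homog m A p = (\<forall>a b. A a b \<noteq> 0 \<longrightarrow> (par m a \<noteq> par m b) = p)"

text \<open>Super bracket of homogeneous elements A, B; the argument p is |A||B|.\<close>
definition osp_bracket :: "nat \<Rightarrow> nat \<Rightarrow> tensor2 \<Rightarrow> bool \<Rightarrow> tensor2 \<Rightarrow> tensor2 \<Rightarrow> tensor2" where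
  "osp_bracket m n gm p A B = (\<lambda>a b. \<Sum>c<dimN m n. \<Sum>e<dimN m n.
       A a c * gm e c * B e b - sgn_b p * B a c * gm e c * A e b)"

definition inv_form :: "nat \<Rightarrow> nat \<Rightarrow> tensor2 \<Rightarrow> tensor2 \<Rightarrow> tensor2 \<Rightarrow> complex" where
  "inv_form m n gm U V = (\<Sum>a<dimN m n. \<Sum>b<dimN m n.
       (\<Sum>c<dimN m n. \<Sum>d<dimN m n. gm a c * gm b d * U c d) * V b a)"

definition sym_vec :: "nat \<Rightarrow> nat \<Rightarrow> tensor2 set" where
  "sym_vec m n = {X. supp2 (dimN m n) X \<and>
     (\<forall>a b. X a b = sgn_b (par m a \<and> par m b) * X b a)}"

definition tens :: "tensor2 \<Rightarrow> tensor2 \<Rightarrow> tensor4" where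
  "tens X Y = (\<lambda>a b c d. X a b * Y c d)"

definition sym2g :: "nat \<Rightarrow> nat \<Rightarrow> tensor4 set" where
  "sym2g m n = {T. supp4 (dimN m n) T \<and>
     (\<forall>a b c d. T a b c d = - sgn_b (par m a \<and> par m b) * T b a c d) \<and>
     (\<forall>a b c d. T a b c d = - sgn_b (par m c \<and> par m d) * T a b d c) \<and>
     (\<forall>a b c d. T a b c d =
        sgn_b ((par m a \<noteq> par m b) \<and> (par m c \<noteq> par m d)) * T c d a b)}"

definition wedge2g :: "nat \<Rightarrow> nat \<Rightarrow> tensor4 set" where
  "wedge2g m n = {T. supp4 (dimN m n) T \<and>
     (\<forall>a b c d. T a b c d = - sgn_b (par m a \<and> par m b) * T b a c d) \<and>
     (\<forall>a b c d. T a b c d = - sgn_b (par m c \<and> par m d) * T a b d c) \<and>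
     (\<forall>a b c d. T a b c d =
        - sgn_b ((par m a \<noteq> par m b) \<and> (par m c \<noteq> par m d)) * T c d a b)}"

definition qmap :: "nat \<Rightarrow> tensor4 \<Rightarrow> tensor4" where
  "qmap m V = (\<lambda>a b c d. (V a b c d
       + sgn_b (par m a \<and> (par m b \<noteq> par m c)) * V b c a d
       - sgn_b (par m b \<and> par m c) * V a c b d) / 3)"

definition phimap :: "nat \<Rightarrow> tensor2 \<Rightarrow> tensor2 \<Rightarrow> tensor4" where
  "phimap m gm X = (\<lambda>a b c d. (gm b c * X a d
       - sgn_b (par m a \<and> par m b) * gm a c * X b d
       - sgn_b (par m c \<and> par m d) * gm b d * X a c
       + sgn_b (par m a \<and> par m b) * sgn_b (par m c \<and> par m d) * gm a d * X b c) / 4)"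

definition zero4 :: tensor4 where
  "zero4 = (\<lambda>a b c d. 0)"

definition cartan1 :: "nat \<Rightarrow> nat \<Rightarrow> tensor2 \<Rightarrow> tensor4 set" where
  "cartan1 m n gm = {V \<in> sym2g m n.
     (\<forall>a d. (\<Sum>b<dimN m n. \<Sum>c<dimN m n. gm b c * V a c b d) = 0) \<and> qmap m V = zero4}"

text \<open>X (c)_1 Y: component of X tensor Y in the first summand of
  g(x)g = (g (c)_1 g) + Im(q) + phi(C sym C) + (g wedge g).\<close>
definition cartan_prod :: "nat \<Rightarrow> nat \<Rightarrow> tensor2 \<Rightarrow> tensor2 \<Rightarrow> tensor2 \<Rightarrow> tensor4" where
  "cartan_prod m n gm X Y = (THE V. V \<in> cartan1 m n gm \<and>
     (\<exists>Q \<in> qmap m ` sym2g m n. \<exists>P \<in> phimap m gm ` sym_vec m n. \<exists>Z \<in> wedge2g m n.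
        tens X Y = (\<lambda>a b c d. V a b c d + Q a b c d + P a b c d + Z a b c d)))"

subsection \<open>Tensor algebra T(W), W = C^(m|2n) (x) C^(m|2n), with generators E^{ab}\<close>

type_synonym talg = "(nat \<times> nat) list \<Rightarrow> complex"

definition talg_carrier :: "nat \<Rightarrow> talg set" where
  "talg_carrier N = {f. finite {w. f w \<noteq> 0} \<and>
     (\<forall>w. f w \<noteq> 0 \<longrightarrow> (\<forall>x \<in> set w. fst x < N \<and> snd x < N))}"

definition tmul :: "talg \<Rightarrow> talg \<Rightarrow> talg" where
  "tmul f h = (\<lambda>w. \<Sum>i\<le>length w. f (take i w) * h (drop i w))"

definition tadd :: "talg \<Rightarrow> talg \<Rightarrow> talg" where
  "tadd f h = (\<lambda>w. f w + h w)"

definition tsc :: "complex \<Rightarrow> talg \<Rightarrow> talg" where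
  "tsc c f = (\<lambda>w. c * f w)"

definition tconst :: "complex \<Rightarrow> talg" where
  "tconst c = (\<lambda>w. if w = [] then c else 0)"

definition emb1 :: "tensor2 \<Rightarrow> talg" where
  "emb1 A = (\<lambda>w. if length w = 1 then A (fst (w ! 0)) (snd (w ! 0)) else 0)"

definition emb2 :: "tensor4 \<Rightarrow> talg" where
  "emb2 T = (\<lambda>w. if length w = 2
      then T (fst (w ! 0)) (snd (w ! 0)) (fst (w ! 1)) (snd (w ! 1)) else 0)"

definition is_tideal :: "nat \<Rightarrow> talg set \<Rightarrow> bool" where
  "is_tideal N I \<longleftrightarrow> I \<subseteq> talg_carrier N \<and> (\<lambda>w. 0) \<in> I \<and>
     (\<forall>x \<in> I. \<forall>y \<in> I. tadd x y \<in> I) \<and> (\<forall>c. \<forall>x \<in> I. tsc c x \<in> I) \<and>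
     (\<forall>x \<in> I. \<forall>r \<in> talg_carrier N. tmul r x \<in> I \<and> tmul x r \<in> I)"

definition tideal_gen :: "nat \<Rightarrow> talg set \<Rightarrow> talg set" where
  "tideal_gen N S = \<Inter> {I. is_tideal N I \<and> S \<subseteq> I}"

definition cspan :: "talg set \<Rightarrow> talg set" where
  "cspan F = {f. \<exists>c. f = (\<lambda>w. \<Sum>x\<in>F. c x * x w)}"

definition inf_codim :: "nat \<Rightarrow> talg set \<Rightarrow> bool" where
  "inf_codim N K \<longleftrightarrow> \<not> (\<exists>F. finite F \<and> F \<subseteq> talg_carrier N \<and>
      (\<forall>x \<in> talg_carrier N. \<exists>y \<in> cspan F. \<exists>k \<in> K. x = tadd y k))"

text \<open>Generators of the ideal J0 with U(g) = T(W)/J0: kill the complement (super-symmetric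
  2-tensors) of g in W, and impose XY - (-1)^{|X||Y|} YX = [X,Y].\<close>
definition U_rels :: "nat \<Rightarrow> nat \<Rightarrow> tensor2 \<Rightarrow> talg set" where
  "U_rels m n gm = emb1 ` sym_vec m n \<union>
     {(\<lambda>w. emb2 (tens X Y) w - sgn_b (p \<and> p') * emb2 (tens Y X) w
            - emb1 (osp_bracket m n gm (p \<and> p') X Y) w) | X Y p p'.
        X \<in> osp m n \<and> Y \<in> osp m n \<and> homog m X p \<and> homog m Y p'}"

definition lam :: "nat \<Rightarrow> nat \<Rightarrow> complex" where
  "lam m n = - (of_int (int m - 2 * int n) - 4) / (4 * (of_int (int m - 2 * int n) - 1))"

definition joseph_gens :: "nat \<Rightarrow> nat \<Rightarrow> tensor2 \<Rightarrow> talg set" where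
  "joseph_gens m n gm =
     {(\<lambda>w. emb2 (tens X Y) w + sgn_b (p \<and> p') * emb2 (tens Y X) w
            - 2 * emb2 (cartan_prod m n gm X Y) w
            - 2 * lam m n * inv_form m n gm X Y * tconst 1 w) | X Y p p'.
        X \<in> osp m n \<and> Y \<in> osp m n \<and> homog m X p \<and> homog m Y p'}"

text \<open>Preimage in T(W) of the Joseph ideal J^1 of U(g).\<close>
definition joseph_T :: "nat \<Rightarrow> nat \<Rightarrow> tensor2 \<Rightarrow> talg set" where
  "joseph_T m n gm = tideal_gen (dimN m n) (U_rels m n gm \<union> joseph_gens m n gm)"

text \<open>PBW filtration degree and principal symbol in degree 2, valued in g sym g = S^2(g).\<close>
definition deg_le :: "nat \<Rightarrow> talg \<Rightarrow> bool" where
  "deg_le k f = (\<forall>w. f w \<noteq> 0 \<longrightarrow> length w \<le> k)"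

definition symbol2 :: "nat \<Rightarrow> talg \<Rightarrow> tensor4" where
  "symbol2 m f = (let T = (\<lambda>a b c d. f [(a, b), (c, d)]);
       s = (\<lambda>a b. sgn_b (par m a \<and> par m b));
       P = (\<lambda>a b c d. (T a b c d - s a b * T b a c d - s c d * T a b d c
                        + s a b * s c d * T b a d c) / 4)
     in (\<lambda>a b c d. (P a b c d
          + sgn_b ((par m a \<noteq> par m b) \<and> (par m c \<noteq> par m d)) * P c d a b) / 2))"

text \<open>gr(K) \<inter> sym^2 g for the ideal of U(g) whose preimage in T(W) is K.\<close>
definition gr2 :: "nat \<Rightarrow> talg set \<Rightarrow> tensor4 set" where
  "gr2 m K = symbol2 m ` {f \<in> K. deg_le 2 f}"

end

theory Submission
  imports Defs "HOL-Library.Poly_Mapping"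
begin

text \<open>
  Ideals of the enveloping algebra are treated through their preimages in the free algebra on the
  letters \<open>E a b\<close>; they are stable under the adjoint derivations and under the parity automorphism.
  After a linear change of basis the even part of the metric has two hyperbolic pairs, and \<open>z = E 0 1\<close>
  is a highest root vector.  Let \<open>I\<close> be the homogeneous ideal of the supersymmetric algebra generated by
  the Pluecker type relations \<open>PL\<close> (the image of \<open>q\<close>) and the traces \<open>TR\<close> (the image of \<open>\<phi>\<close>).

  Every subspace that contains \<open>I\<close>, is stable under the derivations and contains \<open>z ^ l\<close> contains all
  elements of degree \<open>l\<close>.  Dually, a homogeneous element all of whose derivatives pair to zero with
  \<open>z ^ l\<close> lies in \<open>I\<close>.  Since \<open>2 l\<close> applications of the derivation of \<open>z\<close> map an element of degree \<open>l\<close> to its pairing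
  with \<open>z ^ l\<close> times \<open>z ^ l\<close>, an ideal without \<open>z ^ l\<close> has all its leading terms of degree \<open>l\<close> in \<open>I\<close>.

  The hypothesis on the graded ideal gives lifts of \<open>PL\<close> and \<open>TR\<close> in the ideal \<open>K\<close>, and weight
  considerations force the lower order terms to be \<open>0\<close> and \<open>(M - 4) g\<close>, so \<open>K\<close> contains the Joseph ideal \<open>J\<close>.
  If some \<open>z ^ l\<close> were in \<open>K\<close>, then \<open>K\<close> would have finite codimension; hence all leading terms of \<open>K\<close> lie
  in \<open>I\<close>, whose elements lift to \<open>J\<close>, and \<open>K = J\<close> by induction on the degree.
\<close>

text \<open>Finite-dimensional modules over \<open>osp(m|2n)\<close> need not be completely
  reducible, so the graded algebra cannot be split into irreducible pieces. Two facts replace this: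
  a power of \<open>z\<close> generates everything modulo \<open>I\<close>, and the invariant
  pairing is nondegenerate. If an element is written as \<open>i + u\<close> with \<open>i\<close>
  in \<open>I\<close> and \<open>u\<close> in the cyclic module, orthogonality forces
  \<open>u = 0\<close>. The condition \<open>M > 2\<close> keeps the coefficients
  \<open>M - 4 + 2 * k\<close> and \<open>M - 3 + 2 * k\<close> with \<open>k \<ge> 1\<close>
  nonzero, and makes \<open>M - 2\<close> and \<open>M - 1\<close> invertible in the projection to
  the Cartan product. With \<open>n > 1\<close> it gives \<open>m \<ge> 7\<close>: besides two
  hyperbolic pairs there remain three orthonormal even vectors, and one of them avoids any two given
  indices. Weights alone only show that the traces are a constant times the metric; the value of the
  constant is found by multiplying a Pluecker relation by one more letter. A two-sided ideal is not
  assumed to be graded by parity, yet odd derivations preserve it only up to the parity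
  automorphism. The integral weights of an even element detect parity and remove this
  obstacle.\<close>

instantiation list :: (type) monoid_add
begin
definition zero_list :: "'a list" where "zero_list = []"
definition plus_list :: "'a list \<Rightarrow> 'a list \<Rightarrow> 'a list" where "plus_list = (@)"
instance by standard (simp_all add: zero_list_def plus_list_def)
end

type_synonym word = "(nat \<times> nat) list"
text \<open>With concatenation as the addition of \<open>word\<close>, the convolution product of
  polynomial mappings makes this type the free associative algebra, with the empty word as unit.
  Letters range over all pairs of naturals, which keeps index conditions out of the ring
  structure.\<close>

type_synonym fr = "word \<Rightarrow>\<^sub>0 complex"

abbreviation lk :: "fr \<Rightarrow> word \<Rightarrow> complex" where "lk \<equiv> Poly_Mapping.lookup"
abbreviation ks :: "fr \<Rightarrow> word set" where "ks \<equiv> Poly_Mapping.keys"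
abbreviation cst :: "complex \<Rightarrow> fr" where "cst c \<equiv> Poly_Mapping.single 0 c"
definition wd :: "word \<Rightarrow> fr" where "wd w = Poly_Mapping.single w 1"
definition sm :: "complex \<Rightarrow> fr \<Rightarrow> fr" (infixr "\<cdot>" 75) where "sm c f = cst c * f"
definition E :: "nat \<Rightarrow> nat \<Rightarrow> fr" where "E a b = wd [(a,b)]"

lemma lookup_sm [simp]: "lk (c \<cdot> f) w = c * lk f w"
  unfolding sm_def by (simp add: Poly_Mapping.map.rep_eq when_def flip: mult_map_scale_conv_mult)

lemma wd_mult: "wd u * wd v = wd (u @ v)"
  by (simp add: wd_def mult_single plus_list_def)
lemma wd_Nil [simp]: "wd [] = 1"
  by (simp add: wd_def flip: zero_list_def)
lemma wd_Cons: "wd ((a,b) # w) = E a b * wd w"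
  by (simp add: E_def wd_mult)
lemma lookup_wd: "lk (wd u) w = (if u = w then 1 else 0)"
  by (simp add: wd_def lookup_single when_def)

lemmas lk_simps = lookup_add lookup_minus lookup_uminus lookup_sm lookup_sum

interpretation fr: vector_space sm
  by unfold_locales (simp_all add: poly_mapping_eq_iff fun_eq_iff lookup_add algebra_simps)

lemma fr_decomp: "f = (\<Sum>w\<in>ks f. lk f w \<cdot> wd w)"
proof (rule poly_mapping_eqI)
  fix u
  have "(\<Sum>w\<in>ks f. lk f w * lk (wd w) u) = (\<Sum>w\<in>ks f. if w = u then lk f w else 0)"
    by (rule sum.cong) (auto simp: lookup_wd)
  also have "\<dots> = lk f u" by (simp add: in_keys_iff)
  finally show "lk f u = lk (\<Sum>w\<in>ks f. lk f w \<cdot> wd w) u" by (simp add: lookup_sum)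
qed

lemma fr_induct [case_names zero wd add]:
  assumes "P 0" "\<And>c w. P (c \<cdot> wd w)" "\<And>f g. P f \<Longrightarrow> P g \<Longrightarrow> P (f + g)"
  shows "P f"
proof -
  have "finite A \<Longrightarrow> P (\<Sum>w\<in>A. lk f w \<cdot> wd w)" for A
    by (induction A rule: finite_induct) (auto intro: assms)
  then show ?thesis by (metis finite_keys fr_decomp)
qed

lemma cst_comm: "x * cst c = cst c * (x::fr)"
proof (induction x rule: fr_induct)
  case (wd d w) then show ?case
    by (simp add: sm_def wd_def mult_single plus_list_def zero_list_def mult.commute)
qed (simp_all add: distrib_left distrib_right)

lemma sm_mult_left [simp]: "(c \<cdot> x) * y = c \<cdot> (x * y)"
  by (simp add: sm_def mult.assoc)
lemma sm_mult_right [simp]: "x * (c \<cdot> y) = c \<cdot> (x * y)"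
  by (metis (no_types) sm_def cst_comm mult.assoc)
lemma cst_sm: "cst c = c \<cdot> 1" by (simp add: sm_def)

definition flin :: "(fr \<Rightarrow> fr) \<Rightarrow> bool" where
  "flin F \<longleftrightarrow> (\<forall>f g. F (f + g) = F f + F g) \<and> (\<forall>c f. F (c \<cdot> f) = c \<cdot> F f)"

lemma flinD:
  assumes "flin F"
  shows "F (f + g) = F f + F g" "F (c \<cdot> f) = c \<cdot> F f" "F 0 = 0" "F (- f) = - F f" "F (f - g) = F f - F g"
proof -
  have a: "F (f + g) = F f + F g" for f g using assms by (auto simp: flin_def)
  have c: "F (c \<cdot> f) = c \<cdot> F f" for c f using assms by (auto simp: flin_def)
  have m: "F (- f) = - F f" for f using c[of "-1" f] by simp
  show "F (f + g) = F f + F g" "F (c \<cdot> f) = c \<cdot> F f" by (rule a c)+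
  show "F 0 = 0" using c[of 0 0] by simp
  show "F (- f) = - F f" by (rule m)
  show "F (f - g) = F f - F g" using a[of f "-g"] m by simp
qed

lemma flin_sum: "flin F \<Longrightarrow> F (\<Sum>x\<in>A. f x) = (\<Sum>x\<in>A. F (f x))"
  by (induction A rule: infinite_finite_induct) (auto simp: flinD)

lemma flin_eqI:
  assumes "flin F" "flin G" "\<And>w. F (wd w) = G (wd w)" shows "F f = G f"
  by (induction f rule: fr_induct) (auto simp: flinD[OF assms(1)] flinD[OF assms(2)] assms(3))

definition lin :: "(word \<Rightarrow> fr) \<Rightarrow> fr \<Rightarrow> fr" where
  "lin \<phi> f = (\<Sum>w\<in>ks f. lk f w \<cdot> \<phi> w)"

lemma lin_superset: "finite A \<Longrightarrow> ks f \<subseteq> A \<Longrightarrow> lin \<phi> f = (\<Sum>w\<in>A. lk f w \<cdot> \<phi> w)"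
  unfolding lin_def by (rule sum.mono_neutral_left) (auto simp: in_keys_iff)

lemma flin_lin: "flin (lin \<phi>)"
  unfolding flin_def
proof safe
  fix f g :: fr and c
  let ?A = "ks f \<union> ks g \<union> ks (f + g)"
  have "lin \<phi> f = (\<Sum>w\<in>?A. lk f w \<cdot> \<phi> w)" "lin \<phi> g = (\<Sum>w\<in>?A. lk g w \<cdot> \<phi> w)"
    "lin \<phi> (f + g) = (\<Sum>w\<in>?A. lk (f + g) w \<cdot> \<phi> w)" by (rule lin_superset; auto)+
  then show "lin \<phi> (f + g) = lin \<phi> f + lin \<phi> g"
    by (simp add: lookup_add fr.scale_left_distrib sum.distrib)
  have "lin \<phi> (c \<cdot> f) = (\<Sum>w\<in>ks f. lk (c \<cdot> f) w \<cdot> \<phi> w)"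
    by (rule lin_superset) (auto simp: in_keys_iff)
  then show "lin \<phi> (c \<cdot> f) = c \<cdot> lin \<phi> f"
    by (simp add: lin_def fr.scale_sum_right)
qed

lemma lin_wd [simp]: "lin \<phi> (wd w) = \<phi> w"
  by (simp add: lin_def wd_def)

lemma flin_mult: "flin (\<lambda>f. x * f)" "flin (\<lambda>f. f * x)" "flin (\<lambda>f. c \<cdot> f)"
  by (auto simp: flin_def distrib_left distrib_right fr.scale_right_distrib mult.commute)
lemma flin_comp: "flin F \<Longrightarrow> flin G \<Longrightarrow> flin (\<lambda>f. F (G f))" by (simp add: flin_def)
lemma flin_add: "flin F \<Longrightarrow> flin G \<Longrightarrow> flin (\<lambda>f. F f + G f)"
  by (simp add: flin_def fr.scale_right_distrib algebra_simps)
lemma flin_id: "flin (\<lambda>f. f)" by (simp add: flin_def)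

subsection \<open>Ideals, subspaces and the word-length grading\<close>

definition ideal :: "fr set \<Rightarrow> bool" where
  "ideal L \<longleftrightarrow> 0 \<in> L \<and> (\<forall>x\<in>L. \<forall>y\<in>L. x + y \<in> L) \<and> (\<forall>r. \<forall>x\<in>L. r * x \<in> L \<and> x * r \<in> L)"
definition subsp :: "fr set \<Rightarrow> bool" where
  "subsp S \<longleftrightarrow> 0 \<in> S \<and> (\<forall>x\<in>S. \<forall>y\<in>S. x + y \<in> S) \<and> (\<forall>c. \<forall>x\<in>S. c \<cdot> x \<in> S)"

lemma ideal_subsp: "ideal L \<Longrightarrow> subsp L" by (simp add: ideal_def subsp_def sm_def)
lemma idealD: "ideal L \<Longrightarrow> x \<in> L \<Longrightarrow> r * x \<in> L" "ideal L \<Longrightarrow> x \<in> L \<Longrightarrow> x * r \<in> L"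
  by (auto simp: ideal_def)
lemma subsp_0: "subsp S \<Longrightarrow> 0 \<in> S" by (simp add: subsp_def)
lemma subsp_add: "subsp S \<Longrightarrow> x \<in> S \<Longrightarrow> y \<in> S \<Longrightarrow> x + y \<in> S" by (simp add: subsp_def)
lemma subsp_sm: "subsp S \<Longrightarrow> x \<in> S \<Longrightarrow> c \<cdot> x \<in> S" by (simp add: subsp_def)
lemma subsp_neg: "subsp S \<Longrightarrow> x \<in> S \<Longrightarrow> - x \<in> S" using subsp_sm[of S x "-1"] by simp
lemma subsp_diff: "subsp S \<Longrightarrow> x \<in> S \<Longrightarrow> y \<in> S \<Longrightarrow> x - y \<in> S"
  using subsp_add[of S x "-y"] subsp_neg[of S y] by simp
lemma subsp_sum: "subsp S \<Longrightarrow> (\<And>x. x \<in> A \<Longrightarrow> f x \<in> S) \<Longrightarrow> sum f A \<in> S"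
  by (induction A rule: infinite_finite_induct) (auto intro: subsp_0 subsp_add)
lemma subsp_sm_iff: "subsp S \<Longrightarrow> c \<noteq> 0 \<Longrightarrow> c \<cdot> x \<in> S \<longleftrightarrow> x \<in> S"
  using subsp_sm[of S "c \<cdot> x" "inverse c"] subsp_sm[of S x c] by auto

lemma subsp_cong: "subsp S \<Longrightarrow> x - y \<in> S \<Longrightarrow> x \<in> S \<longleftrightarrow> y \<in> S"
  by (metis add_diff_cancel_left' diff_add_cancel subsp_add subsp_diff)

definition tp :: "nat \<Rightarrow> fr \<Rightarrow> fr" where "tp l = lin (\<lambda>w. if length w = l then wd w else 0)"
text \<open>The bound is strict: \<open>Dlt 0\<close> means zero, which starts the inductions on the
  degree, and \<open>Dlt l\<close> describes exactly what may be added below a leading term of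
  degree \<open>l\<close>.\<close>

definition Dlt :: "nat \<Rightarrow> fr \<Rightarrow> bool" where "Dlt l f \<longleftrightarrow> (\<forall>w. lk f w \<noteq> 0 \<longrightarrow> length w < l)"

lemma flin_tp: "flin (tp l)" unfolding tp_def by (rule flin_lin)
lemma tp_wd: "tp l (wd w) = (if length w = l then wd w else 0)" by (simp add: tp_def)
lemma lk_top: "lk (tp l f) w = (if length w = l then lk f w else 0)"
  by (induction f rule: fr_induct) (auto simp: flinD[OF flin_tp] lookup_add tp_wd lookup_wd)
lemma Dlt_0 [simp]: "Dlt l 0" by (simp add: Dlt_def)
lemma Dlt_add: "Dlt l f \<Longrightarrow> Dlt l g \<Longrightarrow> Dlt l (f + g)"
  unfolding Dlt_def lookup_add by (metis add.right_neutral)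
lemma Dlt_sm: "Dlt l f \<Longrightarrow> Dlt l (c \<cdot> f)" by (auto simp: Dlt_def)
lemma Dlt_mono: "Dlt l f \<Longrightarrow> l \<le> k \<Longrightarrow> Dlt k f" by (force simp: Dlt_def)
lemma Dlt_wd: "length w < l \<Longrightarrow> Dlt l (wd w)" by (auto simp: Dlt_def lookup_wd)
lemma Dlt_neg: "Dlt l f \<Longrightarrow> Dlt l (- f)" by (auto simp: Dlt_def)
lemma Dlt_diff: "Dlt l f \<Longrightarrow> Dlt l g \<Longrightarrow> Dlt l (f - g)"
  using Dlt_add[of l f "- g"] Dlt_neg[of l g] by simp
lemma Dlt_zeroD: "Dlt 0 f \<Longrightarrow> f = 0" by (auto simp: Dlt_def intro: poly_mapping_eqI)
lemma Dlt_sum: "(\<And>x. x \<in> A \<Longrightarrow> Dlt l (f x)) \<Longrightarrow> Dlt l (sum f A)"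
  by (induction A rule: infinite_finite_induct) (auto intro: Dlt_add)
lemma Dlt_ex: "\<exists>l. Dlt l f"
proof (induction f rule: fr_induct)
  case (wd c w) then show ?case by (meson Dlt_sm Dlt_wd lessI)
next
  case (add f g) then obtain k l where "Dlt k f" "Dlt l g" by auto
  then have "Dlt (max k l) (f + g)" by (auto intro!: Dlt_add elim: Dlt_mono)
  then show ?case ..
qed simp
lemma Dlt_top: "Dlt (Suc l) f \<Longrightarrow> Dlt l (f - tp l f)"
  by (force simp: Dlt_def lookup_minus lk_top less_Suc_eq split: if_splits)
lemma tp_Dlt: "Dlt l f \<Longrightarrow> tp l f = 0"
  by (rule poly_mapping_eqI) (auto simp: Dlt_def lk_top)
lemma Dlt_induct [consumes 1, case_names zero wd add]:
  assumes "Dlt l f" "P 0" "\<And>c w. length w < l \<Longrightarrow> P (c \<cdot> wd w)" "\<And>f g. P f \<Longrightarrow> P g \<Longrightarrow> P (f + g)"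
  shows "P f"
proof -
  have "finite A \<Longrightarrow> A \<subseteq> ks f \<Longrightarrow> P (\<Sum>w\<in>A. lk f w \<cdot> wd w)" for A
  proof (induction A rule: finite_induct)
    case (insert x A)
    then have "length x < l" using assms(1) by (auto simp: Dlt_def in_keys_iff)
    then show ?case using insert by (auto intro: assms)
  qed (simp add: assms)
  then show ?thesis by (metis finite_keys fr_decomp order_refl)
qed
lemma Dlt_mult_wd: "Dlt l f \<Longrightarrow> Dlt (l + length u) (wd u * f)" "Dlt l f \<Longrightarrow> Dlt (l + length u) (f * wd u)"
  by (induction rule: Dlt_induct; auto intro!: Dlt_sm Dlt_wd Dlt_add simp: distrib_left distrib_right wd_mult)+

lemma tp_mult_wd:
  "tp l (wd u * f) = (if length u \<le> l then wd u * tp (l - length u) f else 0)"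
  "tp l (f * wd u) = (if length u \<le> l then tp (l - length u) f * wd u else 0)"
  by (induction f rule: fr_induct;
      auto simp: flinD[OF flin_tp] wd_mult tp_wd distrib_left distrib_right)+

text \<open>Only the component of degree \<open>l\<close> of \<open>F\<close> is constrained, so
  this is a subspace of the whole algebra; that form allows it to serve as a derivation-stable
  subspace in \<open>z_power_finite_codim\<close>. The intersection over all \<open>l\<close> is the
  associated graded ideal.\<close>

definition lifts :: "fr set \<Rightarrow> nat \<Rightarrow> fr set" where
  "lifts L l = {F. \<exists>g. Dlt l g \<and> tp l F + g \<in> L}"
definition gr :: "fr set \<Rightarrow> fr set" where "gr L = (\<Inter>l. lifts L l)"

lemma subsp_lifts:
  assumes "subsp L" shows "subsp (lifts L l)"
proof -
  have "x + y \<in> lifts L l" if xy: "x \<in> lifts L l" "y \<in> lifts L l" for x y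
  proof -
    obtain g k where "Dlt l g" "tp l x + g \<in> L" "Dlt l k" "tp l y + k \<in> L"
      using xy unfolding lifts_def by blast
    then have "Dlt l (g + k)" "tp l (x + y) + (g + k) \<in> L"
      using subsp_add[OF assms, of "tp l x + g" "tp l y + k"]
      by (auto simp: Dlt_add flinD[OF flin_tp] algebra_simps)
    then show ?thesis unfolding lifts_def by blast
  qed
  moreover have "c \<cdot> x \<in> lifts L l" if x: "x \<in> lifts L l" for c x
  proof -
    obtain g where "Dlt l g" "tp l x + g \<in> L" using x by (auto simp: lifts_def)
    then have "Dlt l (c \<cdot> g)" "tp l (c \<cdot> x) + c \<cdot> g \<in> L"
      using subsp_sm[OF assms, of "tp l x + g" c]
      by (auto simp: Dlt_sm flinD[OF flin_tp] fr.scale_right_distrib)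
    then show ?thesis unfolding lifts_def by blast
  qed
  moreover have "0 \<in> lifts L l"
    using subsp_0[OF assms] by (auto simp: lifts_def flinD[OF flin_tp] intro!: exI[of _ 0])
  ultimately show ?thesis by (auto simp: subsp_def)
qed

lemma subsp_gr: "subsp L \<Longrightarrow> subsp (gr L)"
  using subsp_lifts[of L] by (auto simp: gr_def subsp_def)

lemma ideal_gr:
  assumes L: "ideal L" shows "ideal (gr L)"
proof -
  have s: "subsp (gr L)" using subsp_gr[OF ideal_subsp[OF L]] .
  have w: "wd u * x \<in> gr L \<and> x * wd u \<in> gr L" if x: "x \<in> gr L" for u x
  proof -
    have "wd u * x \<in> lifts L l \<and> x * wd u \<in> lifts L l" for l
    proof (cases "length u \<le> l")
      case True
      obtain g where g: "Dlt (l - length u) g" "tp (l - length u) x + g \<in> L"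
        using x by (auto simp: gr_def lifts_def)
      have "Dlt l (wd u * g)" "Dlt l (g * wd u)" using Dlt_mult_wd[OF g(1), of u] True by auto
      moreover have "tp l (wd u * x) + wd u * g \<in> L" "tp l (x * wd u) + g * wd u \<in> L"
        using idealD[OF L g(2), of "wd u"] True by (auto simp: tp_mult_wd distrib_left distrib_right)
      ultimately show ?thesis unfolding lifts_def by blast
    next
      case False
      then show ?thesis using subsp_0[OF ideal_subsp[OF L]]
        by (auto simp: lifts_def tp_mult_wd intro!: exI[of _ 0])
    qed
    then show ?thesis by (auto simp: gr_def)
  qed
  have "r * x \<in> gr L \<and> x * r \<in> gr L" if x: "x \<in> gr L" for r x
    by (induction r rule: fr_induct)
      (auto simp: distrib_left distrib_right intro: subsp_0[OF s] subsp_sm[OF s] subsp_add[OF s] w[OF x, THEN conjunct1] w[OF x, THEN conjunct2])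
  then show ?thesis using s by (auto simp: ideal_def subsp_def)
qed

lemma grI:
  assumes "subsp L" "tp l F = F" "Dlt l g" "F + g \<in> L" shows "F \<in> gr L"
proof -
  have "F \<in> lifts L k" for k
  proof (cases "k = l")
    case True then show ?thesis using assms by (auto simp: lifts_def)
  next
    case False
    then have "tp k F = 0" by (metis assms(2) lk_top lookup_zero poly_mapping_eqI)
    then show ?thesis using subsp_0[OF assms(1)] by (auto simp: lifts_def intro!: exI[of _ 0])
  qed
  then show ?thesis by (auto simp: gr_def)
qed

lemma sgn_b_simps [simp]: "sgn_b True = -1" "sgn_b False = 1" "sgn_b q * sgn_b q = 1" "sgn_b q \<noteq> 0"
  "sgn_b q * (sgn_b q * c) = c"
  by (auto simp: sgn_b_def)
lemma sgn_b_xor: "sgn_b (q \<noteq> r) = sgn_b q * sgn_b r" "sgn_b (q = (\<not> r)) = sgn_b q * sgn_b r"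
  by (auto simp: sgn_b_def)
lemma sgn_b_not [simp]: "sgn_b (\<not> q) = - sgn_b q" by (simp add: sgn_b_def)

section \<open>Superderivations and the parity automorphism of the free algebra\<close>

locale ospl =
  fixes m n :: nat and h :: tensor2
  assumes met: "osp_metric m n h"
begin

abbreviation N where "N \<equiv> dimN m n"

text \<open>Indices beyond the dimension count as even, so that the letters carrying them have weight zero
  under the grading element below.\<close>
definition pr :: "nat \<Rightarrow> bool" where "pr a \<longleftrightarrow> m \<le> a \<and> a < N"
definition s :: "nat \<Rightarrow> nat \<Rightarrow> complex" where "s a b = sgn_b (pr a \<and> pr b)"

lemma h_supp: "\<not> (a < N \<and> b < N) \<Longrightarrow> h a b = 0"
  using met unfolding osp_metric_def supp2_def by (meson not_less)
lemma h_par: "pr a \<noteq> pr b \<Longrightarrow> h a b = 0"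
  using met h_supp[of a b] unfolding osp_metric_def pr_def par_def by metis
lemma h_sym: "h b a = s a b * h a b"
proof (cases "a < N \<and> b < N")
  case True
  have "h b a = sgn_b (par m a \<and> par m b) * h a b" using met unfolding osp_metric_def by blast
  then show ?thesis using True by (simp add: s_def pr_def par_def)
next
  case False
  then have "h a b = 0" "h b a = 0" by (auto intro: h_supp)
  then show ?thesis by simp
qed
lemma h_inv: "b < N \<Longrightarrow> c < N \<Longrightarrow> (\<Sum>a<N. h a c * h a b) = (if b = c then 1 else 0)"
  using met unfolding osp_metric_def by blast
lemma s_sq [simp]: "s a b * s a b = 1" "s a b * (s a b * c) = c" by (simp_all add: s_def)
text \<open>Action of the Lie superalgebra element belonging to \<open>E x y\<close> on a vector
  with index \<open>a\<close>. The factor 1/2 appears because the letter \<open>E x y\<close> stands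
  for half of the antisymmetrised elementary tensor, see \<open>asym\<close>.\<close>

definition dvec :: "nat \<Rightarrow> nat \<Rightarrow> nat \<Rightarrow> (nat \<Rightarrow> fr) \<Rightarrow> fr" where
  "dvec x y a G = (h a y / 2) \<cdot> G x - (s x y * h a x / 2) \<cdot> G y"

definition dl :: "nat \<Rightarrow> nat \<Rightarrow> nat \<Rightarrow> nat \<Rightarrow> fr" where
  "dl x y a b = dvec x y a (\<lambda>k. E k b) + sgn_b ((pr x \<noteq> pr y) \<and> pr a) \<cdot> dvec x y b (\<lambda>k. E a k)"

primrec Dw :: "nat \<Rightarrow> nat \<Rightarrow> word \<Rightarrow> fr" where
  "Dw x y [] = 0"
| "Dw x y (l # w) = dl x y (fst l) (snd l) * wd w +
     sgn_b ((pr x \<noteq> pr y) \<and> (pr (fst l) \<noteq> pr (snd l))) \<cdot> (E (fst l) (snd l) * Dw x y w)"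

definition D :: "nat \<Rightarrow> nat \<Rightarrow> fr \<Rightarrow> fr" where "D x y = lin (Dw x y)"

primrec wpar :: "word \<Rightarrow> bool" where
  "wpar [] = False"
| "wpar (l # w) = ((pr (fst l) \<noteq> pr (snd l)) \<noteq> wpar w)"

definition sig :: "fr \<Rightarrow> fr" where "sig = lin (\<lambda>w. sgn_b (wpar w) \<cdot> wd w)"
definition sgp :: "bool \<Rightarrow> fr \<Rightarrow> fr" where "sgp q f = (if q then sig f else f)"

lemma flin_D: "flin (D x y)" unfolding D_def by (rule flin_lin)
lemma flin_sig: "flin sig" unfolding sig_def by (rule flin_lin)
lemma flin_sgp: "flin (sgp q)" by (cases q) (simp_all add: sgp_def[abs_def] flin_sig flin_id)
lemma D_wd: "D x y (wd w) = Dw x y w" by (simp add: D_def)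
lemma sig_wd: "sig (wd w) = sgn_b (wpar w) \<cdot> wd w" by (simp add: sig_def)
lemma D_E: "D x y (E a b) = dl x y a b" by (simp add: E_def D_wd)
lemma D_1 [simp]: "D x y 1 = 0" using D_wd[of x y "[]"] by simp
lemma sig_1 [simp]: "sig 1 = 1" using sig_wd[of "[]"] by simp
lemma wpar_append: "wpar (u @ v) = (wpar u \<noteq> wpar v)" by (induction u) auto
lemma sig_E: "sig (E a b) = sgn_b (pr a \<noteq> pr b) \<cdot> E a b" by (simp add: E_def sig_wd)
lemma sgp_E: "sgp q (E a b) = sgn_b (q \<and> (pr a \<noteq> pr b)) \<cdot> E a b" by (simp add: sgp_def sig_E)

lemma sig_mult: "sig (f * g) = sig f * sig g"
proof -
  have w: "sig (wd u * g) = sig (wd u) * sig g" for u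
    by (rule flin_eqI[OF flin_comp[OF flin_sig flin_mult(1)] flin_comp[OF flin_mult(1) flin_sig]])
      (simp add: wd_mult sig_wd wpar_append sgn_b_xor flinD[OF flin_sig] mult.commute)
  show ?thesis
    by (rule flin_eqI[OF flin_comp[OF flin_sig flin_mult(2)] flin_comp[OF flin_mult(2) flin_sig]]) (rule w)
qed
lemma sgp_mult: "sgp q (f * g) = sgp q f * sgp q g" by (simp add: sgp_def sig_mult)
lemma sgp_1 [simp]: "sgp q 1 = 1" by (simp add: sgp_def)
lemma sig_sig [simp]: "sig (sig f) = f"
  by (rule flin_eqI[OF flin_comp[OF flin_sig flin_sig] flin_id]) (simp add: sig_wd flinD[OF flin_sig])
lemma sgp_sgp [simp]: "sgp q (sgp q f) = f" by (simp add: sgp_def)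

lemma Dw_append: "Dw x y (u @ v) = Dw x y u * wd v + sgp (pr x \<noteq> pr y) (wd u) * Dw x y v"
proof (induction u)
  case (Cons l u)
  have "wd (l # u) = E (fst l) (snd l) * wd u" by (metis prod.collapse wd_Cons)
  then show ?case using Cons
    by (simp add: sgp_mult sgp_E algebra_simps fr.scale_right_distrib flip: wd_mult)
qed simp

lemma D_mult: "D x y (f * g) = D x y f * g + sgp (pr x \<noteq> pr y) f * D x y g"
proof -
  let ?q = "pr x \<noteq> pr y"
  have w: "D x y (wd u * g) = D x y (wd u) * g + sgp ?q (wd u) * D x y g" for u
    by (rule flin_eqI[OF flin_comp[OF flin_D flin_mult(1)] flin_add[OF flin_mult(1) flin_comp[OF flin_mult(1) flin_D]]])
      (simp add: wd_mult D_wd Dw_append)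
  show ?thesis
    by (rule flin_eqI[OF flin_comp[OF flin_D flin_mult(2)] flin_add[OF flin_comp[OF flin_mult(2) flin_D] flin_comp[OF flin_mult(2) flin_sgp]]]) (rule w)
qed

text \<open>A metric entry is nonzero only between indices of equal parity, so replacing one index
  by \<open>x\<close> or \<open>y\<close> shifts the parity of the letter by the parity of the
  operator.\<close>

lemma sig_dl: "sig (dl x y a b) = sgn_b ((pr x \<noteq> pr y) \<noteq> (pr a \<noteq> pr b)) \<cdot> dl x y a b"
  by (cases "pr x"; cases "pr y"; cases "pr a"; cases "pr b")
    (simp_all add: dl_def dvec_def flinD[OF flin_sig] sig_E h_par s_def algebra_simps fr.scale_right_distrib)

lemma sig_D: "sig (D x y f) = sgn_b (pr x \<noteq> pr y) \<cdot> D x y (sig f)"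
proof -
  have w: "sig (Dw x y w) = sgn_b (pr x \<noteq> pr y) \<cdot> (sgn_b (wpar w) \<cdot> Dw x y w)" for w
  proof (induction w)
    case (Cons l w)
    then show ?case
      by (cases "pr x = pr y"; cases "pr (fst l) = pr (snd l)")
        (simp_all add: flinD[OF flin_sig] sig_mult sig_dl sig_wd sig_E sgn_b_xor algebra_simps fr.scale_right_distrib mult.commute)
  qed (simp add: flinD[OF flin_sig])
  show ?thesis
    by (rule flin_eqI[OF flin_comp[OF flin_sig flin_D] flin_comp[OF flin_mult(3) flin_comp[OF flin_D flin_sig]]])
      (simp add: w D_wd sig_wd flinD[OF flin_D])
qed

lemma Dlt_D: "Dlt l f \<Longrightarrow> Dlt l (D x y f)"
proof (induction rule: Dlt_induct)
  case (wd c w)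
  have "Dlt (Suc (length w)) (Dw x y w)" for w
  proof (induction w)
    case (Cons l w)
    have "Dlt 2 (dl x y (fst l) (snd l))"
      unfolding dl_def dvec_def E_def by (intro Dlt_add Dlt_sm Dlt_diff Dlt_wd) auto
    from Dlt_mult_wd(2)[OF this, of w] Dlt_mult_wd(1)[OF Cons, of "[l]"] show ?case
      by (auto simp: E_def intro!: Dlt_add Dlt_sm)
  qed simp
  then show ?case using wd Dlt_mono[of "Suc (length w)" _ l] by (simp add: flinD[OF flin_D] D_wd Dlt_sm)
qed (auto simp: flinD[OF flin_D] intro: Dlt_add)

lemma tp_D: "tp l (D x y f) = D x y (tp l f)"
proof -
  have w: "tp l (Dw x y w) = (if length w = l then Dw x y w else 0)" for w
  proof (induction w arbitrary: l)
    case (Cons c w)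
    have d: "tp k (dl x y a b) = (if k = 1 then dl x y a b else 0)" for k a b
      by (simp add: dl_def dvec_def E_def flinD[OF flin_tp] tp_wd)
    have "tp l (E (fst c) (snd c) * Dw x y w) = (if length w + 1 = l then E (fst c) (snd c) * Dw x y w else 0)"
      using Cons by (auto simp: E_def tp_mult_wd)
    moreover have "tp l (dl x y (fst c) (snd c) * wd w) = (if length w + 1 = l then dl x y (fst c) (snd c) * wd w else 0)"
      by (auto simp: tp_mult_wd d)
    ultimately show ?case by (simp add: flinD[OF flin_tp])
  qed (simp add: flinD[OF flin_tp])
  show ?thesis
    by (rule flin_eqI[OF flin_comp[OF flin_tp flin_D] flin_comp[OF flin_D flin_tp]])
      (simp add: w D_wd tp_wd flinD[OF flin_D])
qed

subsection \<open>Ideals containing the relations of the enveloping algebra\<close>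

definition r1 :: "nat \<Rightarrow> nat \<Rightarrow> fr" where "r1 a b = E a b + s a b \<cdot> E b a"
definition r2 :: "nat \<Rightarrow> nat \<Rightarrow> nat \<Rightarrow> nat \<Rightarrow> fr" where
  "r2 a b c d = E a b * E c d - sgn_b ((pr a \<noteq> pr b) \<and> (pr c \<noteq> pr d)) \<cdot> (E c d * E a b)"

text \<open>Preimages of the two-sided ideals of the enveloping algebra. Since the letters with an
  index out of range are included, the last two conditions extend to all indices
  (\<open>oideal_r1\<close>, \<open>oideal_r2\<close>), and later computations can use them
  freely.\<close>

definition oideal :: "fr set \<Rightarrow> bool" where
  "oideal L \<longleftrightarrow> ideal L \<and> (\<forall>a b. \<not> (a < N \<and> b < N) \<longrightarrow> E a b \<in> L) \<and>
     (\<forall>a<N. \<forall>b<N. r1 a b \<in> L) \<and> (\<forall>a<N. \<forall>b<N. \<forall>c<N. \<forall>d<N. r2 a b c d - D a b (E c d) \<in> L)"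

lemma oideal_r1: assumes "oideal L" shows "r1 a b \<in> L"
proof (cases "a < N \<and> b < N")
  case False
  then have "E a b \<in> L" "E b a \<in> L" using assms by (auto simp: oideal_def)
  moreover have "subsp L" using assms by (simp add: oideal_def ideal_subsp)
  ultimately show ?thesis unfolding r1_def by (intro subsp_add subsp_sm)
qed (use assms in \<open>auto simp: oideal_def\<close>)

lemma oideal_r2: assumes L: "oideal L" shows "r2 a b c d - D a b (E c d) \<in> L"
proof (cases "a < N \<and> b < N \<and> c < N \<and> d < N")
  case False
  have i: "ideal L" and sp: "subsp L" using L ideal_subsp by (auto simp: oideal_def)
  have l: "E k l \<in> L" if "\<not> (k < N \<and> l < N)" for k l using L that by (auto simp: oideal_def)
  have "E a b \<in> L \<or> E c d \<in> L" using False l by blast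
  then have "E a b * E c d \<in> L" "E c d * E a b \<in> L" using idealD[OF i] by blast+
  then have "r2 a b c d \<in> L" unfolding r2_def by (intro subsp_diff[OF sp] subsp_sm[OF sp])
  moreover have g: "v \<cdot> E k l \<in> L" if "v = 0 \<or> \<not> (k < N \<and> l < N)" for v k l
    using that l subsp_sm[OF sp] subsp_0[OF sp] by auto
  have "dl a b c d \<in> L" unfolding dl_def dvec_def fr.scale_right_diff_distrib fr.scale_scale
    by (intro subsp_diff[OF sp] subsp_add[OF sp] g) (use False h_supp in auto)
  ultimately show ?thesis by (simp add: D_E subsp_diff[OF sp])
qed (use L in \<open>auto simp: oideal_def\<close>)

text \<open>Modulo \<open>L\<close>, the supercommutator with a letter is the derivation of that
  letter: this is the defining relation on letters, and both sides obey the same super Leibniz rule.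
  It is the source of the stability of ideals under derivations.\<close>

lemma oideal_comm:
  assumes L: "oideal L"
  shows "E a b * f - sgp (pr a \<noteq> pr b) f * E a b - D a b f \<in> L"
proof -
  have i: "ideal L" and sp: "subsp L" using L ideal_subsp by (auto simp: oideal_def)
  let ?q = "pr a \<noteq> pr b"
  show ?thesis
  proof (induction f rule: fr_induct)
    case (wd c w)
    have "E a b * wd w - sgp ?q (wd w) * E a b - D a b (wd w) \<in> L"
    proof (induction w)
      case (Cons l w)
      obtain c d where l: "l = (c, d)" by force
      let ?t = "sgn_b (?q \<and> (pr c \<noteq> pr d))"
      have "E a b * wd (l # w) - sgp ?q (wd (l # w)) * E a b - D a b (wd (l # w))
        = (r2 a b c d - D a b (E c d)) * wd w + (?t \<cdot> E c d) * (E a b * wd w - sgp ?q (wd w) * E a b - D a b (wd w))"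
        by (simp add: l wd_Cons D_mult sgp_mult sgp_E r2_def algebra_simps fr.scale_right_diff_distrib)
      then show ?case
        using subsp_add[OF sp idealD(2)[OF i oideal_r2[OF L, of a b c d], of "wd w"] idealD(1)[OF i Cons, of "?t \<cdot> E c d"]]
        by simp
    qed (simp add: subsp_0[OF sp])
    from subsp_sm[OF sp this, of c] show ?case
      by (simp add: flinD[OF flin_D] flinD[OF flin_sgp] fr.scale_right_diff_distrib)
  next
    case (add f g)
    from subsp_add[OF sp this] show ?case
      by (simp add: flinD[OF flin_D] flinD[OF flin_sgp] algebra_simps)
  qed (simp add: flinD[OF flin_D] flinD[OF flin_sgp] subsp_0[OF sp])
qed

end

subsection \<open>Ideals of the enveloping algebra are graded by parity\<close>

context ospl
begin

abbreviation Od :: "nat set" where "Od \<equiv> {m..<N}"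

text \<open>The central element of the Levi factor gl(n) of sp(2n): it acts by an involution on the odd part
  of the natural module and by 0 on the even part, so its weights detect parity.\<close>
definition kap :: "fr \<Rightarrow> fr" where "kap f = (\<Sum>a\<in>Od. \<i> \<cdot> D a a f)"
definition Q :: "nat \<Rightarrow> (nat \<Rightarrow> fr) \<Rightarrow> fr" where "Q c G = (\<Sum>a\<in>Od. (\<i> * h c a) \<cdot> G a)"
definition eig :: "int \<Rightarrow> fr \<Rightarrow> bool" where
  "eig j f \<longleftrightarrow> kap f = of_int j \<cdot> f \<and> sig f = sgn_b (odd j) \<cdot> f"

lemma flin_kap: "flin kap"
  unfolding flin_def kap_def
  by (simp add: flinD[OF flin_D] fr.scale_right_distrib sum.distrib fr.scale_sum_right mult.commute)
lemma kap_mult: "kap (f * g) = kap f * g + f * kap g"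
  by (simp add: kap_def D_mult sgp_def fr.scale_right_distrib sum.distrib sum_distrib_left sum_distrib_right)
lemma kap_E: "kap (E c d) = Q c (\<lambda>a. E a d) + Q d (\<lambda>a. E c a)"
proof -
  have "D a a (E c d) = h c a \<cdot> E a d + h d a \<cdot> E c a" if "a \<in> Od" for a
    using that by (simp add: D_E dl_def dvec_def s_def pr_def fr.scale_left_distrib[symmetric])
  then show ?thesis by (simp add: kap_def Q_def fr.scale_right_distrib sum.distrib)
qed
text \<open>On odd indices the metric is antisymmetric, so the inverse property, which pairs
  \<open>h\<close> with its transpose, gives a square equal to minus the identity. The factor \<i>
  in \<open>kap\<close> turns this into an involution (\<open>Q_Q\<close>), so that the weights
  become integers.\<close>

lemma h_odd_sq: "c \<in> Od \<Longrightarrow> b \<in> Od \<Longrightarrow> (\<Sum>a\<in>Od. h c a * h a b) = (if b = c then -1 else 0)"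
proof -
  assume a: "c \<in> Od" "b \<in> Od"
  have "(\<Sum>a\<in>Od. h c a * h a b) = (\<Sum>a\<in>Od. - (h a c * h a b))"
    using a by (intro sum.cong refl) (subst h_sym, auto simp: s_def pr_def)
  also have "\<dots> = - (\<Sum>a<N. h a c * h a b)"
    unfolding sum_negf using a by (intro arg_cong[of _ _ uminus] sum.mono_neutral_left) (auto simp: h_par pr_def)
  finally show ?thesis using a h_inv[of b c] by simp
qed
lemma Q_Q: "pr c \<Longrightarrow> Q c (\<lambda>a. Q a G) = G c"
proof -
  assume "pr c"
  then have c: "c \<in> Od" by (simp add: pr_def)
  have eq: "\<i> * h c a * (\<i> * h a b) = - (h c a * h a b)" for a b
    by (metis (no_types) i_squared mult.assoc mult.left_commute mult_minus1)
  have "Q c (\<lambda>a. Q a G) = (\<Sum>a\<in>Od. \<Sum>b\<in>Od. (- (h c a * h a b)) \<cdot> G b)"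
    unfolding Q_def fr.scale_sum_right fr.scale_scale eq ..
  also have "\<dots> = (\<Sum>b\<in>Od. (- (\<Sum>a\<in>Od. h c a * h a b)) \<cdot> G b)"
    by (subst sum.swap) (simp add: fr.scale_sum_left sum_negf)
  also have "\<dots> = (\<Sum>b\<in>Od. (if b = c then G b else 0))"
    by (intro sum.cong refl) (simp add: h_odd_sq[OF c])
  finally show ?thesis using c by simp
qed
lemma Q_add: "Q c (\<lambda>a. F a + G a) = Q c F + Q c G" by (simp add: Q_def fr.scale_right_distrib sum.distrib)
lemma Q_swap: "Q d (\<lambda>b. Q c (\<lambda>a. F a b)) = Q c (\<lambda>a. Q d (\<lambda>b. F a b))"
  unfolding Q_def fr.scale_sum_right by (subst sum.swap) (simp add: mult.commute)
lemma Q_even: "\<not> pr c \<Longrightarrow> Q c G = 0" unfolding Q_def by (rule sum.neutral) (auto simp: h_par pr_def)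
lemma kap_Q: "kap (Q c G) = Q c (\<lambda>a. kap (G a))"
  unfolding Q_def by (simp add: flin_sum[OF flin_kap] flinD[OF flin_kap])
lemma sig_kap: "sig (kap f) = kap (sig f)"
  by (simp add: kap_def flin_sum[OF flin_sig] flinD[OF flin_sig] sig_D)

lemma eig_add: "eig j f \<Longrightarrow> eig j g \<Longrightarrow> eig j (f + g)"
  by (simp add: eig_def flinD[OF flin_kap] flinD[OF flin_sig] fr.scale_right_distrib)
lemma eig_0: "eig j 0" by (simp add: eig_def flinD[OF flin_kap] flinD[OF flin_sig])
lemma eig_sm: "eig j f \<Longrightarrow> eig j (c \<cdot> f)"
  by (simp add: eig_def flinD[OF flin_kap] flinD[OF flin_sig] mult.commute)
lemma eig_mult: "eig j f \<Longrightarrow> eig k g \<Longrightarrow> eig (j + k) (f * g)"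
  by (auto simp: eig_def kap_mult sig_mult fr.scale_left_distrib sgn_b_def)

definition eigdec :: "fr \<Rightarrow> bool" where
  "eigdec f \<longleftrightarrow> (\<exists>A g. finite A \<and> f = (\<Sum>j\<in>A. g j) \<and> (\<forall>j\<in>A. eig j (g j)))"

lemma eigdec_eig: "eig j f \<Longrightarrow> eigdec f"
  unfolding eigdec_def by (intro exI[of _ "{j}"] exI[of _ "\<lambda>_. f"]) auto
lemma eigdec_0: "eigdec 0" using eig_0 eigdec_eig by blast
lemma eigdec_add:
  assumes "eigdec f" "eigdec g" shows "eigdec (f + g)"
proof -
  obtain A u B v where A: "finite A" "f = (\<Sum>j\<in>A. u j)" "\<forall>j\<in>A. eig j (u j)"
    and B: "finite B" "g = (\<Sum>j\<in>B. v j)" "\<forall>j\<in>B. eig j (v j)" using assms unfolding eigdec_def by metis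
  let ?w = "\<lambda>j. (if j \<in> A then u j else 0) + (if j \<in> B then v j else 0)"
  have "(\<Sum>j\<in>A \<union> B. if j \<in> A then u j else 0) = sum u A" "(\<Sum>j\<in>A \<union> B. if j \<in> B then v j else 0) = sum v B"
    by (rule sum.mono_neutral_cong_right; use A B in simp)+
  then have "f + g = (\<Sum>j\<in>A \<union> B. ?w j)" using A(2) B(2) by (simp add: sum.distrib)
  moreover have "\<forall>j\<in>A \<union> B. eig j (?w j)" using A(3) B(3) by (simp add: eig_add eig_0)
  moreover have "finite (A \<union> B)" using A(1) B(1) by simp
  ultimately show ?thesis unfolding eigdec_def by blast
qed
lemma eigdec_sum: "(\<And>x. x \<in> A \<Longrightarrow> eigdec (f x)) \<Longrightarrow> eigdec (sum f A)"
  by (induction A rule: infinite_finite_induct) (auto intro: eigdec_0 eigdec_add)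
lemma eigdec_mult: assumes "eigdec f" "eigdec g" shows "eigdec (f * g)"
proof -
  obtain A u B v where A: "finite A" "f = (\<Sum>j\<in>A. u j)" "\<forall>j\<in>A. eig j (u j)"
    and B: "finite B" "g = (\<Sum>j\<in>B. v j)" "\<forall>j\<in>B. eig j (v j)" using assms unfolding eigdec_def by metis
  have "f * g = (\<Sum>j\<in>A. \<Sum>k\<in>B. u j * v k)" by (simp add: A B sum_product)
  moreover have "eigdec (u j * v k)" if "j \<in> A" "k \<in> B" for j k
    using A(3) B(3) that eig_mult eigdec_eig by blast
  ultimately show ?thesis by (simp add: eigdec_sum)
qed

text \<open>Each odd index contributes a weight 1 or -1 and each even index the weight 0. On a
  letter \<open>kap\<close> is therefore annihilated by \<open>x\<close>, by \<open>x^2 - 1\<close>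
  or by \<open>x^3 - 4 * x\<close>, depending on the number of odd indices; the summands below are
  the corresponding Lagrange projections.\<close>

lemma eigdec_E: "eigdec (E c d)"
proof -
  let ?x = "E c d"
  have K: "kap (kap ?x) = Q c (\<lambda>a. kap (E a d)) + Q d (\<lambda>b. kap (E c b))"
    by (simp add: kap_E[of c d] flinD[OF flin_kap] kap_Q)
  consider "\<not> pr c" "\<not> pr d" | "pr c \<noteq> pr d" | "pr c" "pr d" by blast
  then show ?thesis
  proof cases
    case 1
    then have "eig 0 ?x" by (simp add: eig_def kap_E Q_even sig_E)
    then show ?thesis by (rule eigdec_eig)
  next
    case 2
    have "kap (kap ?x) = ?x"
      using 2 unfolding K by (cases "pr c") (simp_all add: kap_E Q_even Q_add Q_Q)
    moreover have "sig ?x = - ?x" using 2 by (auto simp: sig_E)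
    ultimately have "eig 1 (?x + kap ?x)" "eig (-1) (?x - kap ?x)"
      by (simp_all add: eig_def flinD[OF flin_kap] flinD[OF flin_sig] sig_kap)
    then have "eig 1 ((1/2) \<cdot> (?x + kap ?x))" "eig (-1) ((1/2) \<cdot> (?x - kap ?x))" by (simp_all only: eig_sm)
    moreover have "?x = (1/2) \<cdot> (?x + kap ?x) + (1/2) \<cdot> (?x - kap ?x)"
      by (rule poly_mapping_eqI) (simp add: lk_simps field_simps)
    ultimately show ?thesis by (metis eigdec_add eigdec_eig)
  next
    case 3
    let ?w = "Q c (\<lambda>a. Q d (\<lambda>b. E a b))"
    have k2: "kap (kap ?x) = 2 \<cdot> ?x + 2 \<cdot> ?w"
      unfolding K unfolding kap_E Q_add using 3
      by (simp add: Q_Q Q_swap[of d c]) (rule poly_mapping_eqI, simp add: lk_simps)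
    have "kap ?w = Q d (\<lambda>b. Q c (\<lambda>a. Q a (\<lambda>a'. E a' b))) + Q c (\<lambda>a. Q d (\<lambda>b. Q b (\<lambda>b'. E a b')))"
      unfolding kap_Q kap_E Q_add by (subst Q_swap[of d c]) (rule refl)
    also have "\<dots> = kap ?x" using 3 by (simp add: Q_Q kap_E add.commute)
    finally have k3: "kap (kap (kap ?x)) = 4 \<cdot> kap ?x"
      by (simp add: k2 flinD[OF flin_kap]) (rule poly_mapping_eqI, simp add: lk_simps)
    have sx: "sig ?x = ?x" using 3 by (simp add: sig_E)
    have "eig 2 (kap (kap ?x) + 2 \<cdot> kap ?x)" "eig (-2) (kap (kap ?x) - 2 \<cdot> kap ?x)"
      "eig 0 (?x - (1/4) \<cdot> kap (kap ?x))"
      using sx k3 by (simp_all add: eig_def flinD[OF flin_kap] flinD[OF flin_sig] sig_kap fr.scale_right_distrib fr.scale_right_diff_distrib)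
    then have "eig 2 ((1/8) \<cdot> (kap (kap ?x) + 2 \<cdot> kap ?x))" "eig (-2) ((1/8) \<cdot> (kap (kap ?x) - 2 \<cdot> kap ?x))"
      "eig 0 (?x - (1/4) \<cdot> kap (kap ?x))" by (simp_all only: eig_sm)
    moreover have "?x = (1/8) \<cdot> (kap (kap ?x) + 2 \<cdot> kap ?x) + ((1/8) \<cdot> (kap (kap ?x) - 2 \<cdot> kap ?x) + (?x - (1/4) \<cdot> kap (kap ?x)))"
      by (rule poly_mapping_eqI) (simp add: lk_simps field_simps)
    ultimately show ?thesis by (metis eigdec_add eigdec_eig)
  qed
qed

lemma eigdec_all: "eigdec f"
proof (induction f rule: fr_induct)
  case (wd c w)
  have "eigdec (wd w)"
  proof (induction w)
    case Nil
    have "eig 0 1" using kap_mult[of 1 1] by (simp add: eig_def)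
    then show ?case by (simp add: eigdec_eig)
  next
    case (Cons l w) then show ?case by (cases l) (simp add: wd_Cons eigdec_mult eigdec_E)
  qed
  moreover have "eigdec (cst c)"
    using kap_mult[of 1 1] by (intro eigdec_eig[of 0]) (simp add: cst_sm eig_def flinD[OF flin_kap] flinD[OF flin_sig])
  ultimately show ?case by (simp add: sm_def eigdec_mult)
qed (auto intro: eigdec_0 eigdec_add)

text \<open>Subtracting \<open>i\<close> times the element from its image under \<open>kap\<close>
  removes the summand of weight \<open>i\<close> and rescales the others by nonzero factors, so that
  the induction hypothesis applies to them.\<close>

lemma eig_separate:
  assumes L: "subsp L" "\<And>f. f \<in> L \<Longrightarrow> kap f \<in> L"
  shows "finite A \<Longrightarrow> (\<And>j. j \<in> A \<Longrightarrow> eig j (g j)) \<Longrightarrow> (\<Sum>j\<in>A. g j) \<in> L \<Longrightarrow> \<forall>j\<in>A. g j \<in> L"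
proof (induction A arbitrary: g rule: finite_induct)
  case (insert i A)
  let ?f = "g i + (\<Sum>j\<in>A. g j)"
  have f: "?f \<in> L" using insert by simp
  have "kap (g j) = of_int j \<cdot> g j" if "j \<in> insert i A" for j using insert.prems(1)[OF that] by (simp add: eig_def)
  then have "kap ?f - of_int i \<cdot> ?f = (\<Sum>j\<in>A. (of_int j - of_int i) \<cdot> g j)"
    by (simp add: flinD[OF flin_kap] flin_sum[OF flin_kap] fr.scale_right_distrib fr.scale_sum_right
        fr.scale_left_diff_distrib sum_subtractf)
  then have S: "(\<Sum>j\<in>A. (of_int j - of_int i) \<cdot> g j) \<in> L"
    using subsp_diff[OF L(1) L(2)[OF f] subsp_sm[OF L(1) f, of "of_int i"]] by simp
  have "\<forall>j\<in>A. (of_int j - of_int i) \<cdot> g j \<in> L"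
    by (rule insert.IH[OF _ S]) (rule eig_sm, rule insert.prems(1), simp)
  moreover have "(of_int j - of_int i :: complex) \<noteq> 0" if "j \<in> A" for j using insert.hyps that by auto
  ultimately have a: "\<forall>j\<in>A. g j \<in> L" by (simp add: subsp_sm_iff[OF L(1)])
  then have "(\<Sum>j\<in>A. g j) \<in> L" by (intro subsp_sum[OF L(1)]) simp
  from subsp_diff[OF L(1) f this] have "g i \<in> L" by simp
  then show ?case using a by blast
qed simp

lemma oideal_idealD: "oideal L \<Longrightarrow> ideal L" "oideal L \<Longrightarrow> subsp L"
  using ideal_subsp by (auto simp: oideal_def)

text \<open>For an even letter the supercommutator is an ordinary commutator, so this holds before
  anything is known about parity. It suffices for \<open>kap\<close>, all of whose summands are
  even.\<close>

lemma oideal_D_even: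
  assumes "oideal L" "f \<in> L" "pr x = pr y" shows "D x y f \<in> L"
proof -
  note L = oideal_idealD[OF assms(1)]
  have "E x y * f - f * E x y - D x y f \<in> L" using oideal_comm[OF assms(1), of x y f] assms(3) by (simp add: sgp_def)
  moreover have "E x y * f - f * E x y \<in> L" using idealD[OF L(1) assms(2)] subsp_diff[OF L(2)] by blast
  ultimately show ?thesis using subsp_cong[OF L(2)] by blast
qed

text \<open>The weights of \<open>kap\<close> split \<open>f\<close> inside the ideal, and
  \<open>eig\<close> ties the parity of each part to the parity of its weight.\<close>

lemma oideal_sig:
  assumes L: "oideal L" "f \<in> L" shows "sig f \<in> L"
proof -
  note L' = oideal_idealD[OF L(1)]
  have k: "kap f \<in> L" if "f \<in> L" for f
    unfolding kap_def using oideal_D_even[OF L(1) that] by (intro subsp_sum[OF L'(2)] subsp_sm[OF L'(2)]) auto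
  obtain A g where A: "finite A" "f = (\<Sum>j\<in>A. g j)" "\<forall>j\<in>A. eig j (g j)"
    using eigdec_all[of f] unfolding eigdec_def by metis
  then have "\<forall>j\<in>A. g j \<in> L" using eig_separate[OF L'(2) k A(1)] L(2) by blast
  moreover have "sig f = (\<Sum>j\<in>A. sgn_b (odd j) \<cdot> g j)" using A by (simp add: flin_sum[OF flin_sig] eig_def)
  ultimately show ?thesis by (simp only:) (blast intro: subsp_sum[OF L'(2)] subsp_sm[OF L'(2)])
qed

lemma oideal_D:
  assumes L: "oideal L" "f \<in> L" shows "D x y f \<in> L"
proof -
  note L' = oideal_idealD[OF L(1)]
  have "sgp (pr x \<noteq> pr y) f \<in> L" using oideal_sig[OF L] L(2) by (simp add: sgp_def)
  then have "E x y * f - sgp (pr x \<noteq> pr y) f * E x y \<in> L"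
    using idealD[OF L'(1)] L(2) subsp_diff[OF L'(2)] by blast
  then show ?thesis using subsp_cong[OF L'(2) oideal_comm[OF L(1), of x y f]] by blast
qed

end

subsection \<open>Equivariant families of quadratic elements\<close>

context ospl
begin

type_synonym (in -) fam = "nat \<Rightarrow> nat \<Rightarrow> nat \<Rightarrow> nat \<Rightarrow> fr"

definition act4 :: "nat \<Rightarrow> nat \<Rightarrow> fam \<Rightarrow> fam" where
  "act4 x y F a b c d = dvec x y a (\<lambda>k. F k b c d)
     + sgn_b ((pr x \<noteq> pr y) \<and> pr a) \<cdot> dvec x y b (\<lambda>k. F a k c d)
     + sgn_b ((pr x \<noteq> pr y) \<and> (pr a \<noteq> pr b)) \<cdot> dvec x y c (\<lambda>k. F a b k d)
     + sgn_b ((pr x \<noteq> pr y) \<and> (pr a \<noteq> (pr b \<noteq> pr c))) \<cdot> dvec x y d (\<lambda>k. F a b c k)"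
definition act2 :: "nat \<Rightarrow> nat \<Rightarrow> (nat \<Rightarrow> nat \<Rightarrow> fr) \<Rightarrow> nat \<Rightarrow> nat \<Rightarrow> fr" where
  "act2 x y F a d = dvec x y a (\<lambda>k. F k d) + sgn_b ((pr x \<noteq> pr y) \<and> pr a) \<cdot> dvec x y d (\<lambda>k. F a k)"
text \<open>Families that transform like a tensor in their four indices. If such a family meets a
  stable subspace for one choice of indices, derivations carry this to other choices; the exact
  relations in \<open>PL_in\<close> are obtained in this way.\<close>

definition eqv4 :: "fam \<Rightarrow> bool" where
  "eqv4 F \<longleftrightarrow> (\<forall>a b c d. sig (F a b c d) = sgn_b ((pr a \<noteq> pr b) \<noteq> (pr c \<noteq> pr d)) \<cdot> F a b c d) \<and>
     (\<forall>x y a b c d. D x y (F a b c d) = act4 x y F a b c d)"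
text \<open>The range condition on \<open>x\<close> and \<open>y\<close> reflects
  \<open>eqv2_contract\<close>, where the inverse property of the metric is applied at these
  indices.\<close>

definition eqv2 :: "(nat \<Rightarrow> nat \<Rightarrow> fr) \<Rightarrow> bool" where
  "eqv2 F \<longleftrightarrow> (\<forall>a d. sig (F a d) = sgn_b (pr a \<noteq> pr d) \<cdot> F a d) \<and>
     (\<forall>x<N. \<forall>y<N. \<forall>a d. D x y (F a d) = act2 x y F a d)"

lemma eqv4D: "eqv4 F \<Longrightarrow> sig (F a b c d) = sgn_b ((pr a \<noteq> pr b) \<noteq> (pr c \<noteq> pr d)) \<cdot> F a b c d"
  "eqv4 F \<Longrightarrow> D x y (F a b c d) = act4 x y F a b c d"
  by (auto simp: eqv4_def)
lemma eqv2D: "eqv2 F \<Longrightarrow> sig (F a d) = sgn_b (pr a \<noteq> pr d) \<cdot> F a d" "eqv2 F \<Longrightarrow> x < N \<Longrightarrow> y < N \<Longrightarrow> D x y (F a d) = act2 x y F a d"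
  by (auto simp: eqv2_def)

text \<open>Signed adjacent transpositions. They generate the signed action of the symmetric group
  on the four indices, and each of them preserves equivariance; hence every signed sum of
  permutations of \<open>W\<close> is equivariant.\<close>

definition sw1 :: "fam \<Rightarrow> fam" where "sw1 F a b c d = s a b \<cdot> F b a c d"
definition sw2 :: "fam \<Rightarrow> fam" where "sw2 F a b c d = s b c \<cdot> F a c b d"
definition sw3 :: "fam \<Rightarrow> fam" where "sw3 F a b c d = s c d \<cdot> F a b d c"

lemma eqv4_sw1: assumes "eqv4 F" shows "eqv4 (sw1 F)"
proof -
  have "D x y (sw1 F a b c d) = act4 x y (sw1 F) a b c d" for x y a b c d
    unfolding sw1_def flinD[OF flin_D] eqv4D(2)[OF assms] act4_def dvec_def
    by (cases "pr x"; cases "pr y"; cases "pr a"; cases "pr b"; rule poly_mapping_eqI)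
      (simp_all add: s_def h_par lk_simps algebra_simps)
  moreover have "sig (sw1 F a b c d) = sgn_b ((pr a \<noteq> pr b) \<noteq> (pr c \<noteq> pr d)) \<cdot> sw1 F a b c d" for a b c d
    unfolding sw1_def flinD[OF flin_sig] eqv4D(1)[OF assms] by (simp add: mult.commute eq_commute)
  ultimately show ?thesis unfolding eqv4_def by blast
qed
lemma eqv4_sw2: assumes "eqv4 F" shows "eqv4 (sw2 F)"
proof -
  have "D x y (sw2 F a b c d) = act4 x y (sw2 F) a b c d" for x y a b c d
    unfolding sw2_def flinD[OF flin_D] eqv4D(2)[OF assms] act4_def dvec_def
    by (cases "pr x"; cases "pr y"; cases "pr c"; cases "pr b"; cases "pr a"; rule poly_mapping_eqI)
      (simp_all add: s_def h_par lk_simps algebra_simps)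
  moreover have "sig (sw2 F a b c d) = sgn_b ((pr a \<noteq> pr b) \<noteq> (pr c \<noteq> pr d)) \<cdot> sw2 F a b c d" for a b c d
    unfolding sw2_def flinD[OF flin_sig] eqv4D(1)[OF assms]
    by (cases "pr c"; cases "pr b"; cases "pr a"; cases "pr d") simp_all
  ultimately show ?thesis unfolding eqv4_def by blast
qed
lemma eqv4_sw3: assumes "eqv4 F" shows "eqv4 (sw3 F)"
proof -
  have "D x y (sw3 F a b c d) = act4 x y (sw3 F) a b c d" for x y a b c d
    unfolding sw3_def flinD[OF flin_D] eqv4D(2)[OF assms] act4_def dvec_def
    by (cases "pr x"; cases "pr y"; cases "pr c"; cases "pr d"; cases "pr a"; cases "pr b"; rule poly_mapping_eqI)
      (simp_all add: s_def h_par lk_simps algebra_simps)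
  moreover have "sig (sw3 F a b c d) = sgn_b ((pr a \<noteq> pr b) \<noteq> (pr c \<noteq> pr d)) \<cdot> sw3 F a b c d" for a b c d
    unfolding sw3_def flinD[OF flin_sig] eqv4D(1)[OF assms]
    by (cases "pr c"; cases "pr b"; cases "pr a"; cases "pr d") simp_all
  ultimately show ?thesis unfolding eqv4_def by blast
qed
lemma eqv4_lin: assumes "eqv4 F" "eqv4 G" shows "eqv4 (\<lambda>a b c d. u \<cdot> F a b c d + v \<cdot> G a b c d)"
  unfolding eqv4_def flinD[OF flin_D] flinD[OF flin_sig] eqv4D[OF assms(1)] eqv4D[OF assms(2)] act4_def dvec_def
  by (auto intro!: poly_mapping_eqI simp: lk_simps algebra_simps)

definition W :: fam where "W a b c d = E a b * E c d"

lemma eqv4_W: "eqv4 W"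
proof -
  have "D x y (W a b c d) = act4 x y W a b c d" for x y a b c d
    unfolding W_def D_mult sgp_E D_E dl_def act4_def dvec_def
    by (cases "pr x = pr y"; cases "pr a"; cases "pr b"; cases "pr c")
       (simp_all add: algebra_simps fr.scale_right_distrib fr.scale_right_diff_distrib)
  moreover have "sig (W a b c d) = sgn_b ((pr a \<noteq> pr b) \<noteq> (pr c \<noteq> pr d)) \<cdot> W a b c d" for a b c d
    by (cases "pr a = pr b"; cases "pr c = pr d") (simp_all add: W_def sig_mult sig_E)
  ultimately show ?thesis unfolding eqv4_def by blast
qed

definition hs :: "fam \<Rightarrow> fam" where
  "hs F a b c d = sgn_b ((pr a \<noteq> pr b) \<and> (pr c \<noteq> pr d)) \<cdot> F c d a b"
text \<open>Exchanging the two index pairs takes four adjacent transpositions, and their Koszul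
  signs multiply up to the single sign in \<open>hs\<close>.\<close>

lemma hs_eq: "hs F = sw2 (sw1 (sw3 (sw2 F)))"
proof (intro ext)
  fix a b c d show "hs F a b c d = sw2 (sw1 (sw3 (sw2 F))) a b c d"
    unfolding hs_def sw1_def sw2_def sw3_def s_def
    by (cases "pr c"; cases "pr b"; cases "pr a"; cases "pr d") simp_all
qed
lemma eqv4_hs: "eqv4 F \<Longrightarrow> eqv4 (hs F)" unfolding hs_eq by (intro eqv4_sw1 eqv4_sw2 eqv4_sw3)

text \<open>Signed sums of permuted monomials: \<open>Sy\<close> projects onto the symmetric square of the algebra
  (up to the factor 8), \<open>PL\<close> is 24 times its total antisymmetrisation.\<close>
definition Wa :: fam where "Wa a b c d = W a b c d - s a b \<cdot> W b a c d - s c d \<cdot> W a b d c + (s a b * s c d) \<cdot> W b a d c"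
definition Sy :: fam where "Sy a b c d = Wa a b c d + sgn_b ((pr a \<noteq> pr b) \<and> (pr c \<noteq> pr d)) \<cdot> Wa c d a b"
definition PL :: fam where
  "PL a b c d = Sy a b c d + sgn_b (pr a \<and> (pr b \<noteq> pr c)) \<cdot> Sy b c a d - s b c \<cdot> Sy a c b d"
definition TR :: "nat \<Rightarrow> nat \<Rightarrow> fr" where "TR a d = (\<Sum>b<N. \<Sum>c<N. h b c \<cdot> Sy a b c d)"

lemma eqv4_diff: "eqv4 F \<Longrightarrow> eqv4 G \<Longrightarrow> eqv4 (\<lambda>a b c d. F a b c d - G a b c d)"
  using eqv4_lin[of F G 1 "-1"] by simp
lemma eqv4_add: "eqv4 F \<Longrightarrow> eqv4 G \<Longrightarrow> eqv4 (\<lambda>a b c d. F a b c d + G a b c d)"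
  using eqv4_lin[of F G 1 1] by simp

lemma eqv4_Sy: "eqv4 Sy"
proof -
  have "Wa = (\<lambda>a b c d. (W a b c d - sw1 W a b c d) - (sw3 W a b c d - sw3 (sw1 W) a b c d))"
    by (intro ext) (simp add: Wa_def sw1_def sw3_def algebra_simps)
  moreover have "eqv4 \<dots>" by (intro eqv4_diff eqv4_sw3 eqv4_sw1 eqv4_W)
  ultimately have "eqv4 Wa" by simp
  then have "eqv4 (\<lambda>a b c d. Wa a b c d + hs Wa a b c d)" by (intro eqv4_add eqv4_hs)
  moreover have "Sy = (\<lambda>a b c d. Wa a b c d + hs Wa a b c d)" by (intro ext) (simp add: Sy_def hs_def)
  ultimately show ?thesis by simp
qed
lemma eqv4_PL: "eqv4 PL"
proof -
  have "PL = (\<lambda>a b c d. Sy a b c d + sw1 (sw2 Sy) a b c d - sw2 Sy a b c d)"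
  proof (intro ext)
    fix a b c d show "PL a b c d = Sy a b c d + sw1 (sw2 Sy) a b c d - sw2 Sy a b c d"
      by (cases "pr a"; cases "pr b"; cases "pr c") (simp_all add: PL_def sw1_def sw2_def s_def)
  qed
  moreover have "eqv4 \<dots>" by (intro eqv4_diff eqv4_add eqv4_sw2 eqv4_sw1 eqv4_Sy)
  ultimately show ?thesis by simp
qed

lemma Sy_sym: "Sy b a c d = (- s a b) \<cdot> Sy a b c d" "Sy a b d c = (- s c d) \<cdot> Sy a b c d"
  "Sy c d a b = sgn_b ((pr a \<noteq> pr b) \<and> (pr c \<noteq> pr d)) \<cdot> Sy a b c d"
proof -
  show "Sy b a c d = (- s a b) \<cdot> Sy a b c d"
    unfolding Sy_def Wa_def s_def
    by (cases "pr a"; cases "pr b"; cases "pr c"; cases "pr d") (simp_all add: algebra_simps)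
  show "Sy a b d c = (- s c d) \<cdot> Sy a b c d"
    unfolding Sy_def Wa_def s_def
    by (cases "pr a"; cases "pr b"; cases "pr c"; cases "pr d") (simp_all add: algebra_simps)
  show "Sy c d a b = sgn_b ((pr a \<noteq> pr b) \<and> (pr c \<noteq> pr d)) \<cdot> Sy a b c d"
    unfolding Sy_def
    by (cases "pr a = pr b"; cases "pr c = pr d") (simp_all add: algebra_simps)
qed

lemma PL_sym: "PL b a c d = (- s a b) \<cdot> PL a b c d" "PL a c b d = (- s b c) \<cdot> PL a b c d"
  "PL a b d c = (- s c d) \<cdot> PL a b c d"
proof -
  \<comment> \<open>These instances bring every permuted \<open>Sy\<close> to one of three
    representatives, one for each splitting of the four indices into two pairs, with
    \<open>a\<close> in front.\<close>
  note y = Sy_sym(1)[where a=a and b=b] Sy_sym(2)[where c=a and d=b] Sy_sym(1)[where a=a and b=c]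
    Sy_sym(2)[where c=a and d=c] Sy_sym(1)[where a=a and b=d] Sy_sym(2)[where c=a and d=d]
    Sy_sym(1)[where a=b and b=c] Sy_sym(2)[where c=b and d=c] Sy_sym(1)[where a=b and b=d]
    Sy_sym(2)[where c=b and d=d] Sy_sym(1)[where a=c and b=d] Sy_sym(2)[where c=c and d=d]
    Sy_sym(3)[where a=a and b=b and c=c and d=d] Sy_sym(3)[where a=a and b=c and c=b and d=d] Sy_sym(3)[where a=a and b=d and c=b and d=c]
  show "PL b a c d = (- s a b) \<cdot> PL a b c d"
    unfolding PL_def y s_def
    by (cases "pr a"; cases "pr b"; cases "pr c"; cases "pr d") (simp_all add: algebra_simps)
  show "PL a c b d = (- s b c) \<cdot> PL a b c d"
    unfolding PL_def y s_def
    by (cases "pr a"; cases "pr b"; cases "pr c"; cases "pr d") (simp_all add: algebra_simps)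
  show "PL a b d c = (- s c d) \<cdot> PL a b c d"
    unfolding PL_def y s_def
    by (cases "pr a"; cases "pr b"; cases "pr c"; cases "pr d") (simp_all add: algebra_simps)
qed

lemma Wa_oideal: assumes L: "oideal L" shows "Wa a b c d - 4 \<cdot> W a b c d \<in> L"
proof -
  note Li = oideal_idealD(1)[OF L] and Ls = oideal_idealD(2)[OF L]
  have "Wa a b c d - 4 \<cdot> W a b c d =
    (- 1) \<cdot> (r1 a b * E c d) + (- 2) \<cdot> (E a b * r1 c d) + s c d \<cdot> (r1 a b * E d c)"
    by (rule poly_mapping_eqI) (simp add: Wa_def W_def r1_def distrib_left distrib_right lk_simps algebra_simps)
  also have "\<dots> \<in> L" by (intro subsp_add[OF Ls] subsp_sm[OF Ls] idealD[OF Li] oideal_r1[OF L])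
  finally show ?thesis .
qed
text \<open>A product is its symmetrisation plus half the bracket. The factor 8 counts the summands
  of \<open>Sy\<close>; the factor 4 counts those coming from the exchanged pair, each of which
  contributes one bracket.\<close>

lemma Sy_oideal: assumes L: "oideal L" shows "Sy a b c d - (8 \<cdot> W a b c d - 4 \<cdot> D a b (E c d)) \<in> L"
proof -
  note Ls = oideal_idealD(2)[OF L]
  let ?t = "sgn_b ((pr a \<noteq> pr b) \<and> (pr c \<noteq> pr d))"
  have "Sy a b c d - (8 \<cdot> W a b c d - 4 \<cdot> D a b (E c d)) =
    (Wa a b c d - 4 \<cdot> W a b c d) + ?t \<cdot> (Wa c d a b - 4 \<cdot> W c d a b) - 4 \<cdot> (r2 a b c d - D a b (E c d))"
    by (rule poly_mapping_eqI) (simp add: Sy_def r2_def W_def[symmetric] lk_simps algebra_simps)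
  also have "\<dots> \<in> L" by (intro subsp_add[OF Ls] subsp_diff[OF Ls] subsp_sm[OF Ls] oideal_r2[OF L] Wa_oideal[OF L])
  finally show ?thesis .
qed

lemma sum_h_contract: "y < N \<Longrightarrow> (\<Sum>c<N. (\<Sum>b<N. h b c * h b y) \<cdot> G c) = G y" for G :: "nat \<Rightarrow> fr"
proof -
  assume "y < N"
  then have "(\<Sum>b<N. h b c * h b y) \<cdot> G c = (if c = y then G c else 0)" if "c < N" for c
    using that h_inv[of y c] by simp
  then show ?thesis using \<open>y < N\<close> by simp
qed

text \<open>Invariance of the metric: the terms in which the derivation hits one of the two
  contracted indices, called \<open>Z\<close> and \<open>V\<close> in the proof, cancel.\<close>

lemma eqv2_contract:
  assumes F: "eqv4 F" shows "eqv2 (\<lambda>a d. \<Sum>b<N. \<Sum>c<N. h b c \<cdot> F a b c d)" (is "eqv2 ?T")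
proof -
  have S: "sig (h b c \<cdot> F a b c d) = sgn_b (pr a \<noteq> pr d) \<cdot> (h b c \<cdot> F a b c d)" for a b c d
  proof (cases "pr b = pr c")
    case True then show ?thesis
      by (cases "pr c"; cases "pr a"; cases "pr d") (simp_all add: flinD[OF flin_sig] eqv4D(1)[OF F])
  qed (simp add: h_par flinD[OF flin_sig])
  have "sig (?T a d) = sgn_b (pr a \<noteq> pr d) \<cdot> ?T a d" for a d
    unfolding flin_sum[OF flin_sig] S fr.scale_sum_right ..
  moreover
  have "D x y (?T a d) = act2 x y ?T a d" if xy: "x < N" "y < N" for x y a d
  proof -
    let ?q = "pr x \<noteq> pr y"
    define X where "X b c = h b c \<cdot> dvec x y a (\<lambda>k. F k b c d)" for b c
    define Y where "Y b c = h b c \<cdot> dvec x y d (\<lambda>k. F a b c k)" for b c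
    define Z where "Z b c = h b c \<cdot> dvec x y b (\<lambda>k. F a k c d)" for b c
    define V where "V b c = sgn_b (?q \<and> pr b) \<cdot> h b c \<cdot> dvec x y c (\<lambda>k. F a b k d)" for b c
    have 1: "h b c \<cdot> act4 x y F a b c d = X b c + sgn_b (?q \<and> pr a) \<cdot> Y b c + sgn_b (?q \<and> pr a) \<cdot> (Z b c + V b c)" for b c
    proof (cases "pr b = pr c")
      case True then show ?thesis unfolding act4_def X_def Y_def Z_def V_def
        by (cases "?q"; cases "pr a"; cases "pr c") (simp_all add: fr.scale_right_distrib algebra_simps)
    qed (simp add: h_par X_def Y_def Z_def V_def)
    have 2: "(\<Sum>b<N. \<Sum>c<N. Z b c) = (1/2) \<cdot> F a x y d - (s x y/2) \<cdot> F a y x d"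
    proof -
      have "Z b c = (1/2) \<cdot> (h b c * h b y) \<cdot> F a x c d - (s x y/2) \<cdot> (h b c * h b x) \<cdot> F a y c d" for b c
        by (simp add: Z_def dvec_def fr.scale_right_diff_distrib mult.commute mult.left_commute)
      then have "(\<Sum>b<N. \<Sum>c<N. Z b c) = (\<Sum>c<N. \<Sum>b<N. (1/2) \<cdot> (h b c * h b y) \<cdot> F a x c d - (s x y/2) \<cdot> (h b c * h b x) \<cdot> F a y c d)"
        by (subst sum.swap) (simp only:)
      also have "\<dots> = (1/2) \<cdot> (\<Sum>c<N. (\<Sum>b<N. h b c * h b y) \<cdot> F a x c d) - (s x y/2) \<cdot> (\<Sum>c<N. (\<Sum>b<N. h b c * h b x) \<cdot> F a y c d)"
        unfolding fr.scale_sum_left fr.scale_sum_right sum_subtractf ..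
      finally show ?thesis using xy by (simp only: sum_h_contract)
    qed
    have 3: "(\<Sum>b<N. \<Sum>c<N. V b c) = (s x y/2) \<cdot> F a y x d - (1/2) \<cdot> F a x y d"
    proof -
      have "V b c = (s x y/2) \<cdot> (h c b * h c y) \<cdot> F a b x d - (1/2) \<cdot> (h c b * h c x) \<cdot> F a b y d" for b c
        unfolding dvec_def V_def h_sym[where b=b and a=c]
        by (cases "pr b"; cases "pr c"; cases "pr x"; cases "pr y") (simp_all add: s_def h_par fr.scale_right_distrib fr.scale_right_diff_distrib mult.commute)
      then have "(\<Sum>b<N. \<Sum>c<N. V b c) =
        (s x y/2) \<cdot> (\<Sum>b<N. (\<Sum>c<N. h c b * h c y) \<cdot> F a b x d) - (1/2) \<cdot> (\<Sum>b<N. (\<Sum>c<N. h c b * h c x) \<cdot> F a b y d)"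
        unfolding fr.scale_sum_left fr.scale_sum_right by (simp only: sum_subtractf)
      then show ?thesis using xy by (simp only: sum_h_contract)
    qed
    have "D x y (?T a d) = (\<Sum>b<N. \<Sum>c<N. X b c) + sgn_b (?q \<and> pr a) \<cdot> (\<Sum>b<N. \<Sum>c<N. Y b c)
       + sgn_b (?q \<and> pr a) \<cdot> ((\<Sum>b<N. \<Sum>c<N. Z b c) + (\<Sum>b<N. \<Sum>c<N. V b c))"
      unfolding flin_sum[OF flin_D] flinD[OF flin_D] eqv4D(2)[OF F] 1 fr.scale_right_distrib fr.scale_sum_right
      by (simp only: sum.distrib)
    also have "\<dots> = (\<Sum>b<N. \<Sum>c<N. X b c) + sgn_b (?q \<and> pr a) \<cdot> (\<Sum>b<N. \<Sum>c<N. Y b c)"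
      unfolding 2 3 by simp
    also have "\<dots> = act2 x y ?T a d"
      unfolding act2_def dvec_def X_def Y_def fr.scale_right_diff_distrib sum_subtractf fr.scale_sum_right fr.scale_scale
      by (simp add: mult.commute mult.left_commute)
    finally show ?thesis .
  qed
  ultimately show ?thesis unfolding eqv2_def by blast
qed

lemma eqv2_TR: "eqv2 TR"
  using eqv2_contract[OF eqv4_Sy] by (simp add: TR_def[abs_def])

lemma TR_sym: "TR d a = s a d \<cdot> TR a d"
proof -
  have "h b c \<cdot> Sy d b c a = s a d \<cdot> h c b \<cdot> Sy a c b d" for b c
    unfolding h_sym[where b=c and a=b]
      Sy_sym(3)[where a=c and b=a and c=d and d=b] Sy_sym(1)[where a=a and b=c] Sy_sym(2)[where c=b and d=d]
    by (cases "pr b = pr c"; cases "pr a"; cases "pr b"; cases "pr d") (simp_all add: s_def h_par)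
  then have "TR d a = (\<Sum>b<N. \<Sum>c<N. s a d \<cdot> h c b \<cdot> Sy a c b d)" by (simp only: TR_def)
  also have "\<dots> = s a d \<cdot> TR a d" by (subst sum.swap) (simp only: TR_def fr.scale_sum_right)
  finally show ?thesis .
qed

subsection \<open>The graded Joseph ideal\<close>

text \<open>The letters out of range, \<open>r1\<close> and \<open>r2\<close> cut the free algebra
  down to the supersymmetric algebra \<open>S(g)\<close>. For an ordinary antisymmetric matrix
  \<open>A\<close>, the remaining generators say that \<open>A \<and> A = 0\<close> and
  \<open>A^2 = 0\<close>, the equations of the closure of the minimal nilpotent orbit.\<close>

inductive_set I :: "fr set" where
  I_letter: "\<not> (a < N \<and> b < N) \<Longrightarrow> E a b \<in> I"
| I_r1: "r1 a b \<in> I"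
| I_r2: "r2 a b c d \<in> I"
| I_PL: "PL a b c d \<in> I"
| I_TR: "TR a d \<in> I"
| I_zero: "0 \<in> I"
| I_add: "f \<in> I \<Longrightarrow> g \<in> I \<Longrightarrow> f + g \<in> I"
| I_left: "f \<in> I \<Longrightarrow> r * f \<in> I"
| I_right: "f \<in> I \<Longrightarrow> f * r \<in> I"

lemma ideal_I: "ideal I" by (simp add: ideal_def I_zero I_add I_left I_right)
lemma subsp_I: "subsp I" by (rule ideal_subsp[OF ideal_I])

lemma eqv2_r1: "eqv2 r1"
proof -
  have "D x y (r1 a b) = act2 x y r1 a b" for x y a b
    unfolding r1_def flinD[OF flin_D] D_E dl_def act2_def dvec_def
    by (cases "pr x"; cases "pr y"; cases "pr a"; cases "pr b"; rule poly_mapping_eqI)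
      (simp_all add: s_def h_par lk_simps algebra_simps)
  moreover have "sig (r1 a b) = sgn_b (pr a \<noteq> pr b) \<cdot> r1 a b" for a b
    unfolding r1_def flinD[OF flin_sig] sig_E
    by (cases "pr a"; cases "pr b") (simp_all add: s_def)
  ultimately show ?thesis unfolding eqv2_def by blast
qed
lemma eqv4_r2: "eqv4 r2"
proof -
  have "r2 = (\<lambda>a b c d. W a b c d - hs W a b c d)" by (intro ext) (simp add: r2_def hs_def W_def)
  then show ?thesis using eqv4_diff[OF eqv4_W eqv4_hs[OF eqv4_W]] by simp
qed

lemma dvec_in: "subsp S \<Longrightarrow> (\<And>k. G k \<in> S) \<Longrightarrow> dvec x y a G \<in> S"
  unfolding dvec_def by (intro subsp_diff subsp_sm)
lemma act4_in: "subsp S \<Longrightarrow> (\<And>a b c d. F a b c d \<in> S) \<Longrightarrow> act4 x y F a b c d \<in> S"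
  unfolding act4_def by (intro subsp_add subsp_sm dvec_in)
lemma act2_in: "subsp S \<Longrightarrow> (\<And>a d. F a d \<in> S) \<Longrightarrow> act2 x y F a d \<in> S"
  unfolding act2_def by (intro subsp_add subsp_sm dvec_in)

lemma I_sig: "f \<in> I \<Longrightarrow> sig f \<in> I"
proof (induction rule: I.induct)
  case (I_letter a b) then show ?case unfolding sig_E by (intro subsp_sm[OF subsp_I] I.I_letter)
next
  case (I_r1 a b) then show ?case unfolding eqv2D(1)[OF eqv2_r1] by (intro subsp_sm[OF subsp_I] I.I_r1)
next
  case (I_r2 a b) then show ?case unfolding eqv4D(1)[OF eqv4_r2] by (intro subsp_sm[OF subsp_I] I.I_r2)
next
  case (I_PL a b) then show ?case unfolding eqv4D(1)[OF eqv4_PL] by (intro subsp_sm[OF subsp_I] I.I_PL)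
next
  case (I_TR a b) then show ?case unfolding eqv2D(1)[OF eqv2_TR] by (intro subsp_sm[OF subsp_I] I.I_TR)
qed (simp_all add: flinD[OF flin_sig] sig_mult I_zero I_add I_left I_right)

lemma I_D:
  assumes xy: "x < N" "y < N" shows "f \<in> I \<Longrightarrow> D x y f \<in> I"
proof (induction rule: I.induct)
  case (I_letter a b)
  have g: "v \<cdot> E k l \<in> I" if "v = 0 \<or> \<not> (k < N \<and> l < N)" for v k l
    using that I.I_letter[of k l] subsp_sm[OF subsp_I, of "E k l" v] I_zero by (cases "v = 0") simp_all
  show ?case unfolding D_E dl_def dvec_def fr.scale_right_diff_distrib fr.scale_scale
    by (intro subsp_diff[OF subsp_I] subsp_add[OF subsp_I] g) (use I_letter h_supp in auto)
next
  case (I_r1 a b) then show ?case unfolding eqv2D(2)[OF eqv2_r1 xy] by (intro act2_in[OF subsp_I] I.I_r1)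
next
  case (I_r2 a b) then show ?case unfolding eqv4D(2)[OF eqv4_r2] by (intro act4_in[OF subsp_I] I.I_r2)
next
  case (I_PL a b) then show ?case unfolding eqv4D(2)[OF eqv4_PL] by (intro act4_in[OF subsp_I] I.I_PL)
next
  case (I_TR a b) then show ?case unfolding eqv2D(2)[OF eqv2_TR xy] by (intro act2_in[OF subsp_I] I.I_TR)
next
  case (I_left f r) then show ?case unfolding D_mult by (intro I.I_add I.I_left)
next
  case (I_right f r)
  then have "sgp (pr x \<noteq> pr y) f \<in> I" by (simp add: sgp_def I_sig)
  then show ?case unfolding D_mult using I_right by (intro I.I_add I.I_right)
qed (simp_all add: flinD[OF flin_D] I_zero I_add)

end

lemma subsp_cancel: "subsp S \<Longrightarrow> x + y \<in> S \<Longrightarrow> y \<in> S \<Longrightarrow> x \<in> S"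
  using subsp_diff[of S "x + y" y] by simp

subsection \<open>Canonical metric: the powers of the highest root vector generate\<close>

text \<open>The even index paired with \<open>a\<close> by the canonical metric: 0 with 2 and 1 with
  3 form hyperbolic planes, and the other even vectors are orthonormal. So 0 and 1 span an isotropic
  plane, and \<open>E 0 1\<close> is a root vector.\<close>

definition tw :: "nat \<Rightarrow> nat" where
  "tw a = (if a = 0 then 2 else if a = 1 then 3 else if a = 2 then 0 else if a = 3 then 1 else a)"

locale canon = ospl +
  assumes m7: "m \<ge> 7" and Mpos: "int m - 2 * int n > 2"
    and hcan: "\<And>a b. a < m \<Longrightarrow> b < m \<Longrightarrow> h a b = (if b = tw a then 1 else 0)"
begin

definition M :: complex where "M = of_nat m - 2 * of_nat n"
abbreviation z :: fr where "z \<equiv> E 0 1"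
abbreviation R :: "nat set" where "R \<equiv> {4..<N}"

lemma mN: "m \<le> N" "7 \<le> N" using m7 by (simp_all add: dimN_def)

text \<open>\<open>M\<close> is an integer above 2. The coefficients that have to be inverted in
  \<open>P03\<close> and \<open>P23\<close> are of this form, with \<open>j = 2 * k - 4\<close> and
  \<open>j = 2 * k - 3\<close> for \<open>k \<ge> 1\<close>.\<close>

lemma M_ne: "M + of_int j \<noteq> 0" if "j \<ge> -2" for j :: int
proof
  assume "M + of_int j = 0"
  moreover have "M + of_int j = of_int (int m - 2 * int n + j)" by (simp add: M_def)
  ultimately have "int m - 2 * int n + j = 0" by (metis of_int_eq_0_iff)
  then show False using Mpos that by simp
qed

lemma pr_even: "j < m \<Longrightarrow> \<not> pr j" by (simp add: pr_def)
lemma pr_small [simp]: "\<not> pr 0" "\<not> pr (Suc 0)" "\<not> pr 1" "\<not> pr 2" "\<not> pr 3" "\<not> pr 4" "\<not> pr 5" "\<not> pr 6"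
  using m7 by (simp_all add: pr_def)
lemma s_even [simp]: "\<not> pr a \<Longrightarrow> s a b = 1" "\<not> pr b \<Longrightarrow> s a b = 1" by (simp_all add: s_def)

lemma hL: "j < m \<Longrightarrow> h j a = (if a = tw j then 1 else 0)"
proof -
  assume j: "j < m"
  have t: "tw j < m" using j m7 by (auto simp: tw_def)
  consider "a < m" | "pr a" | "\<not> a < N" unfolding pr_def by linarith
  then show ?thesis
  proof cases
    case 2
    then have "h j a = 0" using j by (intro h_par) (simp add: pr_even)
    then show ?thesis using 2 t by (auto simp: pr_def)
  next
    case 3
    then have "h j a = 0" by (intro h_supp) simp
    then show ?thesis using 3 t mN by auto
  qed (use j hcan in simp)
qed
lemma hR: "j < m \<Longrightarrow> h a j = (if a = tw j then 1 else 0)"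
  using hL[of j a] h_sym[where b=a and a=j] by (simp add: pr_even)

lemma hv [simp]: "h 0 a = (if a = 2 then 1 else 0)" "h a 0 = (if a = 2 then 1 else 0)"
  "h 1 a = (if a = 3 then 1 else 0)" "h a 1 = (if a = 3 then 1 else 0)"
  "h (Suc 0) a = (if a = 3 then 1 else 0)" "h a (Suc 0) = (if a = 3 then 1 else 0)"
  "h 2 a = (if a = 0 then 1 else 0)" "h a 2 = (if a = 0 then 1 else 0)"
  "h 3 a = (if a = 1 then 1 else 0)" "h a 3 = (if a = 1 then 1 else 0)"
  "h 4 a = (if a = 4 then 1 else 0)" "h a 4 = (if a = 4 then 1 else 0)"
  "h 5 a = (if a = 5 then 1 else 0)" "h a 5 = (if a = 5 then 1 else 0)"
  "h 6 a = (if a = 6 then 1 else 0)" "h a 6 = (if a = 6 then 1 else 0)"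
  using m7 by (auto simp: hL hR tw_def)

lemma sum_small: "(\<Sum>b<N. f b) = f 0 + f 1 + f 2 + f 3 + (\<Sum>b\<in>R. f b)" for f :: "nat \<Rightarrow> 'a::comm_monoid_add"
proof -
  have "{..<N} = {0,1,2,3} \<union> R" using mN by auto
  then have "(\<Sum>b<N. f b) = sum f ({0,1,2,3} \<union> R)" by (simp only:)
  also have "\<dots> = sum f {0,1,2,3} + sum f R" by (rule sum.union_disjoint) auto
  also have "sum f {0,1,2,3} = f 0 + f 1 + f 2 + f 3" by (simp add: add.assoc)
  finally show ?thesis .
qed

lemma hsplit: "(\<Sum>b<N. \<Sum>c<N. h b c \<cdot> F b c) = F 0 2 + F 1 3 + F 2 0 + F 3 1 + (\<Sum>b\<in>R. \<Sum>c\<in>R. h b c \<cdot> F b c)"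
proof -
  have "(\<Sum>c<N. h b c \<cdot> F b c) = (\<Sum>c\<in>R. h b c \<cdot> F b c)" if "b \<in> R" for b
    unfolding sum_small using that by simp
  moreover have "(\<Sum>c<N. h b c \<cdot> F b c) = F b (tw b)" if "b < 4" for b
  proof -
    have "(\<Sum>c<N. h b c \<cdot> F b c) = (\<Sum>c<N. if c = tw b then F b c else 0)"
      using that m7 by (intro sum.cong) (auto simp: hL)
    then show ?thesis using that mN by (auto simp: tw_def)
  qed
  ultimately have "(\<Sum>b<N. \<Sum>c<N. h b c \<cdot> F b c) = F 0 (tw 0) + F 1 (tw 1) + F 2 (tw 2) + F 3 (tw 3) + (\<Sum>b\<in>R. \<Sum>c\<in>R. h b c \<cdot> F b c)"
    unfolding sum_small[of "\<lambda>b. \<Sum>c<N. h b c \<cdot> F b c"] by (simp del: hv)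
  then show ?thesis by (simp add: tw_def)
qed

text \<open>This sum is the superdimension of the orthogonal complement of the two hyperbolic
  planes: an even index contributes 1, an odd one -1.\<close>

lemma sum_hh: "(\<Sum>b\<in>R. \<Sum>c\<in>R. h b c * h c b) = M - 4"
proof -
  have "(\<Sum>c\<in>R. h b c * h c b) = s b b" if b: "b \<in> R" for b
  proof -
    have "(\<Sum>c\<in>R. h b c * h c b) = (\<Sum>c\<in>R. s b b * (h c b * h c b))"
    proof (intro sum.cong refl)
      fix c show "h b c * h c b = s b b * (h c b * h c b)"
        by (cases "pr b = pr c") (simp_all add: h_sym[where b=b and a=c] h_par s_def)
    qed
    also have "\<dots> = s b b * (\<Sum>c<N. h c b * h c b)"
      unfolding sum_small using b by (simp add: sum_distrib_left)
    finally show ?thesis using b h_inv[of b b] by simp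
  qed
  then have "(\<Sum>b\<in>R. \<Sum>c\<in>R. h b c * h c b) = (\<Sum>b\<in>R. s b b)" by simp
  also have "\<dots> = (\<Sum>b\<in>{4..<m} \<union> {m..<N}. s b b)" using m7 mN by (intro sum.cong) auto
  also have "\<dots> = (\<Sum>b\<in>{4..<m}. s b b) + (\<Sum>b\<in>{m..<N}. s b b)" by (rule sum.union_disjoint) auto
  also have "\<dots> = (\<Sum>b\<in>{4..<m}. 1) + (\<Sum>b\<in>{m..<N}. -1)"
    by (intro arg_cong2[of _ _ _ _ "(+)"] sum.cong) (auto simp: s_def pr_def)
  also have "\<dots> = M - 4" using m7 by (simp add: M_def dimN_def of_nat_diff)
  finally show ?thesis .
qed

definition cg :: "fr \<Rightarrow> fr \<Rightarrow> bool" (infix "\<approx>" 50) where "x \<approx> y \<longleftrightarrow> x - y \<in> I"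

lemma cg_refl [simp]: "x \<approx> x" by (simp add: cg_def I_zero)
lemma cg_in: "x \<approx> y \<Longrightarrow> y \<in> I \<Longrightarrow> x \<in> I" unfolding cg_def using subsp_cong[OF subsp_I] by blast
lemma cg_sym: "x \<approx> y \<Longrightarrow> y \<approx> x" unfolding cg_def using subsp_neg[OF subsp_I] by fastforce
lemma cg_trans [trans]: "x \<approx> y \<Longrightarrow> y \<approx> w \<Longrightarrow> x \<approx> w" unfolding cg_def using I_add by fastforce
lemma cg_add: "x \<approx> y \<Longrightarrow> x' \<approx> y' \<Longrightarrow> x + x' \<approx> y + y'"
  unfolding cg_def by (drule (1) I_add) (simp add: algebra_simps)
lemma cg_sm: "x \<approx> y \<Longrightarrow> c \<cdot> x \<approx> c \<cdot> y"
  unfolding cg_def by (drule subsp_sm[OF subsp_I, of _ c]) (simp add: fr.scale_right_diff_distrib)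
lemma cg_diff: "x \<approx> y \<Longrightarrow> x' \<approx> y' \<Longrightarrow> x - x' \<approx> y - y'"
  using cg_add[of x y "(-1) \<cdot> x'" "(-1) \<cdot> y'"] cg_sm[of x' y' "-1"] by simp
lemma cg_multL: "x \<approx> y \<Longrightarrow> r * x \<approx> r * y" unfolding cg_def by (drule I_left[of _ r]) (simp add: algebra_simps)
lemma cg_multR: "x \<approx> y \<Longrightarrow> x * r \<approx> y * r" unfolding cg_def by (drule I_right[of _ r]) (simp add: algebra_simps)
lemma cg_mult: "x \<approx> y \<Longrightarrow> x' \<approx> y' \<Longrightarrow> x * x' \<approx> y * y'"
  by (rule cg_trans[OF cg_multL cg_multR])
lemma cg_sum: "(\<And>x. x \<in> A \<Longrightarrow> f x \<approx> g x) \<Longrightarrow> sum f A \<approx> sum g A"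
  by (induction A rule: infinite_finite_induct) (simp_all add: cg_add)
lemma cg_0: "x \<in> I \<longleftrightarrow> x \<approx> 0" by (simp add: cg_def)

lemma cg_E: "E b a \<approx> (- s a b) \<cdot> E a b"
  unfolding cg_def using subsp_sm[OF subsp_I I_r1[of a b], of "s a b"]
  by (simp add: r1_def fr.scale_right_distrib add.commute)
lemma E_diag: "\<not> pr a \<Longrightarrow> E a a \<in> I"
proof -
  assume "\<not> pr a"
  then have "r1 a a = 2 \<cdot> E a a" by (simp add: r1_def) (rule poly_mapping_eqI, simp add: lk_simps)
  then have "2 \<cdot> E a a \<in> I" using I_r1[of a a] by simp
  then show ?thesis by (simp add: subsp_sm_iff[OF subsp_I])
qed
lemma cg_W: "E a b * E c d \<approx> sgn_b ((pr a \<noteq> pr b) \<and> (pr c \<noteq> pr d)) \<cdot> (E c d * E a b)"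
  unfolding cg_def using I_r2[of a b c d] by (simp add: r2_def)

lemma cg_z: "z * f \<approx> f * z"
proof (induction f rule: fr_induct)
  case (wd c w)
  have "z * wd w \<approx> wd w * z"
  proof (induction w)
    case (Cons l w)
    obtain a b where l: "l = (a, b)" by force
    have "z * E a b * wd w \<approx> E a b * z * wd w" using cg_multR[OF cg_W[of 0 1 a b]] by simp
    also have "E a b * z * wd w = E a b * (z * wd w)" by (simp add: mult.assoc)
    also have "\<dots> \<approx> E a b * (wd w * z)" by (rule cg_multL[OF Cons])
    finally show ?case by (simp add: l wd_Cons mult.assoc)
  qed simp
  then show ?case using cg_sm[of "z * wd w" "wd w * z" c] by simp
qed (auto simp: distrib_left distrib_right intro: cg_add)

lemma cg_Wa: "Wa a b c d \<approx> 4 \<cdot> W a b c d"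
proof -
  have "Wa a b c d - 4 \<cdot> W a b c d =
    (- 1) \<cdot> (r1 a b * E c d) + (- 2) \<cdot> (E a b * r1 c d) + s c d \<cdot> (r1 a b * E d c)"
    by (rule poly_mapping_eqI) (simp add: Wa_def W_def r1_def distrib_left distrib_right lk_simps algebra_simps)
  also have "\<dots> \<in> I" by (intro I_add subsp_sm[OF subsp_I] I_left I_right I_r1)
  finally show ?thesis by (simp add: cg_def)
qed
lemma cg_Sy: "Sy a b c d \<approx> 8 \<cdot> W a b c d"
proof -
  let ?t = "sgn_b ((pr a \<noteq> pr b) \<and> (pr c \<noteq> pr d))"
  have "Sy a b c d \<approx> 4 \<cdot> W a b c d + ?t \<cdot> (4 \<cdot> W c d a b)"
    unfolding Sy_def by (intro cg_add cg_sm cg_Wa)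
  also have "\<dots> = 4 \<cdot> W a b c d + 4 \<cdot> (?t \<cdot> (E c d * E a b))" by (simp add: W_def mult.commute)
  also have "\<dots> \<approx> 4 \<cdot> W a b c d + 4 \<cdot> (E a b * E c d)" by (intro cg_add cg_refl cg_sm cg_sym[OF cg_W])
  also have "\<dots> = 8 \<cdot> W a b c d" by (rule poly_mapping_eqI) (simp add: W_def lk_simps)
  finally show ?thesis .
qed

lemma PL_rel: "E a b * E c d + sgn_b (pr a \<and> (pr b \<noteq> pr c)) \<cdot> (E b c * E a d) - s b c \<cdot> (E a c * E b d) \<in> I"
proof -
  have "PL a b c d \<approx> 8 \<cdot> W a b c d + sgn_b (pr a \<and> (pr b \<noteq> pr c)) \<cdot> 8 \<cdot> W b c a d - s b c \<cdot> 8 \<cdot> W a c b d"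
    unfolding PL_def by (intro cg_add cg_diff cg_sm cg_Sy)
  also have "\<dots> = 8 \<cdot> (E a b * E c d + sgn_b (pr a \<and> (pr b \<noteq> pr c)) \<cdot> (E b c * E a d) - s b c \<cdot> (E a c * E b d))"
    by (simp add: W_def fr.scale_right_distrib fr.scale_right_diff_distrib mult.commute)
  finally have "8 \<cdot> (E a b * E c d + sgn_b (pr a \<and> (pr b \<noteq> pr c)) \<cdot> (E b c * E a d) - s b c \<cdot> (E a c * E b d)) \<in> I"
    using I_PL[of a b c d] subsp_cong[OF subsp_I] unfolding cg_def by blast
  then show ?thesis by (simp add: subsp_sm_iff[OF subsp_I])
qed
lemma TR_rel: "(\<Sum>b<N. \<Sum>c<N. h b c \<cdot> (E a b * E c d)) \<in> I"
proof -
  have "TR a d \<approx> (\<Sum>b<N. \<Sum>c<N. h b c \<cdot> (8 \<cdot> W a b c d))"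
    unfolding TR_def by (intro cg_sum cg_sm cg_Sy)
  also have "\<dots> = 8 \<cdot> (\<Sum>b<N. \<Sum>c<N. h b c \<cdot> (E a b * E c d))"
    by (simp add: W_def fr.scale_sum_right mult.commute)
  finally have "8 \<cdot> (\<Sum>b<N. \<Sum>c<N. h b c \<cdot> (E a b * E c d)) \<in> I"
    using I_TR[of a d] subsp_cong[OF subsp_I] unfolding cg_def by blast
  then show ?thesis by (simp add: subsp_sm_iff[OF subsp_I])
qed

text \<open>\<open>z\<close> is even and commutes with everything modulo \<open>I\<close>, hence the
  ordinary power rule.\<close>

lemma D_zpow:
  assumes "x < N" "y < N" shows "D x y (z ^ k) \<approx> of_nat k \<cdot> (dl x y 0 1 * z ^ (k - 1))"
proof (induction k)
  case (Suc k)
  have "D x y (z ^ Suc k) = dl x y 0 1 * z ^ k + z * D x y (z ^ k)"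
    by (simp add: D_mult sgp_E D_E)
  also have "\<dots> \<approx> dl x y 0 1 * z ^ k + z * (of_nat k \<cdot> (dl x y 0 1 * z ^ (k - 1)))"
    by (intro cg_add cg_refl cg_multL Suc)
  also have "\<dots> = dl x y 0 1 * z ^ k + of_nat k \<cdot> ((z * dl x y 0 1) * z ^ (k - 1))" by (simp add: mult.assoc)
  also have "\<dots> \<approx> dl x y 0 1 * z ^ k + of_nat k \<cdot> ((dl x y 0 1 * z) * z ^ (k - 1))"
    by (intro cg_add cg_refl cg_sm cg_multR cg_z)
  also have "\<dots> = of_nat (Suc k) \<cdot> (dl x y 0 1 * z ^ (Suc k - 1))"
    by (cases k; rule poly_mapping_eqI) (simp_all add: mult.assoc lk_simps algebra_simps)
  finally show ?case .
qed simp

text \<open>This property is isolated because it is applied to three kinds of subspaces: the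
  residual of a stable subspace by a letter (\<open>z_power_generates\<close>), the sum of
  \<open>I\<close> and a cyclic module (\<open>zstable_in_I\<close>), and \<open>lifts L l\<close>
  (\<open>z_power_finite_codim\<close>).\<close>

definition Dst :: "fr set \<Rightarrow> bool" where
  "Dst S \<longleftrightarrow> subsp S \<and> I \<subseteq> S \<and> (\<forall>x<N. \<forall>y<N. \<forall>f\<in>S. D x y f \<in> S)"

lemma DstD: "Dst S \<Longrightarrow> subsp S" "Dst S \<Longrightarrow> f \<in> I \<Longrightarrow> f \<in> S"
  "Dst S \<Longrightarrow> x < N \<Longrightarrow> y < N \<Longrightarrow> f \<in> S \<Longrightarrow> D x y f \<in> S"
  unfolding Dst_def by blast+

lemma Dst_cg: "Dst S \<Longrightarrow> x \<approx> y \<Longrightarrow> x \<in> S \<longleftrightarrow> y \<in> S"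
  unfolding cg_def by (rule subsp_cong[OF DstD(1)], assumption, rule DstD(2))

section \<open>Exchanging one factor of a power of the highest root vector for an arbitrary
  letter\<close>

context
  fixes S k assumes S: "Dst S" and zS: "z ^ Suc k \<in> S"
begin

abbreviation (input) P where "P a b \<equiv> E a b * z ^ k \<in> S"

lemma sp: "subsp S" using S by (rule DstD)

text \<open>Besides the wanted letter times \<open>z ^ k\<close>, a derivative leaves a product of
  two letters times \<open>z ^ (k - 1)\<close>. The relations of \<open>I\<close> serve to turn this
  second term back into a single letter times \<open>z ^ k\<close>.\<close>

lemma P_D:
  assumes "x < N" "y < N" "P a b"
  shows "dl x y a b * z ^ k + (sgn_b ((pr x \<noteq> pr y) \<and> (pr a \<noteq> pr b)) * of_nat k) \<cdot> (E a b * dl x y 0 1 * z ^ (k - 1)) \<in> S"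
proof -
  let ?t = "sgn_b ((pr x \<noteq> pr y) \<and> (pr a \<noteq> pr b))"
  have "D x y (E a b * z ^ k) = dl x y a b * z ^ k + (?t \<cdot> E a b) * D x y (z ^ k)"
    by (simp add: D_mult D_E sgp_E)
  also have "\<dots> \<approx> dl x y a b * z ^ k + (?t \<cdot> E a b) * (of_nat k \<cdot> (dl x y 0 1 * z ^ (k - 1)))"
    by (intro cg_add cg_refl cg_multL D_zpow assms)
  finally have c: "D x y (E a b * z ^ k) \<approx> \<dots>" .
  have "D x y (E a b * z ^ k) \<in> S" using DstD(3)[OF S assms] .
  then have "dl x y a b * z ^ k + (?t \<cdot> E a b) * (of_nat k \<cdot> (dl x y 0 1 * z ^ (k - 1))) \<in> S"
    using Dst_cg[OF S c] by simp
  then show ?thesis by (simp add: mult.assoc mult.commute[of "of_nat k"])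
qed

lemma P_z: assumes "x < N" "y < N" shows "dl x y 0 1 * z ^ k \<in> S"
proof -
  have "D x y (z ^ Suc k) \<in> S" using DstD(3)[OF S assms zS] .
  then have "of_nat (Suc k) \<cdot> (dl x y 0 1 * z ^ k) \<in> S"
    using Dst_cg[OF S D_zpow[OF assms, of "Suc k"]] by simp
  then show ?thesis by (rule subsp_sm_iff[OF sp, THEN iffD1, rotated]) (simp only: of_nat_eq_0_iff nat.simps not_False_eq_True)
qed

lemma P_swap: "P a b \<Longrightarrow> P b a"
  using Dst_cg[OF S cg_multR[OF cg_E[of b a]], of "z ^ k"] subsp_sm[OF sp, of "E a b * z ^ k" "- s a b"]
  by (simp only: sm_mult_left)
lemma P_half: "(c \<cdot> E a b) * z ^ k \<in> S \<Longrightarrow> c \<noteq> 0 \<Longrightarrow> P a b"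
  by (simp add: subsp_sm_iff[OF sp])
lemma P_I: "E a b \<in> I \<Longrightarrow> P a b" by (rule DstD(2)[OF S I_right])

lemma P0u: "u \<in> R \<Longrightarrow> P 0 u"
  using P_z[of u 3] mN by (intro P_half[of "1/2"]) (simp_all add: dl_def dvec_def)
lemma P1u: "u \<in> R \<Longrightarrow> P 1 u"
  using P_z[of u 2] mN by (intro P_swap[of u 1] P_half[of "1/2" u 1]) (simp_all add: dl_def dvec_def)

lemma in_S: "f \<in> I \<Longrightarrow> f \<in> S" by (rule DstD(2)[OF S])
lemma z_split: "k \<noteq> 0 \<Longrightarrow> f * z ^ k \<approx> z * f * z ^ (k - 1)"
proof -
  assume "k \<noteq> 0"
  then have "f * z ^ k = (f * z) * z ^ (k - 1)" by (cases k) (simp_all add: mult.assoc)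
  then show ?thesis using cg_multR[OF cg_sym[OF cg_z[of f]]] by simp
qed

text \<open>Contracting the derivatives along \<open>b 3\<close> of the elements
  \<open>E 0 c * z ^ k\<close> over \<open>R\<close> gives \<open>- (M - 4) / 2\<close> times the
  wanted element plus a quadratic sum, which the trace relation for \<open>0 0\<close> turns into
  \<open>- 2 \<cdot> (z * E 0 3)\<close>. The total coefficient \<open>- (M - 4 + 2 * k) / 2\<close>
  is nonzero for \<open>k \<ge> 1\<close>. For \<open>k = 0\<close> it vanishes when
  \<open>M = 4\<close>, but then there is no quadratic remainder, and one derivative using the unit
  vector 4 suffices.\<close>

lemma P03: "P 0 3"
proof (cases "k = 0")
  case True
  have "dl 4 3 0 4 = (- 1/2) \<cdot> E 0 3" by (simp add: dl_def dvec_def)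
  then show ?thesis using P_D[of 4 3 0 4] P0u[of 4] mN True by (intro P_half[of "- 1/2"]) simp_all
next
  case False
  let ?Y = "E 0 3 * z ^ k" and ?z = "z ^ (k - 1)"
  have el: "(- (h b c * h c b) / 2) \<cdot> ?Y + (of_nat k / 2) \<cdot> ((h c b) \<cdot> (E 0 c * E 0 b)) * ?z \<in> S"
    if "b \<in> R" "c \<in> R" for b c
  proof -
    have d: "dl b 3 0 c = (- h c b / 2) \<cdot> E 0 3" "dl b 3 0 1 = (1/2) \<cdot> E 0 b"
      using that by (simp_all add: dl_def dvec_def)
    have "h b c \<cdot> (dl b 3 0 c * z ^ k + (sgn_b ((pr b \<noteq> pr 3) \<and> (pr 0 \<noteq> pr c)) * of_nat k) \<cdot> (E 0 c * dl b 3 0 1 * ?z)) \<in> S"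
      using that mN by (intro subsp_sm[OF sp] P_D P0u) simp_all
    also have "h b c \<cdot> (dl b 3 0 c * z ^ k + (sgn_b ((pr b \<noteq> pr 3) \<and> (pr 0 \<noteq> pr c)) * of_nat k) \<cdot> (E 0 c * dl b 3 0 1 * ?z))
      = (- (h b c * h c b) / 2) \<cdot> ?Y + (of_nat k / 2) \<cdot> ((s b c * h b c) \<cdot> (E 0 c * E 0 b)) * ?z"
      unfolding d by (simp add: fr.scale_right_distrib fr.scale_right_diff_distrib mult.assoc s_def mult.commute mult.left_commute)
    finally show ?thesis by (simp only: h_sym[symmetric])
  qed
  have "(\<Sum>b\<in>R. \<Sum>c\<in>R. (- (h b c * h c b) / 2) \<cdot> ?Y + (of_nat k / 2) \<cdot> (h c b \<cdot> (E 0 c * E 0 b)) * ?z) \<in> S"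
    by (intro subsp_sum[OF sp] el)
  also have "(\<Sum>b\<in>R. \<Sum>c\<in>R. (- (h b c * h c b) / 2) \<cdot> ?Y + (of_nat k / 2) \<cdot> (h c b \<cdot> (E 0 c * E 0 b)) * ?z)
     = (- (\<Sum>b\<in>R. \<Sum>c\<in>R. h b c * h c b) / 2) \<cdot> ?Y + (of_nat k / 2) \<cdot> (\<Sum>b\<in>R. \<Sum>c\<in>R. h c b \<cdot> (E 0 c * E 0 b)) * ?z"
  proof -
    have "(- (\<Sum>b\<in>R. \<Sum>c\<in>R. h b c * h c b) / 2) = (\<Sum>b\<in>R. \<Sum>c\<in>R. - (h b c * h c b) / 2)"
      by (simp add: sum_negf sum_divide_distrib)
    then show ?thesis
      by (simp only: sum.distrib fr.scale_sum_left fr.scale_sum_right sum_distrib_right sum_distrib_left)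
  qed
  also have "\<dots> = (- (M - 4) / 2) \<cdot> ?Y + (of_nat k / 2) \<cdot> (\<Sum>b\<in>R. \<Sum>c\<in>R. h b c \<cdot> (E 0 b * E 0 c)) * ?z"
    by (subst sum.swap[of "\<lambda>b c. h c b \<cdot> (E 0 c * E 0 b)"]) (simp only: sum_hh)
  finally have A: "(- (M - 4) / 2) \<cdot> ?Y + (of_nat k / 2) \<cdot> (\<Sum>b\<in>R. \<Sum>c\<in>R. h b c \<cdot> (E 0 b * E 0 c)) * ?z \<in> S" .
  have "(\<Sum>b<N. \<Sum>c<N. h b c \<cdot> (E 0 b * E c 0)) \<approx> (\<Sum>b<N. \<Sum>c<N. h b c \<cdot> (E 0 b * ((- 1) \<cdot> E 0 c)))"
  proof (intro cg_sum cg_sm cg_multL)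
    fix c show "E c 0 \<approx> (- 1) \<cdot> E 0 c" using cg_E[of c 0] by simp
  qed
  also have "\<dots> = - (\<Sum>b<N. \<Sum>c<N. h b c \<cdot> (E 0 b * E 0 c))" by (simp add: sum_negf)
  finally have "- (\<Sum>b<N. \<Sum>c<N. h b c \<cdot> (E 0 b * E 0 c)) \<in> I"
    using TR_rel[of 0 0] subsp_cong[OF subsp_I] unfolding cg_def by blast
  from subsp_neg[OF subsp_I this] have "(\<Sum>b<N. \<Sum>c<N. h b c \<cdot> (E 0 b * E 0 c)) \<in> I" by simp
  then have B: "E 0 0 * E 0 2 + z * E 0 3 + E 0 2 * E 0 0 + E 0 3 * z + (\<Sum>b\<in>R. \<Sum>c\<in>R. h b c \<cdot> (E 0 b * E 0 c)) \<approx> 0"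
    unfolding hsplit cg_0 by simp
  have "(\<Sum>b\<in>R. \<Sum>c\<in>R. h b c \<cdot> (E 0 b * E 0 c)) + 2 \<cdot> (z * E 0 3) =
     (E 0 0 * E 0 2 + z * E 0 3 + E 0 2 * E 0 0 + E 0 3 * z + (\<Sum>b\<in>R. \<Sum>c\<in>R. h b c \<cdot> (E 0 b * E 0 c)))
     - E 0 0 * E 0 2 - E 0 2 * E 0 0 + (z * E 0 3 - E 0 3 * z)"
    by (rule poly_mapping_eqI) (simp add: lk_simps)
  also have "\<dots> \<in> I"
    by (rule I_add[OF subsp_diff[OF subsp_I subsp_diff[OF subsp_I]]], rule B[folded cg_0],
        rule I_right[OF E_diag], simp, rule I_left[OF E_diag], simp, rule cg_z[unfolded cg_def])
  finally have C: "((\<Sum>b\<in>R. \<Sum>c\<in>R. h b c \<cdot> (E 0 b * E 0 c)) + 2 \<cdot> (z * E 0 3)) * ?z \<in> S" by (intro in_S I_right)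
  have Dz: "?Y - z * E 0 3 * ?z \<in> S" using z_split[OF False, of "E 0 3"] by (intro in_S) (simp add: cg_def)
  have "(- (M - 4 + 2 * of_nat k) / 2) \<cdot> ?Y =
    ((- (M - 4) / 2) \<cdot> ?Y + (of_nat k / 2) \<cdot> (\<Sum>b\<in>R. \<Sum>c\<in>R. h b c \<cdot> (E 0 b * E 0 c)) * ?z)
    - (of_nat k / 2) \<cdot> (((\<Sum>b\<in>R. \<Sum>c\<in>R. h b c \<cdot> (E 0 b * E 0 c)) + 2 \<cdot> (z * E 0 3)) * ?z)
    - of_nat k \<cdot> (?Y - z * E 0 3 * ?z)"
    by (rule poly_mapping_eqI) (simp add: lk_simps distrib_right algebra_simps, simp add: field_simps)
  also have "\<dots> \<in> S" by (intro subsp_diff[OF sp] subsp_sm[OF sp] A C Dz)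
  finally have F: "(- (M - 4 + 2 * of_nat k) / 2) \<cdot> ?Y \<in> S" .
  have "M - 4 + 2 * of_nat k \<noteq> 0" using M_ne[of "2 * int k - 4"] False by (simp add: algebra_simps)
  then have "- (M - 4 + 2 * of_nat k) / 2 \<noteq> 0" by (metis divide_eq_0_iff neg_equal_0_iff_equal zero_neq_numeral)
  then show ?thesis using F subsp_sm_iff[OF sp] by blast
qed

text \<open>Two independent combinations: the derivative of the power along \<open>2 3\<close>
  yields the sum of the two letters, and the derivative along \<open>1 2\<close> of the element from
  \<open>P03\<close> yields their difference.\<close>

lemma P02_13: "P 0 2" "P 1 3"
proof -
  have d: "dl 2 3 0 1 = (1/2) \<cdot> E 0 2 - (1/2) \<cdot> E 3 1" by (simp add: dl_def dvec_def)
  have "((1/2) \<cdot> E 0 2 - (1/2) \<cdot> E 3 1) * z ^ k \<in> S" using P_z[of 2 3] mN unfolding d by simp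
  moreover have "((1/2) \<cdot> E 0 2 - (1/2) \<cdot> E 3 1) * z ^ k \<approx> ((1/2) \<cdot> E 0 2 - (1/2) \<cdot> ((- 1) \<cdot> E 1 3)) * z ^ k"
    using cg_E[of 3 1] by (intro cg_multR cg_diff cg_sm cg_refl) simp
  ultimately have A: "((1/2) \<cdot> E 0 2 - (1/2) \<cdot> ((- 1) \<cdot> E 1 3)) * z ^ k \<in> S" using Dst_cg[OF S] by blast
  have e: "dl 1 2 0 3 = (1/2) \<cdot> E 1 3 - (1/2) \<cdot> E 0 2" "dl 1 2 0 1 = (1/2) \<cdot> E 1 1" by (simp_all add: dl_def dvec_def)
  have "((1/2) \<cdot> E 1 3 - (1/2) \<cdot> E 0 2) * z ^ k + of_nat k \<cdot> (E 0 3 * ((1/2) \<cdot> E 1 1) * z ^ (k - 1)) \<in> S"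
    using P_D[of 1 2 0 3] mN P03 unfolding e by simp
  moreover have "of_nat k \<cdot> (E 0 3 * ((1/2) \<cdot> E 1 1) * z ^ (k - 1)) \<in> S"
    by (intro in_S subsp_sm[OF subsp_I] I_right I_left E_diag) simp
  ultimately have B: "((1/2) \<cdot> E 1 3 - (1/2) \<cdot> E 0 2) * z ^ k \<in> S"
    by (rule subsp_cancel[OF sp])
  have "E 0 2 * z ^ k = ((1/2) \<cdot> E 0 2 - (1/2) \<cdot> ((- 1) \<cdot> E 1 3)) * z ^ k - ((1/2) \<cdot> E 1 3 - (1/2) \<cdot> E 0 2) * z ^ k"
    "E 1 3 * z ^ k = ((1/2) \<cdot> E 0 2 - (1/2) \<cdot> ((- 1) \<cdot> E 1 3)) * z ^ k + ((1/2) \<cdot> E 1 3 - (1/2) \<cdot> E 0 2) * z ^ k"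
    by (rule poly_mapping_eqI, simp add: lk_simps distrib_right left_diff_distrib)+
  then show "P 0 2" "P 1 3" using subsp_diff[OF sp A B] subsp_add[OF sp A B] by simp_all
qed

lemma P12: "P 1 2"
proof -
  have e: "dl 1 2 0 2 = (1/2) \<cdot> E 1 2" "dl 1 2 0 1 = (1/2) \<cdot> E 1 1" by (simp_all add: dl_def dvec_def)
  have "((1/2) \<cdot> E 1 2) * z ^ k + of_nat k \<cdot> (E 0 2 * ((1/2) \<cdot> E 1 1) * z ^ (k - 1)) \<in> S"
    using P_D[of 1 2 0 2] mN P02_13 unfolding e by simp
  moreover have "of_nat k \<cdot> (E 0 2 * ((1/2) \<cdot> E 1 1) * z ^ (k - 1)) \<in> S"
    by (intro in_S subsp_sm[OF subsp_I] I_right I_left E_diag) simp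
  ultimately have "((1/2) \<cdot> E 1 2) * z ^ k \<in> S" by (rule subsp_cancel[OF sp])
  then show ?thesis by (rule P_half) simp
qed

lemma P_diag: "\<not> pr a \<Longrightarrow> P a a" by (rule P_I[OF E_diag])

lemma P0: "b < N \<Longrightarrow> P 0 b"
proof -
  assume "b < N"
  then consider "b = 0" | "b = 1" | "b = 2" | "b = 3" | "b \<in> R" by fastforce
  then show ?thesis by cases (use zS P_diag[of 0] P02_13 P03 P0u in simp_all)
qed
lemma P1: "b < N \<Longrightarrow> P 1 b"
proof -
  assume "b < N"
  then consider "b = 0" | "b = 1" | "b = 2" | "b = 3" | "b \<in> R" by fastforce
  then show ?thesis by cases (use zS P_diag[of 1] P_swap[of 0 1] P02_13 P12 P1u in simp_all)
qed

text \<open>Derivatives of \<open>E 0 v * z ^ k\<close> and of \<open>E 1 v * z ^ k\<close> both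
  reach \<open>E u v\<close>, with different quadratic remainders (\<open>A\<close>,
  \<open>B\<close>). The Pluecker relation for \<open>0 1 u v\<close> expresses the difference of
  the remainders by \<open>z * E u v\<close> (\<open>C\<close>). Adding up gives the nonzero
  coefficient \<open>1 + k / 2\<close>.\<close>

lemma Puv: assumes u: "u \<in> R" and v: "v < N" "v \<ge> 2" shows "P u v"
proof -
  let ?Y = "E u v * z ^ k" and ?z = "z ^ (k - 1)" and ?T1 = "E 1 u * E 0 v" and ?T2 = "E 0 u * E 1 v"
  have d: "dl u 2 0 v = (1/2) \<cdot> E u v - (h v u / 2) \<cdot> E 0 2" "dl u 2 0 1 = (1/2) \<cdot> E u 1"
    "dl u 3 1 v = (1/2) \<cdot> E u v - (h v u / 2) \<cdot> E 1 3" "dl u 3 0 1 = (1/2) \<cdot> E 0 u"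
    using u v by (simp_all add: dl_def dvec_def)
  have A: "(1/2) \<cdot> ?Y - (of_nat k / 2) \<cdot> (?T1 * ?z) \<in> S"
  proof -
    have "E 0 v * E u 1 \<approx> E 0 v * ((- 1) \<cdot> E 1 u)" using cg_E[of u 1] by (intro cg_multL) simp
    also have "\<dots> = (- 1) \<cdot> (E 0 v * E 1 u)" by simp
    also have "\<dots> \<approx> (- 1) \<cdot> (s u v \<cdot> ?T1)"
      using cg_W[of 0 v 1 u] by (intro cg_sm) (simp add: s_def conj_commute)
    finally have c: "E 0 v * E u 1 \<approx> (- s u v) \<cdot> ?T1" by simp
    have "((1/2) \<cdot> E u v - (h v u / 2) \<cdot> E 0 2) * z ^ k + (s u v * of_nat k) \<cdot> (E 0 v * ((1/2) \<cdot> E u 1) * ?z) \<in> S"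
      using P_D[of u 2 0 v] u v mN P0[of v] unfolding d by (simp add: s_def)
    then have "((1/2) \<cdot> E u v - (h v u / 2) \<cdot> E 0 2) * z ^ k + (s u v * of_nat k) \<cdot> (E 0 v * ((1/2) \<cdot> E u 1) * ?z) + (h v u / 2) \<cdot> (E 0 2 * z ^ k) \<in> S"
      by (rule subsp_add[OF sp _ subsp_sm[OF sp P02_13(1)]])
    also have "((1/2) \<cdot> E u v - (h v u / 2) \<cdot> E 0 2) * z ^ k + (s u v * of_nat k) \<cdot> (E 0 v * ((1/2) \<cdot> E u 1) * ?z) + (h v u / 2) \<cdot> (E 0 2 * z ^ k)
      = (1/2) \<cdot> ?Y + (s u v * of_nat k / 2) \<cdot> (E 0 v * E u 1 * ?z)"
      by (rule poly_mapping_eqI) (simp add: lk_simps left_diff_distrib)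
    finally have "(1/2) \<cdot> ?Y + (s u v * of_nat k / 2) \<cdot> (E 0 v * E u 1 * ?z) \<in> S" .
    moreover have "(1/2) \<cdot> ?Y + (s u v * of_nat k / 2) \<cdot> (E 0 v * E u 1 * ?z) \<approx> (1/2) \<cdot> ?Y + (s u v * of_nat k / 2) \<cdot> (((- s u v) \<cdot> ?T1) * ?z)"
      by (intro cg_add cg_refl cg_sm cg_multR c)
    ultimately have "(1/2) \<cdot> ?Y + (s u v * of_nat k / 2) \<cdot> (((- s u v) \<cdot> ?T1) * ?z) \<in> S" using Dst_cg[OF S] by blast
    then show ?thesis by (simp add: mult.commute mult.left_commute)
  qed
  have B: "(1/2) \<cdot> ?Y + (of_nat k / 2) \<cdot> (?T2 * ?z) \<in> S"
  proof -
    have c: "E 1 v * E 0 u \<approx> s u v \<cdot> ?T2" using cg_W[of 1 v 0 u] by (simp add: s_def conj_commute)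
    have "((1/2) \<cdot> E u v - (h v u / 2) \<cdot> E 1 3) * z ^ k + (s u v * of_nat k) \<cdot> (E 1 v * ((1/2) \<cdot> E 0 u) * ?z) \<in> S"
      using P_D[of u 3 1 v] u v mN P1[of v] unfolding d by (simp add: s_def)
    then have "((1/2) \<cdot> E u v - (h v u / 2) \<cdot> E 1 3) * z ^ k + (s u v * of_nat k) \<cdot> (E 1 v * ((1/2) \<cdot> E 0 u) * ?z) + (h v u / 2) \<cdot> (E 1 3 * z ^ k) \<in> S"
      by (rule subsp_add[OF sp _ subsp_sm[OF sp P02_13(2)]])
    also have "((1/2) \<cdot> E u v - (h v u / 2) \<cdot> E 1 3) * z ^ k + (s u v * of_nat k) \<cdot> (E 1 v * ((1/2) \<cdot> E 0 u) * ?z) + (h v u / 2) \<cdot> (E 1 3 * z ^ k)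
      = (1/2) \<cdot> ?Y + (s u v * of_nat k / 2) \<cdot> (E 1 v * E 0 u * ?z)"
      by (rule poly_mapping_eqI) (simp add: lk_simps left_diff_distrib)
    finally have "(1/2) \<cdot> ?Y + (s u v * of_nat k / 2) \<cdot> (E 1 v * E 0 u * ?z) \<in> S" .
    moreover have "(1/2) \<cdot> ?Y + (s u v * of_nat k / 2) \<cdot> (E 1 v * E 0 u * ?z) \<approx> (1/2) \<cdot> ?Y + (s u v * of_nat k / 2) \<cdot> ((s u v \<cdot> ?T2) * ?z)"
      by (intro cg_add cg_refl cg_sm cg_multR c)
    ultimately have "(1/2) \<cdot> ?Y + (s u v * of_nat k / 2) \<cdot> ((s u v \<cdot> ?T2) * ?z) \<in> S" using Dst_cg[OF S] by blast
    then show ?thesis by (simp add: mult.commute mult.left_commute)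
  qed
  have C: "of_nat k \<cdot> (?Y + ?T1 * ?z - ?T2 * ?z) \<in> S"
  proof (cases "k = 0")
    case False
    have "z * E u v + ?T1 - ?T2 \<in> I" using PL_rel[of 0 1 u v] by simp
    then have i: "(z * E u v + ?T1 - ?T2) * ?z \<in> I" by (rule I_right)
    have c: "?Y + ?T1 * ?z - ?T2 * ?z \<approx> z * E u v * ?z + ?T1 * ?z - ?T2 * ?z"
      by (intro cg_add cg_diff cg_refl z_split[OF False])
    have "?Y + ?T1 * ?z - ?T2 * ?z \<in> I" by (rule cg_in[OF c i[unfolded distrib_right left_diff_distrib]])
    then show ?thesis by (intro subsp_sm[OF sp] in_S)
  qed (simp add: subsp_0[OF sp])
  have "(1 + of_nat k / 2) \<cdot> ?Y = ((1/2) \<cdot> ?Y - (of_nat k / 2) \<cdot> (?T1 * ?z)) + ((1/2) \<cdot> ?Y + (of_nat k / 2) \<cdot> (?T2 * ?z))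
     + (1/2) \<cdot> (of_nat k \<cdot> (?Y + ?T1 * ?z - ?T2 * ?z))"
    by (rule poly_mapping_eqI) (simp add: lk_simps algebra_simps)
  also have "\<dots> \<in> S" by (intro subsp_add[OF sp] subsp_sm[OF sp] A B C)
  finally have F: "(1 + of_nat k / 2) \<cdot> ?Y \<in> S" .
  have "(1 + of_nat k / 2 :: complex) = of_nat (k + 2) / 2" by simp
  then have "(1 + of_nat k / 2 :: complex) \<noteq> 0" by (metis add_is_0 divide_eq_0_iff of_nat_eq_0_iff zero_neq_numeral)
  then show ?thesis using F subsp_sm_iff[OF sp] by blast
qed

text \<open>The lowest root vector needs both kinds of relations. The derivative along
  \<open>2 3\<close> leaves the remainder \<open>?T + ?X\<close>, the contraction over
  \<open>R\<close> leaves \<open>?S\<close>, and the trace relation for \<open>3 1\<close> together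
  with the Pluecker relation for \<open>0 1 2 3\<close> makes \<open>?S + ?T + ?X\<close> equal to
  \<open>2 \<cdot> (z * E 2 3)\<close>. The resulting coefficient is
  \<open>(M - 3 + 2 * k) / 2\<close>.\<close>

lemma P23: "P 2 3"
proof -
  let ?Y = "E 2 3 * z ^ k" and ?z = "z ^ (k - 1)" and ?T = "E 0 2 * E 1 3" and ?X = "E 1 3 * E 1 3"
  let ?S = "\<Sum>b\<in>R. \<Sum>c\<in>R. h b c \<cdot> (E 3 b * E c 1)"
  have d: "dl 2 3 1 3 = (1/2) \<cdot> E 2 3" "dl 2 3 0 1 = (1/2) \<cdot> E 0 2 - (1/2) \<cdot> E 3 1" by (simp_all add: dl_def dvec_def)
  have eq1: "(1/2) \<cdot> ?Y + (of_nat k / 2) \<cdot> ((?T + ?X) * ?z) \<in> S"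
  proof -
    have "E 1 3 * ((1/2) \<cdot> E 0 2 - (1/2) \<cdot> E 3 1) \<approx> E 1 3 * ((1/2) \<cdot> E 0 2 - (1/2) \<cdot> ((- 1) \<cdot> E 1 3))"
      using cg_E[of 3 1] by (intro cg_multL cg_diff cg_refl cg_sm) simp
    also have "\<dots> = (1/2) \<cdot> (E 1 3 * E 0 2) + (1/2) \<cdot> ?X" by (simp add: distrib_left)
    also have "\<dots> \<approx> (1/2) \<cdot> ?T + (1/2) \<cdot> ?X" using cg_W[of 1 3 0 2] by (intro cg_add cg_sm cg_refl) simp
    finally have c: "E 1 3 * ((1/2) \<cdot> E 0 2 - (1/2) \<cdot> E 3 1) \<approx> (1/2) \<cdot> ?T + (1/2) \<cdot> ?X" .
    have "((1/2) \<cdot> E 2 3) * z ^ k + of_nat k \<cdot> (E 1 3 * ((1/2) \<cdot> E 0 2 - (1/2) \<cdot> E 3 1) * ?z) \<in> S"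
      using P_D[of 2 3 1 3] mN P02_13 unfolding d by simp
    moreover have "((1/2) \<cdot> E 2 3) * z ^ k + of_nat k \<cdot> (E 1 3 * ((1/2) \<cdot> E 0 2 - (1/2) \<cdot> E 3 1) * ?z)
       \<approx> ((1/2) \<cdot> E 2 3) * z ^ k + of_nat k \<cdot> (((1/2) \<cdot> ?T + (1/2) \<cdot> ?X) * ?z)"
      by (intro cg_add cg_refl cg_sm cg_multR c)
    ultimately have "((1/2) \<cdot> E 2 3) * z ^ k + of_nat k \<cdot> (((1/2) \<cdot> ?T + (1/2) \<cdot> ?X) * ?z) \<in> S" using Dst_cg[OF S] by blast
    also have "((1/2) \<cdot> E 2 3) * z ^ k + of_nat k \<cdot> (((1/2) \<cdot> ?T + (1/2) \<cdot> ?X) * ?z) = (1/2) \<cdot> ?Y + (of_nat k / 2) \<cdot> ((?T + ?X) * ?z)"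
      by (rule poly_mapping_eqI) (simp add: lk_simps distrib_right algebra_simps)
    finally show ?thesis .
  qed
  show ?thesis
  proof (cases "k = 0")
    case True
    then show ?thesis using eq1 by (intro P_half[of "1/2"]) simp_all
  next
    case False
    have el: "(- (h b c * h c b) / 2) \<cdot> (E 3 2 * z ^ k) + (of_nat k / 2) \<cdot> ((h c b) \<cdot> (E 3 c * E b 1)) * ?z \<in> S"
      if "b \<in> R" "c \<in> R" for b c
    proof -
      have d: "dl b 2 3 c = (- h c b / 2) \<cdot> E 3 2" "dl b 2 0 1 = (1/2) \<cdot> E b 1"
        using that by (simp_all add: dl_def dvec_def)
      have "h b c \<cdot> (dl b 2 3 c * z ^ k + (sgn_b ((pr b \<noteq> pr 2) \<and> (pr 3 \<noteq> pr c)) * of_nat k) \<cdot> (E 3 c * dl b 2 0 1 * ?z)) \<in> S"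
        using that mN by (intro subsp_sm[OF sp] P_D P_swap[of c 3] Puv) simp_all
      also have "h b c \<cdot> (dl b 2 3 c * z ^ k + (sgn_b ((pr b \<noteq> pr 2) \<and> (pr 3 \<noteq> pr c)) * of_nat k) \<cdot> (E 3 c * dl b 2 0 1 * ?z))
        = (- (h b c * h c b) / 2) \<cdot> (E 3 2 * z ^ k) + (of_nat k / 2) \<cdot> ((s b c * h b c) \<cdot> (E 3 c * E b 1)) * ?z"
        unfolding d by (simp add: fr.scale_right_distrib fr.scale_right_diff_distrib mult.assoc s_def mult.commute mult.left_commute)
      finally show ?thesis by (simp only: h_sym[symmetric])
    qed
    have "(\<Sum>b\<in>R. \<Sum>c\<in>R. (- (h b c * h c b) / 2) \<cdot> (E 3 2 * z ^ k) + (of_nat k / 2) \<cdot> (h c b \<cdot> (E 3 c * E b 1)) * ?z) \<in> S"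
      by (intro subsp_sum[OF sp] el)
    also have "(\<Sum>b\<in>R. \<Sum>c\<in>R. (- (h b c * h c b) / 2) \<cdot> (E 3 2 * z ^ k) + (of_nat k / 2) \<cdot> (h c b \<cdot> (E 3 c * E b 1)) * ?z)
       = (- (\<Sum>b\<in>R. \<Sum>c\<in>R. h b c * h c b) / 2) \<cdot> (E 3 2 * z ^ k) + (of_nat k / 2) \<cdot> (\<Sum>b\<in>R. \<Sum>c\<in>R. h c b \<cdot> (E 3 c * E b 1)) * ?z"
    proof -
      have "(- (\<Sum>b\<in>R. \<Sum>c\<in>R. h b c * h c b) / 2) = (\<Sum>b\<in>R. \<Sum>c\<in>R. - (h b c * h c b) / 2)"
        by (simp add: sum_negf sum_divide_distrib)
      then show ?thesis
        by (simp only: sum.distrib fr.scale_sum_left fr.scale_sum_right sum_distrib_right sum_distrib_left)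
    qed
    also have "\<dots> = (- (M - 4) / 2) \<cdot> (E 3 2 * z ^ k) + (of_nat k / 2) \<cdot> ?S * ?z"
      by (subst sum.swap[of "\<lambda>b c. h c b \<cdot> (E 3 c * E b 1)"]) (simp only: sum_hh)
    finally have "(- (M - 4) / 2) \<cdot> (E 3 2 * z ^ k) + (of_nat k / 2) \<cdot> ?S * ?z \<in> S" .
    moreover have "(- (M - 4) / 2) \<cdot> (E 3 2 * z ^ k) + (of_nat k / 2) \<cdot> ?S * ?z \<approx> (- (M - 4) / 2) \<cdot> (((- 1) \<cdot> E 2 3) * z ^ k) + (of_nat k / 2) \<cdot> ?S * ?z"
      using cg_E[of 3 2] by (intro cg_add cg_refl cg_sm cg_multR) simp
    ultimately have A: "(- (M - 4) / 2) \<cdot> (((- 1) \<cdot> E 2 3) * z ^ k) + (of_nat k / 2) \<cdot> ?S * ?z \<in> S" using Dst_cg[OF S] by blast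
    have e: "E 3 0 \<approx> (- 1) \<cdot> E 0 3" "E 2 1 \<approx> (- 1) \<cdot> E 1 2" "E 3 1 \<approx> (- 1) \<cdot> E 1 3" "E 3 2 \<approx> (- 1) \<cdot> E 2 3"
      using cg_E[of 3 0] cg_E[of 2 1] cg_E[of 3 1] cg_E[of 3 2] by simp_all
    have "E 3 0 * E 2 1 \<approx> ((- 1) \<cdot> E 0 3) * ((- 1) \<cdot> E 1 2)" by (intro cg_mult e)
    also have "\<dots> = E 0 3 * E 1 2" by simp
    also have "\<dots> \<approx> E 1 2 * E 0 3" using cg_W[of 0 3 1 2] by simp
    finally have g1: "E 3 0 * E 2 1 \<approx> E 1 2 * E 0 3" .
    have g2: "E 3 1 * E 3 1 \<approx> ((- 1) \<cdot> E 1 3) * ((- 1) \<cdot> E 1 3)" by (intro cg_mult e)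
    have "E 3 2 * z \<approx> ((- 1) \<cdot> E 2 3) * z" by (intro cg_multR e)
    also have "\<dots> = (- 1) \<cdot> (E 2 3 * z)" by simp
    also have "\<dots> \<approx> (- 1) \<cdot> (z * E 2 3)" by (intro cg_sm cg_sym[OF cg_z])
    finally have g3: "E 3 2 * z \<approx> (- 1) \<cdot> (z * E 2 3)" .
    have g4: "E 3 3 * E 1 1 \<approx> 0" unfolding cg_0[symmetric] by (intro I_left E_diag) simp
    have c: "E 3 0 * E 2 1 + E 3 1 * E 3 1 + E 3 2 * z + E 3 3 * E 1 1 + ?S
       \<approx> E 1 2 * E 0 3 + ((- 1) \<cdot> E 1 3) * ((- 1) \<cdot> E 1 3) + (- 1) \<cdot> (z * E 2 3) + 0 + ?S"
      by (intro cg_add cg_refl g1 g2 g3 g4)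
    have "E 3 0 * E 2 1 + E 3 1 * E 3 1 + E 3 2 * z + E 3 3 * E 1 1 + ?S \<in> I"
      using TR_rel[of 3 1] unfolding hsplit by simp
    from cg_in[OF cg_sym[OF c] this] have "E 1 2 * E 0 3 + ((- 1) \<cdot> E 1 3) * ((- 1) \<cdot> E 1 3) + (- 1) \<cdot> (z * E 2 3) + 0 + ?S \<in> I" .
    moreover have "z * E 2 3 + E 1 2 * E 0 3 - ?T \<in> I" using PL_rel[of 0 1 2 3] by simp
    ultimately have "E 1 2 * E 0 3 + ((- 1) \<cdot> E 1 3) * ((- 1) \<cdot> E 1 3) + (- 1) \<cdot> (z * E 2 3) + 0 + ?S - (z * E 2 3 + E 1 2 * E 0 3 - ?T) \<in> I"
      by (rule subsp_diff[OF subsp_I])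
    also have "E 1 2 * E 0 3 + ((- 1) \<cdot> E 1 3) * ((- 1) \<cdot> E 1 3) + (- 1) \<cdot> (z * E 2 3) + 0 + ?S - (z * E 2 3 + E 1 2 * E 0 3 - ?T)
      = ?S + ?T + ?X - 2 \<cdot> (z * E 2 3)"
      by (rule poly_mapping_eqI) (simp add: lk_simps)
    finally have C: "(?S + ?T + ?X - 2 \<cdot> (z * E 2 3)) * ?z \<in> S" by (intro in_S I_right)
    have Dz: "?Y - z * E 2 3 * ?z \<in> S" using z_split[OF False, of "E 2 3"] by (intro in_S) (simp add: cg_def)
    have "((M - 3 + 2 * of_nat k) / 2) \<cdot> ?Y =
      ((- (M - 4) / 2) \<cdot> (((- 1) \<cdot> E 2 3) * z ^ k) + (of_nat k / 2) \<cdot> ?S * ?z)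
      - (of_nat k / 2) \<cdot> ((?S + ?T + ?X - 2 \<cdot> (z * E 2 3)) * ?z)
      + ((1/2) \<cdot> ?Y + (of_nat k / 2) \<cdot> ((?T + ?X) * ?z))
      + of_nat k \<cdot> (?Y - z * E 2 3 * ?z)"
      by (rule poly_mapping_eqI) (simp add: lk_simps distrib_right left_diff_distrib algebra_simps, simp add: field_simps)
    also have "\<dots> \<in> S" by (intro subsp_add[OF sp] subsp_diff[OF sp] subsp_sm[OF sp] A C Dz eq1)
    finally have F: "((M - 3 + 2 * of_nat k) / 2) \<cdot> ?Y \<in> S" .
    have "M - 3 + 2 * of_nat k \<noteq> 0" using M_ne[of "2 * int k - 3"] False by (simp add: algebra_simps)
  then have "(M - 3 + 2 * of_nat k) / 2 \<noteq> 0" by (metis divide_eq_0_iff neg_equal_0_iff_equal zero_neq_numeral)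
  then show ?thesis using F subsp_sm_iff[OF sp] by blast
  qed
qed

lemma P_all: "P a b"
proof (cases "a < N \<and> b < N")
  case False
  then show ?thesis by (intro P_I I_letter)
next
  case True
  have ge2: "P a b" if "a < N" "b < N" "a \<ge> 2" "b \<ge> 2" for a b
  proof -
    consider "a \<in> R" | "b \<in> R" | "a = b" "a < 4" | "a = 2" "b = 3" | "a = 3" "b = 2" using \<open>a < N\<close> \<open>b < N\<close> \<open>a \<ge> 2\<close> \<open>b \<ge> 2\<close> by fastforce
    then show ?thesis
    proof cases
      case 1 then show ?thesis using that by (intro Puv)
    next
      case 2 then show ?thesis using that by (intro P_swap[of b a] Puv)
    next
      case 3 then show ?thesis using m7 by (simp only:) (intro P_diag, simp add: pr_def)
    next
      case 4 then show ?thesis using P23 by simp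
    next
      case 5 then show ?thesis using P_swap[OF P23] by simp
    qed
  qed
  have P01: "P a b" if "a < 2" "b < N" for a b
    using that P0[of b] P1[of b] by (cases "a = 0") (simp_all add: numeral_2_eq_2 less_Suc_eq)
  show ?thesis
  proof (cases "a < 2")
    case True then show ?thesis using P01 \<open>a < N \<and> b < N\<close> by simp
  next
    case False
    then show ?thesis using P01[of b a, THEN P_swap] ge2[of a b] True by (cases "b < 2") simp_all
  qed
qed

end

text \<open>Induction on the length. The set of all \<open>f\<close> with \<open>E a b * f\<close>
  in \<open>S\<close> for every letter is again stable, because the other Leibniz term
  \<open>dl x y a b * f\<close> is a combination of letters times \<open>f\<close>. That it contains
  \<open>z ^ k\<close> is what \<open>P_all\<close> provides.\<close>

theorem z_power_generates:
  "Dst S \<Longrightarrow> z ^ l \<in> S \<Longrightarrow> length w = l \<Longrightarrow> wd w \<in> S"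
proof (induction l arbitrary: S w)
  case (Suc k)
  note S = Suc.prems(1)
  note sp = DstD(1)[OF S]
  define S' where "S' = {f. \<forall>a b. E a b * f \<in> S}"
  have "Dst S'"
    unfolding Dst_def
  proof (intro conjI allI impI ballI subsetI)
    show "subsp S'"
      unfolding subsp_def S'_def
      by (auto simp: subsp_0[OF sp] distrib_left intro: subsp_add[OF sp] subsp_sm[OF sp])
  next
    fix f assume "f \<in> I" then show "f \<in> S'" unfolding S'_def by (auto intro!: DstD(2)[OF S] I_left)
  next
    fix x y f assume xy: "x < N" "y < N" and f: "f \<in> S'"
    have f': "E a b * f \<in> S" for a b using f by (simp add: S'_def)
    have "E a b * D x y f \<in> S" for a b
    proof -
      let ?t = "sgn_b ((pr x \<noteq> pr y) \<and> (pr a \<noteq> pr b))"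
      have "D x y (E a b * f) \<in> S" using DstD(3)[OF S xy f'] .
      then have 1: "?t \<cdot> (E a b * D x y f) + dl x y a b * f \<in> S" by (simp add: D_mult D_E sgp_E add.commute)
      have "dl x y a b * f = ((h a y / 2) \<cdot> (E x b * f) - (s x y * h a x / 2) \<cdot> (E y b * f))
         + sgn_b ((pr x \<noteq> pr y) \<and> pr a) \<cdot> ((h b y / 2) \<cdot> (E a x * f) - (s x y * h b x / 2) \<cdot> (E a y * f))"
        by (simp add: dl_def dvec_def distrib_right left_diff_distrib)
      also have "\<dots> \<in> S" by (intro subsp_add[OF sp] subsp_diff[OF sp] subsp_sm[OF sp] f')
      finally have "?t \<cdot> (E a b * D x y f) \<in> S" by (rule subsp_cancel[OF sp 1])
      then show ?thesis by (subst (asm) subsp_sm_iff[OF sp]) simp_all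
    qed
    then show "D x y f \<in> S'" by (simp add: S'_def)
  qed
  moreover have "z ^ k \<in> S'" using P_all[OF S Suc.prems(2)] by (simp add: S'_def)
  moreover obtain a b w' where w: "w = (a, b) # w'" "length w' = k" using Suc.prems(3) by (cases w) auto
  ultimately have "wd w' \<in> S'" using Suc.IH by blast
  then show ?case by (simp add: S'_def w wd_Cons)
qed simp

end

subsection \<open>An invariant nondegenerate pairing on homogeneous elements\<close>

definition linc :: "(word \<Rightarrow> complex) \<Rightarrow> fr \<Rightarrow> complex" where
  "linc \<phi> f = lk (lin (\<lambda>w. \<phi> w \<cdot> 1) f) []"
lemma linc_simps: "linc \<phi> (f + g) = linc \<phi> f + linc \<phi> g" "linc \<phi> (c \<cdot> f) = c * linc \<phi> f" "linc \<phi> 0 = 0"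
  "linc \<phi> (- f) = - linc \<phi> f" "linc \<phi> (f - g) = linc \<phi> f - linc \<phi> g"
  by (simp_all add: linc_def flinD[OF flin_lin] lk_simps)
lemma linc_wd [simp]: "linc \<phi> (wd w) = \<phi> w"
  using lookup_wd[of "[]" "[]"] by (simp add: linc_def)
lemma linc_sum: "linc \<phi> (\<Sum>x\<in>A. f x) = (\<Sum>x\<in>A. linc \<phi> (f x))"
  by (induction A rule: infinite_finite_induct) (auto simp: linc_simps)

lemma hom_in:
  assumes "subsp S" "\<And>w. length w = l \<Longrightarrow> wd w \<in> S" "tp l f = f" shows "f \<in> S"
proof -
  have "length w = l" if "w \<in> ks f" for w
    using that lk_top[of l f w] assms(3) by (auto simp: in_keys_iff split: if_splits)
  then have "(\<Sum>w\<in>ks f. lk f w \<cdot> wd w) \<in> S" using assms by (intro subsp_sum subsp_sm) auto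
  then show ?thesis using fr_decomp[of f] by simp
qed

context ospl
begin

definition et :: "nat \<times> nat \<Rightarrow> nat \<times> nat \<Rightarrow> complex" where
  "et x y = h (fst y) (snd x) * h (snd y) (fst x)"

text \<open>Letters are matched from the outside in, so that a word is contracted with the reversal
  of another. Nesting keeps the Koszul signs trivial, because the word between two matched letters
  is even whenever it contributes (\<open>epsw_odd\<close>).\<close>

function epsw :: "word \<Rightarrow> complex" where
  "epsw [] = 1"
| "epsw (x # w) = (if w = [] then 0 else et x (last w) * epsw (butlast w))"
  by pat_completeness auto
termination by (relation "measure length") auto

definition eps :: "fr \<Rightarrow> complex" where "eps = linc epsw"

lemma eps_simps: "eps (f + g) = eps f + eps g" "eps (c \<cdot> f) = c * eps f" "eps 0 = 0" "eps (f - g) = eps f - eps g"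
  "eps (- f) = - eps f"
  by (simp_all add: eps_def linc_simps)

lemma epsw_snoc: "epsw (x # w @ [y]) = et x y * epsw w" by simp
lemma eps_sandwich: "eps (E a b * (g * E c d)) = et (a,b) (c,d) * eps g"
proof (induction g rule: fr_induct)
  case (wd e w)
  have "E a b * (wd w * E c d) = wd ((a,b) # w @ [(c,d)])" by (simp add: E_def wd_mult)
  then show ?case by (simp add: eps_simps) (simp add: eps_def)
qed (simp_all add: distrib_left distrib_right eps_simps)

lemma word_ends_induct [case_names Nil single ends]:
  assumes "P []" "\<And>x. P [x]" "\<And>x w y. P w \<Longrightarrow> P (x # w @ [y])" shows "P w"
proof (induction w rule: length_induct)
  case (1 w)
  show ?case
  proof (cases w)
    case (Cons x v)
    show ?thesis
    proof (cases v rule: rev_cases)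
      case (snoc u y) then show ?thesis using 1 Cons assms(3)[of u x y] by simp
    qed (use Cons assms in simp)
  qed (use assms in simp)
qed

lemma epsw_odd: "wpar w \<Longrightarrow> epsw w = 0"
proof (induction w rule: word_ends_induct)
  case (ends x w y)
  show ?case
  proof (cases "wpar w")
    case False
    then have "(pr (fst x) \<noteq> pr (snd x)) \<noteq> (pr (fst y) \<noteq> pr (snd y))" using ends.prems by (auto simp: wpar_append)
    then have "et x y = 0" unfolding et_def using h_par[of "fst y" "snd x"] h_par[of "snd y" "fst x"] by auto
    then show ?thesis by (simp only: epsw_snoc mult_zero_left)
  qed (use ends in \<open>simp only: epsw_snoc mult_zero_right\<close>)
qed simp_all

lemma et_inv:
  "((h a y / 2) * et (x,b) (c,d) - (s x y * h a x / 2) * et (y,b) (c,d)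
     + sgn_b ((pr x \<noteq> pr y) \<and> pr a) * ((h b y / 2) * et (a,x) (c,d) - (s x y * h b x / 2) * et (a,y) (c,d)))
   + sgn_b ((pr x \<noteq> pr y) \<and> (pr a \<noteq> pr b)) *
     ((h c y / 2) * et (a,b) (x,d) - (s x y * h c x / 2) * et (a,b) (y,d)
     + sgn_b ((pr x \<noteq> pr y) \<and> pr c) * ((h d y / 2) * et (a,b) (c,x) - (s x y * h d x / 2) * et (a,b) (c,y))) = 0"
  unfolding et_def fst_conv snd_conv h_sym[where b=x and a=b] h_sym[where b=y and a=b] h_sym[where b=x and a=a] h_sym[where b=y and a=a]
  by (cases "pr x"; cases "pr y"; cases "pr a"; cases "pr b"; cases "pr c"; cases "pr d")
    (simp_all add: h_par s_def)

lemma eps_D: "eps (D x y f) = 0"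
proof -
  have "eps (Dw x y w) = 0" for w
  proof (induction w rule: word_ends_induct)
    case (single l)
    have "eps (E a b) = 0" for a b by (simp add: E_def eps_def)
    then show ?case by (simp add: dl_def dvec_def eps_simps)
  next
    case (ends l w r)
    obtain a b c d where lr: "l = (a,b)" "r = (c,d)" by force
    let ?q = "pr x \<noteq> pr y"
    have 1: "eps (dl x y a b * (g * E c d)) = ((h a y / 2) * et (x,b) (c,d) - (s x y * h a x / 2) * et (y,b) (c,d)
     + sgn_b (?q \<and> pr a) * ((h b y / 2) * et (a,x) (c,d) - (s x y * h b x / 2) * et (a,y) (c,d))) * eps g" for g
      by (simp add: dl_def dvec_def distrib_right left_diff_distrib eps_simps eps_sandwich algebra_simps)
    have 2: "eps (E a b * (g * dl x y c d)) = ((h c y / 2) * et (a,b) (x,d) - (s x y * h c x / 2) * et (a,b) (y,d)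
     + sgn_b (?q \<and> pr c) * ((h d y / 2) * et (a,b) (c,x) - (s x y * h d x / 2) * et (a,b) (c,y))) * eps g" for g
      by (simp add: dl_def dvec_def distrib_left right_diff_distrib eps_simps eps_sandwich algebra_simps)
    have "Dw x y (l # w @ [r]) = dl x y a b * (wd w * E c d) + sgn_b (?q \<and> (pr a \<noteq> pr b)) \<cdot>
      (E a b * (Dw x y w * E c d)) + sgn_b (?q \<and> (pr a \<noteq> pr b)) \<cdot> (E a b * (sgp ?q (wd w) * dl x y c d))"
      by (simp add: lr Dw_append E_def wd_mult distrib_left fr.scale_right_distrib)
    moreover have "eps (sgp ?q (wd w)) = eps (wd w)"
      using epsw_odd[of w] by (cases "wpar w") (simp_all add: sgp_def sig_wd eps_simps, simp_all add: eps_def)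
    ultimately have "eps (Dw x y (l # w @ [r])) =
      (((h a y / 2) * et (x,b) (c,d) - (s x y * h a x / 2) * et (y,b) (c,d)
     + sgn_b (?q \<and> pr a) * ((h b y / 2) * et (a,x) (c,d) - (s x y * h b x / 2) * et (a,y) (c,d)))
   + sgn_b (?q \<and> (pr a \<noteq> pr b)) *
     ((h c y / 2) * et (a,b) (x,d) - (s x y * h c x / 2) * et (a,b) (y,d)
     + sgn_b (?q \<and> pr c) * ((h d y / 2) * et (a,b) (c,x) - (s x y * h d x / 2) * et (a,b) (c,y)))) * eps (wd w)"
      using ends by (simp only: eps_simps eps_sandwich 1 2 distrib_right mult.assoc mult_zero_right add_0_right)
    then show ?case by (simp only: et_inv mult_zero_left)
  qed (simp add: eps_simps)
  then show ?thesis
    by (induction f rule: fr_induct) (simp_all add: flinD[OF flin_D] eps_simps D_wd)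
qed

text \<open>The dual basis of the letters for \<open>et\<close>. In \<open>du\<close> the duals
  appear in reverse order, as the nested matching requires.\<close>

definition Ed :: "nat \<times> nat \<Rightarrow> fr" where
  "Ed x = (\<Sum>c<N. \<Sum>d<N. (h c (snd x) * h d (fst x)) \<cdot> E c d)"
primrec du :: "word \<Rightarrow> fr" where "du [] = 1" | "du (x # w) = du w * Ed x"

definition inN :: "word \<Rightarrow> bool" where "inN w \<longleftrightarrow> (\<forall>x\<in>set w. fst x < N \<and> snd x < N)"

lemma eps_Ed:
  assumes "fst x < N" "snd x < N" "a < N" "b < N"
  shows "eps (E a b * (g * Ed x)) = (if x = (a,b) then eps g else 0)"
proof -
  have "eps (E a b * (g * Ed x)) = (\<Sum>c<N. \<Sum>d<N. (h c (snd x) * h c b) * (h d (fst x) * h d a) * eps g)"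
    by (simp add: Ed_def sum_distrib_left eps_sandwich et_def eps_def linc_sum linc_simps)
      (simp add: eps_def[symmetric] eps_sandwich et_def ac_simps)
  also have "\<dots> = (\<Sum>c<N. h c (snd x) * h c b) * (\<Sum>d<N. h d (fst x) * h d a) * eps g"
    by (simp only: sum_product) (simp only: sum_distrib_right)
  finally show ?thesis using assms h_inv[of b "snd x"] h_inv[of a "fst x"] by (cases x) auto
qed

lemma eps_du: "length w = length v \<Longrightarrow> inN w \<Longrightarrow> inN v \<Longrightarrow> eps (wd w * du v) = (if w = v then 1 else 0)"
proof (induction w v rule: list_induct2)
  case Nil show ?case using linc_wd[of epsw "[]"] by (simp add: eps_def)
next
  case (Cons x w y v)
  obtain a b where x: "x = (a,b)" by force
  have "wd (x # w) * du (y # v) = E a b * ((wd w * du v) * Ed y)" by (simp add: x wd_Cons mult.assoc)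
  then show ?case using Cons by (auto simp: eps_Ed x inN_def)
qed

lemma tp_sum: "tp l (\<Sum>x\<in>A. f x) = (\<Sum>x\<in>A. tp l (f x))" by (rule flin_sum[OF flin_tp])

lemma tp_du: "tp (length v) (du v) = du v"
proof (induction v)
  case Nil show ?case using tp_wd[of 0 "[]"] by simp
next
  case (Cons x v)
  have "tp (Suc (length v)) (du v * E c d) = du v * E c d" for c d using Cons by (simp add: E_def tp_mult_wd)
  then show ?case by (simp add: Ed_def sum_distrib_left tp_sum flinD[OF flin_tp])
qed

text \<open>Pairing with the dual of a word \<open>v\<close> extracts the coefficient of
  \<open>v\<close>; by linearity the vanishing on words extends to the homogeneous element
  \<open>du v\<close>.\<close>

lemma eps_nondeg:
  assumes u: "tp l u = u" "\<And>w. w \<in> ks u \<Longrightarrow> inN w" and z: "\<And>w. length w = l \<Longrightarrow> eps (u * wd w) = 0"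
  shows "u = 0"
proof (rule poly_mapping_eqI)
  fix v
  have len: "length w = l" if "w \<in> ks u" for w
    using that lk_top[of l u w] u(1) by (auto simp: in_keys_iff split: if_splits)
  show "lk u v = lk 0 v"
  proof (cases "v \<in> ks u")
    case True
    have s: "subsp {f. eps (u * f) = 0}" by (simp add: subsp_def distrib_left eps_simps)
    have "du v \<in> {f. eps (u * f) = 0}" by (rule hom_in[OF s, of l]) (use z tp_du[of v] len[OF True] in auto)
    then have "0 = eps ((\<Sum>w\<in>ks u. lk u w \<cdot> wd w) * du v)" using fr_decomp[of u] by simp
    also have "\<dots> = (\<Sum>w\<in>ks u. lk u w * eps (wd w * du v))"
      by (simp add: sum_distrib_right eps_def linc_sum linc_simps)
    also have "\<dots> = (\<Sum>w\<in>ks u. if w = v then lk u w else 0)"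
      using u(2) True len by (intro sum.cong refl) (simp add: eps_du)
    also have "\<dots> = lk u v" using True by simp
    finally show ?thesis by simp
  qed (simp add: in_keys_iff)
qed

text \<open>The subalgebra on the letters in range, that is, the carrier of the tensor algebra
  (\<open>Nsp_carrier\<close>). Nondegeneracy of the pairing and the inversion of substitutions are
  statements about this subalgebra.\<close>

definition Nsp :: "fr set" where "Nsp = {f. \<forall>w\<in>ks f. inN w}"
lemma Nsp_lk: "f \<in> Nsp \<longleftrightarrow> (\<forall>w. \<not> inN w \<longrightarrow> lk f w = 0)" by (auto simp: Nsp_def in_keys_iff)
lemma subsp_Nsp: "subsp Nsp" by (simp add: subsp_def Nsp_lk lookup_add)
lemma Nsp_wd: "inN w \<Longrightarrow> wd w \<in> Nsp" by (auto simp: Nsp_lk lookup_wd)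
lemma Nsp_induct: "f \<in> Nsp \<Longrightarrow> subsp S \<Longrightarrow> (\<And>w. inN w \<Longrightarrow> wd w \<in> S) \<Longrightarrow> f \<in> S"
  by (subst fr_decomp) (intro subsp_sum subsp_sm, auto simp: Nsp_def)
lemma Nsp_mult: assumes "f \<in> Nsp" "g \<in> Nsp" shows "f * g \<in> Nsp"
proof -
  have "f \<in> {f. \<forall>g\<in>Nsp. f * g \<in> Nsp}"
  proof (rule Nsp_induct[OF assms(1)])
    show "subsp {f. \<forall>g\<in>Nsp. f * g \<in> Nsp}"
      using subsp_Nsp by (simp add: subsp_def distrib_right)
    fix u assume u: "inN u"
    have "wd u * g \<in> Nsp" if "g \<in> Nsp" for g
    proof -
      have "g \<in> {g. wd u * g \<in> Nsp}"
      proof (rule Nsp_induct[OF that])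
        show "subsp {g. wd u * g \<in> Nsp}" using subsp_Nsp by (simp add: subsp_def distrib_left)
        fix w assume "inN w" then show "wd w \<in> {g. wd u * g \<in> Nsp}" using u by (auto simp: wd_mult inN_def intro!: Nsp_wd)
      qed
      then show ?thesis by simp
    qed
    then show "wd u \<in> {f. \<forall>g\<in>Nsp. f * g \<in> Nsp}" by simp
  qed
  then show ?thesis using assms by simp
qed
lemma Nsp_E: "a < N \<Longrightarrow> b < N \<Longrightarrow> E a b \<in> Nsp" unfolding E_def by (rule Nsp_wd) (simp add: inN_def)
lemma Nsp_D: assumes "f \<in> Nsp" "x < N" "y < N" shows "D x y f \<in> Nsp"
proof -
  have "f \<in> {f. D x y f \<in> Nsp}"
  proof (rule Nsp_induct[OF assms(1)])
    show "subsp {f. D x y f \<in> Nsp}" using subsp_Nsp by (simp add: subsp_def flinD[OF flin_D])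
    have "Dw x y w \<in> Nsp" if "inN w" for w
      using that
    proof (induction w)
      case (Cons l w)
      have l: "fst l < N" "snd l < N" and w: "inN w" using Cons.prems by (auto simp: inN_def)
      have "dl x y (fst l) (snd l) \<in> Nsp" unfolding dl_def dvec_def
        by (intro subsp_add[OF subsp_Nsp] subsp_diff[OF subsp_Nsp] subsp_sm[OF subsp_Nsp] Nsp_E l assms)
      then show ?case unfolding Dw.simps
        by (intro subsp_add[OF subsp_Nsp] subsp_sm[OF subsp_Nsp] Nsp_mult Nsp_wd w Nsp_E l Cons.IH)
    qed (simp add: subsp_0[OF subsp_Nsp])
    then show "wd w \<in> {f. D x y f \<in> Nsp}" if "inN w" for w using that by (simp add: D_wd)
  qed
  then show ?thesis by simp
qed
lemma tp_sig: "tp l (sig f) = sig (tp l f)"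
  by (rule flin_eqI[OF flin_comp[OF flin_tp flin_sig] flin_comp[OF flin_sig flin_tp]])
    (simp add: sig_wd tp_wd flinD[OF flin_tp] flinD[OF flin_sig])
lemma Dlt_sig: "Dlt l f \<Longrightarrow> Dlt l (sig f)"
  by (induction rule: Dlt_induct) (auto simp: flinD[OF flin_sig] sig_wd intro!: Dlt_add Dlt_sm Dlt_wd)

end

section \<open>The character given by the highest root vector, and its cyclic module\<close>

context canon
begin

definition zt :: "nat \<times> nat \<Rightarrow> complex" where "zt x = et x (0,1) - et x (1,0)"
primrec ztw :: "word \<Rightarrow> complex" where "ztw [] = 1" | "ztw (x # w) = zt x * ztw w"
text \<open>The algebra homomorphism that evaluates a polynomial function at the highest root
  vector. In degree \<open>l\<close> it agrees with the pairing with \<open>za ^ l\<close> on either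
  side (\<open>eps_zeta_hom\<close>), which makes the pairing with a power multiplicative.\<close>

definition zeta :: "fr \<Rightarrow> complex" where "zeta = linc ztw"

lemma zeta_simps: "zeta (f + g) = zeta f + zeta g" "zeta (c \<cdot> f) = c * zeta f" "zeta 0 = 0" "zeta (f - g) = zeta f - zeta g"
  "zeta (- f) = - zeta f"
  by (simp_all add: zeta_def linc_simps)
lemma zeta_wd [simp]: "zeta (wd w) = ztw w" by (simp add: zeta_def)
lemma ztw_append: "ztw (u @ v) = ztw u * ztw v" by (induction u) simp_all
lemma zeta_mult: "zeta (f * g) = zeta f * zeta g"
proof -
  have "zeta (wd u * g) = ztw u * zeta g" for u
    by (induction g rule: fr_induct) (simp_all add: distrib_left zeta_simps wd_mult ztw_append algebra_simps)
  then show ?thesis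
    by (induction f rule: fr_induct) (simp_all add: distrib_right zeta_simps algebra_simps)
qed
lemma zt_eq: "zt (a,b) = (if a = 3 \<and> b = 2 then 1 else if a = 2 \<and> b = 3 then -1 else 0)"
  by (auto simp: zt_def et_def)
lemma zeta_E: "zeta (E a b) = zt (a,b)" by (simp add: E_def)

text \<open>The antisymmetric representative of the highest root vector; modulo \<open>I\<close> it is twice \<open>z\<close>.\<close>
definition za :: fr where "za = E 0 1 - E 1 0"

lemma eps_za: "eps (E a b * (g * za)) = zt (a,b) * eps g" "eps (za * (g * E a b)) = zt (a,b) * eps g"
  by (auto simp: za_def zt_eq right_diff_distrib left_diff_distrib eps_simps eps_sandwich et_def)

lemma eps_zeta: "length w = l \<Longrightarrow> eps (wd w * za ^ l) = ztw w"
proof (induction w arbitrary: l)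
  case Nil then show ?case using linc_wd[of epsw "[]"] by (simp add: eps_def)
next
  case (Cons x w)
  then obtain k where l: "l = Suc k" "length w = k" by auto
  have "wd (x # w) * za ^ l = E (fst x) (snd x) * ((wd w * za ^ k) * za)"
    using wd_Cons[of "fst x" "snd x" w] by (simp only: l prod.collapse power_Suc2 mult.assoc)
  then show ?case using Cons.IH[OF l(2)] by (simp add: eps_za)
qed
lemma eps_zeta': "length w = l \<Longrightarrow> eps (za ^ l * wd w) = ztw w"
proof (induction w arbitrary: l rule: rev_induct)
  case Nil then show ?case using linc_wd[of epsw "[]"] by (simp add: eps_def)
next
  case (snoc x w)
  then obtain k where l: "l = Suc k" "length w = k" by auto
  have "za ^ l * wd (w @ [x]) = za * ((za ^ k * wd w) * E (fst x) (snd x))"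
    by (simp add: l E_def mult.assoc wd_mult)
  then show ?case using snoc.IH[OF l(2)] by (simp add: eps_za ztw_append)
qed
lemma eps_zeta_hom: assumes "tp l F = F" shows "eps (F * za ^ l) = zeta F" "eps (za ^ l * F) = zeta F"
proof -
  have "F \<in> {f. eps (f * za ^ l) = zeta f}"
    by (rule hom_in[OF _ _ assms]) (simp_all add: subsp_def distrib_right eps_simps zeta_simps eps_zeta)
  then show "eps (F * za ^ l) = zeta F" by simp
  have "F \<in> {f. eps (za ^ l * f) = zeta f}"
    by (rule hom_in[OF _ _ assms]) (simp_all add: subsp_def distrib_left eps_simps zeta_simps eps_zeta')
  then show "eps (za ^ l * F) = zeta F" by simp
qed

lemma za_cg: "za \<approx> 2 \<cdot> z"
proof -
  have "za \<approx> z - (- 1) \<cdot> z" unfolding za_def using cg_E[of 1 0] by (intro cg_diff cg_refl) simp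
  also have "z - (- 1) \<cdot> z = 2 \<cdot> z" by (rule poly_mapping_eqI) (simp add: lk_simps)
  finally show ?thesis .
qed
lemma za_pow: "za ^ l \<approx> (2 ^ l) \<cdot> z ^ l"
proof (induction l)
  case (Suc l)
  have "za * za ^ l \<approx> (2 \<cdot> z) * ((2 ^ l) \<cdot> z ^ l)" by (intro cg_mult za_cg Suc)
  then show ?case by (simp add: mult.commute)
qed simp
lemma sig_za: "sig (za ^ l) = za ^ l"
proof -
  have "sig za = za" by (simp add: za_def flinD[OF flin_sig] sig_E)
  then show ?thesis by (induction l) (simp_all add: sig_mult)
qed

text \<open>The cyclic module is formed inside the free algebra, where the pairing lives; modulo
  \<open>I\<close> it is the module generated by \<open>z ^ l\<close>.\<close>

inductive_set U :: "nat \<Rightarrow> fr set" for l where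
  U_za: "za ^ l \<in> U l"
| U_add: "f \<in> U l \<Longrightarrow> g \<in> U l \<Longrightarrow> f + g \<in> U l"
| U_sm: "f \<in> U l \<Longrightarrow> c \<cdot> f \<in> U l"
| U_D: "f \<in> U l \<Longrightarrow> x < N \<Longrightarrow> y < N \<Longrightarrow> D x y f \<in> U l"

lemma U_tp: "f \<in> U l \<Longrightarrow> tp l f = f"
proof (induction rule: U.induct)
  case U_za
  show ?case
  proof (induction l)
    case 0 show ?case using tp_wd[of 0 "[]"] by simp
  next
    case (Suc l) then show ?case by (simp add: za_def E_def left_diff_distrib flinD[OF flin_tp] tp_mult_wd)
  qed
qed (simp_all add: flinD[OF flin_tp] tp_D)

lemma U_Nsp: "f \<in> U l \<Longrightarrow> f \<in> Nsp"
proof (induction rule: U.induct)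
  case U_za
  have "za \<in> Nsp" unfolding za_def using mN by (intro subsp_diff[OF subsp_Nsp] Nsp_E) simp_all
  moreover have "1 \<in> Nsp" using Nsp_wd[of "[]"] by (simp add: inN_def)
  ultimately show ?case by (induction l) (simp_all add: Nsp_mult)
qed (simp_all add: Nsp_D subsp_add[OF subsp_Nsp] subsp_sm[OF subsp_Nsp])

subsection \<open>The graded Joseph ideal is the annihilator of the cyclic module of the highest root power\<close>

text \<open>By invariance of the pairing, vanishing of \<open>zeta\<close> on a set closed under
  parity and derivations makes the homogeneous elements of that set orthogonal to the whole cyclic
  module. The property is used for \<open>I\<close>, for leading terms of an ideal, and for linear
  parts of invariant elements (\<open>tau_const\<close>).\<close>

definition zstable :: "fr set \<Rightarrow> bool" where
  "zstable T \<longleftrightarrow> (\<forall>f\<in>T. zeta f = 0 \<and> sig f \<in> T \<and> (\<forall>x<N. \<forall>y<N. D x y f \<in> T))"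

lemma zstableD: "zstable T \<Longrightarrow> f \<in> T \<Longrightarrow> zeta f = 0" "zstable T \<Longrightarrow> f \<in> T \<Longrightarrow> sig f \<in> T"
  "zstable T \<Longrightarrow> f \<in> T \<Longrightarrow> x < N \<Longrightarrow> y < N \<Longrightarrow> D x y f \<in> T"
  unfolding zstable_def by blast+

text \<open>\<open>zeta\<close> evaluates at a decomposable bivector of an isotropic plane:
  decomposability kills the Pluecker expressions, isotropy kills the traces.\<close>

lemma zstable_I: "zstable I"
proof -
  have e: "zt (a,b) = 0" if "pr a \<or> pr b \<or> \<not> (a < N \<and> b < N)" for a b using that mN by (auto simp: zt_eq)
  have zW: "zeta (W a b c d) = zt (a,b) * zt (c,d)" for a b c d by (simp add: W_def zeta_mult zeta_E)
  have sw: "s a b * zt (b,a) = - zt (a,b)" for a b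
    by (cases "pr a"; cases "pr b") (auto simp: e, auto simp: zt_eq)
  have zWa: "zeta (Wa a b c d) = 4 * (zt (a,b) * zt (c,d))" for a b c d
  proof -
    have "zeta (Wa a b c d) = zt (a,b) * zt (c,d) - (s a b * zt (b,a)) * zt (c,d) - zt (a,b) * (s c d * zt (d,c)) + (s a b * zt (b,a)) * (s c d * zt (d,c))"
      by (simp add: Wa_def zeta_simps zW)
    then show ?thesis by (simp add: sw)
  qed
  have sg: "sgn_b ((pr a \<noteq> pr b) \<and> (pr c \<noteq> pr d)) * (zt (a,b) * zt (c,d)) = zt (a,b) * zt (c,d)" for a b c d
    using e[of a b] by (cases "pr a"; cases "pr b") simp_all
  have zSy: "zeta (Sy a b c d) = 8 * (zt (a,b) * zt (c,d))" for a b c d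
    using sg[of a b c d] by (simp add: Sy_def zeta_simps zWa algebra_simps)
  have zPL: "zeta (PL a b c d) = 0" for a b c d
  proof (cases "pr a \<or> pr b \<or> pr c \<or> pr d")
    case True
    then show ?thesis unfolding PL_def zeta_simps zSy using e[of a b] e[of c d] e[of b c] e[of a d] e[of a c] e[of b d] by auto
  next
    case False
    then show ?thesis unfolding PL_def zeta_simps zSy by (auto simp: zt_eq)
  qed
  have zTR: "zeta (TR a d) = 0" for a d
  proof -
    have "h b c * (8 * (zt (a,b) * zt (c,d))) = 0" for b c by (auto simp: zt_eq)
    then have "zeta (h b c \<cdot> Sy a b c d) = 0" for b c by (simp only: zeta_simps zSy)
    then show ?thesis unfolding TR_def zeta_def linc_sum by (simp add: zeta_def[symmetric])
  qed
  have "zeta f = 0" if "f \<in> I" for f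
    using that
  proof (induction rule: I.induct)
    case (I_r1 a b) show ?case using sw[of a b] by (simp add: r1_def zeta_simps zeta_E)
  next
    case (I_r2 a b c d) show ?case using sg[of a b c d] by (simp add: r2_def zeta_simps zeta_mult zeta_E algebra_simps)
  qed (simp_all add: zeta_E e zPL zTR zeta_simps zeta_mult)
  then show ?thesis unfolding zstable_def using I_sig I_D by blast
qed

lemma sgp_in: "zstable T \<Longrightarrow> f \<in> T \<Longrightarrow> sgp q f \<in> T" by (simp add: sgp_def zstableD)
lemma tp_sgp: "tp l (sgp q f) = sgp q (tp l f)" by (simp add: sgp_def tp_sig)

text \<open>Integration by parts: \<open>eps\<close> vanishes on derivatives, so a derivation can be
  moved from one factor to the other. Replacing \<open>F\<close> by its parity twist first absorbs
  the sign in the Leibniz rule.\<close>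

lemma eps_U_right:
  assumes T: "zstable T" shows "u \<in> U l \<Longrightarrow> (\<And>F. F \<in> T \<Longrightarrow> tp l F = F \<Longrightarrow> eps (F * u) = 0)"
proof (induction rule: U.induct)
  case U_za then show ?case using zstableD(1)[OF T] by (simp add: eps_zeta_hom)
next
  case (U_D f x y)
  let ?q = "pr x \<noteq> pr y"
  have "eps (D x y (sgp ?q F * f)) = 0" by (rule eps_D)
  then have "eps (D x y (sgp ?q F) * f) + eps (F * D x y f) = 0" by (simp add: D_mult eps_simps)
  moreover have "eps (D x y (sgp ?q F) * f) = 0"
    using U_D by (intro U_D.IH zstableD(3)[OF T] sgp_in[OF T]) (simp_all add: tp_D tp_sgp)
  ultimately show ?case by simp
qed (simp_all add: distrib_left eps_simps)

text \<open>Here the twist falls on the element of the module, so \<open>sig u\<close> is carried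
  along to make the induction close.\<close>

lemma eps_U_left:
  assumes T: "zstable T"
  shows "u \<in> U l \<Longrightarrow> (\<And>F. F \<in> T \<Longrightarrow> tp l F = F \<Longrightarrow> eps (u * F) = 0 \<and> eps (sig u * F) = 0)"
proof (induction rule: U.induct)
  case U_za then show ?case using zstableD(1)[OF T] by (simp add: eps_zeta_hom sig_za)
next
  case (U_D f x y)
  let ?q = "pr x \<noteq> pr y"
  have F: "D x y F \<in> T" "tp l (D x y F) = D x y F" using U_D zstableD(3)[OF T] by (simp_all add: tp_D)
  have "eps (D x y (f * F)) = 0" "eps (D x y (sig f * F)) = 0" by (rule eps_D)+
  then have "eps (D x y f * F) + eps (sgp ?q f * D x y F) = 0" "eps (D x y (sig f) * F) + eps (sgp ?q (sig f) * D x y F) = 0"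
    by (simp_all add: D_mult eps_simps)
  then have "eps (D x y f * F) = 0 \<and> eps (D x y (sig f) * F) = 0"
    using U_D.IH[OF F] by (cases ?q) (simp_all add: sgp_def)
  then show ?case by (simp add: sig_D eps_simps)
qed (simp_all add: distrib_right eps_simps flinD[OF flin_sig])

text \<open>Everything homogeneous of degree \<open>l\<close> lies in \<open>I + U l\<close>. For
  \<open>F = i + u\<close>, the part \<open>u\<close> pairs to zero with \<open>I\<close> by
  \<open>eps_U_left\<close>; it also pairs to zero with \<open>U l\<close>, because both
  \<open>F\<close> and \<open>i\<close> do by \<open>eps_U_right\<close>. Hence \<open>u\<close> is
  orthogonal to all words of length \<open>l\<close> and vanishes.\<close>

theorem zstable_in_I:
  assumes T: "zstable T" and F: "F \<in> T" "tp l F = F" shows "F \<in> I"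
proof -
  define S where "S = {i + u | i u. i \<in> I \<and> u \<in> U l}"
  have S: "Dst S"
    unfolding Dst_def
  proof (intro conjI allI impI ballI subsetI)
    show "subsp S" unfolding subsp_def
    proof (intro conjI ballI allI)
      have "0 \<cdot> za ^ l \<in> U l" by (intro U_sm U_za)
      then show "0 \<in> S" unfolding S_def using I_zero by force
      fix f g assume "f \<in> S" "g \<in> S"
      then obtain i u j v where "f = i + u" "i \<in> I" "u \<in> U l" "g = j + v" "j \<in> I" "v \<in> U l" unfolding S_def by blast
      then have "f + g = (i + j) + (u + v)" "i + j \<in> I" "u + v \<in> U l" by (simp_all add: I_add U_add)
      then show "f + g \<in> S" unfolding S_def by blast
    next
      fix c f assume "f \<in> S"
      then obtain i u where "f = i + u" "i \<in> I" "u \<in> U l" unfolding S_def by blast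
      then have "c \<cdot> f = c \<cdot> i + c \<cdot> u" "c \<cdot> i \<in> I" "c \<cdot> u \<in> U l"
        by (simp_all add: subsp_sm[OF subsp_I] U_sm fr.scale_right_distrib)
      then show "c \<cdot> f \<in> S" unfolding S_def by blast
    qed
  next
    fix f assume "f \<in> I"
    moreover have "0 \<cdot> za ^ l \<in> U l" by (intro U_sm U_za)
    ultimately show "f \<in> S" unfolding S_def by force
  next
    fix x y f assume xy: "x < N" "y < N" and "f \<in> S"
    then obtain i u where "f = i + u" "i \<in> I" "u \<in> U l" unfolding S_def by blast
    then have "D x y f = D x y i + D x y u" "D x y i \<in> I" "D x y u \<in> U l"
      using xy by (simp_all add: I_D U_D flinD[OF flin_D])
    then show "D x y f \<in> S" unfolding S_def by blast
  qed
  have "za ^ l \<in> S" unfolding S_def using I_zero U_za by force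
  then have "(2 ^ l) \<cdot> z ^ l \<in> S" using Dst_cg[OF S za_pow] by simp
  then have "z ^ l \<in> S" by (subst (asm) subsp_sm_iff[OF DstD(1)[OF S]]) simp_all
  then have words: "wd w \<in> S" if "length w = l" for w using z_power_generates[OF S _ that] by blast
  have "F \<in> S" by (rule hom_in[OF DstD(1)[OF S] words F(2)])
  then obtain i u where iu: "F = i + u" "i \<in> I" "u \<in> U l" unfolding S_def by blast
  have ihom: "tp l i = i" using iu F(2) U_tp[OF iu(3)] by (simp add: flinD[OF flin_tp])
  have "u = 0"
  proof (rule eps_nondeg[OF U_tp[OF iu(3)]])
    fix w assume "w \<in> ks u" then show "inN w" using U_Nsp[OF iu(3)] by (simp add: Nsp_def)
  next
    fix w :: word assume w: "length w = l"
    obtain j v where jv: "wd w = j + v" "j \<in> I" "v \<in> U l" using words[OF w] unfolding S_def by blast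
    have "j = wd w - v" using jv(1) by simp
    then have jhom: "tp l j = j" using U_tp[OF jv(3)] w by (simp add: flinD[OF flin_tp] tp_wd)
    have "eps (u * j) = 0" using eps_U_left[OF zstable_I iu(3) jv(2) jhom] by simp
    moreover have "eps (F * v) = 0" "eps (i * v) = 0"
      using eps_U_right[OF T jv(3) F] eps_U_right[OF zstable_I jv(3) iu(2) ihom] by simp_all
    ultimately show "eps (u * wd w) = 0" by (simp add: jv(1) iu(1) distrib_left distrib_right eps_simps)
  qed
  then show ?thesis using iu by simp
qed

subsection \<open>Leading terms of ideals\<close>

definition dz :: "fr \<Rightarrow> fr" where "dz = D 0 1"

lemma dz_mult: "dz (f * g) = dz f * g + f * dz g" by (simp add: dz_def D_mult sgp_def)
lemma flin_dz1: "flin dz" unfolding dz_def by (rule flin_D)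
lemma flin_dz: "flin (dz ^^ k)" by (induction k) (auto simp: flin_def flinD[OF flin_dz1])
text \<open>\<open>z\<close> is an extremal element: modulo \<open>r1\<close> the square of its
  adjoint action maps the Lie superalgebra into the line of \<open>z\<close>, and the cube is
  zero.\<close>

lemma dz_letter: "dz (dz (dz (E a b))) = 0" "dz (dz (E a b)) - (- zt (a,b) / 2) \<cdot> z \<in> {f. \<exists>c a b. f = c \<cdot> r1 a b}"
proof -
  have d: "dz (E a b) = ((if a = 3 then 1/2 else 0) \<cdot> E 0 b - (if a = 2 then 1/2 else 0) \<cdot> E 1 b)
     + ((if b = 3 then 1/2 else 0) \<cdot> E a 0 - (if b = 2 then 1/2 else 0) \<cdot> E a 1)" for a b
    by (simp add: dz_def D_E dl_def dvec_def)
  have dd: "dz (dz (E a b)) = (if a = 3 then (if b = 3 then (1/2) \<cdot> E 0 0 else if b = 2 then (-1/2) \<cdot> E 0 1 else 0)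
     else if a = 2 then (if b = 3 then (-1/2) \<cdot> E 1 0 else if b = 2 then (1/2) \<cdot> E 1 1 else 0) else 0)"
    by (auto simp: d flinD[OF flin_dz1] intro!: poly_mapping_eqI simp: lk_simps)
  show "dz (dz (dz (E a b))) = 0" unfolding dd by (simp add: flinD[OF flin_dz1] d)
  have r: "r1 0 0 = 2 \<cdot> E 0 0" "r1 1 1 = 2 \<cdot> E 1 1" "r1 0 1 = E 0 1 + E 1 0"
    by (simp_all add: r1_def) (auto intro!: poly_mapping_eqI simp: lk_simps)
  have "dz (dz (E a b)) - (- zt (a,b) / 2) \<cdot> z = (if a = 3 \<and> b = 3 then (1/4) \<cdot> r1 0 0 else if a = 2 \<and> b = 2 then (1/4) \<cdot> r1 1 1
     else if a = 2 \<and> b = 3 then (-1/2) \<cdot> r1 0 1 else 0 \<cdot> r1 0 1)"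
    unfolding dd zt_eq r by (auto intro!: poly_mapping_eqI simp: lk_simps add_divide_distrib)
  then show "dz (dz (E a b)) - (- zt (a,b) / 2) \<cdot> z \<in> {f. \<exists>c a b. f = c \<cdot> r1 a b}"
    by (intro CollectI exI[of _ "if a = 3 \<and> b = 3 \<or> a = 2 \<and> b = 2 then 1/4 else if a = 2 \<and> b = 3 then -1/2 else 0"]
        exI[of _ "if a = 2 \<and> b = 2 then 1 else 0"] exI[of _ "if a = 3 \<and> b = 3 then 0 else 1"]) auto
qed

text \<open>The higher Leibniz formula, cut off after the second derivative because the third
  derivative of a letter is zero.\<close>

lemma dz_pow_mult: "(dz ^^ k) (E a b * f) = E a b * (dz ^^ k) f + of_nat k \<cdot> (dz (E a b) * (dz ^^ (k - 1)) f)
   + (of_nat (k * (k - 1)) / 2) \<cdot> (dz (dz (E a b)) * (dz ^^ (k - 2)) f)"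
proof (induction k)
  case (Suc k)
  let ?x = "E a b"
  have "(dz ^^ Suc k) (?x * f) = dz ((dz ^^ k) (?x * f))" by simp
  also have "\<dots> = ?x * (dz ^^ Suc k) f + (dz ?x * (dz ^^ k) f + of_nat k \<cdot> (dz ?x * dz ((dz ^^ (k - 1)) f)))
     + (of_nat k \<cdot> (dz (dz ?x) * (dz ^^ (k - 1)) f) + (of_nat (k * (k - 1)) / 2) \<cdot> (dz (dz ?x) * dz ((dz ^^ (k - 2)) f)))"
    unfolding Suc by (simp add: flinD[OF flin_dz1] dz_mult dz_letter fr.scale_right_distrib algebra_simps)
  also have "of_nat k \<cdot> (dz ?x * dz ((dz ^^ (k - 1)) f)) = of_nat k \<cdot> (dz ?x * (dz ^^ k) f)" by (cases k) simp_all
  also have "(of_nat (k * (k - 1)) / 2) \<cdot> (dz (dz ?x) * dz ((dz ^^ (k - 2)) f)) = (of_nat (k * (k - 1)) / 2) \<cdot> (dz (dz ?x) * (dz ^^ (k - 1)) f)"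
  proof (cases "k \<ge> 2")
    case True
    then have "k - 1 = Suc (k - 2)" by simp
    then show ?thesis by simp
  next
    case False then have "k = 0 \<or> k = 1" by auto
    then show ?thesis by auto
  qed
  also have "?x * (dz ^^ Suc k) f + (dz ?x * (dz ^^ k) f + of_nat k \<cdot> (dz ?x * (dz ^^ k) f))
     + (of_nat k \<cdot> (dz (dz ?x) * (dz ^^ (k - 1)) f) + (of_nat (k * (k - 1)) / 2) \<cdot> (dz (dz ?x) * (dz ^^ (k - 1)) f))
    = ?x * (dz ^^ Suc k) f + of_nat (Suc k) \<cdot> (dz ?x * (dz ^^ (Suc k - 1)) f)
     + (of_nat (Suc k * (Suc k - 1)) / 2) \<cdot> (dz (dz ?x) * (dz ^^ (Suc k - 2)) f)"
  proof -
    have 1: "(of_nat (Suc k * (Suc k - 1)) / 2 :: complex) = of_nat k + of_nat (k * (k - 1)) / 2"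
      by (cases k) (simp_all add: field_simps)
    have 2: "Suc k - 2 = k - 1" "Suc k - 1 = k" by simp_all
    show ?thesis unfolding 1 unfolding 2 of_nat_Suc by (simp only: fr.scale_left_distrib fr.scale_one)
  qed
  finally show ?case .
qed simp

lemma dz_vanish: "2 * length w < k \<Longrightarrow> (dz ^^ k) (wd w) = 0"
proof (induction w arbitrary: k)
  case Nil
  have "dz 1 = 0" by (simp add: dz_def)
  with Nil show ?case by (cases k) (simp_all add: funpow_swap1 flinD[OF flin_dz])
next
  case (Cons x w)
  obtain a b where x: "x = (a,b)" by force
  have "(dz ^^ j) (wd w) = 0" if "j \<ge> k - 2" for j using Cons.IH[of j] Cons.prems that by simp
  then show ?case by (simp add: x wd_Cons dz_pow_mult)
qed

text \<open>The recursion factor is the binomial coefficient \<open>2 * l + 2\<close> over 2, which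
  is \<open>(l + 1) * (2 * l + 1)\<close>, times the -1/2 from \<open>dz_letter\<close>.\<close>

primrec cz :: "nat \<Rightarrow> complex" where "cz 0 = 1" | "cz (Suc l) = - (of_nat ((l + 1) * (2 * l + 1)) / 2) * cz l"
lemma cz_ne: "cz l \<noteq> 0"
proof (induction l)
  case (Suc l)
  have "(of_nat ((l + 1) * (2 * l + 1)) :: complex) \<noteq> 0" by (simp only: of_nat_eq_0_iff) simp
  then show ?case using Suc by simp
qed simp

text \<open>A letter survives at most two applications of \<open>dz\<close>, so in
  \<open>2 * length w\<close> applications each letter is differentiated exactly twice and becomes a
  multiple of \<open>z\<close> modulo \<open>L\<close>.\<close>

lemma dz_top_word:
  assumes L: "ideal L" "\<And>a b. r1 a b \<in> L"
  shows "(dz ^^ (2 * length w)) (wd w) - (cz (length w) * ztw w) \<cdot> z ^ length w \<in> L"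
proof (induction w)
  case Nil then show ?case using subsp_0[OF ideal_subsp[OF L(1)]] by simp
next
  case (Cons x w)
  obtain a b where x: "x = (a,b)" by force
  note sp = ideal_subsp[OF L(1)]
  let ?l = "length w" and ?k = "of_nat ((length w + 1) * (2 * length w + 1)) :: complex"
  let ?g = "(dz ^^ (2 * ?l)) (wd w)" and ?x = "dz (dz (E a b))"
  have v: "(dz ^^ (2 * ?l + 2)) (wd w) = 0" "(dz ^^ (2 * ?l + 1)) (wd w) = 0" by (rule dz_vanish, simp)+
  have e: "2 * length (x # w) = 2 * ?l + 2" "2 * ?l + 2 - 1 = 2 * ?l + 1" "2 * ?l + 2 - 2 = 2 * ?l" by simp_all
  have k: "(of_nat ((2 * ?l + 2) * (2 * ?l + 1)) / 2 :: complex) = ?k" by (simp add: field_simps)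
  have 1: "(dz ^^ (2 * length (x # w))) (wd (x # w)) = ?k \<cdot> (?x * ?g)"
    using dz_pow_mult[of "2 * ?l + 2" a b "wd w"] unfolding e v k unfolding x wd_Cons
    by (simp only: mult_zero_right fr.scale_zero_right add_0_left)
  obtain c a' b' where r: "?x - (- zt (a,b) / 2) \<cdot> z = c \<cdot> r1 a' b'" using dz_letter(2)[of a b] by blast
  have A: "?x - (- zt (a,b) / 2) \<cdot> z \<in> L" unfolding r by (intro subsp_sm[OF sp] L(2))
  have "(dz ^^ (2 * length (x # w))) (wd (x # w)) - (cz (length (x # w)) * ztw (x # w)) \<cdot> z ^ length (x # w)
    = ?k \<cdot> ((?x - (- zt (a,b) / 2) \<cdot> z) * ?g + ((- zt (a,b) / 2) \<cdot> z) * (?g - (cz ?l * ztw w) \<cdot> z ^ ?l))"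
    unfolding 1 by (rule poly_mapping_eqI) (simp add: x lk_simps left_diff_distrib right_diff_distrib algebra_simps)
  also have "\<dots> \<in> L" by (intro subsp_sm[OF sp] subsp_add[OF sp] idealD(2)[OF L(1) A] idealD(1)[OF L(1) Cons])
  finally show ?case .
qed

lemma dz_top:
  assumes L: "ideal L" "\<And>a b. r1 a b \<in> L" and f: "Dlt (Suc l) f"
  shows "(dz ^^ (2 * l)) f - (cz l * zeta (tp l f)) \<cdot> z ^ l \<in> L"
  using f
proof (induction rule: Dlt_induct)
  case zero then show ?case using subsp_0[OF ideal_subsp[OF L(1)]] by (simp add: flinD[OF flin_dz] flinD[OF flin_tp] zeta_simps)
next
  case (wd c w)
  note sp = ideal_subsp[OF L(1)]
  have "(dz ^^ (2 * l)) (wd w) - (cz l * zeta (tp l (wd w))) \<cdot> z ^ l \<in> L"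
  proof (cases "length w = l")
    case True then show ?thesis using dz_top_word[OF L, of w] by (simp add: tp_wd)
  next
    case False then have "length w < l" using wd by simp
    then show ?thesis using subsp_0[OF sp] by (simp add: tp_wd dz_vanish zeta_simps)
  qed
  from subsp_sm[OF sp this, of c] show ?case
    by (simp add: flinD[OF flin_dz] flinD[OF flin_tp] zeta_simps fr.scale_right_diff_distrib ac_simps)
next
  case (add f g)
  from subsp_add[OF ideal_subsp[OF L(1)] this] show ?case
    by (simp add: flinD[OF flin_dz] flinD[OF flin_tp] zeta_simps algebra_simps fr.scale_left_distrib)
qed

lemma oideal_dz_pow: "oideal L \<Longrightarrow> f \<in> L \<Longrightarrow> (dz ^^ k) f \<in> L"
  by (induction k) (simp_all add: dz_def oideal_D)

theorem leading_in_I: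
  assumes L: "oideal L" and zl: "z ^ l \<notin> L" and f: "f \<in> L" "Dlt (Suc l) f" shows "tp l f \<in> I"
proof -
  note L' = oideal_idealD[OF L]
  define T where "T = {tp l g | g. g \<in> L \<and> Dlt (Suc l) g}"
  have "zeta (tp l g) = 0" if g: "g \<in> L" "Dlt (Suc l) g" for g
  proof (rule ccontr)
    assume n: "zeta (tp l g) \<noteq> 0"
    have "(cz l * zeta (tp l g)) \<cdot> z ^ l \<in> L"
      using dz_top[OF L'(1) oideal_r1[OF L] g(2)] subsp_cong[OF L'(2)] oideal_dz_pow[OF L g(1)] by blast
    then show False using n zl cz_ne[of l] by (simp add: subsp_sm_iff[OF L'(2)])
  qed
  moreover have "sig (tp l g) \<in> T" if "g \<in> L" "Dlt (Suc l) g" for g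
    unfolding T_def using that oideal_sig[OF L] Dlt_sig[OF that(2)] tp_sig[symmetric] by blast
  moreover have "D x y (tp l g) \<in> T" if "g \<in> L" "Dlt (Suc l) g" for g x y
    unfolding T_def using that oideal_D[OF L] Dlt_D[OF that(2)] tp_D[symmetric] by blast
  ultimately have T: "zstable T" unfolding zstable_def by (auto simp: T_def)
  have "tp l f \<in> T" unfolding T_def using f by blast
  moreover have "tp l (tp l f) = tp l f" by (rule poly_mapping_eqI) (simp add: lk_top)
  ultimately show ?thesis by (rule zstable_in_I[OF T])
qed

text \<open>Since \<open>gr L\<close> is an ideal, only generators have to be lifted. For indices
  out of range they are combinations of products containing a letter of \<open>L\<close>; for
  indices in range the assumptions supply the lifts.\<close>

lemma I_subset_grI:
  assumes L: "oideal L" and PL: "\<And>a b c d. \<lbrakk>a < N; b < N; c < N; d < N\<rbrakk> \<Longrightarrow> \<exists>g. Dlt 2 g \<and> PL a b c d + g \<in> L"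
    and TR: "\<And>a d. \<lbrakk>a < N; d < N\<rbrakk> \<Longrightarrow> \<exists>g. Dlt 2 g \<and> TR a d + g \<in> L"
  shows "I \<subseteq> gr L"
proof
  note L' = oideal_idealD[OF L]
  note G = ideal_gr[OF L'(1)]
  note gs = ideal_subsp[OF G]
  have tE: "tp 1 (E a b) = E a b" for a b by (simp add: E_def tp_wd)
  have lett: "E a b \<in> gr L" if "\<not> (a < N \<and> b < N)" for a b
    using L that by (intro grI[OF L'(2) tE, of 0]) (auto simp: oideal_def)
  have tW: "tp 2 (W a b c d) = W a b c d" for a b c d by (simp add: W_def E_def wd_mult tp_wd)
  have tSy: "tp 2 (Sy a b c d) = Sy a b c d" for a b c d by (simp add: Sy_def Wa_def flinD[OF flin_tp] tW)
  have tPL: "tp 2 (PL a b c d) = PL a b c d" for a b c d by (simp add: PL_def flinD[OF flin_tp] tSy)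
  have tTR: "tp 2 (TR a d) = TR a d" for a d by (simp add: TR_def tp_sum flinD[OF flin_tp] tSy)
  have Wout: "W a b c d \<in> gr L" if "\<not> (a < N \<and> b < N \<and> c < N \<and> d < N)" for a b c d
    unfolding W_def using that lett[of a b] lett[of c d] idealD[OF G] by blast
  have Syout: "Sy a b c d \<in> gr L" if "\<not> (a < N \<and> b < N \<and> c < N \<and> d < N)" for a b c d
    unfolding Sy_def Wa_def using that by (intro subsp_add[OF gs] subsp_diff[OF gs] subsp_sm[OF gs] Wout) auto
  fix f assume "f \<in> I"
  then show "f \<in> gr L"
  proof (induction rule: I.induct)
    case (I_letter a b) then show ?case by (rule lett)
  next
    case (I_r1 a b)
    have "tp 1 (r1 a b) = r1 a b" by (simp add: r1_def flinD[OF flin_tp] E_def tp_wd)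
    then show ?case using oideal_r1[OF L] by (intro grI[OF L'(2), of 1 _ 0]) simp_all
  next
    case (I_r2 a b c d)
    have t: "tp 2 (r2 a b c d) = r2 a b c d" by (simp add: r2_def flinD[OF flin_tp] E_def wd_mult tp_wd)
    have "Dlt 2 (- D a b (E c d))" by (intro Dlt_neg Dlt_D) (simp add: E_def Dlt_wd)
    then show ?case by (rule grI[OF L'(2) t]) (use oideal_r2[OF L, of a b c d] in simp)
  next
    case (I_PL a b c d)
    show ?case
    proof (cases "a < N \<and> b < N \<and> c < N \<and> d < N")
      case True then show ?thesis using PL grI[OF L'(2) tPL] by blast
    next
      case False then show ?thesis unfolding PL_def
        by (intro subsp_add[OF gs] subsp_diff[OF gs] subsp_sm[OF gs] Syout) auto
    qed
  next
    case (I_TR a d)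
    show ?case
    proof (cases "a < N \<and> d < N")
      case True then show ?thesis using TR grI[OF L'(2) tTR] by blast
    next
      case False then show ?thesis unfolding TR_def
        by (intro subsp_sum[OF gs] subsp_sm[OF gs] Syout) auto
    qed
  next
    case I_zero show ?case by (rule subsp_0[OF gs])
  next
    case (I_add f g) then show ?case by (intro subsp_add[OF gs])
  next
    case (I_left f r) then show ?case by (intro idealD[OF G])
  next
    case (I_right f r) then show ?case by (intro idealD[OF G])
  qed
qed

text \<open>\<open>lifts L l\<close> is stable and contains \<open>z ^ l\<close>, hence all words of
  length \<open>l\<close>: each of them is congruent to a combination of shorter words. A longer
  word is split as \<open>u @ v\<close> with \<open>length v = l\<close>, and rewriting
  \<open>v\<close> lowers the degree of the whole.\<close>

theorem z_power_finite_codim: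
  assumes L: "oideal L" "I \<subseteq> gr L" "z ^ l \<in> L" shows "\<exists>g. Dlt l g \<and> f - g \<in> L"
proof -
  note L' = oideal_idealD[OF L(1)]
  have "Dst (lifts L l)"
    unfolding Dst_def
  proof (intro conjI allI impI ballI)
    show "subsp (lifts L l)" by (rule subsp_lifts[OF L'(2)])
    show "I \<subseteq> lifts L l" using L(2) by (auto simp: gr_def)
    fix x y f assume "f \<in> lifts L l"
    then obtain g where g: "Dlt l g" "tp l f + g \<in> L" by (auto simp: lifts_def)
    have "D x y (tp l f + g) \<in> L" by (rule oideal_D[OF L(1) g(2)])
    then have "tp l (D x y f) + D x y g \<in> L" by (simp add: flinD[OF flin_D] tp_D)
    then show "D x y f \<in> lifts L l" using Dlt_D[OF g(1)] by (auto simp: lifts_def)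
  qed
  moreover have "z ^ l \<in> lifts L l"
  proof -
    have "tp l (z ^ l) = z ^ l"
    proof (induction l)
      case 0 show ?case using tp_wd[of 0 "[]"] by simp
    next
      case (Suc l) then show ?case by (simp add: E_def tp_mult_wd)
    qed
    then show ?thesis using L(3) by (auto simp: lifts_def intro!: exI[of _ 0])
  qed
  ultimately have W: "wd w \<in> lifts L l" if "length w = l" for w using z_power_generates that by blast
  have "Dlt k f \<Longrightarrow> \<exists>g. Dlt l g \<and> f - g \<in> L" for k f
  proof (induction k arbitrary: f)
    case 0 then show ?case using subsp_0[OF L'(2)] Dlt_zeroD[of f] by (auto intro!: exI[of _ 0])
  next
    case (Suc k)
    show ?case
      using Suc.prems
    proof (induction rule: Dlt_induct)
      case zero then show ?case using subsp_0[OF L'(2)] by (auto intro!: exI[of _ 0])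
    next
      case (add f g)
      then obtain u v where "Dlt l u" "f - u \<in> L" "Dlt l v" "g - v \<in> L" by blast
      then have "Dlt l (u + v)" "f + g - (u + v) \<in> L"
        using subsp_add[OF L'(2), of "f - u" "g - v"] by (simp_all add: Dlt_add algebra_simps)
      then show ?case by blast
    next
      case (wd c w)
      have "\<exists>g. Dlt l g \<and> wd w - g \<in> L"
      proof (cases "length w < k")
        case True then show ?thesis by (intro Suc.IH Dlt_wd)
      next
        case False
        then have k: "length w = k" using wd by simp
        show ?thesis
        proof (cases "k < l")
          case True then show ?thesis using k subsp_0[OF L'(2)] by (intro exI[of _ "wd w"]) (simp add: Dlt_wd)
        next
          case False
          define u v where "u = take (k - l) w" and "v = drop (k - l) w"
          have uv: "w = u @ v" "length v = l" "length u = k - l" using False k by (simp_all add: u_def v_def)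
          obtain g where g: "Dlt l g" "wd v + g \<in> L" using W[OF uv(2)] uv(2) by (auto simp: lifts_def tp_wd)
          have "Dlt k (- (wd u * g))" using Dlt_mult_wd(1)[OF g(1), of u] uv False by (intro Dlt_neg) simp
          then obtain g' where g': "Dlt l g'" "- (wd u * g) - g' \<in> L" using Suc.IH by blast
          have "wd u * (wd v + g) + (- (wd u * g) - g') \<in> L" by (intro subsp_add[OF L'(2)] idealD(1)[OF L'(1)] g g')
          then show ?thesis using g'(1) by (auto simp: distrib_left uv(1) wd_mult)
        qed
      qed
      then obtain g where "Dlt l g" "wd w - g \<in> L" by blast
      then have "Dlt l (c \<cdot> g)" "c \<cdot> wd w - c \<cdot> g \<in> L"
        using subsp_sm[OF L'(2), of "wd w - g" c] by (simp_all add: Dlt_sm fr.scale_right_diff_distrib)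
      then show ?case by blast
    qed
  qed
  then show ?thesis using Dlt_ex[of f] by blast
qed

end

subsection \<open>Quadratic elements of an ideal are determined by their leading terms\<close>

context canon
begin

context
  fixes L assumes L: "oideal L" and zz: "z ^ 2 \<notin> L"
    and PLlift: "\<And>a b c d. \<lbrakk>a < N; b < N; c < N; d < N\<rbrakk> \<Longrightarrow> \<exists>g. Dlt 2 g \<and> PL a b c d + g \<in> L"
    and TRlift: "\<And>a d. \<lbrakk>a < N; d < N\<rbrakk> \<Longrightarrow> \<exists>g. Dlt 2 g \<and> TR a d + g \<in> L"
begin

lemma Li: "ideal L" and Ls: "subsp L" using oideal_idealD[OF L] by simp_all
lemma LD: "f \<in> L \<Longrightarrow> D x y f \<in> L" by (rule oideal_D[OF L])
lemma z_notin: "z \<notin> L" using zz idealD(1)[OF Li, of z z] by (auto simp: power2_eq_square)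
lemma L_half: "c \<noteq> 0 \<Longrightarrow> c \<cdot> f \<in> L \<Longrightarrow> f \<in> L" by (simp add: subsp_sm_iff[OF Ls])

lemma L_diag: "\<not> pr a \<Longrightarrow> E a a \<in> L"
proof -
  assume "\<not> pr a"
  then have "r1 a a = 2 \<cdot> E a a" by (simp add: r1_def) (rule poly_mapping_eqI, simp add: lk_simps)
  then have "2 \<cdot> E a a \<in> L" using oideal_r1[OF L, of a a] by simp
  then show ?thesis by (rule L_half[rotated]) simp
qed

text \<open>For \<open>i\<close> equal to 0 or 1 this is a torus element with weight 1 on the index
  \<open>i\<close> and -1 on \<open>tw i\<close>; the factor 2 undoes the 1/2 in
  \<open>dvec\<close>.\<close>

definition H :: "nat \<Rightarrow> fr \<Rightarrow> fr" where "H i f = 2 \<cdot> D i (tw i) f"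
definition wt :: "nat \<Rightarrow> nat \<Rightarrow> complex" where "wt i a = (if a = i then 1 else if a = tw i then -1 else 0)"

lemma flin_H: "flin (H i)" unfolding H_def by (rule flin_comp[OF flin_mult(3) flin_D])
lemma LH: "f \<in> L \<Longrightarrow> H i f \<in> L" unfolding H_def by (intro subsp_sm[OF Ls] LD)
lemma H_1: "H i 1 = 0" by (simp add: H_def)
lemma dvec_H: "i \<in> {0,1} \<Longrightarrow> dvec i (tw i) a G = (wt i a / 2) \<cdot> G a"
  by (auto simp: dvec_def wt_def tw_def)
lemma pr_H: "i \<in> {0,1} \<Longrightarrow> \<not> pr i \<and> \<not> pr (tw i)" by (auto simp: tw_def)
lemma H_E: "i \<in> {0,1} \<Longrightarrow> H i (E a b) = (wt i a + wt i b) \<cdot> E a b"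
  using pr_H[of i] by (simp add: H_def D_E dl_def dvec_H fr.scale_right_distrib fr.scale_left_distrib)
lemma H_PL: "i \<in> {0,1} \<Longrightarrow> H i (PL a b c d) = (wt i a + wt i b + wt i c + wt i d) \<cdot> PL a b c d"
  using pr_H[of i] by (simp add: H_def eqv4D(2)[OF eqv4_PL] act4_def dvec_H fr.scale_right_distrib fr.scale_left_distrib)
lemma H_TR: "i \<in> {0,1} \<Longrightarrow> H i (TR a d) = (wt i a + wt i d) \<cdot> TR a d"
proof -
  assume i: "i \<in> {0,1}"
  then have "i < N" "tw i < N" using mN by (auto simp: tw_def)
  then show ?thesis
    using pr_H[OF i] i by (simp add: H_def eqv2D(2)[OF eqv2_TR] act2_def dvec_H fr.scale_right_distrib fr.scale_left_distrib)
qed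

text \<open>Projection (up to the factor 4) to the weight (1,1), respectively (up to 6) to the weight 2 of the
  second torus element; on elements of degree at most one only multiples of \<open>z\<close>, respectively nothing, survives.\<close>
definition op1 :: "fr \<Rightarrow> fr" where "op1 f = (let g = H 0 (H 0 f) + H 0 f in H 1 (H 1 g) + H 1 g)"
definition op2 :: "fr \<Rightarrow> fr" where "op2 f = H 1 (H 1 (H 1 f)) - H 1 f"

lemma flin_op: "flin op1" "flin op2"
  unfolding flin_def op1_def op2_def Let_def
  by (simp_all add: flinD[OF flin_H] fr.scale_right_distrib fr.scale_right_diff_distrib)
lemma L_op: "f \<in> L \<Longrightarrow> op1 f \<in> L" "f \<in> L \<Longrightarrow> op2 f \<in> L"
  unfolding op1_def op2_def Let_def by (intro subsp_add[OF Ls] subsp_diff[OF Ls] LH; assumption)+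

lemma word_lt2: "length w < 2 \<Longrightarrow> (w = [] \<Longrightarrow> thesis) \<Longrightarrow> (\<And>a b. w = [(a,b)] \<Longrightarrow> thesis) \<Longrightarrow> thesis"
  by (cases w; cases "tl w") auto

lemma op1_low: "Dlt 2 g \<Longrightarrow> \<exists>t. op1 g - t \<cdot> z \<in> L"
proof (induction rule: Dlt_induct)
  case zero then show ?case using subsp_0[OF Ls] by (auto simp: flinD[OF flin_op(1)] intro!: exI[of _ 0])
next
  case (wd c w)
  have "\<exists>t. op1 (wd w) - t \<cdot> z \<in> L"
  proof (rule word_lt2[OF wd])
    assume "w = []"
    then have "op1 (wd w) = 0" by (simp add: op1_def H_1 flinD[OF flin_H])
    then show ?thesis using subsp_0[OF Ls] by (auto intro!: exI[of _ 0])
  next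
    fix a b assume w: "w = [(a,b)]"
    let ?u = "wt 0 a + wt 0 b" and ?v = "wt 1 a + wt 1 b"
    have o: "op1 (wd w) = ((?u * ?u + ?u) * (?v * ?v + ?v)) \<cdot> E a b"
      unfolding w E_def[symmetric] op1_def Let_def
      by (simp add: flinD[OF flin_H] H_E) (rule poly_mapping_eqI, simp add: lk_simps algebra_simps)
    \<comment> \<open>\<open>x^2 + x\<close> vanishes at 0 and -1, and a letter of weight 2 or -2
      for one torus element has weight 0 for the other. So only the weight (1,1) remains.\<close>
    have "(a = 0 \<and> b = 1) \<or> (a = 1 \<and> b = 0) \<or> (?u * ?u + ?u) * (?v * ?v + ?v) = 0"
      unfolding wt_def tw_def
      by (cases "a = 0"; cases "a = 1"; cases "a = 2"; cases "a = 3"; cases "b = 0"; cases "b = 1"; cases "b = 2"; cases "b = 3") simp_all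
    then consider "a = 0" "b = 1" | "a = 1" "b = 0" | "(?u * ?u + ?u) * (?v * ?v + ?v) = 0" by blast
    then show ?thesis
    proof cases
      case 1
      then show ?thesis unfolding o using subsp_0[OF Ls] by (auto intro!: exI[of _ 4] simp: wt_def tw_def)
    next
      case 2
      have "4 \<cdot> E 1 0 - (- 4) \<cdot> z = 4 \<cdot> r1 1 0" by (simp add: r1_def fr.scale_right_distrib)
      also have "\<dots> \<in> L" by (intro subsp_sm[OF Ls] oideal_r1[OF L])
      finally have "4 \<cdot> E 1 0 - (- 4) \<cdot> z \<in> L" .
      moreover have "op1 (wd w) = 4 \<cdot> E 1 0" unfolding o using 2 by (simp add: wt_def tw_def)
      ultimately show ?thesis by (intro exI[of _ "- 4"]) (simp only:)
    next
      case 3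
      then show ?thesis unfolding o using subsp_0[OF Ls] by (auto intro!: exI[of _ 0])
    qed
  qed
  then obtain t where "op1 (wd w) - t \<cdot> z \<in> L" ..
  from subsp_sm[OF Ls this, of c] have "op1 (c \<cdot> wd w) - (c * t) \<cdot> z \<in> L"
    by (simp add: flinD[OF flin_op(1)] fr.scale_right_diff_distrib)
  then show ?case ..
next
  case (add f g)
  then obtain t u where "op1 f - t \<cdot> z \<in> L" "op1 g - u \<cdot> z \<in> L" by blast
  from subsp_add[OF Ls this] have "op1 (f + g) - (t + u) \<cdot> z \<in> L"
    by (simp add: flinD[OF flin_op(1)] fr.scale_left_distrib algebra_simps)
  then show ?case ..
qed

lemma op2_low: "Dlt 2 g \<Longrightarrow> op2 g \<in> L"
proof (induction rule: Dlt_induct)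
  case zero then show ?case using subsp_0[OF Ls] by (simp add: flinD[OF flin_op(2)])
next
  case (wd c w)
  have "op2 (wd w) \<in> L"
  proof (rule word_lt2[OF wd])
    assume "w = []"
    then have "op2 (wd w) = 0" by (simp add: op2_def H_1 flinD[OF flin_H])
    then show ?thesis using subsp_0[OF Ls] by simp
  next
    fix a b assume w: "w = [(a,b)]"
    let ?v = "wt 1 a + wt 1 b"
    have o: "op2 (wd w) = (?v * ?v * ?v - ?v) \<cdot> E a b"
      unfolding w E_def[symmetric] op2_def
      by (simp add: flinD[OF flin_H] H_E) (rule poly_mapping_eqI, simp add: lk_simps algebra_simps)
    \<comment> \<open>\<open>x^3 - x\<close> leaves only the weights 2 and -2. They occur for
      letters with a repeated even index, and these belong to \<open>L\<close>.\<close>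
    have "(a = 1 \<and> b = 1) \<or> (a = 3 \<and> b = 3) \<or> ?v * ?v * ?v - ?v = 0"
      unfolding wt_def tw_def
      by (cases "a = 1"; cases "a = 3"; cases "b = 1"; cases "b = 3") simp_all
    then consider "a = 1" "b = 1" | "a = 3" "b = 3" | "?v * ?v * ?v - ?v = 0" by blast
    then show ?thesis
    proof cases
      case 1 then show ?thesis unfolding o by (simp only:) (intro subsp_sm[OF Ls] L_diag, simp)
    next
      case 2 then show ?thesis unfolding o by (simp only:) (intro subsp_sm[OF Ls] L_diag, simp)
    next
      case 3 then show ?thesis by (simp only: o fr.scale_zero_left subsp_0[OF Ls])
    qed
  qed
  then show ?case unfolding flinD[OF flin_op(2)] by (rule subsp_sm[OF Ls])
next
  case (add f g) then show ?case unfolding flinD[OF flin_op(2)] by (rule subsp_add[OF Ls])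
qed

lemma PL_repeat: "\<not> pr u \<Longrightarrow> PL u u c d = 0" "\<not> pr u \<Longrightarrow> PL u b u d = 0" "\<not> pr u \<Longrightarrow> PL u b c u = 0"
  "\<not> pr u \<Longrightarrow> PL b u u d = 0" "\<not> pr u \<Longrightarrow> PL b u c u = 0" "\<not> pr u \<Longrightarrow> PL b c u u = 0"
proof -
  have z: "f = 0" if "f = (- 1) \<cdot> f" for f :: fr
  proof (rule poly_mapping_eqI)
    fix w have "lk f w = lk ((- 1) \<cdot> f) w" using that by simp
    then show "lk f w = lk 0 w" by simp
  qed
  assume u: "\<not> pr u"
  have 1: "PL u u c d = 0" for c d using PL_sym(1)[of u u c d] u by (intro z) simp
  have 2: "PL b u u d = 0" for b d using PL_sym(2)[of b u u d] u by (intro z) simp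
  have 3: "PL b c u u = 0" for b c using PL_sym(3)[of b c u u] u by (intro z) simp
  show "PL u u c d = 0" "PL b u u d = 0" "PL b c u u = 0" by (rule 1 2 3)+
  have 4: "PL u b u d = 0" for b d using PL_sym(2)[of u b u d] 1 by simp
  have 5: "PL b u c u = 0" for b c using PL_sym(3)[of b u c u] 2 by simp
  show "PL u b u d = 0" "PL b u c u = 0" by (rule 4 5)+
  show "PL u b c u = 0" using PL_sym(3)[of u b c u] 4 by simp
qed

lemma PL_sw: "PL a b c d \<in> L \<Longrightarrow> PL b a c d \<in> L" "PL a b c d \<in> L \<Longrightarrow> PL a c b d \<in> L" "PL a b c d \<in> L \<Longrightarrow> PL a b d c \<in> L"
proof -
  assume a: "PL a b c d \<in> L"
  show "PL b a c d \<in> L" unfolding PL_sym(1)[of b a] by (rule subsp_sm[OF Ls a])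
  show "PL a c b d \<in> L" unfolding PL_sym(2)[of a c b] by (rule subsp_sm[OF Ls a])
  show "PL a b d c \<in> L" unfolding PL_sym(3)[of a b d c] by (rule subsp_sm[OF Ls a])
qed

lemma pick: "\<exists>v\<in>{4,5,6::nat}. v \<noteq> u \<and> v \<noteq> d"
proof -
  have "\<not> {4,5,6::nat} \<subseteq> {u,d}" using card_mono[of "{u,d}" "{4,5,6::nat}"] card_insert_le_m1[of 2 "{d}" u] by auto
  then show ?thesis by blast
qed

text \<open>Projection to the weight of \<open>z\<close> reduces the lower-order part of a lift of
  \<open>PL 0 1 v d\<close> to a multiple of \<open>z\<close>. The rotation of the unit vector
  \<open>v\<close> into \<open>u\<close> kills \<open>z\<close> and turns \<open>PL 0 1 v d\<close>
  into a multiple of \<open>PL 0 1 u d\<close>. This requires a third unit vector \<open>v\<close>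
  different from \<open>u\<close> and \<open>d\<close>.\<close>

lemma PL01_uv:
  assumes u: "u \<in> {4,5,6}" and d: "d \<in> R" "u \<noteq> d" shows "PL 0 1 u d \<in> L"
proof -
  obtain v where v: "v \<in> {4,5,6}" "v \<noteq> u" "v \<noteq> d" using pick[of u d] by blast
  obtain g where g: "Dlt 2 g" "PL 0 1 v d + g \<in> L" using PLlift[of 0 1 v d] mN v d by auto
  obtain t where t: "op1 g - t \<cdot> z \<in> L" using op1_low[OF g(1)] ..
  have "op1 (PL 0 1 v d) = 4 \<cdot> PL 0 1 v d"
    using v d by (simp add: op1_def Let_def H_PL flinD[OF flin_H] wt_def tw_def) (auto intro!: poly_mapping_eqI simp: lk_simps)
  then have "4 \<cdot> PL 0 1 v d + op1 g \<in> L" using L_op(1)[OF g(2)] by (simp add: flinD[OF flin_op(1)])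
  from subsp_diff[OF Ls this t] have "4 \<cdot> PL 0 1 v d + t \<cdot> z \<in> L" by simp
  from LD[OF this, of u v] have "4 \<cdot> D u v (PL 0 1 v d) + t \<cdot> D u v z \<in> L" by (simp add: flinD[OF flin_D])
  moreover have "D u v z = 0" using u v by (auto simp: D_E dl_def dvec_def)
  moreover have "D u v (PL 0 1 v d) = (1/2) \<cdot> PL 0 1 u d"
    unfolding eqv4D(2)[OF eqv4_PL] act4_def dvec_def using u v d by auto
  ultimately have "2 \<cdot> PL 0 1 u d \<in> L" by simp
  then show ?thesis by (rule L_half[rotated]) simp
qed

text \<open>The derivation along \<open>a u\<close> replaces an index equal to the unit vector
  \<open>u\<close> by \<open>a\<close>. On the other indices it can only create a second
  \<open>u\<close>, and those terms vanish by antisymmetry.\<close>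

lemma PL_exch:
  assumes u: "u \<in> {4,5,6}" "u \<noteq> b" "u \<noteq> c" "u \<noteq> d" and a: "a < N" and P: "PL u b c d \<in> L" shows "PL a b c d \<in> L"
proof (cases "a = u")
  case False
  have p: "\<not> pr u" using u by auto
  have "D a u (PL u b c d) = (1/2) \<cdot> PL a b c d"
    unfolding eqv4D(2)[OF eqv4_PL] act4_def dvec_def using u False p by (auto simp: PL_repeat[OF p])
  then have "(1/2) \<cdot> PL a b c d \<in> L" using LD[OF P, of a u] by simp
  then show ?thesis by (rule L_half[rotated]) simp
qed (use P in simp)

lemma PL01: assumes "x < N" "y < N" shows "PL 0 1 x y \<in> L"
proof -
  have 4: "PL a 0 1 4 \<in> L" if "a < N" for a
  proof (rule PL_exch[of 5])
    have "PL 0 1 5 4 \<in> L" using mN by (intro PL01_uv) auto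
    then show "PL 5 0 1 4 \<in> L" by (intro PL_sw(1)[of 0 5] PL_sw(2)[of 0 1 5])
  qed (use that in auto)
  have "PL x 0 1 y \<in> L"
  proof (cases "y = 4")
    case False
    have "PL y 0 1 4 \<in> L" using 4 assms by simp
    then have "PL 0 4 1 y \<in> L" by (intro PL_sw(2)[of 0 1 4 y] PL_sw(3)[of 0 1 y 4] PL_sw(2)[of 0 y 1 4] PL_sw(1)[of y 0])
    then have "PL 4 0 1 y \<in> L" by (rule PL_sw)
    from PL_exch[OF _ _ _ _ assms(1) this] False show ?thesis by simp
  qed (use 4 assms in simp)
  then show ?thesis by (intro PL_sw(2)[of 0 x 1 y] PL_sw(1)[of x 0])
qed

text \<open>The derivation along \<open>w 2\<close> replaces the index 0 by \<open>w\<close>. It is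
  zero for \<open>w = 2\<close>, and for \<open>w = 3\<close> it also hits the index 1; in these
  cases another of the three free indices takes the place of \<open>w\<close>. If all three are 2 or
  3, two of them coincide and \<open>PL\<close> vanishes.\<close>

lemma PL1: assumes "w < N" "x < N" "y < N" shows "PL w 1 x y \<in> L"
proof -
  have A: "PL w 1 x y \<in> L" if w: "w < N" "w \<noteq> 2" "w \<noteq> 3" and xy: "x < N" "y < N" for w x y
  proof -
    have k: "2 < N" using mN by simp
    have e: "D w 2 (PL 0 1 x y) = (1/2) \<cdot> PL w 1 x y
      + sgn_b ((pr w \<noteq> pr 2) \<and> (pr 0 \<noteq> pr 1)) \<cdot> dvec w 2 x (\<lambda>k. PL 0 1 k y)
      + sgn_b ((pr w \<noteq> pr 2) \<and> (pr 0 \<noteq> (pr 1 \<noteq> pr x))) \<cdot> dvec w 2 y (\<lambda>k. PL 0 1 x k)"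
      unfolding eqv4D(2)[OF eqv4_PL] act4_def using w by (simp add: dvec_def)
    have m: "D w 2 (PL 0 1 x y) \<in> L" by (intro LD PL01 xy)
    have d: "dvec w 2 x (\<lambda>k. PL 0 1 k y) \<in> L" "dvec w 2 y (\<lambda>k. PL 0 1 x k) \<in> L"
      unfolding dvec_def by (intro subsp_diff[OF Ls] subsp_sm[OF Ls] PL01 xy w k)+
    have "(1/2) \<cdot> PL w 1 x y \<in> L"
      by (rule subsp_cancel[OF Ls subsp_cancel[OF Ls m[unfolded e] subsp_sm[OF Ls d(2)]] subsp_sm[OF Ls d(1)]])
    then show ?thesis by (rule L_half[rotated]) simp
  qed
  consider "w \<noteq> 2" "w \<noteq> 3" | "x \<noteq> 2" "x \<noteq> 3" | "y \<noteq> 2" "y \<noteq> 3" | "w = x \<or> w = y \<or> x = y" "w = 2 \<or> w = 3" "x = 2 \<or> x = 3" "y = 2 \<or> y = 3"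
    by fastforce
  then show ?thesis
  proof cases
    case 1 then show ?thesis using A assms by simp
  next
    case 2
    then have "PL x 1 w y \<in> L" using A assms by simp
    then have "PL 1 w x y \<in> L" by (rule PL_sw(2)[OF PL_sw(1)])
    then show ?thesis by (rule PL_sw(1))
  next
    case 3
    then have "PL y 1 x w \<in> L" using A assms by simp
    then have "PL 1 x y w \<in> L" by (rule PL_sw(2)[OF PL_sw(1)])
    then have "PL 1 x w y \<in> L" by (rule PL_sw(3))
    then show ?thesis by (rule PL_sw(1)[OF PL_sw(2)])
  next
    case 4
    then have "PL w 1 x y = 0" by (auto simp: PL_repeat)
    then show ?thesis using subsp_0[OF Ls] by simp
  qed
qed

lemma PL_in: assumes "a < N" "b < N" "c < N" "d < N" shows "PL a b c d \<in> L"
proof -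
  have A: "PL w v x y \<in> L" if v: "v < N" "v \<noteq> 3" and wxy: "w < N" "x < N" "y < N" for v w x y
  proof -
    have k: "3 < N" using mN by simp
    have e: "D v 3 (PL w 1 x y) = (1/2) \<cdot> (sgn_b ((pr v \<noteq> pr 3) \<and> pr w) \<cdot> PL w v x y)
      + dvec v 3 w (\<lambda>k. PL k 1 x y)
      + sgn_b ((pr v \<noteq> pr 3) \<and> (pr w \<noteq> pr 1)) \<cdot> dvec v 3 x (\<lambda>k. PL w 1 k y)
      + sgn_b ((pr v \<noteq> pr 3) \<and> (pr w \<noteq> (pr 1 \<noteq> pr x))) \<cdot> dvec v 3 y (\<lambda>k. PL w 1 x k)"
      unfolding eqv4D(2)[OF eqv4_PL] act4_def using v by (simp add: dvec_def)
    have m: "D v 3 (PL w 1 x y) \<in> L" by (intro LD PL1 wxy)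
    have d: "dvec v 3 w (\<lambda>k. PL k 1 x y) \<in> L" "dvec v 3 x (\<lambda>k. PL w 1 k y) \<in> L" "dvec v 3 y (\<lambda>k. PL w 1 x k) \<in> L"
      unfolding dvec_def by (intro subsp_diff[OF Ls] subsp_sm[OF Ls] PL1 wxy v k)+
    have "(1/2) \<cdot> (sgn_b ((pr v \<noteq> pr 3) \<and> pr w) \<cdot> PL w v x y) \<in> L"
      by (rule subsp_cancel[OF Ls subsp_cancel[OF Ls subsp_cancel[OF Ls m[unfolded e] subsp_sm[OF Ls d(3)]] subsp_sm[OF Ls d(2)]] d(1)])
    then have "sgn_b ((pr v \<noteq> pr 3) \<and> pr w) \<cdot> PL w v x y \<in> L" by (rule L_half[rotated]) simp
    then show ?thesis by (rule L_half[rotated]) simp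
  qed
  show ?thesis
  proof (cases "b = 3")
    case False then show ?thesis using A assms by simp
  next
    case True
    show ?thesis
    proof (cases "a = 3")
      case True then show ?thesis using \<open>b = 3\<close> subsp_0[OF Ls] by (simp add: PL_repeat)
    next
      case False then show ?thesis using A assms by (intro PL_sw(1)[of b a]) simp
    qed
  qed
qed

lemma TR11: "TR 1 1 \<in> L"
proof -
  obtain g where g: "Dlt 2 g" "TR 1 1 + g \<in> L" using TRlift[of 1 1] mN by auto
  have "op2 (TR 1 1) = 6 \<cdot> TR 1 1"
    by (simp add: op2_def H_TR flinD[OF flin_H] wt_def tw_def) (auto intro!: poly_mapping_eqI simp: lk_simps)
  then have "6 \<cdot> TR 1 1 + op2 g \<in> L" using L_op(2)[OF g(2)] by (simp add: flinD[OF flin_op(2)])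
  then have "6 \<cdot> TR 1 1 \<in> L" using op2_low[OF g(1)] by (rule subsp_cancel[OF Ls])
  then show ?thesis by (rule L_half[rotated]) simp
qed

lemma D_TR: "x < N \<Longrightarrow> y < N \<Longrightarrow> D x y (TR a d) = act2 x y TR a d" by (rule eqv2D(2)[OF eqv2_TR])

lemma TR_a1: assumes "a < N" "a \<noteq> 3" shows "TR a 1 \<in> L"
proof -
  have "D a 3 (TR 1 1) = TR a 1"
    using mN assms TR_sym[of 1 a] by (simp add: D_TR act2_def dvec_def) (rule poly_mapping_eqI, simp add: lk_simps)
  then show ?thesis using LD[OF TR11, of a 3] by simp
qed

text \<open>Derivations carry \<open>TR 1 1\<close>, whose lower-order terms vanish by weight,
  through the other components. In the end \<open>TR\<close> is proportional to the metric modulo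
  \<open>L\<close>, with \<open>TR 3 1\<close> as the only unknown factor.\<close>

lemma TR_ad: assumes "a < N" "d < N" "a \<noteq> 1" "a \<noteq> 3" "d \<noteq> 3" shows "TR a d - h d a \<cdot> TR 3 1 \<in> L"
proof -
  have "D d 3 (TR a 1) = (- h a d / 2) \<cdot> TR 3 1 + (s a d / 2) \<cdot> TR a d"
    using mN assms by (simp add: D_TR act2_def dvec_def s_def conj_commute)
  then have "(2 * s a d) \<cdot> ((- h a d / 2) \<cdot> TR 3 1 + (s a d / 2) \<cdot> TR a d) \<in> L"
    using LD[OF TR_a1, of a d 3] assms subsp_sm[OF Ls] by simp
  also have "(2 * s a d) \<cdot> ((- h a d / 2) \<cdot> TR 3 1 + (s a d / 2) \<cdot> TR a d) = TR a d - h d a \<cdot> TR 3 1"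
    unfolding h_sym[where b=d and a=a] by (rule poly_mapping_eqI) (simp add: lk_simps algebra_simps)
  finally show ?thesis .
qed

lemma TR_3x: assumes "x < N" "x \<noteq> 1" shows "TR 3 x \<in> L"
proof -
  have A: "TR 3 x \<in> L" if x: "x < N" "x \<noteq> 1" and u: "u \<in> {4,5}" "u \<noteq> x" "TR u x \<in> L" for u x
  proof -
    have "D 3 u (TR u x) = (1/2) \<cdot> TR 3 x"
      using mN x u by (auto simp: D_TR act2_def dvec_def)
    then have "(1/2) \<cdot> TR 3 x \<in> L" using LD[OF u(3), of 3 u] by simp
    then show ?thesis by (rule L_half[rotated]) simp
  qed
  have B: "TR 3 x \<in> L" if x: "x < N" "x \<noteq> 1" "x \<noteq> 3" for x
  proof (cases "x = 4")
    case True
    have "TR 5 x \<in> L" using TR_ad[of 5 x] x True mN by simp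
    then show ?thesis using x True A[of x 5] by simp
  next
    case False
    have "TR 4 x \<in> L" using TR_ad[of 4 x] x False mN by simp
    then show ?thesis using x False A[of x 4] by simp
  qed
  show ?thesis
  proof (cases "x = 3")
    case True
    have "TR 4 3 \<in> L" using B[of 4] mN TR_sym[of 4 3] by simp
    then show ?thesis using True assms A[of x 4] by simp
  qed (use B assms in simp)
qed

lemma TR_all: assumes "a < N" "d < N" shows "TR a d - h d a \<cdot> TR 3 1 \<in> L"
proof -
  consider "a \<noteq> 1" "a \<noteq> 3" "d \<noteq> 3" | "a = 1" "d = 3" | "a = 1" "d \<noteq> 3" | "a = 3" "d = 1" | "a = 3" "d \<noteq> 1" | "a \<noteq> 1" "a \<noteq> 3" "d = 3" by blast
  then show ?thesis
  proof cases
    case 1 then show ?thesis by (intro TR_ad assms)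
  next
    case 2 then show ?thesis using TR_sym[of 1 3] subsp_0[OF Ls] by simp
  next
    case 3 then show ?thesis using TR_a1[of d] TR_sym[of 1 d] assms by simp
  next
    case 4 then show ?thesis using subsp_0[OF Ls] by simp
  next
    case 5 then show ?thesis using TR_3x[of d] assms by simp
  next
    case 6 then show ?thesis using TR_3x[of a] TR_sym[of a 3] assms by simp
  qed
qed

text \<open>Modulo \<open>L\<close> the element \<open>TR 3 1\<close> equals \<open>TR v v\<close>
  for each of the three unit vectors \<open>v\<close>. One of them differs from \<open>x\<close> and
  \<open>y\<close>, and the derivation along \<open>x y\<close> annihilates it.\<close>

lemma D_tau: assumes xy: "x < N" "y < N" shows "D x y (TR 3 1) \<in> L"
proof -
  obtain v where v: "v \<in> {4,5,6}" "v \<noteq> x" "v \<noteq> y" using pick[of x y] by blast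
  have "TR v v - h v v \<cdot> TR 3 1 \<in> L" using v mN by (intro TR_all) auto
  then have "TR v v - TR 3 1 \<in> L" using v by auto
  from LD[OF this, of x y] have "D x y (TR v v) - D x y (TR 3 1) \<in> L" by (simp add: flinD[OF flin_D])
  moreover have "D x y (TR v v) = 0" using v xy by (auto simp: D_TR act2_def dvec_def)
  ultimately have "- D x y (TR 3 1) \<in> L" by simp
  from subsp_neg[OF Ls this] show ?thesis by simp
qed

lemma Dlt1: "Dlt 1 f \<Longrightarrow> f = lk f [] \<cdot> 1"
proof (rule poly_mapping_eqI)
  fix w assume "Dlt 1 f"
  then show "lk f w = lk (lk f [] \<cdot> 1) w"
    using lookup_wd[of "[]" w] by (cases w) (auto simp: Dlt_def)
qed

text \<open>An element of degree at most one with all derivatives in \<open>L\<close> is constant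
  modulo \<open>L\<close>. If \<open>zeta\<close> of its linear part were nonzero, two applications
  of \<open>dz\<close> would put \<open>z\<close> into \<open>L\<close>. So these linear parts form
  a \<open>zstable\<close> set; they lie in \<open>I\<close>, whose elements lift to
  \<open>L\<close>, and subtracting the lift leaves degree zero.\<close>

lemma tau_const: "\<exists>c. TR 3 1 + c \<cdot> 1 \<in> L"
proof -
  have IL: "I \<subseteq> gr L" by (rule I_subset_grI[OF L PLlift TRlift])
  obtain g where g: "Dlt 2 g" "TR 3 1 + g \<in> L" using TRlift[of 3 1] mN by auto
  define T where "T = {tp 1 f | f. Dlt 2 f \<and> (\<forall>x<N. \<forall>y<N. D x y f \<in> L)}"
  have zt0: "zeta (tp 1 f) = 0" if f: "Dlt 2 f" "\<forall>x<N. \<forall>y<N. D x y f \<in> L" for f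
  proof (rule ccontr)
    assume n: "zeta (tp 1 f) \<noteq> 0"
    have "dz f \<in> L" using f(2) mN by (simp add: dz_def)
    then have 2: "(dz ^^ (2 * 1)) f \<in> L" by (simp add: numeral_2_eq_2) (simp add: dz_def LD)
    have "Dlt (Suc 1) f" using f(1) by (simp add: numeral_2_eq_2)
    from dz_top[OF Li oideal_r1[OF L] this] 2 have "(cz 1 * zeta (tp 1 f)) \<cdot> z ^ 1 \<in> L" using subsp_cong[OF Ls] by blast
    then show False using n z_notin cz_ne[of 1] by (simp only: subsp_sm_iff[OF Ls] power_one_right mult_eq_0_iff simp_thms)
  qed
  have "zstable T"
    unfolding zstable_def
  proof (intro ballI conjI allI impI)
    fix F assume "F \<in> T"
    then obtain f where f: "F = tp 1 f" "Dlt 2 f" "\<forall>x<N. \<forall>y<N. D x y f \<in> L" unfolding T_def by blast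
    show "zeta F = 0" using zt0 f by simp
    have "D x y (sig f) \<in> L" if "x < N" "y < N" for x y
    proof -
      have "sig (D x y f) \<in> L" using f(3) that oideal_sig[OF L] by blast
      then show ?thesis unfolding sig_D by (rule L_half[rotated]) simp
    qed
    then have "tp 1 (sig f) \<in> T" unfolding T_def using Dlt_sig[OF f(2)] by blast
    then show "sig F \<in> T" by (simp only: f(1) tp_sig)
    fix x y assume xy: "x < N" "y < N"
    have "\<forall>x'<N. \<forall>y'<N. D x' y' (D x y f) \<in> L" using f(3) xy LD by blast
    then have "tp 1 (D x y f) \<in> T" unfolding T_def using Dlt_D[OF f(2)] by blast
    then show "D x y F \<in> T" by (simp only: f(1) tp_D)
  qed
  moreover have "tp 1 g \<in> T"
  proof -
    have "D x y g \<in> L" if "x < N" "y < N" for x y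
    proof -
      have "D x y g + D x y (TR 3 1) \<in> L" using LD[OF g(2), of x y] by (simp add: flinD[OF flin_D] add.commute)
      then show ?thesis using D_tau[OF that] by (rule subsp_cancel[OF Ls])
    qed
    then show ?thesis unfolding T_def using g(1) by blast
  qed
  moreover have tt: "tp 1 (tp 1 g) = tp 1 g" by (rule poly_mapping_eqI) (simp add: lk_top)
  ultimately have "tp 1 g \<in> I" by (rule zstable_in_I)
  then have "tp 1 g \<in> lifts L 1" using IL by (auto simp: gr_def)
  then obtain g' where g': "Dlt 1 g'" "tp 1 g + g' \<in> L" unfolding lifts_def using tt by auto
  have "Dlt 1 (g - tp 1 g)" using Dlt_top[of 1 g] g(1) by (simp add: numeral_2_eq_2)
  then have "Dlt 1 (g - tp 1 g - g')" using g'(1) by (rule Dlt_diff)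
  then obtain c where c: "g - tp 1 g - g' = c \<cdot> 1" using Dlt1 by blast
  have "TR 3 1 + g - (tp 1 g + g') \<in> L" by (rule subsp_diff[OF Ls g(2) g'(2)])
  then have "TR 3 1 + c \<cdot> 1 \<in> L" by (simp flip: c add: algebra_simps)
  then show ?thesis ..
qed

definition ql :: "fr \<Rightarrow> fr \<Rightarrow> bool" (infix "\<simeq>" 50) where "x \<simeq> y \<longleftrightarrow> x - y \<in> L"

lemma ql_refl: "x \<simeq> x" by (simp add: ql_def subsp_0[OF Ls])
lemma ql_sym: "x \<simeq> y \<Longrightarrow> y \<simeq> x" unfolding ql_def by (drule subsp_neg[OF Ls]) simp
lemma ql_trans [trans]: "x \<simeq> y \<Longrightarrow> y \<simeq> w \<Longrightarrow> x \<simeq> w"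
  unfolding ql_def by (drule (1) subsp_add[OF Ls]) simp
lemma ql_add: "x \<simeq> y \<Longrightarrow> x' \<simeq> y' \<Longrightarrow> x + x' \<simeq> y + y'"
  unfolding ql_def by (drule (1) subsp_add[OF Ls]) (simp add: algebra_simps)
lemma ql_diff: "x \<simeq> y \<Longrightarrow> x' \<simeq> y' \<Longrightarrow> x - x' \<simeq> y - y'"
  unfolding ql_def by (drule (1) subsp_diff[OF Ls]) (simp add: algebra_simps)
lemma ql_sm: "x \<simeq> y \<Longrightarrow> c \<cdot> x \<simeq> c \<cdot> y"
  unfolding ql_def by (drule subsp_sm[OF Ls, of _ c]) (simp add: fr.scale_right_diff_distrib)
lemma ql_multL: "x \<simeq> y \<Longrightarrow> r * x \<simeq> r * y" unfolding ql_def by (drule idealD(1)[OF Li, of _ r]) (simp add: algebra_simps)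
lemma ql_multR: "x \<simeq> y \<Longrightarrow> x * r \<simeq> y * r" unfolding ql_def by (drule idealD(2)[OF Li, of _ r]) (simp add: algebra_simps)
lemma ql_sum: "(\<And>x. x \<in> A \<Longrightarrow> f x \<simeq> g x) \<Longrightarrow> sum f A \<simeq> sum g A"
  by (induction A rule: infinite_finite_induct) (simp_all add: ql_add ql_refl)
lemma ql_0: "x \<in> L \<longleftrightarrow> x \<simeq> 0" by (simp add: ql_def)

lemma Sy_ql: "Sy a b c d \<simeq> 8 \<cdot> W a b c d - 4 \<cdot> D a b (E c d)"
  unfolding ql_def by (rule Sy_oideal[OF L])

text \<open>Entries of the square of the matrix of generators. The products are taken as they stand,
  whereas \<open>TR\<close> contracts their symmetrisation; \<open>Tn_ql\<close> records the
  difference.\<close>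

definition Tn :: "nat \<Rightarrow> nat \<Rightarrow> fr" where "Tn a b = (\<Sum>d<N. \<Sum>e<N. h d e \<cdot> (E a d * E e b))"

lemma sum_hh_all: "(\<Sum>d<N. \<Sum>e<N. h d e * h e d) = M"
proof -
  have i: "(\<Sum>e<N. h b e * h e b) = (\<Sum>e\<in>R. h b e * h e b)" if "b \<in> R" for b
    unfolding sum_small using that by simp
  have j: "(\<Sum>e<N. h b e * h e b) = 1" if "b < 4" for b
  proof -
    have "(\<Sum>e<N. h b e * h e b) = (\<Sum>e<N. if e = tw b then 1 else 0)"
      using that m7 by (intro sum.cong) (auto simp: hL hR)
    then show ?thesis using that mN by (auto simp: tw_def)
  qed
  have "(\<Sum>d<N. \<Sum>e<N. h d e * h e d) = 1 + 1 + 1 + 1 + (\<Sum>d\<in>R. \<Sum>e\<in>R. h d e * h e d)"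
    unfolding sum_small[of "\<lambda>d. \<Sum>e<N. h d e * h e d"] using j[of 0] j[of 1] j[of 2] j[of 3] i by (simp del: hv)
  then show ?thesis by (simp add: sum_hh)
qed

text \<open>\<open>M\<close> is the superdimension from the fully contracted metric, and the next
  two terms contribute -1 each once \<open>E b a\<close> is replaced by \<open>- E a b\<close>. The
  last term contracts the supersymmetric metric with super-antisymmetric letters, so it lies in
  \<open>L\<close>.\<close>

lemma Y_ql:
  assumes ab: "a < m" "b < m"
  shows "(\<Sum>d<N. \<Sum>e<N. h d e \<cdot> D a d (E e b)) \<simeq> ((M - 2) / 2) \<cdot> E a b"
proof -
  have N: "a < N" "b < N" and p: "\<not> pr a" "\<not> pr b" using ab mN by (auto simp: pr_def)
  define T where "T = (\<Sum>d<N. \<Sum>e<N. h e d \<cdot> E e d)"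
  have "h d e \<cdot> D a d (E e b) = (1/2) \<cdot> ((h d e * h e d) \<cdot> E a b) - (1/2) \<cdot> ((h e d * h e a) \<cdot> E d b)
     + (1/2) \<cdot> ((h d e * h d b) \<cdot> E e a) - (h b a / 2) \<cdot> (h e d \<cdot> E e d)" for d e
  proof -
    have 1: "h d e * h e a = h e d * h e a" using p by (cases "pr e") (simp_all add: h_par h_sym[where b=d and a=e])
    have 2: "sgn_b (pr d \<and> pr e) * h d e = h e d" using h_sym[where b=e and a=d] by (simp add: s_def)
    have 3: "h e d * h b d = h d e * h d b"
      using p h_sym[where b=e and a=d] h_sym[where b=b and a=d] by (cases "pr d") (simp_all add: h_par)
    have "h d e \<cdot> D a d (E e b) = (h d e * h e d / 2) \<cdot> E a b - (h d e * h e a / 2) \<cdot> E d b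
      + ((sgn_b (pr d \<and> pr e) * h d e) * h b d / 2) \<cdot> E e a - ((sgn_b (pr d \<and> pr e) * h d e) * h b a / 2) \<cdot> E e d"
      using p by (simp add: D_E dl_def dvec_def) (rule poly_mapping_eqI, simp add: lk_simps algebra_simps)
    also have "\<dots> = (1/2) \<cdot> ((h d e * h e d) \<cdot> E a b) - (1/2) \<cdot> ((h e d * h e a) \<cdot> E d b)
     + (1/2) \<cdot> ((h d e * h d b) \<cdot> E e a) - (h b a / 2) \<cdot> (h e d \<cdot> E e d)"
      unfolding 1 2 3 by (simp add: mult.commute)
    finally show ?thesis .
  qed
  then have "(\<Sum>d<N. \<Sum>e<N. h d e \<cdot> D a d (E e b)) =
     (1/2) \<cdot> ((\<Sum>d<N. \<Sum>e<N. h d e * h e d) \<cdot> E a b) - (1/2) \<cdot> (\<Sum>d<N. (\<Sum>e<N. h e d * h e a) \<cdot> E d b)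
     + (1/2) \<cdot> (\<Sum>d<N. \<Sum>e<N. (h d e * h d b) \<cdot> E e a) - (h b a / 2) \<cdot> T"
    unfolding T_def by (simp only: sum.distrib sum_subtractf fr.scale_sum_left fr.scale_sum_right)
  also have "(\<Sum>d<N. \<Sum>e<N. (h d e * h d b) \<cdot> E e a) = E b a"
    by (subst sum.swap) (simp only: fr.scale_sum_left[symmetric] sum_h_contract[OF N(2)])
  also have "(\<Sum>d<N. (\<Sum>e<N. h e d * h e a) \<cdot> E d b) = E a b" by (rule sum_h_contract[OF N(1)])
  finally have Y: "(\<Sum>d<N. \<Sum>e<N. h d e \<cdot> D a d (E e b)) = (1/2) \<cdot> (M \<cdot> E a b) - (1/2) \<cdot> E a b + (1/2) \<cdot> E b a - (h b a / 2) \<cdot> T"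
    by (simp only: sum_hh_all)
  have "T + T = (\<Sum>d<N. \<Sum>e<N. h e d \<cdot> r1 e d)"
  proof -
    have "h e d \<cdot> r1 e d = h e d \<cdot> E e d + h d e \<cdot> E d e" for d e
      unfolding r1_def h_sym[where b=d and a=e] by (simp add: fr.scale_right_distrib mult.commute)
    then have "(\<Sum>d<N. \<Sum>e<N. h e d \<cdot> r1 e d) = T + (\<Sum>d<N. \<Sum>e<N. h d e \<cdot> E d e)"
      unfolding T_def by (simp only: sum.distrib)
    also have "(\<Sum>d<N. \<Sum>e<N. h d e \<cdot> E d e) = T" unfolding T_def by (rule sum.swap)
    finally show ?thesis by simp
  qed
  also have "\<dots> \<in> L" by (intro subsp_sum[OF Ls] subsp_sm[OF Ls] oideal_r1[OF L])
  also have "T + T = 2 \<cdot> T" by (rule poly_mapping_eqI) (simp add: lk_simps)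
  finally have T: "T \<in> L" by (rule L_half[rotated]) simp
  have "(\<Sum>d<N. \<Sum>e<N. h d e \<cdot> D a d (E e b)) - ((M - 2) / 2) \<cdot> E a b = (1/2) \<cdot> r1 a b - (h b a / 2) \<cdot> T"
    unfolding Y r1_def using p by (auto intro!: poly_mapping_eqI simp: lk_simps field_simps)
  also have "\<dots> \<in> L" by (intro subsp_diff[OF Ls] subsp_sm[OF Ls] T oideal_r1[OF L])
  finally show ?thesis by (simp add: ql_def)
qed

lemma Tn_ql: assumes "a < m" "b < m" shows "8 \<cdot> Tn a b \<simeq> TR a b + (2 * (M - 2)) \<cdot> E a b"
proof -
  have "TR a b \<simeq> (\<Sum>d<N. \<Sum>e<N. h d e \<cdot> (8 \<cdot> W a d e b - 4 \<cdot> D a d (E e b)))"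
    unfolding TR_def by (intro ql_sum ql_sm Sy_ql)
  also have "\<dots> = 8 \<cdot> Tn a b - 4 \<cdot> (\<Sum>d<N. \<Sum>e<N. h d e \<cdot> D a d (E e b))"
    unfolding Tn_def W_def fr.scale_right_diff_distrib sum_subtractf fr.scale_sum_right
    by (simp only: fr.scale_scale mult.commute)
  also have "\<dots> \<simeq> 8 \<cdot> Tn a b - 4 \<cdot> (((M - 2) / 2) \<cdot> E a b)" by (intro ql_diff ql_refl ql_sm Y_ql assms)
  finally have "TR a b + (2 * (M - 2)) \<cdot> E a b \<simeq> 8 \<cdot> Tn a b - 4 \<cdot> (((M - 2) / 2) \<cdot> E a b) + (2 * (M - 2)) \<cdot> E a b"
    by (intro ql_add ql_refl)
  also have "\<dots> = 8 \<cdot> Tn a b" by (rule poly_mapping_eqI) (simp add: lk_simps field_simps)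
  finally show ?thesis by (rule ql_sym)
qed

lemma comm_140: "E 1 4 * E 0 4 - E 0 4 * E 1 4 \<simeq> (1/2) \<cdot> z"
proof -
  have "D 1 4 (E 0 4) = (1/2) \<cdot> z" by (simp add: D_E dl_def dvec_def)
  then show ?thesis using oideal_r2[OF L, of 1 4 0 4] by (simp add: r2_def ql_def)
qed

text \<open>Contracting the relation \<open>PL 0 1 4 d\<close> with the letters \<open>E e 4\<close> produces a multiple of \<open>z\<close> in the ideal,
  which fixes the constant.\<close>
lemma z_tau: "z * TR 3 1 + (M - 4) \<cdot> z \<in> L"
proof -
  let ?q = "\<lambda>d. D 0 1 (E 4 d) + D 1 4 (E 0 d) - D 0 4 (E 1 d)"
  have small: "0 < m" "1 < m" "4 < m" "0 < N" "1 < N" "4 < N" "3 < N" using m7 mN by simp_all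
  have c: "(\<Sum>d<N. \<Sum>e<N. (h d e * h d j) \<cdot> (X * E e 4)) = X * E j 4" if "j < N" for j X
    by (subst sum.swap) (simp only: fr.scale_sum_left[symmetric] sum_h_contract[OF that])
  define K0 where "K0 = (1/2) \<cdot> (E 4 0 * E 1 4) - (1/2) \<cdot> (E 4 1 * E 0 4) + (1/2) \<cdot> (E 0 1 * E 4 4) - (1/2) \<cdot> (E 0 4 * E 1 4)
     - (1/2) \<cdot> (E 1 0 * E 4 4) + (1/2) \<cdot> (E 1 4 * E 0 4)"
  have "h d e \<cdot> (?q d * E e 4) = (1/2) \<cdot> ((h d e * h d 1) \<cdot> (E 4 0 * E e 4)) - (1/2) \<cdot> ((h d e * h d 0) \<cdot> (E 4 1 * E e 4))
     + (1/2) \<cdot> ((h d e * h d 4) \<cdot> (E 0 1 * E e 4)) - (1/2) \<cdot> ((h d e * h d 1) \<cdot> (E 0 4 * E e 4))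
     - (1/2) \<cdot> ((h d e * h d 4) \<cdot> (E 1 0 * E e 4)) + (1/2) \<cdot> ((h d e * h d 0) \<cdot> (E 1 4 * E e 4))" for d e
    unfolding D_E dl_def dvec_def
    by (rule poly_mapping_eqI) (simp add: lk_simps distrib_right left_diff_distrib)
  then have q: "(\<Sum>d<N. \<Sum>e<N. h d e \<cdot> (?q d * E e 4)) = K0"
    unfolding K0_def by (simp only: sum.distrib sum_subtractf fr.scale_sum_right[symmetric] c small)
  have "K0 - (E 1 4 * E 0 4 - E 0 4 * E 1 4) = (1/2) \<cdot> (r1 0 4 * E 1 4) - (1/2) \<cdot> (r1 1 4 * E 0 4) + (1/2) \<cdot> (E 0 1 * E 4 4) - (1/2) \<cdot> (E 1 0 * E 4 4)"
    unfolding K0_def r1_def by (rule poly_mapping_eqI) (simp add: lk_simps distrib_right add_divide_distrib)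
  also have "\<dots> \<in> L" by (intro subsp_add[OF Ls] subsp_diff[OF Ls] subsp_sm[OF Ls] idealD[OF Li] oideal_r1[OF L] L_diag) simp_all
  finally have "K0 \<simeq> E 1 4 * E 0 4 - E 0 4 * E 1 4" by (simp add: ql_def)
  then have K0: "K0 \<simeq> (1/2) \<cdot> z" using comm_140 by (rule ql_trans)
  have p: "PL 0 1 4 d \<simeq> 8 \<cdot> (E 0 1 * E 4 d + E 1 4 * E 0 d - E 0 4 * E 1 d) - 4 \<cdot> ?q d" for d
  proof -
    have "PL 0 1 4 d = Sy 0 1 4 d + Sy 1 4 0 d - Sy 0 4 1 d" by (simp add: PL_def)
    also have "\<dots> \<simeq> (8 \<cdot> W 0 1 4 d - 4 \<cdot> D 0 1 (E 4 d)) + (8 \<cdot> W 1 4 0 d - 4 \<cdot> D 1 4 (E 0 d)) - (8 \<cdot> W 0 4 1 d - 4 \<cdot> D 0 4 (E 1 d))"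
      by (intro ql_add ql_diff Sy_ql)
    also have "\<dots> = 8 \<cdot> (E 0 1 * E 4 d + E 1 4 * E 0 d - E 0 4 * E 1 d) - 4 \<cdot> ?q d"
      by (rule poly_mapping_eqI) (simp add: W_def lk_simps algebra_simps)
    finally show ?thesis .
  qed
  have "(\<Sum>d<N. \<Sum>e<N. h d e \<cdot> (PL 0 1 4 d * E e 4)) \<simeq>
    (\<Sum>d<N. \<Sum>e<N. h d e \<cdot> ((8 \<cdot> (E 0 1 * E 4 d + E 1 4 * E 0 d - E 0 4 * E 1 d) - 4 \<cdot> ?q d) * E e 4))"
    by (intro ql_sum ql_sm ql_multR p)
  also have "\<dots> = (E 0 1 * (8 \<cdot> Tn 4 4) + E 1 4 * (8 \<cdot> Tn 0 4) - E 0 4 * (8 \<cdot> Tn 1 4)) - 4 \<cdot> K0"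
  proof -
    have "h d e \<cdot> ((8 \<cdot> (E 0 1 * E 4 d + E 1 4 * E 0 d - E 0 4 * E 1 d) - 4 \<cdot> ?q d) * E e 4) =
      (E 0 1 * (8 \<cdot> (h d e \<cdot> (E 4 d * E e 4))) + E 1 4 * (8 \<cdot> (h d e \<cdot> (E 0 d * E e 4))) - E 0 4 * (8 \<cdot> (h d e \<cdot> (E 1 d * E e 4))))
       - 4 \<cdot> (h d e \<cdot> (?q d * E e 4))" for d e
      by (rule poly_mapping_eqI) (simp add: lk_simps distrib_right left_diff_distrib mult.assoc algebra_simps)
    then show ?thesis
      unfolding q[symmetric] Tn_def fr.scale_sum_right sum_distrib_left by (simp only: sum.distrib sum_subtractf)
  qed
  \<comment> \<open>Origin of the constant: \<open>Tn 4 4\<close> supplies \<open>TR 3 1\<close>,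
    the other two terms combine to a commutator worth \<open>(M - 2) \<cdot> z\<close>, and the
    bracket terms collected in \<open>K0\<close> subtract \<open>2 \<cdot> z\<close>.\<close>
  also have "\<dots> \<simeq> (E 0 1 * TR 3 1 + E 1 4 * ((2 * (M - 2)) \<cdot> E 0 4) - E 0 4 * ((2 * (M - 2)) \<cdot> E 1 4)) - 4 \<cdot> ((1/2) \<cdot> z)"
  proof (intro ql_add ql_diff ql_multL ql_sm K0)
    have "8 \<cdot> Tn 4 4 \<simeq> TR 4 4 + (2 * (M - 2)) \<cdot> E 4 4" by (intro Tn_ql small)
    also have "\<dots> \<simeq> TR 3 1 + 0"
      using TR_all[of 4 4] small L_diag[of 4] by (intro ql_add) (simp_all add: ql_def subsp_sm[OF Ls])
    finally show "8 \<cdot> Tn 4 4 \<simeq> TR 3 1" by simp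
    have "8 \<cdot> Tn 0 4 \<simeq> TR 0 4 + (2 * (M - 2)) \<cdot> E 0 4" by (intro Tn_ql small)
    also have "\<dots> \<simeq> 0 + (2 * (M - 2)) \<cdot> E 0 4" using TR_all[of 0 4] small by (intro ql_add ql_refl) (simp add: ql_def)
    finally show "8 \<cdot> Tn 0 4 \<simeq> (2 * (M - 2)) \<cdot> E 0 4" by simp
    have "8 \<cdot> Tn 1 4 \<simeq> TR 1 4 + (2 * (M - 2)) \<cdot> E 1 4" by (intro Tn_ql small)
    also have "\<dots> \<simeq> 0 + (2 * (M - 2)) \<cdot> E 1 4" using TR_all[of 1 4] small by (intro ql_add ql_refl) (simp add: ql_def)
    finally show "8 \<cdot> Tn 1 4 \<simeq> (2 * (M - 2)) \<cdot> E 1 4" by simp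
  qed
  also have "\<dots> = E 0 1 * TR 3 1 + (2 * (M - 2)) \<cdot> (E 1 4 * E 0 4 - E 0 4 * E 1 4) - 2 \<cdot> z"
    by (rule poly_mapping_eqI) (simp add: lk_simps algebra_simps)
  also have "\<dots> \<simeq> E 0 1 * TR 3 1 + (2 * (M - 2)) \<cdot> ((1/2) \<cdot> z) - 2 \<cdot> z"
    by (intro ql_add ql_diff ql_refl ql_sm comm_140)
  also have "\<dots> = z * TR 3 1 + (M - 4) \<cdot> z" by (rule poly_mapping_eqI) (simp add: lk_simps algebra_simps)
  finally have "z * TR 3 1 + (M - 4) \<cdot> z \<simeq> (\<Sum>d<N. \<Sum>e<N. h d e \<cdot> (PL 0 1 4 d * E e 4))" by (rule ql_sym)
  also have "\<dots> \<simeq> 0" unfolding ql_0[symmetric]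
    by (intro subsp_sum[OF Ls] subsp_sm[OF Ls] idealD(2)[OF Li] PL_in small) simp
  finally show ?thesis by (simp only: ql_0)
qed

text \<open>\<open>tau_const\<close> and \<open>z_tau\<close> both compute \<open>z * TR 3 1\<close>
  modulo \<open>L\<close>. As \<open>z\<close> is not in \<open>L\<close>, the two multiples of
  \<open>z\<close> agree, which determines the constant.\<close>

theorem TR_in: assumes "a < N" "d < N" shows "TR a d - ((4 - M) * h d a) \<cdot> 1 \<in> L"
proof -
  obtain c where c: "TR 3 1 + c \<cdot> 1 \<in> L" using tau_const ..
  have "z * (TR 3 1 + c \<cdot> 1) - (z * TR 3 1 + (M - 4) \<cdot> z) \<in> L" by (rule subsp_diff[OF Ls idealD(1)[OF Li c] z_tau])
  also have "z * (TR 3 1 + c \<cdot> 1) - (z * TR 3 1 + (M - 4) \<cdot> z) = (c - (M - 4)) \<cdot> z"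
    by (rule poly_mapping_eqI) (simp add: lk_simps distrib_left algebra_simps)
  finally have "c = M - 4" using z_notin subsp_sm_iff[OF Ls, of "c - (M - 4)" z] by fastforce
  with c have "TR 3 1 + (M - 4) \<cdot> 1 \<in> L" by simp
  then have "TR a d - h d a \<cdot> TR 3 1 + h d a \<cdot> (TR 3 1 + (M - 4) \<cdot> 1) \<in> L"
    by (rule subsp_add[OF Ls TR_all[OF assms] subsp_sm[OF Ls]])
  also have "TR a d - h d a \<cdot> TR 3 1 + h d a \<cdot> (TR 3 1 + (M - 4) \<cdot> 1) = TR a d - ((4 - M) * h d a) \<cdot> 1"
    by (rule poly_mapping_eqI) (simp add: lk_simps algebra_simps)
  finally show ?thesis .
qed

end
end

section \<open>Equality of the two ideals in canonical coordinates\<close>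

context canon
begin

theorem core_eq:
  assumes K: "oideal K" and z2: "z ^ 2 \<notin> K" and J: "oideal J" "J \<subseteq> K"
    and K_PL: "\<And>a b c d. \<lbrakk>a < N; b < N; c < N; d < N\<rbrakk> \<Longrightarrow> \<exists>g. Dlt 2 g \<and> PL a b c d + g \<in> K"
    and K_TR: "\<And>a d. \<lbrakk>a < N; d < N\<rbrakk> \<Longrightarrow> \<exists>g. Dlt 2 g \<and> TR a d + g \<in> K"
    and J_PL: "\<And>a b c d. \<lbrakk>a < N; b < N; c < N; d < N\<rbrakk> \<Longrightarrow> \<exists>g. Dlt 2 g \<and> PL a b c d + g \<in> J"
    and J_TR: "\<And>a d. \<lbrakk>a < N; d < N\<rbrakk> \<Longrightarrow> \<exists>g. Dlt 2 g \<and> TR a d + g \<in> J"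
    and inf: "\<And>l. \<exists>f. \<forall>g. Dlt l g \<longrightarrow> f - g \<notin> K"
  shows "K = J"
proof
  note Ks = oideal_idealD(2)[OF K]
  have zl: "z ^ l \<notin> K" for l
    using z_power_finite_codim[OF K I_subset_grI[OF K K_PL K_TR]] inf[of l] by blast
  have IJ: "I \<subseteq> gr J" by (rule I_subset_grI[OF J(1) J_PL J_TR])
  have "Dlt l f \<Longrightarrow> f \<in> K \<Longrightarrow> f \<in> J" for l f
  proof (induction l arbitrary: f)
    case 0 then show ?case using Dlt_zeroD subsp_0[OF oideal_idealD(2)[OF J(1)]] by fastforce
  next
    case (Suc l)
    have "tp l f \<in> I" by (rule leading_in_I[OF K zl Suc.prems(2,1)])
    then have "tp l f \<in> lifts J l" using IJ by (auto simp: gr_def)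
    moreover have "tp l (tp l f) = tp l f" by (rule poly_mapping_eqI) (simp add: lk_top)
    ultimately obtain g where g: "Dlt l g" "tp l f + g \<in> J" by (auto simp: lifts_def)
    have "f - (tp l f + g) \<in> K" using subsp_diff[OF Ks Suc.prems(2), of "tp l f + g"] g(2) J(2) by blast
    moreover have "Dlt l (f - (tp l f + g))" using Dlt_diff[OF Dlt_top[OF Suc.prems(1)] g(1)] by (simp add: algebra_simps)
    ultimately have "f - (tp l f + g) \<in> J" using Suc.IH by blast
    from subsp_add[OF oideal_idealD(2)[OF J(1)] this g(2)] show ?case by simp
  qed
  then show "K \<subseteq> J" using Dlt_ex by blast
qed (rule J(2))

end

subsection \<open>Linear substitutions of the letters\<close>

text \<open>Substitution in a single index, applied to a family of elements. Nesting it describes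
  substitutions in several indices, and by \<open>Tm_swap\<close> the order of nesting is
  immaterial.\<close>

definition Tm :: "nat \<Rightarrow> tensor2 \<Rightarrow> nat \<Rightarrow> (nat \<Rightarrow> fr) \<Rightarrow> fr" where
  "Tm k P a G = (\<Sum>i<k. P i a \<cdot> G i)"

lemma Tm_add: "Tm k P a (\<lambda>i. F i + G i) = Tm k P a F + Tm k P a G"
  by (simp add: Tm_def fr.scale_right_distrib sum.distrib)
lemma Tm_diff: "Tm k P a (\<lambda>i. F i - G i) = Tm k P a F - Tm k P a G"
  by (simp add: Tm_def fr.scale_right_diff_distrib sum_subtractf)
lemma Tm_sm: "Tm k P a (\<lambda>i. c \<cdot> F i) = c \<cdot> Tm k P a F"
  by (simp add: Tm_def fr.scale_sum_right mult.commute)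
lemma Tm_swap: "Tm k P a (\<lambda>i. Tm k Q b (\<lambda>j. F i j)) = Tm k Q b (\<lambda>j. Tm k P a (\<lambda>i. F i j))"
  unfolding Tm_def fr.scale_sum_right by (subst sum.swap) (simp add: mult.commute)
lemma Tm_multL: "x * Tm k P a G = Tm k P a (\<lambda>i. x * G i)" by (simp add: Tm_def sum_distrib_left)
lemma Tm_multR: "Tm k P a G * x = Tm k P a (\<lambda>i. G i * x)" by (simp add: Tm_def sum_distrib_right)
lemma Tm_in: "subsp S \<Longrightarrow> (\<And>i. i < k \<Longrightarrow> G i \<in> S) \<Longrightarrow> Tm k P a G \<in> S"
  unfolding Tm_def by (intro subsp_sum subsp_sm) simp_all
lemma Tm_sum: "(\<Sum>b\<in>A. Tm k P a (\<lambda>i. F i b)) = Tm k P a (\<lambda>i. \<Sum>b\<in>A. F i b)"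
  unfolding Tm_def fr.scale_sum_right by (rule sum.swap)
lemma Tm_sum2: "(\<Sum>b\<in>A. \<Sum>c\<in>B. q b c \<cdot> Tm k P a (\<lambda>i. F i b c)) = Tm k P a (\<lambda>i. \<Sum>b\<in>A. \<Sum>c\<in>B. q b c \<cdot> F i b c)"
  by (simp only: Tm_sm[symmetric] Tm_sum)
lemma Tm_flin: "flin F \<Longrightarrow> F (Tm k P a G) = Tm k P a (\<lambda>i. F (G i))"
  by (simp add: Tm_def flin_sum flinD)
lemma Tm_cong: "(\<And>i. i < k \<Longrightarrow> P i a \<noteq> 0 \<Longrightarrow> F i = G i) \<Longrightarrow> Tm k P a F = Tm k P a G"
  unfolding Tm_def by (intro sum.cong refl) (metis fr.scale_zero_left lessThan_iff)

definition Xl :: "nat \<Rightarrow> tensor2 \<Rightarrow> nat \<Rightarrow> nat \<Rightarrow> fr" where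
  "Xl k P a b = Tm k P a (\<lambda>i. Tm k P b (\<lambda>j. E i j))"
primrec thw :: "nat \<Rightarrow> tensor2 \<Rightarrow> word \<Rightarrow> fr" where
  "thw k P [] = 1" | "thw k P (x # w) = Xl k P (fst x) (snd x) * thw k P w"
definition th :: "nat \<Rightarrow> tensor2 \<Rightarrow> fr \<Rightarrow> fr" where "th k P = lin (thw k P)"

lemma flin_th: "flin (th k P)" unfolding th_def by (rule flin_lin)
lemma th_wd: "th k P (wd w) = thw k P w" by (simp add: th_def)
lemma th_E: "th k P (E a b) = Xl k P a b" by (simp add: E_def th_wd)
lemma th_1: "th k P 1 = 1" using th_wd[of k P "[]"] by simp
lemma thw_append: "thw k P (u @ v) = thw k P u * thw k P v" by (induction u) (simp_all add: mult.assoc)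
lemma th_mult: "th k P (f * g) = th k P f * th k P g"
proof -
  have w: "th k P (wd u * g) = th k P (wd u) * th k P g" for u
    by (rule flin_eqI[OF flin_comp[OF flin_th flin_mult(1)] flin_comp[OF flin_mult(1) flin_th]])
      (simp add: wd_mult th_wd thw_append)
  show ?thesis
    by (rule flin_eqI[OF flin_comp[OF flin_th flin_mult(2)] flin_comp[OF flin_mult(2) flin_th]]) (rule w)
qed

lemma tp_E_mult: "tp l (E a b * f) = (if l = 0 then 0 else E a b * tp (l - 1) f)"
  by (cases l) (simp_all add: E_def tp_mult_wd)
lemma tp_th: "tp l (th k P f) = th k P (tp l f)"
proof -
  have w: "tp l (thw k P w) = (if length w = l then thw k P w else 0)" for w
  proof (induction w arbitrary: l)
    case Nil show ?case using tp_wd[of l "[]"] by simp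
  next
    case (Cons x w)
    show ?case
    proof (cases l)
      case 0 then show ?thesis by (simp add: Xl_def Tm_multR Tm_flin[OF flin_tp] tp_E_mult) (simp add: Tm_def)
    next
      case (Suc l') then show ?thesis using Cons[of l']
        by (simp add: Xl_def Tm_multR Tm_flin[OF flin_tp] tp_E_mult) (simp add: Tm_def)
    qed
  qed
  show ?thesis
    by (rule flin_eqI[OF flin_comp[OF flin_tp flin_th] flin_comp[OF flin_th flin_tp]])
      (simp add: w th_wd tp_wd flinD[OF flin_th])
qed
lemma Dlt_tp: "Dlt l f \<longleftrightarrow> (\<forall>k\<ge>l. tp k f = 0)"
proof
  assume "Dlt l f" then show "\<forall>k\<ge>l. tp k f = 0" using tp_Dlt Dlt_mono by blast
next
  assume "\<forall>k\<ge>l. tp k f = 0"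
  then have "lk f w = 0" if "length w \<ge> l" for w using that lk_top[of "length w" f w] by simp
  then show "Dlt l f" unfolding Dlt_def by (meson not_le)
qed
lemma Dlt_th: "Dlt l f \<Longrightarrow> Dlt l (th k P f)"
  unfolding Dlt_tp by (simp add: tp_th flinD[OF flin_th])

context ospl
begin

lemma Nsp_1: "1 \<in> Nsp" using Nsp_wd[of "[]"] by (simp add: inN_def)
lemma Nsp_th: "th N P f \<in> Nsp"
proof -
  have "thw N P w \<in> Nsp" for w
    by (induction w) (auto simp: Nsp_1 Xl_def intro!: Nsp_mult Tm_in[OF subsp_Nsp] Nsp_E)
  then show ?thesis
    by (induction f rule: fr_induct) (simp_all add: flinD[OF flin_th] th_wd subsp_0[OF subsp_Nsp] subsp_add[OF subsp_Nsp] subsp_sm[OF subsp_Nsp])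
qed
lemma Nsp_alg_induct:
  assumes "f \<in> Nsp" "subsp S" "1 \<in> S" "\<And>a b g. a < N \<Longrightarrow> b < N \<Longrightarrow> g \<in> S \<Longrightarrow> E a b * g \<in> S" shows "f \<in> S"
proof (rule Nsp_induct[OF assms(1,2)])
  fix w assume "inN w"
  then show "wd w \<in> S"
  proof (induction w)
    case (Cons x w) then show ?case using assms(4)[of "fst x" "snd x" "wd w"] wd_Cons[of "fst x" "snd x" w] by (auto simp: inN_def)
  qed (simp add: assms)
qed

lemma th_inverse:
  assumes PR: "\<And>k i. k < N \<Longrightarrow> i < N \<Longrightarrow> (\<Sum>a<N. P k a * R a i) = (if k = i then 1 else 0)" and f: "f \<in> Nsp"
  shows "th N P (th N R f) = f"
proof -
  have inv: "Tm N R i (\<lambda>a. Tm N P a G) = G i" if "i < N" for i G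
  proof -
    have "Tm N R i (\<lambda>a. Tm N P a G) = (\<Sum>k<N. (\<Sum>a<N. P k a * R a i) \<cdot> G k)"
      unfolding Tm_def fr.scale_sum_right fr.scale_sum_left by (subst sum.swap) (simp add: mult.commute)
    also have "\<dots> = (\<Sum>k<N. if k = i then G k else 0)" using PR that by (intro sum.cong) auto
    finally show ?thesis using that by simp
  qed
  have "f \<in> {f. th N P (th N R f) = f}"
  proof (rule Nsp_alg_induct[OF f])
    show "subsp {f. th N P (th N R f) = f}" by (simp add: subsp_def flinD[OF flin_th])
    show "1 \<in> {f. th N P (th N R f) = f}" by (simp add: th_1)
    fix i j g assume i: "i < N" "j < N" and g: "g \<in> {f. th N P (th N R f) = f}"
    have "th N P (th N R (E i j)) = Tm N R i (\<lambda>a. Tm N R j (\<lambda>b. Tm N P a (\<lambda>k. Tm N P b (\<lambda>l. E k l))))"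
      by (simp add: th_E Xl_def Tm_flin[OF flin_th])
    also have "\<dots> = Tm N R i (\<lambda>a. Tm N P a (\<lambda>k. Tm N R j (\<lambda>b. Tm N P b (\<lambda>l. E k l))))"
      by (subst Tm_swap[of N P _ R j]) (rule refl)
    also have "\<dots> = E i j" by (simp add: inv i)
    finally show "E i j * g \<in> {f. th N P (th N R f) = f}" using g by (simp add: th_mult)
  qed
  then show ?thesis by simp
qed

end

text \<open>In matrix form the last two assumptions read \<open>P^T gm P = h\<close> and
  \<open>P h P^T = gm\<close>. The first transforms the metric in derivations
  (\<open>T_contract\<close>), the second the metric in traces (\<open>h_contract\<close>).\<close>

locale bchange = g: ospl m n gm + h: ospl m n h for m n gm h +
  fixes P :: tensor2
  assumes P_par: "\<And>i a. P i a \<noteq> 0 \<Longrightarrow> ospl.pr m n i = ospl.pr m n a"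
    and P_supp: "\<And>i a. \<not> a < dimN m n \<Longrightarrow> P i a = 0"
    and Pgh: "\<And>b c. b < dimN m n \<Longrightarrow> c < dimN m n \<Longrightarrow> (\<Sum>j<dimN m n. \<Sum>k<dimN m n. P j b * P k c * gm k j) = h c b"
    and Phg: "\<And>j k. j < dimN m n \<Longrightarrow> k < dimN m n \<Longrightarrow> (\<Sum>b<dimN m n. \<Sum>c<dimN m n. h b c * (P j b * P k c)) = gm j k"
begin

abbreviation N where "N \<equiv> dimN m n"
abbreviation T where "T \<equiv> Tm N P"
abbreviation theta where "theta \<equiv> th N P"
abbreviation pr where "pr \<equiv> ospl.pr m n"
abbreviation s where "s \<equiv> ospl.s m n"

lemma T_par: "T a (\<lambda>i. \<phi> (pr i) \<cdot> F i) = \<phi> (pr a) \<cdot> T a F"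
  unfolding Tm_sm[symmetric] by (rule Tm_cong) (simp add: P_par)

lemma T_out: "\<not> a < N \<Longrightarrow> T a F = 0" by (simp add: Tm_def P_supp)

lemma T_contract: "T b (\<lambda>j. T c (\<lambda>k. gm k j \<cdot> X)) = h c b \<cdot> X"
proof (cases "b < N \<and> c < N")
  case True
  have "T b (\<lambda>j. T c (\<lambda>k. gm k j \<cdot> X)) = (\<Sum>j<N. \<Sum>k<N. P j b * P k c * gm k j) \<cdot> X"
    unfolding Tm_def fr.scale_sum_right fr.scale_sum_left by (simp add: mult.assoc)
  then show ?thesis using Pgh True by simp
next
  case False then show ?thesis using h.h_supp[of c b] by (auto simp: T_out) (simp add: Tm_def)
qed

lemma h_contract: "(\<Sum>b<N. \<Sum>c<N. h b c \<cdot> T b (\<lambda>j. T c (\<lambda>k. G j k))) = (\<Sum>j<N. \<Sum>k<N. gm j k \<cdot> G j k)"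
proof -
  have "(\<Sum>b<N. \<Sum>c<N. h b c \<cdot> T b (\<lambda>j. T c (\<lambda>k. G j k))) = (\<Sum>b<N. \<Sum>c<N. \<Sum>j<N. \<Sum>k<N. (h b c * (P j b * P k c)) \<cdot> G j k)"
    unfolding Tm_def fr.scale_sum_right by (simp add: mult.assoc)
  also have "\<dots> = (\<Sum>b<N. \<Sum>j<N. \<Sum>c<N. \<Sum>k<N. (h b c * (P j b * P k c)) \<cdot> G j k)"
    by (rule sum.cong[OF refl], rule sum.swap)
  also have "\<dots> = (\<Sum>j<N. \<Sum>b<N. \<Sum>c<N. \<Sum>k<N. (h b c * (P j b * P k c)) \<cdot> G j k)" by (rule sum.swap)
  also have "\<dots> = (\<Sum>j<N. \<Sum>b<N. \<Sum>k<N. \<Sum>c<N. (h b c * (P j b * P k c)) \<cdot> G j k)"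
    by (rule sum.cong[OF refl], rule sum.cong[OF refl], rule sum.swap)
  also have "\<dots> = (\<Sum>j<N. \<Sum>k<N. \<Sum>b<N. \<Sum>c<N. (h b c * (P j b * P k c)) \<cdot> G j k)"
    by (rule sum.cong[OF refl], rule sum.swap)
  also have "\<dots> = (\<Sum>j<N. \<Sum>k<N. (\<Sum>b<N. \<Sum>c<N. h b c * (P j b * P k c)) \<cdot> G j k)"
    by (simp only: fr.scale_sum_left)
  finally show ?thesis using Phg by simp
qed

definition T4 :: "fam \<Rightarrow> fam" where
  "T4 F a b c d = T a (\<lambda>i. T b (\<lambda>j. T c (\<lambda>k. T d (\<lambda>l. F i j k l))))"

lemma T4_sw1: "T4 (g.sw1 F) = g.sw1 (T4 F)"
proof (intro ext)
  fix a b c d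
  have "T4 (g.sw1 F) a b c d = T a (\<lambda>i. T b (\<lambda>j. sgn_b (pr i \<and> pr j) \<cdot> T c (\<lambda>k. T d (\<lambda>l. F j i k l))))"
    by (simp only: T4_def g.sw1_def g.s_def Tm_sm)
  also have "\<dots> = T a (\<lambda>i. sgn_b (pr i \<and> pr b) \<cdot> T b (\<lambda>j. T c (\<lambda>k. T d (\<lambda>l. F j i k l))))"
    by (subst T_par[where \<phi>="\<lambda>q. sgn_b (_ \<and> q)"]) (rule refl)
  also have "\<dots> = sgn_b (pr a \<and> pr b) \<cdot> T a (\<lambda>i. T b (\<lambda>j. T c (\<lambda>k. T d (\<lambda>l. F j i k l))))"
    by (rule T_par[where \<phi>="\<lambda>q. sgn_b (q \<and> pr b)"])
  also have "\<dots> = g.sw1 (T4 F) a b c d" unfolding g.sw1_def g.s_def T4_def by (subst Tm_swap) (rule refl)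
  finally show "T4 (g.sw1 F) a b c d = g.sw1 (T4 F) a b c d" .
qed
lemma T2_swap: "T b (\<lambda>j. T c (\<lambda>k. s j k \<cdot> G k j)) = s b c \<cdot> T c (\<lambda>k. T b (\<lambda>j. G k j))"
proof -
  have "T b (\<lambda>j. T c (\<lambda>k. s j k \<cdot> G k j)) = T b (\<lambda>j. sgn_b (pr j \<and> pr c) \<cdot> T c (\<lambda>k. G k j))"
    unfolding g.s_def by (subst T_par[where \<phi>="\<lambda>q. sgn_b (_ \<and> q)"]) (rule refl)
  also have "\<dots> = sgn_b (pr b \<and> pr c) \<cdot> T b (\<lambda>j. T c (\<lambda>k. G k j))"
    by (rule T_par[where \<phi>="\<lambda>q. sgn_b (q \<and> pr c)"])
  finally show ?thesis unfolding g.s_def by (subst (asm) (2) Tm_swap) simp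
qed
lemma T4_sw2: "T4 (g.sw2 F) = g.sw2 (T4 F)"
  by (intro ext) (simp only: T4_def g.sw2_def Tm_sm T2_swap)
lemma T4_sw3: "T4 (g.sw3 F) = g.sw3 (T4 F)"
  by (intro ext) (simp only: T4_def g.sw3_def Tm_sm T2_swap)
lemma T4_add: "T4 (\<lambda>a b c d. F a b c d + G a b c d) = (\<lambda>a b c d. T4 F a b c d + T4 G a b c d)"
  by (intro ext) (simp only: T4_def Tm_add)
lemma T4_diff: "T4 (\<lambda>a b c d. F a b c d - G a b c d) = (\<lambda>a b c d. T4 F a b c d - T4 G a b c d)"
  by (intro ext) (simp only: T4_def Tm_diff)

text \<open>Since \<open>P\<close> preserves parity, substitution commutes with signed permutations
  of the indices. The relation therefore passes from \<open>W\<close> to every family built from it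
  by such permutations.\<close>

definition thf :: "fam \<Rightarrow> fam \<Rightarrow> bool" where "thf F G \<longleftrightarrow> (\<forall>a b c d. theta (F a b c d) = T4 G a b c d)"

lemma thf_sw1: "thf F G \<Longrightarrow> thf (g.sw1 F) (g.sw1 G)" unfolding thf_def T4_sw1 by (simp add: g.sw1_def flinD[OF flin_th])
lemma thf_sw2: "thf F G \<Longrightarrow> thf (g.sw2 F) (g.sw2 G)" unfolding thf_def T4_sw2 by (simp add: g.sw2_def flinD[OF flin_th])
lemma thf_sw3: "thf F G \<Longrightarrow> thf (g.sw3 F) (g.sw3 G)" unfolding thf_def T4_sw3 by (simp add: g.sw3_def flinD[OF flin_th])
lemma thf_add: "thf F G \<Longrightarrow> thf F' G' \<Longrightarrow> thf (\<lambda>a b c d. F a b c d + F' a b c d) (\<lambda>a b c d. G a b c d + G' a b c d)"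
  unfolding thf_def T4_add by (simp add: flinD[OF flin_th])
lemma thf_diff: "thf F G \<Longrightarrow> thf F' G' \<Longrightarrow> thf (\<lambda>a b c d. F a b c d - F' a b c d) (\<lambda>a b c d. G a b c d - G' a b c d)"
  unfolding thf_def T4_diff by (simp add: flinD[OF flin_th])

lemma thf_W: "thf g.W g.W"
  unfolding thf_def T4_def g.W_def th_mult th_E Xl_def Tm_multR unfolding Tm_multL by simp
lemma thf_hs: "thf F G \<Longrightarrow> thf (g.hs F) (g.hs G)" unfolding g.hs_eq by (intro thf_sw1 thf_sw2 thf_sw3)
lemma thf_Sy: "thf g.Sy g.Sy"
proof -
  have "g.Wa = (\<lambda>a b c d. (g.W a b c d - g.sw1 g.W a b c d) - (g.sw3 g.W a b c d - g.sw3 (g.sw1 g.W) a b c d))"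
    by (intro ext) (simp add: g.Wa_def g.sw1_def g.sw3_def algebra_simps)
  moreover have "thf \<dots> \<dots>" by (intro thf_diff thf_sw3 thf_sw1 thf_W)
  ultimately have "thf g.Wa g.Wa" by simp
  then have "thf (\<lambda>a b c d. g.Wa a b c d + g.hs g.Wa a b c d) (\<lambda>a b c d. g.Wa a b c d + g.hs g.Wa a b c d)"
    by (intro thf_add thf_hs)
  moreover have "g.Sy = (\<lambda>a b c d. g.Wa a b c d + g.hs g.Wa a b c d)" by (intro ext) (simp add: g.Sy_def g.hs_def)
  ultimately show ?thesis by simp
qed
lemma thf_PL: "thf g.PL g.PL"
proof -
  have "g.PL = (\<lambda>a b c d. g.Sy a b c d + g.sw1 (g.sw2 g.Sy) a b c d - g.sw2 g.Sy a b c d)"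
  proof (intro ext)
    fix a b c d show "g.PL a b c d = g.Sy a b c d + g.sw1 (g.sw2 g.Sy) a b c d - g.sw2 g.Sy a b c d"
      by (cases "pr a"; cases "pr b"; cases "pr c") (simp_all add: g.PL_def g.sw1_def g.sw2_def g.s_def)
  qed
  moreover have "thf \<dots> \<dots>" by (intro thf_diff thf_add thf_sw2 thf_sw1 thf_Sy)
  ultimately show ?thesis by simp
qed
lemma thf_r2: "thf g.r2 g.r2"
proof -
  have "g.r2 = (\<lambda>a b c d. g.W a b c d - g.hs g.W a b c d)" by (intro ext) (simp add: g.r2_def g.hs_def g.W_def)
  then show ?thesis using thf_diff[OF thf_W thf_hs[OF thf_W]] by simp
qed

lemma th_r1: "theta (g.r1 a b) = T a (\<lambda>i. T b (\<lambda>j. g.r1 i j))"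
  unfolding g.r1_def flinD[OF flin_th] th_E Xl_def Tm_add T2_swap ..

lemma th_TR: "theta (h.TR a d) = T a (\<lambda>i. T d (\<lambda>l. g.TR i l))"
proof -
  have "theta (h.TR a d) = (\<Sum>b<N. \<Sum>c<N. h b c \<cdot> T4 g.Sy a b c d)"
    unfolding h.TR_def flin_sum[OF flin_th] flinD[OF flin_th] using thf_Sy unfolding thf_def by simp
  also have "\<dots> = T a (\<lambda>i. \<Sum>b<N. \<Sum>c<N. h b c \<cdot> T b (\<lambda>j. T c (\<lambda>k. T d (\<lambda>l. g.Sy i j k l))))"
    unfolding T4_def by (rule Tm_sum2)
  also have "\<dots> = T a (\<lambda>i. T d (\<lambda>l. g.TR i l))"
    unfolding h_contract g.TR_def Tm_sum2 ..
  finally show ?thesis .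
qed

text \<open>The derivation of a letter involves the metric, so its transformation rests on
  \<open>T_contract\<close>. \<open>B\<close> gives the term acting on the first index of the
  letter, \<open>B'\<close> the one acting on the second; signed permutations produce the
  rest.\<close>

lemma thf_D: "thf (\<lambda>a b c d. h.D a b (E c d)) (\<lambda>a b c d. g.D a b (E c d))"
proof -
  define B where "B q a b c d = (q c b / 2) \<cdot> E a d" for q :: tensor2 and a b c d
  define B' where "B' q a b c d = s a d \<cdot> (q c b / 2) \<cdot> E d a" for q :: tensor2 and a b c d
  have tB: "thf (B h) (B gm)"
    unfolding thf_def
  proof (intro allI)
    fix a b c d
    have "T4 (B gm) a b c d = T a (\<lambda>i. T b (\<lambda>j. T c (\<lambda>k. gm k j \<cdot> ((1/2) \<cdot> T d (\<lambda>l. E i l)))))"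
      unfolding T4_def B_def Tm_sm by simp
    also have "\<dots> = (h c b / 2) \<cdot> T a (\<lambda>i. T d (\<lambda>l. E i l))" unfolding T_contract Tm_sm by simp
    finally show "theta (B h a b c d) = T4 (B gm) a b c d" by (simp add: B_def flinD[OF flin_th] th_E Xl_def)
  qed
  have tB': "thf (B' h) (B' gm)"
    unfolding thf_def
  proof (intro allI)
    fix a b c d
    have "T4 (B' gm) a b c d = T a (\<lambda>i. T b (\<lambda>j. T c (\<lambda>k. gm k j \<cdot> ((1/2) \<cdot> T d (\<lambda>l. s i l \<cdot> E l i)))))"
      unfolding T4_def B'_def Tm_sm[symmetric] by (simp add: mult.commute)
    also have "\<dots> = (h c b / 2) \<cdot> T a (\<lambda>i. T d (\<lambda>l. s i l \<cdot> E l i))" unfolding T_contract Tm_sm by simp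
    finally show "theta (B' h a b c d) = T4 (B' gm) a b c d"
      unfolding T2_swap by (simp add: B'_def flinD[OF flin_th] th_E Xl_def mult.commute)
  qed
  have eq: "(\<lambda>a b c d. ospl.D m n q a b (E c d)) = (\<lambda>a b c d. (B q a b c d - g.sw1 (B q) a b c d) + (g.sw3 (B' q) a b c d - g.sw1 (g.sw3 (B' q)) a b c d))"
    if "ospl m n q" for q
  proof (intro ext)
    interpret q: ospl m n q by (rule that)
    fix a b c d
    show "ospl.D m n q a b (E c d) = (B q a b c d - g.sw1 (B q) a b c d) + (g.sw3 (B' q) a b c d - g.sw1 (g.sw3 (B' q)) a b c d)"
      unfolding q.D_E q.dl_def q.dvec_def B_def B'_def g.sw1_def g.sw3_def
      by (cases "pr a"; cases "pr b"; cases "pr c"; cases "pr d")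
        (simp_all add: q.h_par g.s_def fr.scale_right_diff_distrib)
  qed
  show ?thesis unfolding eq[OF h.ospl_axioms] eq[OF g.ospl_axioms]
    by (intro thf_add thf_diff thf_sw1 thf_sw3 tB tB')
qed

end

subsection \<open>Ideals of the tensor algebra as sets of polynomial mappings\<close>

lemma mult_if_one: "(if p then 1 else 0) * (if q then 1 else 0) = (if p \<and> q then 1 else (0::complex))"
  "(if p then (if q then 1 else 0) else 0) = (if p \<and> q then 1 else (0::complex))" by simp_all

lemma lk_mult: "lk (x * y) = tmul (lk x) (lk y)"
proof -
  have add1: "tmul (lk (a + b)) f = (\<lambda>w. tmul (lk a) f w + tmul (lk b) f w)" for a b f
    by (auto simp: tmul_def lookup_add distrib_right sum.distrib)
  have add2: "tmul f (lk (a + b)) = (\<lambda>w. tmul f (lk a) w + tmul f (lk b) w)" for a b f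
    by (auto simp: tmul_def lookup_add distrib_left sum.distrib)
  have sm1: "tmul (lk (c \<cdot> a)) f = (\<lambda>w. c * tmul (lk a) f w)" for a c f
    by (auto simp: tmul_def sum_distrib_left mult.assoc)
  have sm2: "tmul f (lk (c \<cdot> a)) = (\<lambda>w. c * tmul f (lk a) w)" for a c f
    by (auto simp: tmul_def sum_distrib_left mult.left_commute)
  have w: "tmul (lk (wd u)) (lk (wd v)) = lk (wd (u @ v))" for u v
  proof
    fix w
    have "tmul (lk (wd u)) (lk (wd v)) w = (\<Sum>i\<le>length w. if i = length u then (if w = u @ v then 1 else 0) else 0)"
      unfolding tmul_def
    proof (rule sum.cong[OF refl])
      fix i assume "i \<in> {..length w}"
      then have "(u = take i w \<and> v = drop i w) \<longleftrightarrow> (i = length u \<and> w = u @ v)" by auto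
      then show "lk (wd u) (take i w) * lk (wd v) (drop i w) = (if i = length u then if w = u @ v then 1 else 0 else 0)"
        by (simp only: lookup_wd mult_if_one)
    qed
    also have "\<dots> = lk (wd (u @ v)) w" by (auto simp: lookup_wd)
    finally show "tmul (lk (wd u)) (lk (wd v)) w = lk (wd (u @ v)) w" .
  qed
  have v: "lk (wd u * y) = tmul (lk (wd u)) (lk y)" for u
  proof (induction y rule: fr_induct)
    case (wd c w) show ?case unfolding sm2 w sm_mult_right wd_mult by (rule ext) (rule lookup_sm)
  next
    case (add f g) then show ?case unfolding add2 distrib_left by (intro ext) (simp only: lookup_add)
  qed (auto simp: tmul_def)
  show ?thesis
  proof (induction x rule: fr_induct)
    case (wd c w) show ?case unfolding sm1 sm_mult_left v[symmetric] by (rule ext) (rule lookup_sm)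
  next
    case (add f g) then show ?case unfolding add1 distrib_right by (intro ext) (simp only: lookup_add)
  qed (auto simp: tmul_def)
qed

lemma ex_fr: "finite {w. f w \<noteq> 0} \<Longrightarrow> \<exists>x::fr. lk x = f"
  by (rule exI[of _ "Poly_Mapping.Abs_poly_mapping f"]) simp

definition fS :: "talg set \<Rightarrow> fr set" where "fS K = {x. lk x \<in> K}"
definition e1 :: "nat \<Rightarrow> tensor2 \<Rightarrow> fr" where "e1 k A = (\<Sum>a<k. \<Sum>b<k. A a b \<cdot> E a b)"
definition e2 :: "nat \<Rightarrow> tensor4 \<Rightarrow> fr" where
  "e2 k T = (\<Sum>a<k. \<Sum>b<k. \<Sum>c<k. \<Sum>d<k. T a b c d \<cdot> (E a b * E c d))"

lemma lk_E: "lk (E a b) w = (if w = [(a,b)] then 1 else 0)" by (auto simp: E_def lookup_wd)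
lemma lk_EE: "lk (E a b * E c d) w = (if w = [(a,b),(c,d)] then 1 else 0)" by (auto simp: E_def wd_mult lookup_wd)

lemma lk_e1: "supp2 k A \<Longrightarrow> lk (e1 k A) = emb1 A"
proof
  fix w assume A: "supp2 k A"
  show "lk (e1 k A) w = emb1 A w"
  proof (cases "length w = 1")
    case True
    then obtain i j where w: "w = [(i,j)]" by (cases w; cases "hd w") auto
    have "lk (e1 k A) w = (\<Sum>a<k. \<Sum>b<k. if b = j then (if a = i then A a b else 0) else 0)"
      unfolding e1_def lookup_sum w by (intro sum.cong refl) (auto simp: lk_E)
    also have "\<dots> = A i j" using A by (cases "j < k"; cases "i < k") (simp_all add: supp2_def not_less)
    finally show ?thesis by (simp add: emb1_def w)
  next
    case False
    then have "lk (E a b) w = 0" for a b by (auto simp: lk_E)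
    then show ?thesis using False by (simp add: e1_def lookup_sum emb1_def)
  qed
qed

lemma lk_e2: "supp4 k T \<Longrightarrow> lk (e2 k T) = emb2 T"
proof
  fix w assume A: "supp4 k T"
  show "lk (e2 k T) w = emb2 T w"
  proof (cases "length w = 2")
    case True
    then obtain x y where "w = [x,y]" by (cases w; cases "tl w") auto
    then obtain i j p q where w: "w = [(i,j),(p,q)]" by (cases x; cases y) auto
    have "lk (e2 k T) w = (\<Sum>a<k. \<Sum>b<k. \<Sum>c<k. \<Sum>d<k. if d = q then (if c = p then (if b = j then (if a = i then T a b c d else 0) else 0) else 0) else 0)"
      unfolding e2_def lookup_sum w by (intro sum.cong refl) (auto simp: lk_EE)
    also have "\<dots> = T i j p q" using A by (cases "q < k"; cases "p < k"; cases "j < k"; cases "i < k") (simp_all add: supp4_def not_less)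
    finally show ?thesis by (simp add: emb2_def w)
  next
    case False
    then have "lk (E a b * E c d) w = 0" for a b c d by (auto simp: lk_EE)
    then show ?thesis using False by (simp add: e2_def lookup_sum emb2_def)
  qed
qed

lemma lk_const: "lk (c \<cdot> 1) = (\<lambda>w. c * tconst 1 w)"
  using lookup_wd[of "[]"] by (auto simp: tconst_def)

lemma e1_mult: "e1 k X * e1 k Y = e2 k (tens X Y)"
  unfolding e1_def sum_distrib_right unfolding sum_distrib_left e2_def tens_def by (simp add: mult.commute)

lemma e1_lin: "e1 k (\<lambda>a b. A a b + B a b) = e1 k A + e1 k B" "e1 k (\<lambda>a b. x * A a b) = x \<cdot> e1 k A"
  "e1 k (\<lambda>a b. A a b - B a b) = e1 k A - e1 k B"
  by (simp_all add: e1_def fr.scale_left_distrib sum.distrib fr.scale_sum_right fr.scale_left_diff_distrib sum_subtractf)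
definition dlt :: "nat \<Rightarrow> nat \<Rightarrow> tensor2" where "dlt i j = (\<lambda>a b. if a = i \<and> b = j then 1 else 0)"
lemma e1_dlt: "i < k \<Longrightarrow> j < k \<Longrightarrow> e1 k (dlt i j) = E i j"
proof -
  assume ij: "i < k" "j < k"
  have "e1 k (dlt i j) = (\<Sum>a<k. \<Sum>b<k. if b = j then (if a = i then E a b else 0) else 0)"
    unfolding e1_def dlt_def by (intro sum.cong refl) auto
  then show ?thesis using ij by simp
qed

section \<open>The relations of the enveloping algebra expressed by letters\<close>

context ospl
begin

lemma pr_par: "a < N \<Longrightarrow> pr a \<longleftrightarrow> par m a" by (simp add: pr_def par_def)

lemma s_par: "a < N \<Longrightarrow> b < N \<Longrightarrow> s a b = sgn_b (par m a \<and> par m b)" by (simp add: s_def pr_def par_def)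

lemma Nsp_carrier: "lk x \<in> talg_carrier N \<longleftrightarrow> x \<in> Nsp"
  by (force simp: talg_carrier_def Nsp_lk inN_def)
lemma carrier_ex: "f \<in> talg_carrier N \<Longrightarrow> \<exists>x\<in>Nsp. lk x = f"
proof -
  assume f: "f \<in> talg_carrier N"
  then obtain x :: fr where "lk x = f" using ex_fr[of f] by (auto simp: talg_carrier_def)
  then show ?thesis using f Nsp_carrier by auto
qed

text \<open>The projection of an elementary tensor to the Lie superalgebra; \<open>ssym\<close> is
  twice the projection to its complement. Together they express a letter by elements to which the
  defining relations apply.\<close>

definition asym :: "nat \<Rightarrow> nat \<Rightarrow> tensor2" where "asym i j = (\<lambda>a b. (dlt i j a b - s i j * dlt j i a b) / 2)"
definition ssym :: "nat \<Rightarrow> nat \<Rightarrow> tensor2" where "ssym i j = (\<lambda>a b. dlt i j a b + s i j * dlt j i a b)"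

lemma ssym_sym: "i < N \<Longrightarrow> j < N \<Longrightarrow> ssym i j \<in> sym_vec m n"
proof -
  assume ij: "i < N" "j < N"
  have "ssym i j a b = sgn_b (par m a \<and> par m b) * ssym i j b a" for a b
    unfolding ssym_def dlt_def s_par[OF ij]
    by (cases "a = i"; cases "b = j"; cases "a = j"; cases "b = i"; cases "par m i"; cases "par m j") simp_all
  moreover have "supp2 N (ssym i j)" using ij by (auto simp: supp2_def ssym_def dlt_def)
  ultimately show ?thesis unfolding sym_vec_def by blast
qed
lemma asym_osp: "i < N \<Longrightarrow> j < N \<Longrightarrow> asym i j \<in> osp m n"
proof -
  assume ij: "i < N" "j < N"
  have "asym i j a b = - sgn_b (par m a \<and> par m b) * asym i j b a" for a b
    unfolding asym_def dlt_def s_par[OF ij]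
    by (cases "a = i"; cases "b = j"; cases "a = j"; cases "b = i"; cases "par m i"; cases "par m j") simp_all
  moreover have "supp2 N (asym i j)" using ij by (auto simp: supp2_def asym_def dlt_def)
  ultimately show ?thesis unfolding osp_def by blast
qed
lemma asym_homog: "i < N \<Longrightarrow> j < N \<Longrightarrow> homog m (asym i j) (pr i \<noteq> pr j)"
  by (auto simp: homog_def asym_def dlt_def pr_par split: if_splits)
lemma e1_ssym: "i < N \<Longrightarrow> j < N \<Longrightarrow> e1 N (ssym i j) = r1 i j"
  unfolding ssym_def e1_lin by (simp add: e1_dlt r1_def)
lemma e1_asym: "i < N \<Longrightarrow> j < N \<Longrightarrow> e1 N (asym i j) = E i j - (1/2) \<cdot> r1 i j"
proof -
  assume ij: "i < N" "j < N"
  have "asym i j = (\<lambda>a b. (1/2) * (dlt i j a b - s i j * dlt j i a b))" by (simp add: asym_def)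
  then have "e1 N (asym i j) = (1/2) \<cdot> (E i j - s i j \<cdot> E j i)" using ij by (simp only: e1_lin e1_dlt)
  then show ?thesis by (simp only: r1_def) (rule poly_mapping_eqI, simp add: lk_simps field_simps)
qed

definition br :: "tensor2 \<Rightarrow> tensor2 \<Rightarrow> tensor2" where
  "br A B = (\<lambda>a b. \<Sum>c<N. \<Sum>e<N. A a c * h e c * B e b)"

lemma bracket_br: "osp_bracket m n h p A B = (\<lambda>a b. br A B a b - sgn_b p * br B A a b)"
  by (simp add: osp_bracket_def br_def sum_subtractf sum_distrib_left mult.assoc)

lemma br_asym:
  assumes "i < N" "j < N" "k < N" "l < N"
  shows "br (asym i j) (asym k l) = (\<lambda>a b. (1/4) * (h k j * dlt i l a b - s k l * h l j * dlt i k a b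
     - s i j * h k i * dlt j l a b + s i j * s k l * h l i * dlt j k a b))"
proof (intro ext)
  fix a b
  have r: "(\<Sum>e<N. x e * asym k l e b) = (x k * (if b = l then 1 else 0) - s k l * x l * (if b = k then 1 else 0)) / 2" for x :: "nat \<Rightarrow> complex"
  proof -
    have "(\<Sum>e<N. x e * asym k l e b) = (\<Sum>e<N. (if e = k then x e * (if b = l then 1 else 0) / 2 else 0) - (if e = l then s k l * x e * (if b = k then 1 else 0) / 2 else 0))"
      by (intro sum.cong refl) (auto simp: asym_def dlt_def field_simps)
    then show ?thesis using assms by (simp add: sum_subtractf diff_divide_distrib)
  qed
  have q: "(\<Sum>c<N. asym i j a c * x c) = ((if a = i then 1 else 0) * x j - s i j * (if a = j then 1 else 0) * x i) / 2" for x :: "nat \<Rightarrow> complex"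
  proof -
    have "(\<Sum>c<N. asym i j a c * x c) = (\<Sum>c<N. (if c = j then (if a = i then 1 else 0) * x c / 2 else 0) - (if c = i then s i j * (if a = j then 1 else 0) * x c / 2 else 0))"
      by (intro sum.cong refl) (auto simp: asym_def dlt_def field_simps)
    then show ?thesis using assms by (simp add: sum_subtractf diff_divide_distrib)
  qed
  have "br (asym i j) (asym k l) a b = (\<Sum>c<N. asym i j a c * (\<Sum>e<N. h e c * asym k l e b))"
    by (simp add: br_def sum_distrib_left mult.assoc)
  moreover define u v x y :: complex where "u = (if a = i then 1 else 0)" and "v = (if a = j then 1 else 0)"
    and "x = (if b = k then 1 else 0)" and "y = (if b = l then 1 else 0)"
  ultimately have "br (asym i j) (asym k l) a b = (u * ((h k j * y - s k l * h l j * x) / 2) - s i j * v * ((h k i * y - s k l * h l i * x) / 2)) / 2"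
    by (simp only: r q)
  moreover have "dlt i l a b = u * y" "dlt i k a b = u * x" "dlt j l a b = v * y" "dlt j k a b = v * x"
    by (simp_all add: dlt_def u_def v_def x_def y_def)
  ultimately show "br (asym i j) (asym k l) a b = (1/4) * (h k j * dlt i l a b - s k l * h l j * dlt i k a b
     - s i j * h k i * dlt j l a b + s i j * s k l * h l i * dlt j k a b)"
    by (simp add: algebra_simps diff_divide_distrib add_divide_distrib)
qed

lemma e1_br:
  assumes "i < N" "j < N" "k < N" "l < N"
  shows "e1 N (br (asym i j) (asym k l)) = (1/4) \<cdot> (h k j \<cdot> E i l - (s k l * h l j) \<cdot> E i k
     - (s i j * h k i) \<cdot> E j l + (s i j * s k l * h l i) \<cdot> E j k)"
  unfolding br_asym[OF assms] e1_lin using assms by (simp add: e1_dlt)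

text \<open>The bracket of the Lie superalgebra produces antisymmetrised tensors, while
  \<open>D\<close> is written with plain letters; their difference consists of multiples of
  \<open>r1\<close>.\<close>

lemma e1_bracket:
  assumes "i < N" "j < N" "k < N" "l < N"
  shows "e1 N (osp_bracket m n h ((pr i \<noteq> pr j) \<and> (pr k \<noteq> pr l)) (asym i j) (asym k l)) - D i j (E k l) =
     (- h k j / 4) \<cdot> r1 i l + (s k l * h l j / - 4) \<cdot> r1 i k + (s i j * h k i / 4) \<cdot> r1 j l + (- s i j * s k l * h l i / - 4) \<cdot> r1 j k"
proof -
  note hs = h_sym[where b=i and a=k] h_sym[where b=i and a=l] h_sym[where b=j and a=k] h_sym[where b=j and a=l]
  show ?thesis
  unfolding bracket_br e1_lin e1_br[OF assms] e1_br[OF assms(3,4,1,2)] D_E dl_def dvec_def r1_def hs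
  by (cases "pr i"; cases "pr j"; cases "pr k"; cases "pr l"; rule poly_mapping_eqI)
    (simp_all add: s_def h_par lk_simps algebra_simps)
qed

text \<open>Everything that is used later about an ideal of the tensor algebra above the relations
  of the enveloping algebra. Multipliers are restricted to \<open>Nsp\<close>, because the ideal
  lives in the carrier.\<close>

lemma U_rels_D:
  assumes K: "is_tideal N K" "U_rels m n h \<subseteq> K"
  shows "subsp (fS K)" "x \<in> fS K \<Longrightarrow> x \<in> Nsp" "x \<in> fS K \<Longrightarrow> r \<in> Nsp \<Longrightarrow> r * x \<in> fS K \<and> x * r \<in> fS K"
    "i < N \<Longrightarrow> j < N \<Longrightarrow> r1 i j \<in> fS K"
    "i < N \<Longrightarrow> j < N \<Longrightarrow> k < N \<Longrightarrow> l < N \<Longrightarrow> r2 i j k l - D i j (E k l) \<in> fS K"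
proof -
  have add: "lk (x + y) = tadd (lk x) (lk y)" for x y by (auto simp: tadd_def lookup_add)
  have sc: "lk (c \<cdot> x) = tsc c (lk x)" for c x by (auto simp: tsc_def)
  have z: "lk 0 = (\<lambda>w. 0)" by auto
  show sp: "subsp (fS K)" using K(1) unfolding subsp_def fS_def by (simp add: add sc z is_tideal_def)
  show inN: "x \<in> fS K \<Longrightarrow> x \<in> Nsp" for x using K(1) unfolding fS_def is_tideal_def using Nsp_carrier by blast
  show ml: "x \<in> fS K \<Longrightarrow> r \<in> Nsp \<Longrightarrow> r * x \<in> fS K \<and> x * r \<in> fS K" for x r
    using K(1) unfolding fS_def is_tideal_def by (simp add: lk_mult Nsp_carrier)
  show r1: "r1 i j \<in> fS K" if "i < N" "j < N" for i j
  proof -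
    have "emb1 (ssym i j) \<in> K" using K(2) ssym_sym[OF that] by (auto simp: U_rels_def)
    then show ?thesis using lk_e1[of N "ssym i j"] ssym_sym[OF that] e1_ssym[OF that] by (simp add: fS_def sym_vec_def)
  qed
  assume ij: "i < N" "j < N" and kl: "k < N" "l < N"
  let ?p = "(pr i \<noteq> pr j) \<and> (pr k \<noteq> pr l)" and ?X = "asym i j" and ?Y = "asym k l"
  let ?B = "osp_bracket m n h ?p ?X ?Y"
  have supp: "supp2 N ?X" "supp2 N ?Y" using asym_osp[OF ij] asym_osp[OF kl] by (simp_all add: osp_def)
  then have s4: "supp4 N (tens ?X ?Y)" "supp4 N (tens ?Y ?X)" by (auto simp: supp2_def supp4_def tens_def)
  have sB: "supp2 N ?B" using supp unfolding osp_bracket_def supp2_def by (auto intro!: sum.neutral)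
  have "(\<lambda>w. emb2 (tens ?X ?Y) w - sgn_b ?p * emb2 (tens ?Y ?X) w - emb1 ?B w) \<in> K"
    using K(2) asym_osp[OF ij] asym_osp[OF kl] asym_homog[OF ij] asym_homog[OF kl] unfolding U_rels_def by blast
  moreover have "(\<lambda>w. emb2 (tens ?X ?Y) w - sgn_b ?p * emb2 (tens ?Y ?X) w - emb1 ?B w) =
     lk (e1 N ?X * e1 N ?Y - sgn_b ?p \<cdot> (e1 N ?Y * e1 N ?X) - e1 N ?B)"
    unfolding e1_mult by (rule ext) (simp only: lk_simps lk_e1[OF sB] lk_e2[OF s4(1)] lk_e2[OF s4(2)])
  ultimately have 1: "e1 N ?X * e1 N ?Y - sgn_b ?p \<cdot> (e1 N ?Y * e1 N ?X) - e1 N ?B \<in> fS K" by (simp add: fS_def)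
  have 2: "e1 N ?B - D i j (E k l) \<in> fS K"
    unfolding e1_bracket[OF ij kl] using ij kl by (intro subsp_add[OF sp] subsp_sm[OF sp] r1)
  have nE: "E i j \<in> Nsp" "E k l \<in> Nsp" "e1 N ?X \<in> Nsp" "e1 N ?Y \<in> Nsp"
    unfolding e1_def using ij kl by (auto intro!: Nsp_E subsp_sum[OF subsp_Nsp] subsp_sm[OF subsp_Nsp])
  have e: "E i j = e1 N ?X + (1/2) \<cdot> r1 i j" "E k l = e1 N ?Y + (1/2) \<cdot> r1 k l"
    by (simp_all add: e1_asym[OF ij] e1_asym[OF kl])
  have h: "(1/2) \<cdot> r1 i j \<in> fS K" "(1/2) \<cdot> r1 k l \<in> fS K" using r1 ij kl by (auto intro: subsp_sm[OF sp])
  have "E i j * E k l - e1 N ?X * e1 N ?Y = ((1/2) \<cdot> r1 i j) * E k l + e1 N ?X * ((1/2) \<cdot> r1 k l)"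
    by (simp only: e distrib_left distrib_right) (simp add: algebra_simps)
  then have 3: "E i j * E k l - e1 N ?X * e1 N ?Y \<in> fS K" using ml[OF h(1) nE(2)] ml[OF h(2) nE(3)] subsp_add[OF sp] by simp
  have "E k l * E i j - e1 N ?Y * e1 N ?X = ((1/2) \<cdot> r1 k l) * E i j + e1 N ?Y * ((1/2) \<cdot> r1 i j)"
    by (simp only: e distrib_left distrib_right) (simp add: algebra_simps)
  then have 4: "E k l * E i j - e1 N ?Y * e1 N ?X \<in> fS K" using ml[OF h(2) nE(1)] ml[OF h(1) nE(4)] subsp_add[OF sp] by simp
  have "r2 i j k l - D i j (E k l) = (e1 N ?X * e1 N ?Y - sgn_b ?p \<cdot> (e1 N ?Y * e1 N ?X) - e1 N ?B)
     + (e1 N ?B - D i j (E k l)) + (E i j * E k l - e1 N ?X * e1 N ?Y) - sgn_b ?p \<cdot> (E k l * E i j - e1 N ?Y * e1 N ?X)"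
    unfolding r2_def fr.scale_right_diff_distrib by simp
  also have "\<dots> \<in> fS K"
    by (rule subsp_diff[OF sp subsp_add[OF sp subsp_add[OF sp 1 2] 3] subsp_sm[OF sp 4]])
  finally show "r2 i j k l - D i j (E k l) \<in> fS K" .
qed

end

context bchange
begin

text \<open>The ideal in canonical coordinates. It is an ideal of the whole free algebra, although
  \<open>K\<close> is one of the carrier only, because \<open>theta\<close> maps every element into
  the carrier (\<open>Nsp_th\<close>).\<close>

definition LL :: "talg set \<Rightarrow> fr set" where "LL K = {x. theta x \<in> fS K}"

lemma T4_in: "subsp S \<Longrightarrow> (\<And>i j k l. i < N \<Longrightarrow> j < N \<Longrightarrow> k < N \<Longrightarrow> l < N \<Longrightarrow> F i j k l \<in> S) \<Longrightarrow> T4 F a b c d \<in> S"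
  unfolding T4_def by (intro Tm_in)

theorem LL_oideal:
  assumes K: "is_tideal N K" "U_rels m n gm \<subseteq> K" shows "h.oideal (LL K)"
proof -
  note KD = g.U_rels_D[OF K]
  note sp = KD(1)
  have "ideal (LL K)"
    unfolding ideal_def LL_def using sp KD(3)[OF _ g.Nsp_th]
    by (auto simp: flinD[OF flin_th] th_mult intro: subsp_0 subsp_add)
  moreover have "E a b \<in> LL K" if "\<not> (a < N \<and> b < N)" for a b
  proof -
    have "theta (E a b) = 0" using that by (auto simp: th_E Xl_def T_out) (simp add: Tm_def)
    then show ?thesis using subsp_0[OF sp] by (simp add: LL_def)
  qed
  moreover have "h.r1 a b \<in> LL K" for a b
    unfolding LL_def mem_Collect_eq th_r1 by (intro Tm_in[OF sp] KD(4))
  moreover have "h.r2 a b c d - h.D a b (E c d) \<in> LL K" for a b c d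
  proof -
    have "theta (h.r2 a b c d - h.D a b (E c d)) = T4 (\<lambda>a b c d. g.r2 a b c d - g.D a b (E c d)) a b c d"
      using thf_diff[OF thf_r2 thf_D] by (simp add: thf_def)
    also have "\<dots> \<in> fS K" by (intro T4_in[OF sp] KD(5))
    finally show ?thesis by (simp add: LL_def)
  qed
  ultimately show ?thesis unfolding h.oideal_def by blast
qed

end

subsection \<open>Decomposition of the symmetric square\<close>

lemma sym2gD:
  assumes "T \<in> sym2g m n"
  shows "T b a c d = - sgn_b (par m a \<and> par m b) * T a b c d" "T a b d c = - sgn_b (par m c \<and> par m d) * T a b c d"
    "T c d a b = sgn_b ((par m a \<noteq> par m b) \<and> (par m c \<noteq> par m d)) * T a b c d" "supp4 (dimN m n) T"
proof -
  have "T b a c d = - sgn_b (par m b \<and> par m a) * T a b c d" "T a b d c = - sgn_b (par m d \<and> par m c) * T a b c d"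
    "T c d a b = sgn_b ((par m c \<noteq> par m d) \<and> (par m a \<noteq> par m b)) * T a b c d" "supp4 (dimN m n) T"
    using assms unfolding sym2g_def by blast+
  then show "T b a c d = - sgn_b (par m a \<and> par m b) * T a b c d" "T a b d c = - sgn_b (par m c \<and> par m d) * T a b c d"
    "T c d a b = sgn_b ((par m a \<noteq> par m b) \<and> (par m c \<noteq> par m d)) * T a b c d" "supp4 (dimN m n) T"
    by (simp_all only: conj_commute)
qed
lemma sym2gI:
  assumes "supp4 (dimN m n) T"
    "\<And>a b c d. T a b c d = - sgn_b (par m a \<and> par m b) * T b a c d"
    "\<And>a b c d. T a b c d = - sgn_b (par m c \<and> par m d) * T a b d c"
    "\<And>a b c d. T a b c d = sgn_b ((par m a \<noteq> par m b) \<and> (par m c \<noteq> par m d)) * T c d a b"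
  shows "T \<in> sym2g m n"
  using assms unfolding sym2g_def by blast

definition anti4 :: "nat \<Rightarrow> tensor4 \<Rightarrow> bool" where
  "anti4 m B \<longleftrightarrow> (\<forall>a b c d. B b a c d = - sgn_b (par m a \<and> par m b) * B a b c d) \<and>
     (\<forall>a b c d. B a c b d = - sgn_b (par m b \<and> par m c) * B a b c d) \<and>
     (\<forall>a b c d. B a b d c = - sgn_b (par m c \<and> par m d) * B a b c d)"

lemma anti4D: "anti4 m B \<Longrightarrow> B b a c d = - sgn_b (par m a \<and> par m b) * B a b c d"
  "anti4 m B \<Longrightarrow> B a c b d = - sgn_b (par m b \<and> par m c) * B a b c d"
  "anti4 m B \<Longrightarrow> B a b d c = - sgn_b (par m c \<and> par m d) * B a b c d"
  unfolding anti4_def by blast+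

lemma sym2g_normal:
  assumes T: "T \<in> sym2g m n"
  shows "T b c a d = sgn_b ((par m a \<noteq> par m d) \<and> (par m b \<noteq> par m c)) * T a d b c"
  by (rule sym2gD(3)[OF T])

text \<open>Together with \<open>qmap_fix\<close> this shows that on the symmetric square
  \<open>q\<close> is the projection onto totally super-antisymmetric tensors.\<close>

lemma qmap_anti:
  assumes T: "T \<in> sym2g m n" shows "anti4 m (qmap m T)"
proof -
  have 1: "qmap m T b a c d = - sgn_b (par m a \<and> par m b) * qmap m T a b c d" for a b c d
    unfolding qmap_def sym2gD(1)[OF T, where b=b and a=a and c=c and d=d]
    by (cases "par m a"; cases "par m b"; cases "par m c"; cases "par m d") (simp_all add: field_simps)
  have 2: "qmap m T a c b d = - sgn_b (par m b \<and> par m c) * qmap m T a b c d" for a b c d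
    unfolding qmap_def sym2gD(1)[OF T, where b=c and a=b]
    by (cases "par m a"; cases "par m b"; cases "par m c") (simp_all add: field_simps)
  have 3: "qmap m T a b d c = - sgn_b (par m c \<and> par m d) * qmap m T a b c d" for a b c d
    unfolding qmap_def sym2g_normal[OF T, where b=b and c=c and a=a and d=d] sym2g_normal[OF T, where b=b and c=d and a=a and d=c]
      sym2gD(2)[OF T, where c=c and d=d and a=a and b=b]
    by (cases "par m a"; cases "par m b"; cases "par m c"; cases "par m d") (simp_all add: field_simps)
  show ?thesis unfolding anti4_def using 1 2 3 by blast
qed

lemma anti4_sym2g: assumes B: "anti4 m B" "supp4 (dimN m n) B" shows "B \<in> sym2g m n"
proof (rule sym2gI[OF B(2)])
  fix a b c d
  show "B a b c d = - sgn_b (par m a \<and> par m b) * B b a c d" by (subst anti4D(1)[OF B(1)]) (simp add: conj_commute)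
  show "B a b c d = - sgn_b (par m c \<and> par m d) * B a b d c" by (subst anti4D(3)[OF B(1)]) (simp add: conj_commute)
  have "B c d a b = - sgn_b (par m a \<and> par m d) * B c a d b" by (rule anti4D(2)[OF B(1)])
  also have "B c a d b = - sgn_b (par m a \<and> par m c) * B a c d b" by (rule anti4D(1)[OF B(1)])
  also have "B a c d b = - sgn_b (par m b \<and> par m d) * B a c b d" by (rule anti4D(3)[OF B(1)])
  also have "B a c b d = - sgn_b (par m b \<and> par m c) * B a b c d" by (rule anti4D(2)[OF B(1)])
  finally show "B a b c d = sgn_b ((par m a \<noteq> par m b) \<and> (par m c \<noteq> par m d)) * B c d a b"
    by (cases "par m a"; cases "par m b"; cases "par m c"; cases "par m d") simp_all
qed

lemma qmap_supp: "supp4 k T \<Longrightarrow> supp4 k (qmap m T)" by (auto simp: supp4_def qmap_def)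
lemma qmap_sym2g: "T \<in> sym2g m n \<Longrightarrow> qmap m T \<in> sym2g m n"
  by (rule anti4_sym2g[OF qmap_anti qmap_supp[OF sym2gD(4)]])
lemma qmap_fix: "anti4 m B \<Longrightarrow> qmap m B = B"
proof (intro ext)
  fix a b c d assume B: "anti4 m B"
  have "B b c a d = - sgn_b (par m a \<and> par m c) * B b a c d" by (rule anti4D(2)[OF B])
  also have "B b a c d = - sgn_b (par m a \<and> par m b) * B a b c d" by (rule anti4D(1)[OF B])
  finally show "qmap m B a b c d = B a b c d"
    unfolding qmap_def anti4D(2)[OF B, where a=a and c=c and b=b and d=d]
    by (cases "par m a"; cases "par m b"; cases "par m c") simp_all
qed

locale ospM = ospl +
  assumes Mbig: "int m - 2 * int n > 2"
begin

definition MM :: complex where "MM = of_nat m - 2 * of_nat n"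

lemma MM_ne: "MM \<noteq> 2" "MM \<noteq> 1" "MM - 2 \<noteq> 0" "MM - 1 \<noteq> 0"
proof -
  have "MM = of_int (int m - 2 * int n)" by (simp add: MM_def)
  then show "MM \<noteq> 2" "MM \<noteq> 1" using Mbig
    by (simp_all only: of_int_eq_numeral_iff of_int_eq_1_iff)
  then show "MM - 2 \<noteq> 0" "MM - 1 \<noteq> 0" by simp_all
qed

lemma hp_par: "par m a \<noteq> par m b \<Longrightarrow> h a b = 0" using met unfolding osp_metric_def by blast
lemma hp_sym: "h b a = sgn_b (par m a \<and> par m b) * h a b" using met unfolding osp_metric_def by blast
lemma h_sym_vec: "h \<in> sym_vec m n"
proof -
  have "h a b = sgn_b (par m a \<and> par m b) * h b a" for a b by (subst hp_sym) (simp only: conj_commute)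
  moreover have "supp2 N h" using met unfolding osp_metric_def by blast
  ultimately show ?thesis unfolding sym_vec_def by blast
qed
lemma sym_vecD: "X \<in> sym_vec m n \<Longrightarrow> X b a = sgn_b (par m a \<and> par m b) * X a b" "X \<in> sym_vec m n \<Longrightarrow> supp2 N X"
proof -
  assume X: "X \<in> sym_vec m n"
  then have "X b a = sgn_b (par m b \<and> par m a) * X a b" unfolding sym_vec_def by blast
  then show "X b a = sgn_b (par m a \<and> par m b) * X a b" by (simp only: conj_commute)
  show "supp2 N X" using X unfolding sym_vec_def by blast
qed

definition tr :: "tensor4 \<Rightarrow> tensor2" where "tr T = (\<lambda>a d. \<Sum>b<N. \<Sum>c<N. h b c * T a c b d)"
definition trv :: "tensor2 \<Rightarrow> complex" where "trv X = (\<Sum>b<N. \<Sum>c<N. h b c * X c b)"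
text \<open>The solution \<open>X\<close> of \<open>tr (phimap m h X) = tr T\<close>. By
  \<open>tr_phi\<close> the left side is \<open>((M - 2) X + trv X h) / 4\<close>; contracting once
  more gives \<open>trv X\<close> as \<open>2 / (M - 1)\<close> times the contraction of
  \<open>tr T\<close>, and substituting this back yields the formula.\<close>

definition XT :: "tensor4 \<Rightarrow> tensor2" where
  "XT T = (\<lambda>a d. 4 / (MM - 2) * (tr T a d - trv (tr T) / (2 * (MM - 1)) * h a d))"
text \<open>The projection of the symmetric square onto the Cartan product along the images of
  \<open>q\<close> and \<phi>; an explicit linear formula replaces the abstract direct sum.\<close>

definition Cp :: "tensor4 \<Rightarrow> tensor4" where
  "Cp T = (\<lambda>a b c d. T a b c d - qmap m T a b c d - phimap m h (XT T) a b c d)"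

lemma tr_anti: assumes B: "anti4 m B" shows "tr B a d = 0"
proof -
  have "tr B a d = (\<Sum>c<N. \<Sum>b<N. h b c * B a c b d)" unfolding tr_def by (rule sum.swap)
  also have "\<dots> = (\<Sum>c<N. \<Sum>b<N. - (h c b * B a b c d))"
  proof (intro sum.cong refl)
    fix b c show "h b c * B a c b d = - (h c b * B a b c d)"
      unfolding hp_sym[where b=b and a=c] anti4D(2)[OF B, where a=a and c=c and b=b and d=d] by (simp add: conj_commute sgn_b_def)
  qed
  also have "\<dots> = - tr B a d" unfolding tr_def by (simp add: sum_negf)
  finally show ?thesis by simp
qed

lemma tr_sym: assumes T: "T \<in> sym2g m n" shows "tr T \<in> sym_vec m n"
proof -
  have e: "h b c * T d c b a = sgn_b (par m d \<and> par m a) * (h c b * T a b c d)" for a b c d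
  proof -
    have "T d c b a = sgn_b ((par m b \<noteq> par m a) \<and> (par m d \<noteq> par m c)) * T b a d c" by (rule sym2gD(3)[OF T])
    also have "T b a d c = - sgn_b (par m a \<and> par m b) * T a b d c" by (rule sym2gD(1)[OF T])
    also have "T a b d c = - sgn_b (par m c \<and> par m d) * T a b c d" by (rule sym2gD(2)[OF T])
    finally show ?thesis unfolding hp_sym[where b=b and a=c]
      by (cases "par m b = par m c"; cases "par m a"; cases "par m b"; cases "par m d") (simp_all add: hp_par)
  qed
  have "tr T d a = sgn_b (par m d \<and> par m a) * tr T a d" for a d
  proof -
    have "tr T d a = (\<Sum>b<N. \<Sum>c<N. sgn_b (par m d \<and> par m a) * (h c b * T a b c d))"
      unfolding tr_def by (intro sum.cong refl e)
    also have "\<dots> = (\<Sum>c<N. \<Sum>b<N. sgn_b (par m d \<and> par m a) * (h c b * T a b c d))" by (rule sum.swap)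
    finally show ?thesis unfolding tr_def sum_distrib_left .
  qed
  moreover have "supp2 N (tr T)" using sym2gD(4)[OF T] unfolding supp2_def supp4_def tr_def by (auto intro!: sum.neutral)
  ultimately show ?thesis unfolding sym_vec_def mem_Collect_eq by (intro conjI allI)
qed

lemma phi_sym2g: assumes X: "X \<in> sym_vec m n" shows "phimap m h X \<in> sym2g m n"
proof (rule sym2gI)
  show "supp4 N (phimap m h X)"
    using sym_vecD(2)[OF X] h_supp unfolding supp4_def supp2_def phimap_def by (auto simp: not_less)
  fix a b c d
  show "phimap m h X a b c d = - sgn_b (par m a \<and> par m b) * phimap m h X b a c d"
    unfolding phimap_def by (cases "par m a"; cases "par m b"; cases "par m c"; cases "par m d") (simp_all add: field_simps)
  show "phimap m h X a b c d = - sgn_b (par m c \<and> par m d) * phimap m h X a b d c"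
    unfolding phimap_def by (cases "par m a"; cases "par m b"; cases "par m c"; cases "par m d") (simp_all add: field_simps)
  show "phimap m h X a b c d = sgn_b ((par m a \<noteq> par m b) \<and> (par m c \<noteq> par m d)) * phimap m h X c d a b"
    unfolding phimap_def hp_sym[where b=d and a=a] hp_sym[where b=c and a=a] hp_sym[where b=d and a=b] hp_sym[where b=c and a=b]
      sym_vecD(1)[OF X, where b=c and a=b] sym_vecD(1)[OF X, where b=c and a=a] sym_vecD(1)[OF X, where b=d and a=b] sym_vecD(1)[OF X, where b=d and a=a]
    by (cases "par m a"; cases "par m b"; cases "par m c"; cases "par m d") (simp_all add: hp_par field_simps)
qed

lemma q_phi: assumes X: "X \<in> sym_vec m n" shows "qmap m (phimap m h X) = zero4"
proof (intro ext)
  fix a b c d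
  show "qmap m (phimap m h X) a b c d = zero4 a b c d"
    unfolding qmap_def phimap_def zero4_def hp_sym[where b=c and a=a] hp_sym[where b=c and a=b] hp_sym[where b=b and a=a]
      sym_vecD(1)[OF X, where b=c and a=b] sym_vecD(1)[OF X, where b=c and a=a] sym_vecD(1)[OF X, where b=b and a=a]
    by (cases "par m a"; cases "par m b"; cases "par m c"; cases "par m d") (simp_all add: hp_par field_simps)
qed

lemma trv_h: "trv h = MM"
proof -
  have "(\<Sum>c<N. h b c * h c b) = sgn_b (par m b)" if b: "b < N" for b
  proof -
    have "(\<Sum>c<N. h b c * h c b) = (\<Sum>c<N. sgn_b (par m b) * (h c b * h c b))"
    proof (intro sum.cong refl)
      fix c show "h b c * h c b = sgn_b (par m b) * (h c b * h c b)"
        unfolding hp_sym[where b=b and a=c] by (cases "par m b = par m c") (simp_all add: hp_par)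
    qed
    then show ?thesis using h_inv[OF b b] by (simp add: sum_distrib_left[symmetric])
  qed
  then have "trv h = (\<Sum>b<N. sgn_b (par m b))" by (simp add: trv_def)
  also have "\<dots> = (\<Sum>b\<in>{..<m} \<union> {m..<N}. sgn_b (par m b))" by (intro sum.cong) (auto simp: dimN_def)
  also have "\<dots> = (\<Sum>b<m. sgn_b (par m b)) + (\<Sum>b\<in>{m..<N}. sgn_b (par m b))" by (rule sum.union_disjoint) auto
  also have "\<dots> = (\<Sum>b<m. 1) + (\<Sum>b\<in>{m..<N}. -1)" by (intro arg_cong2[of _ _ _ _ "(+)"] sum.cong) (auto simp: par_def)
  finally show ?thesis by (simp add: MM_def dimN_def)
qed

lemma contract2: "y < N \<Longrightarrow> (\<Sum>c<N. (\<Sum>b<N. h b c * h b y) * G c) = (G y :: complex)"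
proof -
  assume y: "y < N"
  have "(\<Sum>c<N. (\<Sum>b<N. h b c * h b y) * G c) = (\<Sum>c<N. if c = y then G c else 0)"
    using h_inv[OF y] by (intro sum.cong) auto
  then show ?thesis using y by simp
qed

text \<open>Of the four terms of \<open>phimap\<close>, the first contributes the superdimension,
  the two middle ones contribute \<open>- X\<close> each by the inverse property of the metric, and
  the last one the full trace.\<close>

lemma tr_phi: assumes X: "X \<in> sym_vec m n" and ad: "a < N" "d < N"
  shows "tr (phimap m h X) a d = ((MM - 2) * X a d + h a d * trv X) / 4"
proof -
  have e: "h b c * phimap m h X a c b d = (1/4) * ((h b c * h c b) * X a d - (h b c * h b a) * X c d - (h c b * h c d) * X a b + h a d * (h b c * X c b))" for b c
  proof -
    have 1: "sgn_b (par m a \<and> par m c) * h a b * h b c = h b c * h b a"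
      unfolding hp_sym[where b=a and a=b] by (cases "par m a = par m b"; cases "par m b = par m c"; cases "par m b") (simp_all add: hp_par)
    have 2: "sgn_b (par m b \<and> par m d) * h c d * h b c = h c b * h c d"
      unfolding hp_sym[where b=b and a=c] by (cases "par m c = par m d"; cases "par m b = par m c"; cases "par m b") (simp_all add: hp_par)
    have 3: "sgn_b (par m a \<and> par m c) * sgn_b (par m b \<and> par m d) * h a d * h b c = h a d * h b c"
      by (cases "par m a = par m d"; cases "par m b = par m c"; cases "par m b"; cases "par m a") (simp_all add: hp_par)
    have "h b c * phimap m h X a c b d = (1/4) * ((h b c * h c b) * X a d - (sgn_b (par m a \<and> par m c) * h a b * h b c) * X c d
        - (sgn_b (par m b \<and> par m d) * h c d * h b c) * X a b + (sgn_b (par m a \<and> par m c) * sgn_b (par m b \<and> par m d) * h a d * h b c) * X c b)"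
      unfolding phimap_def by (simp add: field_simps)
    then show ?thesis unfolding 1 2 3 by simp
  qed
  have "tr (phimap m h X) a d = (1/4) * (trv h * X a d - (\<Sum>c<N. (\<Sum>b<N. h b c * h b a) * X c d)
     - (\<Sum>b<N. (\<Sum>c<N. h c b * h c d) * X a b) + h a d * trv X)"
  proof -
    have 1: "(\<Sum>b<N. \<Sum>c<N. (h b c * h b a) * X c d) = (\<Sum>c<N. (\<Sum>b<N. h b c * h b a) * X c d)"
      by (subst sum.swap) (simp only: sum_distrib_right)
    have 2: "(\<Sum>b<N. \<Sum>c<N. (h b c * h c b) * X a d) = trv h * X a d" by (simp only: trv_def sum_distrib_right)
    have 3: "(\<Sum>b<N. \<Sum>c<N. (h c b * h c d) * X a b) = (\<Sum>b<N. (\<Sum>c<N. h c b * h c d) * X a b)" by (simp only: sum_distrib_right)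
    have 4: "(\<Sum>b<N. \<Sum>c<N. h a d * (h b c * X c b)) = h a d * trv X" by (simp only: trv_def sum_distrib_left)
    have "tr (phimap m h X) a d = (1/4) * ((\<Sum>b<N. \<Sum>c<N. (h b c * h c b) * X a d) - (\<Sum>b<N. \<Sum>c<N. (h b c * h b a) * X c d)
       - (\<Sum>b<N. \<Sum>c<N. (h c b * h c d) * X a b) + (\<Sum>b<N. \<Sum>c<N. h a d * (h b c * X c b)))"
      unfolding tr_def e by (simp only: sum_distrib_left[symmetric, where r="1/4"] sum.distrib sum_subtractf)
    then show ?thesis unfolding 1 2 3 4 .
  qed
  then show ?thesis unfolding trv_h contract2[OF ad(1)] contract2[OF ad(2)] by (simp add: field_simps)
qed

lemma tr_lin: "tr (\<lambda>a b c d. x * S a b c d + y * T a b c d) = (\<lambda>a d. x * tr S a d + y * tr T a d)"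
  unfolding tr_def by (intro ext) (simp add: distrib_left sum.distrib sum_distrib_left mult.left_commute)
lemma trv_lin: "trv (\<lambda>a d. x * X a d + y * Y a d) = x * trv X + y * trv Y"
  unfolding trv_def by (simp add: distrib_left sum.distrib sum_distrib_left mult.left_commute)
lemma q_lin: "qmap m (\<lambda>a b c d. x * S a b c d + y * T a b c d) = (\<lambda>a b c d. x * qmap m S a b c d + y * qmap m T a b c d)"
  unfolding qmap_def by (intro ext) (simp add: field_simps)
lemma phi_lin: "phimap m h (\<lambda>a d. x * X a d + y * Y a d) = (\<lambda>a b c d. x * phimap m h X a b c d + y * phimap m h Y a b c d)"
  unfolding phimap_def by (intro ext) (simp add: field_simps)
text \<open>\<open>k1\<close> and \<open>k2\<close> stand for the inverses of \<open>M - 2\<close>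
  and \<open>M - 1\<close> up to scaling. With \<open>k12\<close> the later computations become
  polynomial identities without division.\<close>

definition k1 :: complex where "k1 = 4 / (MM - 2)"
definition k2 :: complex where "k2 = 1 / (2 * (MM - 1))"
lemma k12: "k1 * (MM - 2) = 4" "k2 * (2 * (MM - 1)) = 1"
proof -
  show "k1 * (MM - 2) = 4" unfolding k1_def by (rule nonzero_eq_divide_eq[THEN iffD1, OF MM_ne(3) refl])
  have "2 * (MM - 1) \<noteq> 0" using MM_ne(4) by simp
  then show "k2 * (2 * (MM - 1)) = 1" unfolding k2_def by (rule nonzero_eq_divide_eq[THEN iffD1, OF _ refl])
qed
lemma XT_alt: "XT T = (\<lambda>a d. k1 * tr T a d + (- (k1 * k2 * trv (tr T))) * h a d)"
  unfolding XT_def k1_def k2_def by (intro ext) (simp add: right_diff_distrib)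
lemma XT_lin: "XT (\<lambda>a b c d. x * S a b c d + y * T a b c d) = (\<lambda>a d. x * XT S a d + y * XT T a d)"
  unfolding XT_alt tr_lin trv_lin by (intro ext) (simp add: algebra_simps)
lemma Cp_lin: "Cp (\<lambda>a b c d. x * S a b c d + y * T a b c d) = (\<lambda>a b c d. x * Cp S a b c d + y * Cp T a b c d)"
  unfolding Cp_def q_lin XT_lin phi_lin by (intro ext) (simp add: algebra_simps)

lemma sym2g_lin: assumes "S \<in> sym2g m n" "T \<in> sym2g m n" shows "(\<lambda>a b c d. x * S a b c d + y * T a b c d) \<in> sym2g m n"
proof (rule sym2gI)
  show "supp4 N (\<lambda>a b c d. x * S a b c d + y * T a b c d)" using sym2gD(4)[OF assms(1)] sym2gD(4)[OF assms(2)] by (auto simp: supp4_def)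
  fix a b c d
  show "x * S a b c d + y * T a b c d = - sgn_b (par m a \<and> par m b) * (x * S b a c d + y * T b a c d)"
    unfolding sym2gD(1)[OF assms(1), where b=b and a=a] sym2gD(1)[OF assms(2), where b=b and a=a] by (simp add: sgn_b_def)
  show "x * S a b c d + y * T a b c d = - sgn_b (par m c \<and> par m d) * (x * S a b d c + y * T a b d c)"
    unfolding sym2gD(2)[OF assms(1), where c=c and d=d] sym2gD(2)[OF assms(2), where c=c and d=d] by (simp add: sgn_b_def)
  show "x * S a b c d + y * T a b c d = sgn_b ((par m a \<noteq> par m b) \<and> (par m c \<noteq> par m d)) * (x * S c d a b + y * T c d a b)"
    unfolding sym2gD(3)[OF assms(1), where a=a and b=b and c=c and d=d] sym2gD(3)[OF assms(2), where a=a and b=b and c=c and d=d] by (simp add: sgn_b_def)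
qed
lemma sym_vec_lin: assumes "X \<in> sym_vec m n" "Y \<in> sym_vec m n" shows "(\<lambda>a d. x * X a d + y * Y a d) \<in> sym_vec m n"
proof -
  have "supp2 N (\<lambda>a d. x * X a d + y * Y a d)" using sym_vecD(2)[OF assms(1)] sym_vecD(2)[OF assms(2)] by (auto simp: supp2_def)
  moreover have "x * X a b + y * Y a b = sgn_b (par m a \<and> par m b) * (x * X b a + y * Y b a)" for a b
    unfolding sym_vecD(1)[OF assms(1), where b=b and a=a] sym_vecD(1)[OF assms(2), where b=b and a=a] by (simp add: sgn_b_def)
  ultimately show ?thesis unfolding sym_vec_def by blast
qed
lemma XT_sym: assumes "T \<in> sym2g m n" shows "XT T \<in> sym_vec m n"
  unfolding XT_alt by (rule sym_vec_lin[OF tr_sym[OF assms] h_sym_vec])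

lemma trv_XT: "trv (XT T) = 4 * k2 * trv (tr T)"
proof -
  have "trv (XT T) = k1 * trv (tr T) + (- (k1 * k2 * trv (tr T))) * MM" unfolding XT_alt trv_lin trv_h ..
  then show ?thesis using k12 by algebra
qed

lemma tr_phi_XT: assumes T: "T \<in> sym2g m n" shows "tr (phimap m h (XT T)) = tr T"
proof (intro ext)
  fix a d
  show "tr (phimap m h (XT T)) a d = tr T a d"
  proof (cases "a < N \<and> d < N")
    case True
    then have "4 * tr (phimap m h (XT T)) a d = (MM - 2) * XT T a d + h a d * trv (XT T)"
      using tr_phi[OF XT_sym[OF T], of a d] by (simp add: mult.commute[of _ 4])
    moreover have "XT T a d = k1 * tr T a d + (- (k1 * k2 * trv (tr T))) * h a d" unfolding XT_alt ..
    ultimately have "4 * tr (phimap m h (XT T)) a d = 4 * tr T a d" using trv_XT[of T] k12 by algebra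
    then show ?thesis by simp
  next
    case False
    then show ?thesis using sym_vecD(2)[OF tr_sym[OF T]] sym_vecD(2)[OF tr_sym[OF phi_sym2g[OF XT_sym[OF T]]]]
      unfolding supp2_def by (metis not_less)
  qed
qed

lemma Cp_cartan: assumes T: "T \<in> sym2g m n" shows "Cp T \<in> cartan1 m n h"
proof -
  have e: "Cp T = (\<lambda>a b c d. 1 * (1 * T a b c d + (-1) * qmap m T a b c d) + (-1) * phimap m h (XT T) a b c d)"
    unfolding Cp_def by simp
  have "Cp T \<in> sym2g m n" unfolding e by (intro sym2g_lin T qmap_sym2g phi_sym2g XT_sym)
  moreover have "tr (Cp T) a d = 0" for a d
    unfolding e tr_lin tr_anti[OF qmap_anti[OF T]] tr_phi_XT[OF T] by simp
  moreover have "qmap m (Cp T) = zero4"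
    unfolding e q_lin qmap_fix[OF qmap_anti[OF T]] q_phi[OF XT_sym[OF T]] by (simp add: zero4_def)
  ultimately show ?thesis unfolding cartan1_def tr_def by simp
qed

lemma phi_0: "phimap m h (\<lambda>a d. 0) = zero4" by (simp add: phimap_def zero4_def)
lemma XT_0: "(\<And>a d. tr T a d = 0) \<Longrightarrow> XT T = (\<lambda>a d. 0)" by (simp add: XT_def trv_def)

lemma Cp_id: assumes T: "T \<in> cartan1 m n h" shows "Cp T = T"
proof -
  have "XT T = (\<lambda>a d. 0)" using T by (intro XT_0) (simp add: cartan1_def tr_def)
  moreover have "qmap m T = zero4" using T by (simp add: cartan1_def)
  ultimately show ?thesis unfolding Cp_def by (simp add: phi_0) (simp add: zero4_def)
qed
lemma Cp_q: assumes T: "T \<in> sym2g m n" shows "Cp (qmap m T) = zero4"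
proof -
  have "XT (qmap m T) = (\<lambda>a d. 0)" by (intro XT_0 tr_anti qmap_anti[OF T])
  then show ?thesis unfolding Cp_def qmap_fix[OF qmap_anti[OF T]] by (simp add: phi_0) (simp add: zero4_def)
qed
lemma Cp_phi: assumes X: "X \<in> sym_vec m n" shows "Cp (phimap m h X) = zero4"
proof -
  have t: "tr (phimap m h X) a d = ((MM - 2) / 4) * X a d + (trv X / 4) * h a d" for a d
  proof (cases "a < N \<and> d < N")
    case True then show ?thesis using tr_phi[OF X, of a d] by (simp add: field_simps)
  next
    case False
    then have "X a d = 0" "h a d = 0" "tr (phimap m h X) a d = 0"
      using sym_vecD(2)[OF X] h_supp sym_vecD(2)[OF tr_sym[OF phi_sym2g[OF X]]] unfolding supp2_def by (meson not_less)+
    then show ?thesis by simp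
  qed
  then have t': "tr (phimap m h X) = (\<lambda>a d. ((MM - 2) / 4) * X a d + (trv X / 4) * h a d)" by blast
  have tv: "2 * trv (tr (phimap m h X)) = (MM - 1) * trv X" unfolding t' trv_lin trv_h by (simp add: field_simps)
  have "XT (phimap m h X) = X"
  proof (intro ext)
    fix a d
    have "XT (phimap m h X) a d = k1 * tr (phimap m h X) a d + (- (k1 * k2 * trv (tr (phimap m h X)))) * h a d" unfolding XT_alt ..
    moreover have "4 * tr (phimap m h X) a d = (MM - 2) * X a d + trv X * h a d" unfolding t by simp
    ultimately have "4 * XT (phimap m h X) a d = 4 * X a d" using tv k12 by algebra
    then show "XT (phimap m h X) a d = X a d" by simp
  qed
  then show ?thesis unfolding Cp_def q_phi[OF X] by (simp add: zero4_def)
qed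

definition ssq :: "tensor4 \<Rightarrow> tensor4" where
  "ssq T = (\<lambda>a b c d. (T a b c d + sgn_b ((par m a \<noteq> par m b) \<and> (par m c \<noteq> par m d)) * T c d a b) / 2)"

text \<open>This evaluates the definite description. Existence comes from splitting the symmetric
  part by \<open>Cp\<close>; for uniqueness, symmetrisation removes the wedge summand, and
  \<open>Cp\<close> annihilates the summands of \<open>q\<close> and \<phi> while fixing the Cartan
  product.\<close>

lemma cartan_prod_eq:
  assumes X: "X \<in> osp m n" and Y: "Y \<in> osp m n" shows "cartan_prod m n h X Y = Cp (ssq (tens X Y))" "ssq (tens X Y) \<in> sym2g m n"
proof -
  have x: "X a b = - sgn_b (par m a \<and> par m b) * X b a" and y: "Y a b = - sgn_b (par m a \<and> par m b) * Y b a" for a b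
    using X Y unfolding osp_def by blast+
  have sx: "supp2 N X" "supp2 N Y" using X Y unfolding osp_def by blast+
  let ?t = "tens X Y" and ?S = "ssq (tens X Y)"
  have s4: "supp4 N ?S" using sx by (auto simp: supp4_def supp2_def ssq_def tens_def)
  have a1: "?S a b c d = - sgn_b (par m a \<and> par m b) * ?S b a c d" for a b c d
    unfolding ssq_def tens_def x[of a b] y[of a b] by (cases "par m a"; cases "par m b"; cases "par m c"; cases "par m d") simp_all
  have a2: "?S a b c d = - sgn_b (par m c \<and> par m d) * ?S a b d c" for a b c d
    unfolding ssq_def tens_def x[of c d] y[of c d] by (cases "par m a"; cases "par m b"; cases "par m c"; cases "par m d") simp_all
  have a3: "?S a b c d = sgn_b ((par m a \<noteq> par m b) \<and> (par m c \<noteq> par m d)) * ?S c d a b" for a b c d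
    unfolding ssq_def tens_def by (cases "par m a = par m b"; cases "par m c = par m d") (simp_all add: field_simps)
  show S: "?S \<in> sym2g m n" by (rule sym2gI[OF s4]) (rule a1 a2 a3)+
  define Z where "Z = (\<lambda>a b c d. ?t a b c d - ?S a b c d)"
  have t1: "?t a b c d = - sgn_b (par m a \<and> par m b) * ?t b a c d" for a b c d unfolding tens_def x[of a b] by simp
  have t2: "?t a b c d = - sgn_b (par m c \<and> par m d) * ?t a b d c" for a b c d unfolding tens_def y[of c d] by simp
  have Z: "Z \<in> wedge2g m n"
  proof -
    have "supp4 N Z" using s4 sx by (auto simp: supp4_def supp2_def Z_def tens_def)
    moreover have "Z a b c d = - sgn_b (par m a \<and> par m b) * Z b a c d" for a b c d
      unfolding Z_def a1[of a b c d] t1[of a b c d] by (simp add: algebra_simps)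
    moreover have "Z a b c d = - sgn_b (par m c \<and> par m d) * Z a b d c" for a b c d
      unfolding Z_def a2[of a b c d] t2[of a b c d] by (simp add: algebra_simps)
    moreover have "Z a b c d = - sgn_b ((par m a \<noteq> par m b) \<and> (par m c \<noteq> par m d)) * Z c d a b" for a b c d
      unfolding Z_def ssq_def by (cases "par m a = par m b"; cases "par m c = par m d") (simp_all add: field_simps)
    ultimately show ?thesis unfolding wedge2g_def mem_Collect_eq by (intro conjI allI)
  qed
  have uniq: "V = Cp ?S" if V: "V \<in> cartan1 m n h" and Q: "Q \<in> qmap m ` sym2g m n" and P: "P \<in> phimap m h ` sym_vec m n"
    and Z': "Z' \<in> wedge2g m n" and e: "?t = (\<lambda>a b c d. V a b c d + Q a b c d + P a b c d + Z' a b c d)" for V Q P Z'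
  proof -
    obtain T where T: "Q = qmap m T" "T \<in> sym2g m n" using Q by blast
    obtain X' where X': "P = phimap m h X'" "X' \<in> sym_vec m n" using P by blast
    have Qs: "Q \<in> sym2g m n" "P \<in> sym2g m n" "V \<in> sym2g m n" using T X' V by (simp_all add: qmap_sym2g phi_sym2g cartan1_def)
    have zz: "Z' c d a b = - sgn_b ((par m c \<noteq> par m d) \<and> (par m a \<noteq> par m b)) * Z' a b c d" for a b c d
      using Z' unfolding wedge2g_def by blast
    have "?S = (\<lambda>a b c d. 1 * (1 * V a b c d + 1 * Q a b c d) + 1 * P a b c d)"
    proof (intro ext)
      fix a b c d
      have "?S a b c d = (V a b c d + Q a b c d + P a b c d + Z' a b c d + sgn_b ((par m a \<noteq> par m b) \<and> (par m c \<noteq> par m d)) *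
         (V c d a b + Q c d a b + P c d a b + Z' c d a b)) / 2" unfolding ssq_def e ..
      then have "2 * ?S a b c d = 2 * (V a b c d + Q a b c d + P a b c d)"
        unfolding zz[where c=c and d=d and a=a and b=b] sym2gD(3)[OF Qs(1), where a=a and b=b and c=c and d=d]
          sym2gD(3)[OF Qs(2), where a=a and b=b and c=c and d=d] sym2gD(3)[OF Qs(3), where a=a and b=b and c=c and d=d]
        by (cases "par m a = par m b"; cases "par m c = par m d") (simp_all add: field_simps)
      then show "?S a b c d = 1 * (1 * V a b c d + 1 * Q a b c d) + 1 * P a b c d" unfolding mult_cancel_left by simp
    qed
    then have "Cp ?S = (\<lambda>a b c d. 1 * (1 * Cp V a b c d + 1 * Cp Q a b c d) + 1 * Cp P a b c d)" by (simp only: Cp_lin)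
    then show ?thesis unfolding T(1) X'(1) Cp_q[OF T(2)] Cp_phi[OF X'(2)] Cp_id[OF V] by (simp add: zero4_def)
  qed
  show "cartan_prod m n h X Y = Cp ?S"
    unfolding cartan_prod_def
  proof (rule the_equality)
    have "?t = (\<lambda>a b c d. Cp ?S a b c d + qmap m ?S a b c d + phimap m h (XT ?S) a b c d + Z a b c d)"
      unfolding Cp_def Z_def by simp
    then show "Cp ?S \<in> cartan1 m n h \<and> (\<exists>Q\<in>qmap m ` sym2g m n. \<exists>P\<in>phimap m h ` sym_vec m n. \<exists>Z\<in>wedge2g m n.
       ?t = (\<lambda>a b c d. Cp ?S a b c d + Q a b c d + P a b c d + Z a b c d))"
      using Cp_cartan[OF S] imageI[OF S, of "qmap m"] imageI[OF XT_sym[OF S], of "phimap m h"] Z by (intro conjI bexI)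
  next
    fix V assume "V \<in> cartan1 m n h \<and> (\<exists>Q\<in>qmap m ` sym2g m n. \<exists>P\<in>phimap m h ` sym_vec m n. \<exists>Z\<in>wedge2g m n.
       ?t = (\<lambda>a b c d. V a b c d + Q a b c d + P a b c d + Z a b c d))"
    then show "V = Cp ?S" by (elim conjE bexE) (rule uniq)
  qed
qed

end

section \<open>Pairing families of quadratic elements with coefficient tensors\<close>

context ospM
begin

text \<open>For this pairing the signed transpositions of families (\<open>sw1\<close>,
  \<open>sw2\<close>, \<open>sw3\<close>) are adjoint to those of tensors (\<open>t1\<close>,
  \<open>t2\<close>, \<open>t3\<close>). Symmetrisers can thus be moved between the two sides
  instead of being expanded.\<close>

definition eF :: "fam \<Rightarrow> tensor4 \<Rightarrow> fr" where
  "eF G T = (\<Sum>a<N. \<Sum>b<N. \<Sum>c<N. \<Sum>d<N. T a b c d \<cdot> G a b c d)"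
definition t1 :: "tensor4 \<Rightarrow> tensor4" where "t1 T = (\<lambda>a b c d. sgn_b (par m a \<and> par m b) * T b a c d)"
definition t2 :: "tensor4 \<Rightarrow> tensor4" where "t2 T = (\<lambda>a b c d. sgn_b (par m b \<and> par m c) * T a c b d)"
definition t3 :: "tensor4 \<Rightarrow> tensor4" where "t3 T = (\<lambda>a b c d. sgn_b (par m c \<and> par m d) * T a b d c)"
definition ht :: "tensor4 \<Rightarrow> tensor4" where
  "ht T = (\<lambda>a b c d. sgn_b ((par m a \<noteq> par m b) \<and> (par m c \<noteq> par m d)) * T c d a b)"

lemma eF_t1: "eF G (t1 T) = eF (sw1 G) T"
  unfolding eF_def
  by (subst sum.swap) (intro sum.cong refl, simp add: t1_def sw1_def s_par conj_commute mult.commute)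
lemma eF_t2: "eF G (t2 T) = eF (sw2 G) T"
  unfolding eF_def
  by (rule sum.cong[OF refl], subst sum.swap) (intro sum.cong refl, simp add: t2_def sw2_def s_par conj_commute mult.commute)
lemma eF_t3: "eF G (t3 T) = eF (sw3 G) T"
  unfolding eF_def
  by (rule sum.cong[OF refl], rule sum.cong[OF refl], subst sum.swap) (intro sum.cong refl, simp add: t3_def sw3_def s_par conj_commute mult.commute)
lemma ht_eq: "ht T = t2 (t3 (t1 (t2 T)))"
proof (intro ext)
  fix a b c d show "ht T a b c d = t2 (t3 (t1 (t2 T))) a b c d"
    unfolding ht_def t1_def t2_def t3_def
    by (cases "par m a"; cases "par m b"; cases "par m c"; cases "par m d") simp_all
qed
lemma eF_ht: "eF G (ht T) = eF (hs G) T"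
  unfolding ht_eq hs_eq eF_t1 eF_t2 eF_t3 ..

lemma eF_lin: "eF G (\<lambda>a b c d. x * S a b c d + y * T a b c d) = x \<cdot> eF G S + y \<cdot> eF G T"
  unfolding eF_def by (simp add: fr.scale_left_distrib sum.distrib fr.scale_sum_right)
lemma eF_linG: "eF (\<lambda>a b c d. x \<cdot> F a b c d + y \<cdot> G a b c d) T = x \<cdot> eF F T + y \<cdot> eF G T"
  unfolding eF_def by (simp add: fr.scale_right_distrib sum.distrib fr.scale_sum_right mult.commute)
lemma eF_add: "eF G (\<lambda>a b c d. S a b c d + T a b c d) = eF G S + eF G T"
  using eF_lin[of G 1 S 1 T] by simp
lemma eF_diff: "eF G (\<lambda>a b c d. S a b c d - T a b c d) = eF G S - eF G T"
  using eF_lin[of G 1 S "-1" T] by simp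
lemma eF_sm: "eF G (\<lambda>a b c d. x * S a b c d) = x \<cdot> eF G S"
  using eF_lin[of G x S 0 S] by simp
lemma eF_addG: "eF (\<lambda>a b c d. F a b c d + G a b c d) T = eF F T + eF G T"
  using eF_linG[of 1 F 1 G T] by simp
lemma eF_diffG: "eF (\<lambda>a b c d. F a b c d - G a b c d) T = eF F T - eF G T"
  using eF_linG[of 1 F "-1" G T] by simp
lemma eF_negG: "eF (\<lambda>a b c d. - G a b c d) T = - eF G T"
  using eF_linG[of "-1" G 0 G T] by simp
lemma eF_neg: "eF G (\<lambda>a b c d. - S a b c d) = - eF G S"
  using eF_sm[of G "-1" S] by simp
lemma eF_in: "subsp S \<Longrightarrow> (\<And>a b c d. \<lbrakk>a < N; b < N; c < N; d < N\<rbrakk> \<Longrightarrow> G a b c d \<in> S) \<Longrightarrow> eF G T \<in> S"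
  unfolding eF_def by (intro subsp_sum subsp_sm) simp_all
lemma e2_eF: "e2 N T = eF W T" by (simp add: e2_def eF_def W_def)

definition d4 :: "nat \<Rightarrow> nat \<Rightarrow> nat \<Rightarrow> nat \<Rightarrow> tensor4" where
  "d4 i j k l = (\<lambda>a b c d. if a = i \<and> b = j \<and> c = k \<and> d = l then 1 else 0)"
lemma eF_d4: assumes "i < N" "j < N" "k < N" "l < N" shows "eF G (d4 i j k l) = G i j k l"
proof -
  have "d4 i j k l a b c d \<cdot> G a b c d = (if d = l then if c = k then if b = j then if a = i then G i j k l else 0 else 0 else 0 else 0)" for a b c d
    by (simp add: d4_def)
  then show ?thesis unfolding eF_def using assms by (simp only: sum.delta' sum.delta finite_lessThan lessThan_iff if_True)
qed

definition sy :: "tensor4 \<Rightarrow> tensor4" where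
  "sy T = (\<lambda>a b c d. (1/8) * ((T a b c d - t1 T a b c d - t3 T a b c d + t1 (t3 T) a b c d)
     + ht (\<lambda>a b c d. T a b c d - t1 T a b c d - t3 T a b c d + t1 (t3 T) a b c d) a b c d))"
lemma symbol2_sy: "symbol2 m f = sy (\<lambda>a b c d. f [(a, b), (c, d)])"
  unfolding symbol2_def sy_def t1_def t3_def ht_def Let_def by (intro ext) (simp add: field_simps)

lemma sym2g_t: assumes "T \<in> sym2g m n" shows "t1 T = (\<lambda>a b c d. - T a b c d)" "t3 T = (\<lambda>a b c d. - T a b c d)" "ht T = T"
  unfolding t1_def t3_def ht_def
  by (intro ext; subst sym2gD[OF assms]; simp add: sgn_b_def conj_commute)+

lemma sw_Sy: "sw1 Sy = (\<lambda>a b c d. - Sy a b c d)" "sw3 Sy = (\<lambda>a b c d. - Sy a b c d)" "hs Sy = Sy"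
  unfolding sw1_def sw3_def hs_def
  by (intro ext; subst Sy_sym; simp add: s_def sgn_b_def conj_commute)+
lemma sw_PL: "sw1 PL = (\<lambda>a b c d. - PL a b c d)" "sw2 PL = (\<lambda>a b c d. - PL a b c d)" "sw3 PL = (\<lambda>a b c d. - PL a b c d)"
  unfolding sw1_def sw2_def sw3_def
  by (intro ext; subst PL_sym; simp add: s_def sgn_b_def conj_commute)+
lemma sw_negG: "sw1 (\<lambda>a b c d. - G a b c d) = (\<lambda>a b c d. - sw1 G a b c d)"
  "sw2 (\<lambda>a b c d. - G a b c d) = (\<lambda>a b c d. - sw2 G a b c d)"
  "sw3 (\<lambda>a b c d. - G a b c d) = (\<lambda>a b c d. - sw3 G a b c d)"
  by (simp_all add: sw1_def sw2_def sw3_def fun_eq_iff)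
lemma hs_PL: "hs PL = PL" unfolding hs_eq sw_PL sw_negG by simp
lemma t_neg: "t1 (\<lambda>a b c d. - T a b c d) = (\<lambda>a b c d. - t1 T a b c d)" "t2 (\<lambda>a b c d. - T a b c d) = (\<lambda>a b c d. - t2 T a b c d)"
  by (simp_all add: t1_def t2_def)

lemma eF_sy: assumes "sw1 G = (\<lambda>a b c d. - G a b c d)" "sw3 G = (\<lambda>a b c d. - G a b c d)" "hs G = G"
  shows "eF G (sy T) = eF G T"
  unfolding sy_def eF_sm eF_add eF_diff eF_ht eF_t1 eF_t3 assms sw_negG eF_negG
  by (simp add: fr.scale_left_distrib[symmetric] fr.scale_right_distrib)
lemma eF_Sy: assumes T: "T \<in> sym2g m n" shows "eF Sy T = 8 \<cdot> eF W T"
proof -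
  have "Sy = (\<lambda>a b c d. Wa a b c d + hs Wa a b c d)" by (intro ext) (simp add: Sy_def hs_def)
  moreover have "Wa = (\<lambda>a b c d. (W a b c d - sw1 W a b c d) - (sw3 W a b c d - sw3 (sw1 W) a b c d))"
    by (intro ext) (simp add: Wa_def sw1_def sw3_def algebra_simps)
  ultimately show ?thesis
    by (simp add: eF_addG eF_diffG eF_ht[symmetric] eF_t1[symmetric] eF_t3[symmetric] sym2g_t[OF T] t_neg eF_neg)
      (rule poly_mapping_eqI, simp add: lk_simps)
qed
lemma PL_eq: "PL = (\<lambda>a b c d. Sy a b c d + sw1 (sw2 Sy) a b c d - sw2 Sy a b c d)"
proof (intro ext)
  fix a b c d show "PL a b c d = Sy a b c d + sw1 (sw2 Sy) a b c d - sw2 Sy a b c d"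
    by (cases "pr a"; cases "pr b"; cases "pr c") (simp_all add: PL_def sw1_def sw2_def s_def)
qed
text \<open>24 is 3 times 8: against an antisymmetric tensor the three summands of \<open>PL\<close>
  agree, and each \<open>Sy\<close> amounts to 8 plain products.\<close>

lemma eF_PL_anti: assumes B: "anti4 m B" "supp4 N B" shows "eF PL B = 24 \<cdot> e2 N B"
proof -
  have t: "t1 B = (\<lambda>a b c d. - B a b c d)" "t2 B = (\<lambda>a b c d. - B a b c d)"
    unfolding t1_def t2_def by (intro ext; subst anti4D[OF B(1)]; simp add: sgn_b_def conj_commute)+
  have "eF PL B = 3 \<cdot> eF Sy B"
    unfolding PL_eq eF_addG eF_diffG eF_t1[symmetric] eF_t2[symmetric] t t_neg eF_neg
    by (rule poly_mapping_eqI) (simp add: lk_simps)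
  then show ?thesis unfolding eF_Sy[OF anti4_sym2g[OF B]] e2_eF by simp
qed
lemma eF_PL_q: "eF PL (qmap m T) = eF PL T"
proof -
  have "qmap m T = (\<lambda>a b c d. (1/3) * (T a b c d + t1 (t2 T) a b c d - t2 T a b c d))"
  proof (intro ext)
    fix a b c d show "qmap m T a b c d = (1/3) * (T a b c d + t1 (t2 T) a b c d - t2 T a b c d)"
      unfolding qmap_def t1_def t2_def by (cases "par m a"; cases "par m b"; cases "par m c") simp_all
  qed
  then have "eF PL (qmap m T) = (1/3) \<cdot> (eF PL T + eF PL T + eF PL T)"
    by (simp only: eF_sm eF_add eF_diff eF_t1 eF_t2 sw_PL sw_negG eF_negG minus_minus diff_minus_eq_add)
  then show ?thesis by (simp only:) (rule poly_mapping_eqI, simp add: lk_simps)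
qed
lemma e2_q: assumes T: "T \<in> sym2g m n" shows "24 \<cdot> e2 N (qmap m T) = eF PL T"
  using eF_PL_anti[OF qmap_anti[OF T] qmap_supp[OF sym2gD(4)[OF T]]] eF_PL_q[of T] by simp

lemma sy_supp: "supp4 N T \<Longrightarrow> supp4 N (sy T)" unfolding supp4_def sy_def t1_def t3_def ht_def by simp
lemma sy_sym2g: assumes "supp4 N T" shows "sy T \<in> sym2g m n"
proof (rule sym2gI[OF sy_supp[OF assms]])
  fix a b c d
  show "sy T a b c d = - sgn_b (par m a \<and> par m b) * sy T b a c d"
    unfolding sy_def t1_def t3_def ht_def by (cases "par m a"; cases "par m b"; cases "par m c"; cases "par m d") simp_all
  show "sy T a b c d = - sgn_b (par m c \<and> par m d) * sy T a b d c"
    unfolding sy_def t1_def t3_def ht_def by (cases "par m a"; cases "par m b"; cases "par m c"; cases "par m d") simp_all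
  show "sy T a b c d = sgn_b ((par m a \<noteq> par m b) \<and> (par m c \<noteq> par m d)) * sy T c d a b"
    unfolding sy_def t1_def t3_def ht_def by (cases "par m a"; cases "par m b"; cases "par m c"; cases "par m d") simp_all
qed
lemma sy_fix: assumes T: "T \<in> sym2g m n" shows "sy T = T"
proof -
  have "t1 (t3 T) = T" unfolding sym2g_t[OF T] t_neg by simp
  moreover have "ht (\<lambda>a b c d. 4 * T a b c d) = (\<lambda>a b c d. 4 * ht T a b c d)" unfolding ht_def by (intro ext) simp
  ultimately show ?thesis unfolding sy_def by (simp add: sym2g_t[OF T])
qed
lemma sy_lin: "sy (\<lambda>a b c d. x * S a b c d + y * T a b c d) = (\<lambda>a b c d. x * sy S a b c d + y * sy T a b c d)"
  unfolding sy_def t1_def t3_def ht_def by (intro ext) (simp add: algebra_simps)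
lemma d4_supp: "i < N \<Longrightarrow> j < N \<Longrightarrow> k < N \<Longrightarrow> l < N \<Longrightarrow> supp4 N (d4 i j k l)" by (auto simp: supp4_def d4_def)

lemma PL_e2: assumes "i < N" "j < N" "k < N" "l < N"
  shows "PL i j k l = 24 \<cdot> e2 N (qmap m (sy (d4 i j k l)))"
  unfolding e2_q[OF sy_sym2g[OF d4_supp[OF assms]]] eF_sy[OF sw_PL(1,3) hs_PL] eF_d4[OF assms] ..

lemma eF_phi: "eF Sy (phimap m h X) = (\<Sum>a<N. \<Sum>d<N. X a d \<cdot> TR a d)"
proof -
  let ?F = "\<lambda>a b c d. h b c * X a d"
  have "phimap m h X = (\<lambda>a b c d. (1/4) * (?F a b c d - t1 ?F a b c d - t3 ?F a b c d + t1 (t3 ?F) a b c d))"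
    unfolding phimap_def t1_def t3_def by (intro ext) (simp add: mult_ac)
  then have "eF Sy (phimap m h X) = (1/4) \<cdot> (eF Sy ?F + eF Sy ?F + eF Sy ?F + eF Sy ?F)"
    by (simp only: eF_sm eF_add eF_diff eF_t1 eF_t3 sw_Sy sw_negG eF_negG minus_minus diff_minus_eq_add)
  also have "\<dots> = eF Sy ?F" by (rule poly_mapping_eqI) (simp add: lk_simps)
  also have "\<dots> = (\<Sum>a<N. \<Sum>d<N. X a d \<cdot> TR a d)"
  proof -
    have "(\<Sum>b<N. \<Sum>c<N. \<Sum>d<N. (h b c * X a d) \<cdot> Sy a b c d) = (\<Sum>d<N. X a d \<cdot> TR a d)" for a
    proof -
      have "(\<Sum>b<N. \<Sum>c<N. \<Sum>d<N. (h b c * X a d) \<cdot> Sy a b c d) = (\<Sum>b<N. \<Sum>d<N. \<Sum>c<N. (h b c * X a d) \<cdot> Sy a b c d)"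
        by (rule sum.cong[OF refl], rule sum.swap)
      also have "\<dots> = (\<Sum>d<N. \<Sum>b<N. \<Sum>c<N. (h b c * X a d) \<cdot> Sy a b c d)" by (rule sum.swap)
      finally show ?thesis by (simp add: TR_def fr.scale_sum_right mult.commute)
    qed
    then show ?thesis unfolding eF_def by simp
  qed
  finally show ?thesis .
qed
lemma e2_phi: assumes X: "X \<in> sym_vec m n" shows "8 \<cdot> e2 N (phimap m h X) = (\<Sum>a<N. \<Sum>d<N. X a d \<cdot> TR a d)"
  using eF_Sy[OF phi_sym2g[OF X]] eF_phi[of X] by (simp add: e2_eF)

lemma ssym_half: "i < N \<Longrightarrow> l < N \<Longrightarrow> (\<lambda>a d. (1/2) * ssym i l a d) \<in> sym_vec m n"
  using sym_vec_lin[OF ssym_sym ssym_sym, of i l i l "1/2" 0] by simp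
lemma TR_e2: assumes il: "i < N" "l < N" shows "TR i l = 8 \<cdot> e2 N (phimap m h (\<lambda>a d. (1/2) * ssym i l a d))"
proof -
  have d: "(\<Sum>a<N. \<Sum>d<N. dlt i l a d \<cdot> TR a d) = TR i l" if "i < N" "l < N" for i l
  proof -
    have "dlt i l a d \<cdot> TR a d = (if d = l then if a = i then TR i l else 0 else 0)" for a d by (simp add: dlt_def)
    then show ?thesis using that by (simp only: sum.delta' sum.delta finite_lessThan lessThan_iff if_True)
  qed
  have half: "(1/2) \<cdot> (x + x) = x" for x :: fr by (rule poly_mapping_eqI) (simp add: lk_simps)
  have "(\<Sum>a<N. \<Sum>d<N. ((1/2) * ssym i l a d) \<cdot> TR a d) = (1/2) \<cdot> ((\<Sum>a<N. \<Sum>d<N. dlt i l a d \<cdot> TR a d) + s i l \<cdot> (\<Sum>a<N. \<Sum>d<N. dlt l i a d \<cdot> TR a d))"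
    unfolding ssym_def by (simp only: fr.scale_left_distrib fr.scale_right_distrib sum.distrib fr.scale_sum_right distrib_left fr.scale_scale)
  also have "\<dots> = TR i l" unfolding d[OF il] d[OF il(2,1)] TR_sym[of l i]
    by (simp add: s_def sgn_b_def half)
  finally show ?thesis unfolding e2_phi[OF ssym_half[OF il]] by simp
qed

lemma trv_swap: "(\<Sum>a<N. \<Sum>d<N. X a d * h d a) = trv X"
  unfolding trv_def by (subst sum.swap) (simp add: mult.commute)

lemma lam_eq: "lam m n = (4 - MM) / 2 * k2"
  unfolding lam_def k2_def MM_def by (simp add: field_simps)

text \<open>Split \<open>T\<close> into its three components. The component in the image of
  \<open>q\<close> is a combination of \<open>PL\<close>, the one in the image of \<phi> a
  combination of \<open>TR\<close>. The constant \<open>(4 - M) h\<close> paired with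
  \<open>XT T\<close> is \<open>(4 - M) * 4 * k2\<close> times the double trace of \<open>T\<close>;
  division by 8 gives the coefficient \<open>lam m n\<close>.\<close>

theorem quadric_in:
  assumes S: "subsp S" and P: "\<And>a b c d. \<lbrakk>a < N; b < N; c < N; d < N\<rbrakk> \<Longrightarrow> PL a b c d \<in> S"
    and R: "\<And>a d. \<lbrakk>a < N; d < N\<rbrakk> \<Longrightarrow> TR a d - ((4 - MM) * h d a) \<cdot> 1 \<in> S" and T: "T \<in> sym2g m n"
  shows "e2 N T - e2 N (Cp T) - (lam m n * trv (tr T)) \<cdot> 1 \<in> S"
proof -
  let ?X = "XT T"
  have "eF PL T \<in> S" by (rule eF_in[OF S P])
  then have q: "e2 N (qmap m T) \<in> S" using subsp_sm_iff[OF S, of 24] unfolding e2_q[OF T, symmetric] by simp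
  have "(\<Sum>a<N. \<Sum>d<N. ?X a d \<cdot> (TR a d - ((4 - MM) * h d a) \<cdot> 1)) \<in> S"
    by (intro subsp_sum[OF S] subsp_sm[OF S] R) simp_all
  also have "(\<Sum>a<N. \<Sum>d<N. ?X a d \<cdot> (TR a d - ((4 - MM) * h d a) \<cdot> 1)) =
     (\<Sum>a<N. \<Sum>d<N. ?X a d \<cdot> TR a d) - ((4 - MM) * (\<Sum>a<N. \<Sum>d<N. ?X a d * h d a)) \<cdot> 1"
    by (simp add: fr.scale_right_diff_distrib sum_subtractf fr.scale_sum_left sum_distrib_left mult_ac)
  also have "\<dots> = 8 \<cdot> (e2 N (phimap m h ?X) - (lam m n * trv (tr T)) \<cdot> 1)"
    unfolding e2_phi[OF XT_sym[OF T], symmetric] trv_swap trv_XT lam_eq by (simp add: fr.scale_right_diff_distrib)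
  finally have p: "e2 N (phimap m h ?X) - (lam m n * trv (tr T)) \<cdot> 1 \<in> S" using subsp_sm_iff[OF S, of 8] by simp
  have "e2 N T - e2 N (Cp T) = e2 N (qmap m T) + e2 N (phimap m h ?X)"
    unfolding e2_eF Cp_def eF_diff by simp
  then have e: "e2 N T - e2 N (Cp T) - (lam m n * trv (tr T)) \<cdot> 1 = e2 N (qmap m T) + (e2 N (phimap m h ?X) - (lam m n * trv (tr T)) \<cdot> 1)" by simp
  show ?thesis unfolding e by (rule subsp_add[OF S q p])
qed

end

section \<open>Symbols of quadratic elements and the generators of the Joseph ideal\<close>

context ospM
begin

definition cf :: "fr \<Rightarrow> tensor4" where "cf y = (\<lambda>a b c d. lk y [(a, b), (c, d)])"

lemma symbol2_cf: "symbol2 m (lk y) = sy (cf y)" unfolding symbol2_sy cf_def ..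
lemma cf_lin: "cf (x \<cdot> f + y \<cdot> g) = (\<lambda>a b c d. x * cf f a b c d + y * cf g a b c d)"
  by (simp add: cf_def lk_simps)
lemma cf_supp: "y \<in> Nsp \<Longrightarrow> supp4 N (cf y)"
  unfolding supp4_def cf_def Nsp_lk inN_def by (auto simp: not_less)
lemma cf_e2: "supp4 N T \<Longrightarrow> cf (e2 N T) = T" by (simp add: cf_def lk_e2 emb2_def)
lemma e2_cf: assumes "y \<in> Nsp" shows "e2 N (cf y) = tp 2 y"
proof (rule poly_mapping_eqI)
  fix w
  have "emb2 (cf y) w = (if length w = 2 then lk y w else 0)"
  proof (cases "length w = 2")
    case True
    then obtain u v where "w = [u, v]" by (auto simp: numeral_2_eq_2 length_Suc_conv)
    then show ?thesis by (simp add: emb2_def cf_def)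
  qed (simp add: emb2_def)
  then show "lk (e2 N (cf y)) w = lk (tp 2 y) w" by (simp add: lk_e2[OF cf_supp[OF assms]] lk_top)
qed

lemma sy_0: "sy (\<lambda>a b c d. 0) = (\<lambda>a b c d. 0)" by (simp add: sy_def t1_def t3_def ht_def)
lemma Cp_0: "Cp (\<lambda>a b c d. 0) = zero4" using Cp_lin[of 0 zero4 0 zero4] by (simp add: zero4_def)
lemma sy_ht: "sy (ht T) = sy T"
proof (intro ext)
  fix a b c d show "sy (ht T) a b c d = sy T a b c d"
    unfolding sy_def t1_def t3_def ht_def by (cases "par m a"; cases "par m b"; cases "par m c"; cases "par m d") simp_all
qed
lemma sy_t13: "t1 T = T \<or> t3 T = T \<Longrightarrow> sy T = (\<lambda>a b c d. 0)"
proof -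
  have "t1 (t3 T) = t3 (t1 T)" by (simp add: t1_def t3_def mult_ac)
  then show "t1 T = T \<or> t3 T = T \<Longrightarrow> sy T = (\<lambda>a b c d. 0)"
    unfolding sy_def by (auto simp: ht_def)
qed

text \<open>The conditions on the parts of degree 0 and 1 make this space stable under multiplication.\<close>
definition good :: "fr set" where
  "good = {y. lk y [] = 0 \<and> (\<forall>a b. lk y [(a, b)] = sgn_b (par m a \<and> par m b) * lk y [(b, a)]) \<and> Cp (sy (cf y)) = zero4}"

lemma goodI:
  assumes "lk y [] = 0" "\<And>a b. lk y [(a, b)] = sgn_b (par m a \<and> par m b) * lk y [(b, a)]" "Cp (sy (cf y)) = zero4"
  shows "y \<in> good"
  unfolding good_def mem_Collect_eq using assms by (intro conjI allI)

lemma good_lin: assumes "f \<in> good" "g \<in> good" shows "x \<cdot> f + y \<cdot> g \<in> good"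
proof (rule goodI)
  have 0: "lk f [] = 0" "lk g [] = 0" "Cp (sy (cf f)) = zero4" "Cp (sy (cf g)) = zero4" using assms unfolding good_def by blast+
  fix a b
  have f: "lk f [(a, b)] = sgn_b (par m a \<and> par m b) * lk f [(b, a)]" and g: "lk g [(a, b)] = sgn_b (par m a \<and> par m b) * lk g [(b, a)]"
    using assms unfolding good_def by blast+
  show "lk (x \<cdot> f + y \<cdot> g) [(a, b)] = sgn_b (par m a \<and> par m b) * lk (x \<cdot> f + y \<cdot> g) [(b, a)]"
    unfolding lk_simps by (subst f, subst g) (simp only: distrib_left mult.left_commute)
  show "lk (x \<cdot> f + y \<cdot> g) [] = 0" using 0(1,2) by (simp add: lk_simps)
  show "Cp (sy (cf (x \<cdot> f + y \<cdot> g))) = zero4" unfolding cf_lin sy_lin Cp_lin 0(3,4) by (simp add: zero4_def)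
qed
lemma subsp_good: "subsp good"
proof -
  have 0: "0 \<in> good" by (simp add: good_def cf_def sy_0 Cp_0)
  then show ?thesis unfolding subsp_def using good_lin[of _ _ 1 1] good_lin[OF _ 0, of _ _ 0] by simp
qed
lemma good_mult: assumes y: "y \<in> good" shows "r * y \<in> good" "y * r \<in> good"
proof -
  have y0: "lk y [] = 0" and y1: "\<And>a b. lk y [(a, b)] = sgn_b (par m a \<and> par m b) * lk y [(b, a)]"
    and y2: "Cp (sy (cf y)) = zero4" using y unfolding good_def by blast+
  have m0: "lk (u * v) [] = lk u [] * lk v []" for u v by (simp add: lk_mult tmul_def)
  have m1: "lk (u * v) [x] = lk u [] * lk v [x] + lk u [x] * lk v []" for u v x
    by (simp add: lk_mult tmul_def)
  have m2: "lk (u * v) [x, x'] = lk u [] * lk v [x, x'] + lk u [x] * lk v [x'] + lk u [x, x'] * lk v []" for u v x x'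
    by (simp add: lk_mult tmul_def)
  have y1': "sgn_b (par m a \<and> par m b) * lk y [(b, a)] = lk y [(a, b)]" for a b by (rule y1[symmetric])
  have "cf (r * y) = (\<lambda>a b c d. lk r [] * cf y a b c d + 1 * (lk r [(a, b)] * lk y [(c, d)]))"
    by (simp add: cf_def m2 y0)
  \<comment> \<open>The cross term is supersymmetric in its last pair because the linear part of
    \<open>y\<close> is, so the antisymmetrisation inside \<open>sy\<close> kills it.\<close>
  moreover have "t3 (\<lambda>a b c d. lk r [(a, b)] * lk y [(c, d)]) = (\<lambda>a b c d. lk r [(a, b)] * lk y [(c, d)])"
    unfolding t3_def by (intro ext) (simp only: mult.left_commute[of "sgn_b _"] y1')
  ultimately have "Cp (sy (cf (r * y))) = zero4"
    using sy_t13[of "\<lambda>a b c d. lk r [(a, b)] * lk y [(c, d)]"] by (simp only: sy_lin Cp_lin y2 Cp_0) (simp add: zero4_def Cp_0[unfolded zero4_def])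
  then show "r * y \<in> good"
  proof (rule goodI[rotated 2])
    show "lk (r * y) [] = 0" unfolding m0 y0 by simp
    show "lk (r * y) [(a, b)] = sgn_b (par m a \<and> par m b) * lk (r * y) [(b, a)]" for a b
      unfolding m1 y0 by (subst y1) simp
  qed
  have "cf (y * r) = (\<lambda>a b c d. lk r [] * cf y a b c d + 1 * (lk y [(a, b)] * lk r [(c, d)]))"
    by (simp add: cf_def m2 y0 mult.commute add.commute)
  moreover have "t1 (\<lambda>a b c d. lk y [(a, b)] * lk r [(c, d)]) = (\<lambda>a b c d. lk y [(a, b)] * lk r [(c, d)])"
    unfolding t1_def by (intro ext) (simp only: mult.assoc[symmetric] y1')
  ultimately have "Cp (sy (cf (y * r))) = zero4"
    using sy_t13[of "\<lambda>a b c d. lk y [(a, b)] * lk r [(c, d)]"] by (simp only: sy_lin Cp_lin y2 Cp_0) (simp add: zero4_def Cp_0[unfolded zero4_def])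
  then show "y * r \<in> good"
  proof (rule goodI[rotated 2])
    show "lk (y * r) [] = 0" unfolding m0 y0 by simp
    show "lk (y * r) [(a, b)] = sgn_b (par m a \<and> par m b) * lk (y * r) [(b, a)]" for a b
      unfolding m1 y0 by (subst y1) simp
  qed
qed

lemma good_r1: assumes "i < N" "j < N" shows "r1 i j \<in> good"
proof (rule goodI)
  show "lk (r1 i j) [(a, b)] = sgn_b (par m a \<and> par m b) * lk (r1 i j) [(b, a)]" for a b
    unfolding r1_def lk_simps lk_E s_par[OF assms]
    by (cases "par m i"; cases "par m j"; cases "a = i"; cases "b = j"; cases "a = j"; cases "b = i") simp_all
  show "lk (r1 i j) [] = 0" by (simp add: r1_def lk_simps lk_E)
  have "cf (r1 i j) = (\<lambda>a b c d. 0)" by (simp add: cf_def r1_def lk_simps lk_E)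
  then show "Cp (sy (cf (r1 i j))) = zero4" by (simp only: sy_0 Cp_0)
qed
lemma good_r2: assumes "i < N" "j < N" "k < N" "l < N" shows "r2 i j k l \<in> good"
proof -
  have "cf (r2 i j k l) = (\<lambda>a b c d. 1 * d4 i j k l a b c d + (-1) * ht (d4 i j k l) a b c d)"
    unfolding cf_def r2_def lk_simps lk_EE ht_def d4_def
    using pr_par[OF assms(1)] pr_par[OF assms(2)] pr_par[OF assms(3)] pr_par[OF assms(4)]
    by (intro ext) (auto simp: conj_commute)
  then have "sy (cf (r2 i j k l)) = (\<lambda>a b c d. 0)" by (simp only: sy_lin sy_ht) simp
  then show ?thesis unfolding good_def by (simp add: r2_def lk_simps lk_EE Cp_0)
qed
lemma good_e2: assumes "T \<in> sym2g m n" "Cp T = zero4" shows "e2 N T \<in> good"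
  using assms sym2gD(4)[OF assms(1)] by (simp add: good_def cf_e2 sy_fix lk_e2 emb2_def)
lemma good_PL: "i < N \<Longrightarrow> j < N \<Longrightarrow> k < N \<Longrightarrow> l < N \<Longrightarrow> PL i j k l \<in> good"
  by (subst PL_e2, assumption+, intro subsp_sm[OF subsp_good] good_e2 qmap_sym2g Cp_q sy_sym2g d4_supp, assumption+)
lemma good_TR: "i < N \<Longrightarrow> l < N \<Longrightarrow> TR i l \<in> good"
  by (subst TR_e2, assumption+, intro subsp_sm[OF subsp_good] good_e2 phi_sym2g Cp_phi ssym_half, assumption+)

text \<open>Passes from the leading term in the free algebra to the symmetrised symbol: by the
  assumed congruence for \<open>Sy\<close>, the two differ by an element of \<open>S\<close> and a
  bracket term of lower degree.\<close>

lemma symbol_lift: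
  assumes S: "subsp S" and r: "\<And>a b c d. \<lbrakk>a < N; b < N; c < N; d < N\<rbrakk> \<Longrightarrow> Sy a b c d - (8 \<cdot> W a b c d - 4 \<cdot> D a b (E c d)) \<in> S"
    and y: "y \<in> Nsp" "Dlt 3 y" "y \<in> S"
  shows "\<exists>g. Dlt 2 g \<and> e2 N (sy (cf y)) + g \<in> S"
proof -
  let ?D = "\<lambda>a b c d. D a b (E c d)"
  let ?d = "eF ?D (cf y)"
  have "eF (\<lambda>a b c d. Sy a b c d - (8 \<cdot> W a b c d - 4 \<cdot> ?D a b c d)) (cf y) \<in> S" by (rule eF_in[OF S r])
  also have "(\<lambda>a b c d. Sy a b c d - (8 \<cdot> W a b c d - 4 \<cdot> ?D a b c d)) = (\<lambda>a b c d. Sy a b c d - (8 \<cdot> W a b c d + (-4) \<cdot> ?D a b c d))"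
    by (simp add: fun_eq_iff)
  also have "eF \<dots> (cf y) = eF Sy (cf y) - (8 \<cdot> eF W (cf y) + (-4) \<cdot> ?d)" unfolding eF_diffG eF_linG ..
  also have "eF Sy (cf y) = 8 \<cdot> e2 N (sy (cf y))"
    using eF_sy[OF sw_Sy, of "cf y"] eF_Sy[OF sy_sym2g[OF cf_supp[OF y(1)]]] by (simp add: e2_eF)
  also have "eF W (cf y) = tp 2 y" using e2_cf[OF y(1)] by (simp add: e2_eF)
  finally have 1: "8 \<cdot> e2 N (sy (cf y)) - (8 \<cdot> tp 2 y + (-4) \<cdot> ?d) \<in> S" .
  define g where "g = (y - tp 2 y) + (1/2) \<cdot> ?d"
  have "Dlt 2 (?D a b c d)" for a b c d using Dlt_D[of 2 "E c d" a b] Dlt_wd[of "[(c,d)]" 2] by (simp add: E_def)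
  then have "Dlt 2 ?d" unfolding eF_def by (intro Dlt_sum Dlt_sm)
  then have "Dlt 2 g" unfolding g_def using y(2) by (intro Dlt_add Dlt_sm Dlt_top) (simp_all add: eval_nat_numeral)
  moreover have "e2 N (sy (cf y)) + g = (1/8) \<cdot> (8 \<cdot> e2 N (sy (cf y)) - (8 \<cdot> tp 2 y + (-4) \<cdot> ?d)) + y"
    by (rule poly_mapping_eqI) (simp add: g_def lk_simps algebra_simps)
  then have "e2 N (sy (cf y)) + g \<in> S" using subsp_add[OF S subsp_sm[OF S 1] y(3)] by simp
  ultimately show ?thesis by blast
qed

lemma sum_block_swap:
  fixes F :: "nat \<Rightarrow> nat \<Rightarrow> nat \<Rightarrow> nat \<Rightarrow> complex"
  shows "(\<Sum>x<k. \<Sum>y<k. \<Sum>u<k. \<Sum>v<k. F x y u v) = (\<Sum>v<k. \<Sum>u<k. \<Sum>y<k. \<Sum>x<k. F x y u v)"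
proof -
  have "(\<Sum>x<k. \<Sum>y<k. \<Sum>u<k. \<Sum>v<k. F x y u v) = (\<Sum>y<k. \<Sum>x<k. \<Sum>v<k. \<Sum>u<k. F x y u v)"
    by (subst sum.swap) (intro sum.cong refl sum.swap)
  also have "\<dots> = (\<Sum>y<k. \<Sum>v<k. \<Sum>x<k. \<Sum>u<k. F x y u v)" by (rule sum.cong[OF refl], rule sum.swap)
  also have "\<dots> = (\<Sum>v<k. \<Sum>y<k. \<Sum>x<k. \<Sum>u<k. F x y u v)" by (rule sum.swap)
  also have "\<dots> = (\<Sum>v<k. \<Sum>y<k. \<Sum>u<k. \<Sum>x<k. F x y u v)" by (rule sum.cong[OF refl], rule sum.cong[OF refl], rule sum.swap)
  also have "\<dots> = (\<Sum>v<k. \<Sum>u<k. \<Sum>y<k. \<Sum>x<k. F x y u v)" by (rule sum.cong[OF refl], rule sum.swap)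
  finally show ?thesis .
qed

lemma trv_tr: "trv (tr T) = (\<Sum>b<N. \<Sum>c<N. \<Sum>b'<N. \<Sum>c'<N. h b c * (h b' c' * T c c' b' b))"
  unfolding trv_def tr_def by (simp only: sum_distrib_left)
lemma trv_tr_ht: "trv (tr (ht T)) = trv (tr T)"
proof -
  have "trv (tr (ht T)) = (\<Sum>b<N. \<Sum>c<N. \<Sum>b'<N. \<Sum>c'<N. h c' b' * (h c b * T b' b c c'))"
    unfolding trv_tr
  proof (intro sum.cong refl)
    fix b c b' c'
    show "h b c * (h b' c' * ht T c c' b' b) = h c' b' * (h c b * T b' b c c')"
      unfolding ht_def hp_sym[where b=c and a=b] hp_sym[where b=c' and a=b']
      by (cases "par m b = par m c"; cases "par m b' = par m c'"; cases "par m b"; cases "par m b'") (simp_all add: hp_par)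
  qed
  also have "\<dots> = trv (tr T)" unfolding trv_tr by (rule sum_block_swap)
  finally show ?thesis .
qed
text \<open>The double contraction is unchanged when the two factors are exchanged, so it may be
  computed on the plain tensor product, where it is the invariant form.\<close>

lemma trv_tr_ssq: "trv (tr (ssq (tens X Y))) = inv_form m n h X Y"
proof -
  have "ssq (tens X Y) = (\<lambda>a b c d. (1/2) * tens X Y a b c d + (1/2) * ht (tens X Y) a b c d)"
    unfolding ssq_def ht_def by (intro ext) (simp add: field_simps)
  then have "trv (tr (ssq (tens X Y))) = trv (tr (tens X Y))" by (simp only: tr_lin trv_lin trv_tr_ht) simp
  also have "\<dots> = inv_form m n h X Y"
  proof -
    have "(\<Sum>c<N. \<Sum>b'<N. \<Sum>c'<N. h b c * (h b' c' * tens X Y c c' b' b)) = (\<Sum>b'<N. (\<Sum>c<N. \<Sum>d<N. h b c * h b' d * X c d) * Y b' b)" for b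
      by (subst sum.swap) (simp add: sum_distrib_right tens_def mult.assoc)
    then show ?thesis unfolding trv_tr inv_form_def by simp
  qed
  finally show ?thesis .
qed

text \<open>The Joseph relation of a symmetric tensor \<open>T\<close>. The generator for
  \<open>X\<close> and \<open>Y\<close> is twice its value at the symmetric part of their tensor
  product (\<open>generator_eq\<close>), and linearity in \<open>T\<close> gives access to all other
  symmetric tensors.\<close>

definition \<Gamma> :: "tensor4 \<Rightarrow> fr" where "\<Gamma> T = e2 N T - e2 N (Cp T) - (lam m n * trv (tr T)) \<cdot> 1"

lemma \<Gamma>_lin: "\<Gamma> (\<lambda>a b c d. x * S a b c d + y * T a b c d) = x \<cdot> \<Gamma> S + y \<cdot> \<Gamma> T"
  unfolding \<Gamma>_def e2_eF Cp_lin tr_lin trv_lin eF_lin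
  by (rule poly_mapping_eqI) (simp add: lk_simps algebra_simps)

lemma generator_eq:
  assumes X: "X \<in> osp m n" "homog m X p" and Y: "Y \<in> osp m n" "homog m Y p'"
  shows "(\<lambda>w. emb2 (tens X Y) w + sgn_b (p \<and> p') * emb2 (tens Y X) w - 2 * emb2 (cartan_prod m n h X Y) w
     - 2 * lam m n * inv_form m n h X Y * tconst 1 w) = lk (2 \<cdot> \<Gamma> (ssq (tens X Y)))"
proof (intro ext)
  fix w
  let ?S = "ssq (tens X Y)"
  have S: "?S \<in> sym2g m n" "supp4 N ?S" using cartan_prod_eq(2)[OF X(1) Y(1)] by (simp_all add: sym2gD)
  have C: "supp4 N (Cp ?S)" using Cp_cartan[OF S(1)] by (simp add: cartan1_def sym2gD)
  have "tens X Y a b c d + sgn_b (p \<and> p') * tens Y X a b c d = 2 * ?S a b c d" for a b c d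
  proof (cases "X c d = 0 \<or> Y a b = 0")
    case False
    then have "(par m c \<noteq> par m d) = p" "(par m a \<noteq> par m b) = p'" using X(2) Y(2) unfolding homog_def by blast+
    then show ?thesis by (auto simp: ssq_def tens_def sgn_b_def)
  qed (auto simp: ssq_def tens_def)
  then have "emb2 (tens X Y) w + sgn_b (p \<and> p') * emb2 (tens Y X) w = 2 * emb2 ?S w" by (simp add: emb2_def)
  then show "emb2 (tens X Y) w + sgn_b (p \<and> p') * emb2 (tens Y X) w - 2 * emb2 (cartan_prod m n h X Y) w
     - 2 * lam m n * inv_form m n h X Y * tconst 1 w = lk (2 \<cdot> \<Gamma> ?S) w"
    unfolding cartan_prod_eq(1)[OF X(1) Y(1)] \<Gamma>_def trv_tr_ssq
    by (simp add: lk_simps lk_e2[OF S(2)] lk_e2[OF C] lk_const right_diff_distrib mult.assoc)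
qed

lemma sy_d4: assumes "i < N" "j < N" "k < N" "l < N" shows "sy (d4 i j k l) = ssq (tens (asym i j) (asym k l))"
proof -
  have 1: "d4 i j k l a b c d - t1 (d4 i j k l) a b c d - t3 (d4 i j k l) a b c d + t1 (t3 (d4 i j k l)) a b c d
     = 4 * tens (asym i j) (asym k l) a b c d" for a b c d
  proof -
    have d: "sgn_b (par m a \<and> par m b) * dlt i j b a = s i j * dlt j i a b" if "i < N" "j < N" for i j a b
      unfolding s_par[OF that] dlt_def by (cases "a = j"; cases "b = i") (simp_all add: conj_commute)
    have e: "d4 i j k l a b c d = dlt i j a b * dlt k l c d" for a b c d
      unfolding d4_def dlt_def by (cases "a = i"; cases "b = j"; cases "c = k"; cases "d = l") simp_all
    have "d4 i j k l a b c d - t1 (d4 i j k l) a b c d - t3 (d4 i j k l) a b c d + t1 (t3 (d4 i j k l)) a b c d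
      = (dlt i j a b - sgn_b (par m a \<and> par m b) * dlt i j b a) * (dlt k l c d - sgn_b (par m c \<and> par m d) * dlt k l d c)"
      unfolding t1_def t3_def e by (simp add: algebra_simps)
    then show ?thesis unfolding d[OF assms(1,2)] d[OF assms(3,4)] by (simp add: tens_def asym_def)
  qed
  show ?thesis unfolding sy_def 1 ht_def ssq_def by (intro ext) (simp add: field_simps)
qed

text \<open>A symmetrised elementary tensor is the symmetric part of a product of two homogeneous
  elements (\<open>sy_d4\<close>), so a generator covers it; expanding \<open>T\<close> in
  elementary tensors finishes by linearity.\<close>

lemma \<Gamma>_in:
  assumes J: "is_tideal N J" "joseph_gens m n h \<subseteq> J" and sp: "subsp (fS J)" and T: "T \<in> sym2g m n"
  shows "\<Gamma> T \<in> fS J"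
proof -
  have g: "\<Gamma> (sy (d4 i j k l)) \<in> fS J" if "i < N" "j < N" "k < N" "l < N" for i j k l
  proof -
    have "lk (2 \<cdot> \<Gamma> (ssq (tens (asym i j) (asym k l)))) \<in> joseph_gens m n h"
      unfolding joseph_gens_def mem_Collect_eq
      using generator_eq[OF asym_osp[OF that(1,2)] asym_homog[OF that(1,2)] asym_osp[OF that(3,4)] asym_homog[OF that(3,4)], symmetric]
        asym_osp[OF that(1,2)] asym_homog[OF that(1,2)] asym_osp[OF that(3,4)] asym_homog[OF that(3,4)] by (intro exI conjI)
    then have "2 \<cdot> \<Gamma> (sy (d4 i j k l)) \<in> fS J" using J(2) by (auto simp: fS_def sy_d4[OF that])
    then show ?thesis using subsp_sm_iff[OF sp, of 2] by simp
  qed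
  let ?F = "{..<N} \<times> {..<N} \<times> {..<N} \<times> {..<N}"
  have sums: "finite F \<Longrightarrow> F \<subseteq> ?F \<Longrightarrow> \<Gamma> (sy (\<lambda>a b c d. \<Sum>(i,j,k,l)\<in>F. T i j k l * d4 i j k l a b c d)) \<in> fS J" for F
  proof (induction F rule: finite_induct)
    case empty
    have "\<Gamma> (\<lambda>a b c d. 0) = 0" using \<Gamma>_lin[of 0 zero4 0 zero4] by simp
    then show ?case by (simp add: sy_0 subsp_0[OF sp])
  next
    case (insert p F)
    obtain i j k l where p: "p = (i, j, k, l)" by (cases p)
    have "\<Gamma> (sy (\<lambda>a b c d. T i j k l * d4 i j k l a b c d + 1 * (\<Sum>(i,j,k,l)\<in>F. T i j k l * d4 i j k l a b c d))) \<in> fS J"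
      unfolding sy_lin \<Gamma>_lin using insert p by (intro subsp_add[OF sp] subsp_sm[OF sp] g) auto
    then show ?case using insert(1,2) by (simp add: p)
  qed
  have "(\<Sum>(i,j,k,l)\<in>?F. T i j k l * d4 i j k l a b c d) = T a b c d" for a b c d
  proof -
    have "(\<Sum>(i,j,k,l)\<in>?F. T i j k l * d4 i j k l a b c d) = (\<Sum>p\<in>?F. if p = (a,b,c,d) then T a b c d else 0)"
      by (rule sum.cong[OF refl]) (auto simp: d4_def split: if_splits)
    also have "\<dots> = T a b c d" using sym2gD(4)[OF T] unfolding supp4_def by (simp add: sum.delta) (meson not_less)
    finally show ?thesis .
  qed
  then show ?thesis using sums[of ?F] by (simp add: sy_fix[OF T])
qed

text \<open>On a tensor with vanishing Cartan component, the Joseph relation is the quadratic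
  element plus a constant, hence a lift. \<open>PL\<close> and \<open>TR\<close> come from such
  tensors.\<close>

lemma lifts_J:
  assumes J: "is_tideal N J" "joseph_gens m n h \<subseteq> J" and sp: "subsp (fS J)"
  shows "\<lbrakk>i < N; j < N; k < N; l < N\<rbrakk> \<Longrightarrow> \<exists>g. Dlt 2 g \<and> PL i j k l + g \<in> fS J"
    "\<lbrakk>i < N; l < N\<rbrakk> \<Longrightarrow> \<exists>g. Dlt 2 g \<and> TR i l + g \<in> fS J"
proof -
  have c: "\<exists>g. Dlt 2 g \<and> x \<cdot> e2 N T + g \<in> fS J" if T: "T \<in> sym2g m n" "Cp T = zero4" for T x
  proof -
    let ?g = "(- x * (lam m n * trv (tr T))) \<cdot> 1"
    have "e2 N (Cp T) = 0" unfolding T(2) by (simp add: e2_def zero4_def)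
    then have "x \<cdot> \<Gamma> T = x \<cdot> e2 N T + ?g" unfolding \<Gamma>_def by (simp add: fr.scale_right_diff_distrib)
    moreover have "Dlt 2 ?g" using Dlt_sm[OF Dlt_wd[of "[]" 2]] by (simp add: Dlt_neg)
    ultimately show ?thesis using subsp_sm[OF sp \<Gamma>_in[OF J sp T(1)], of x] by (intro exI[of _ ?g]) simp
  qed
  show "\<lbrakk>i < N; j < N; k < N; l < N\<rbrakk> \<Longrightarrow> \<exists>g. Dlt 2 g \<and> PL i j k l + g \<in> fS J"
    by (subst PL_e2, assumption+, intro c qmap_sym2g Cp_q sy_sym2g d4_supp, assumption+)
  show "\<lbrakk>i < N; l < N\<rbrakk> \<Longrightarrow> \<exists>g. Dlt 2 g \<and> TR i l + g \<in> fS J"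
    by (subst TR_e2, assumption+, intro c phi_sym2g Cp_phi ssym_half, assumption+)
qed

lemma gens_in:
  assumes sp: "subsp (fS K)" and P: "\<And>a b c d. \<lbrakk>a < N; b < N; c < N; d < N\<rbrakk> \<Longrightarrow> PL a b c d \<in> fS K"
    and R: "\<And>a d. \<lbrakk>a < N; d < N\<rbrakk> \<Longrightarrow> TR a d - ((4 - MM) * h d a) \<cdot> 1 \<in> fS K"
  shows "joseph_gens m n h \<subseteq> K"
proof
  fix f assume "f \<in> joseph_gens m n h"
  then obtain X Y p p' where "f = (\<lambda>w. emb2 (tens X Y) w + sgn_b (p \<and> p') * emb2 (tens Y X) w - 2 * emb2 (cartan_prod m n h X Y) w
     - 2 * lam m n * inv_form m n h X Y * tconst 1 w)" and xy: "X \<in> osp m n" "homog m X p" "Y \<in> osp m n" "homog m Y p'"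
    unfolding joseph_gens_def by blast
  then have "f = lk (2 \<cdot> \<Gamma> (ssq (tens X Y)))" using generator_eq[OF xy] by simp
  moreover have "\<Gamma> (ssq (tens X Y)) \<in> fS K"
    unfolding \<Gamma>_def by (rule quadric_in[OF sp P R cartan_prod_eq(2)[OF xy(1,3)]])
  then have "2 \<cdot> \<Gamma> (ssq (tens X Y)) \<in> fS K" by (rule subsp_sm[OF sp])
  ultimately show "f \<in> K" by (simp add: fS_def)
qed

end

lemma subsp_Dlt: "subsp {x. Dlt l x}" by (simp add: subsp_def Dlt_add Dlt_sm)

section \<open>Transfer between the given and the canonical metric\<close>

locale full = bchange m n gm h P + c: canon m n h for m n gm h P +
  fixes R :: tensor2
  assumes P_supp': "\<And>i a. \<not> i < dimN m n \<Longrightarrow> P i a = 0"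
    and PR: "\<And>k i. k < dimN m n \<Longrightarrow> i < dimN m n \<Longrightarrow> (\<Sum>a<dimN m n. P k a * R a i) = (if k = i then 1 else 0)"
    and RP: "\<And>k i. k < dimN m n \<Longrightarrow> i < dimN m n \<Longrightarrow> (\<Sum>a<dimN m n. R k a * P a i) = (if k = i then 1 else 0)"
begin

sublocale gM: ospM m n gm using c.Mpos by unfold_locales

text \<open>Substituting by the inverse matrix recovers the original family, so membership in a
  subspace can be read off from the substituted one.\<close>

lemma T_inv_in: assumes S: "subsp S" and G: "\<And>a. a < N \<Longrightarrow> T a G \<in> S" and i: "i < N" shows "G i \<in> S"
proof -
  have "Tm N R i (\<lambda>a. T a G) = (\<Sum>k<N. (\<Sum>a<N. P k a * R a i) \<cdot> G k)"
    unfolding Tm_def fr.scale_sum_right fr.scale_sum_left by (subst sum.swap) (simp add: mult.commute)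
  also have "\<dots> = (\<Sum>k<N. if k = i then G k else 0)" using PR i by (intro sum.cong) auto
  also have "\<dots> = G i" using i by simp
  finally have "Tm N R i (\<lambda>a. T a G) = G i" .
  moreover have "Tm N R i (\<lambda>a. T a G) \<in> S" by (intro Tm_in[OF S] G)
  ultimately show ?thesis by simp
qed
lemma T2_inv_in: assumes S: "subsp S" and G: "\<And>a b. a < N \<Longrightarrow> b < N \<Longrightarrow> T a (\<lambda>i. T b (\<lambda>j. G i j)) \<in> S" and i: "i < N" "j < N"
  shows "G i j \<in> S"
proof -
  have "T b (\<lambda>j. G i j) \<in> S" if "b < N" for b
    by (rule T_inv_in[OF S _ i(1), where G="\<lambda>i. T b (\<lambda>j. G i j)"]) (rule G[OF _ that])
  then show ?thesis by (rule T_inv_in[OF S _ i(2)])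
qed
lemma T4_inv_in: assumes S: "subsp S" and F: "\<And>a b c d. \<lbrakk>a < N; b < N; c < N; d < N\<rbrakk> \<Longrightarrow> T4 F a b c d \<in> S"
    and i: "i < N" "j < N" "k < N" "l < N" shows "F i j k l \<in> S"
proof -
  have "T c (\<lambda>k. T d (\<lambda>l. F i j k l)) \<in> S" if cd: "c < N" "d < N" for c d
  proof (rule T2_inv_in[OF S _ i(1,2), where G="\<lambda>i j. T c (\<lambda>k. T d (\<lambda>l. F i j k l))"])
    fix a b assume "a < N" "b < N"
    then show "T a (\<lambda>i. T b (\<lambda>j. T c (\<lambda>k. T d (\<lambda>l. F i j k l)))) \<in> S" using F[OF _ _ cd] by (simp add: T4_def)
  qed
  then show ?thesis by (rule T2_inv_in[OF S _ i(3,4)])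
qed

lemma theta_inv: "y \<in> g.Nsp \<Longrightarrow> theta (th N R y) = y" by (rule g.th_inverse[OF PR])

lemma thf_sm: "thf F G \<Longrightarrow> thf (\<lambda>a b c d. x \<cdot> F a b c d) (\<lambda>a b c d. x \<cdot> G a b c d)"
  unfolding thf_def T4_def by (simp add: flinD[OF flin_th] Tm_sm)

context
  fixes K
  assumes K: "is_tideal N K" "U_rels m n gm \<subseteq> K"
begin

lemmas KD = g.U_rels_D[OF K]
lemmas sp = KD(1)
lemmas LLo = LL_oideal[OF K]

lemma lk_ex: assumes "f \<in> K" shows "\<exists>y. y \<in> g.Nsp \<and> y \<in> fS K \<and> lk y = f"
proof -
  have "f \<in> talg_carrier N" using assms K(1) unfolding is_tideal_def by blast
  then obtain y where "y \<in> g.Nsp" "lk y = f" using g.carrier_ex by blast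
  then show ?thesis using assms by (auto simp: fS_def)
qed

lemma Sy_in: assumes "i < N" "j < N" "k < N" "l < N"
  shows "g.Sy i j k l - (8 \<cdot> g.W i j k l - 4 \<cdot> g.D i j (E k l)) \<in> fS K"
proof (rule T4_inv_in[OF sp _ assms, where F="\<lambda>a b c d. g.Sy a b c d - (8 \<cdot> g.W a b c d - 4 \<cdot> g.D a b (E c d))"])
  fix a b c d
  have "theta (h.Sy a b c d - (8 \<cdot> h.W a b c d - 4 \<cdot> h.D a b (E c d))) \<in> fS K"
    using h.Sy_oideal[OF LLo] by (simp add: LL_def)
  then show "T4 (\<lambda>a b c d. g.Sy a b c d - (8 \<cdot> g.W a b c d - 4 \<cdot> g.D a b (E c d))) a b c d \<in> fS K"
    using thf_diff[OF thf_Sy thf_diff[OF thf_sm[OF thf_W, of 8] thf_sm[OF thf_D, of 4]]] unfolding thf_def by simp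
qed

lemma lift_pull: assumes th: "theta x + y \<in> fS K" "Dlt l y" shows "\<exists>g. Dlt l g \<and> x + g \<in> LL K"
proof -
  have "y = (theta x + y) - theta x" by simp
  also have "\<dots> \<in> g.Nsp" by (rule subsp_diff[OF g.subsp_Nsp KD(2)[OF th(1)] g.Nsp_th])
  finally have "theta (x + th N R y) = theta x + y" by (simp add: flinD[OF flin_th] theta_inv)
  then show ?thesis using th Dlt_th[OF th(2)] by (intro exI[of _ "th N R y"]) (simp add: LL_def)
qed

lemma lift_PL:
  assumes "\<And>i j k l. \<lbrakk>i < N; j < N; k < N; l < N\<rbrakk> \<Longrightarrow> \<exists>g. Dlt 2 g \<and> g.PL i j k l + g \<in> fS K"
  shows "\<exists>g. Dlt 2 g \<and> h.PL a b c d + g \<in> LL K"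
proof -
  \<comment> \<open>Lifts are chosen as a function of the indices, so that the substitution in all
    four indices can be applied to the remainders as well.\<close>
  define G where "G i j k l = (SOME g. Dlt 2 g \<and> g.PL i j k l + g \<in> fS K)" for i j k l
  have G: "Dlt 2 (G i j k l) \<and> g.PL i j k l + G i j k l \<in> fS K" if "i < N" "j < N" "k < N" "l < N" for i j k l
    unfolding G_def by (rule someI_ex[OF assms[OF that]])
  have "T4 (\<lambda>i j k l. g.PL i j k l + G i j k l) a b c d \<in> fS K" using G by (intro T4_in[OF sp]) blast
  then have "theta (h.PL a b c d) + T4 G a b c d \<in> fS K" using thf_PL unfolding T4_add thf_def by simp
  moreover have "T4 G a b c d \<in> {x. Dlt 2 x}" using G by (intro T4_in[OF subsp_Dlt]) blast
  ultimately show ?thesis by (intro lift_pull) auto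
qed
lemma lift_TR:
  assumes "\<And>i l. \<lbrakk>i < N; l < N\<rbrakk> \<Longrightarrow> \<exists>g. Dlt 2 g \<and> g.TR i l + g \<in> fS K"
  shows "\<exists>g. Dlt 2 g \<and> h.TR a d + g \<in> LL K"
proof -
  define G where "G i l = (SOME g. Dlt 2 g \<and> g.TR i l + g \<in> fS K)" for i l
  have G: "Dlt 2 (G i l)" "g.TR i l + G i l \<in> fS K" if "i < N" "l < N" for i l
    using someI_ex[OF assms[OF that]] unfolding G_def by blast+
  have "T a (\<lambda>i. T d (\<lambda>l. g.TR i l + G i l)) \<in> fS K" by (intro Tm_in[OF sp] G)
  then have "theta (h.TR a d) + T a (\<lambda>i. T d (\<lambda>l. G i l)) \<in> fS K" unfolding Tm_add th_TR .
  moreover have "T a (\<lambda>i. T d (\<lambda>l. G i l)) \<in> {x. Dlt 2 x}" by (intro Tm_in[OF subsp_Dlt]) (simp add: G)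
  ultimately show ?thesis by (intro lift_pull) auto
qed

text \<open>The link between the two descriptions of the graded ideal: \<open>I\<close> is given by
  generators, while the symbols are controlled by the projection \<open>Cp\<close>.\<close>

lemma theta_I_good: "x \<in> h.I \<Longrightarrow> theta x \<in> gM.good"
proof (induction rule: h.I.induct)
  case (I_letter a b)
  then have "theta (E a b) = 0" by (auto simp: th_E Xl_def T_out) (simp add: Tm_def)
  then show ?case using subsp_0[OF gM.subsp_good] by simp
next
  case (I_r1 a b) show ?case unfolding th_r1 by (intro Tm_in[OF gM.subsp_good] gM.good_r1)
next
  case (I_r2 a b c d)
  have "T4 g.r2 a b c d \<in> gM.good" by (intro T4_in[OF gM.subsp_good] gM.good_r2)
  then show ?case using thf_r2 unfolding thf_def by simp
next
  case (I_PL a b c d)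
  have "T4 g.PL a b c d \<in> gM.good" by (intro T4_in[OF gM.subsp_good] gM.good_PL)
  then show ?case using thf_PL unfolding thf_def by simp
next
  case (I_TR a d) show ?case unfolding th_TR by (intro Tm_in[OF gM.subsp_good] gM.good_TR)
next
  case I_zero show ?case using subsp_0[OF gM.subsp_good] by (simp add: flinD[OF flin_th])
next
  case (I_add f g) then show ?case using subsp_add[OF gM.subsp_good] by (simp add: flinD[OF flin_th])
next
  case (I_left f r) then show ?case by (simp add: th_mult gM.good_mult)
next
  case (I_right f r) then show ?case by (simp add: th_mult gM.good_mult)
qed

lemma gr2_ex:
  assumes V: "V \<in> gr2 m K" shows "\<exists>y. y \<in> g.Nsp \<and> y \<in> fS K \<and> Dlt 3 y \<and> V = gM.sy (gM.cf y)"
proof -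
  obtain f where f: "f \<in> K" "deg_le 2 f" "V = symbol2 m f" using V unfolding gr2_def by blast
  obtain y where y: "y \<in> g.Nsp" "y \<in> fS K" "lk y = f" using lk_ex[OF f(1)] by blast
  have "Dlt 3 y" using f(2) unfolding deg_le_def Dlt_def y(3) by fastforce
  then show ?thesis using y f(3) gM.symbol2_cf[of y] by auto
qed

text \<open>A complement of the Cartan product need not a priori be the span of the images of
  \<open>q\<close> and \<phi>. Leading terms of degree 2 lie in \<open>I\<close>, though, so their
  Cartan component vanishes; this pins the graded piece down.\<close>

lemma gr2_Cp:
  assumes zz: "E 0 1 ^ 2 \<notin> LL K" and V: "V \<in> gr2 m K" shows "gM.Cp V = zero4"
proof -
  obtain y where y: "y \<in> g.Nsp" "y \<in> fS K" "Dlt 3 y" "V = gM.sy (gM.cf y)" using gr2_ex[OF V] by blast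
  let ?x = "th N R y"
  have "?x \<in> LL K" using y theta_inv[OF y(1)] by (simp add: LL_def)
  moreover have "Dlt (Suc 2) ?x" using Dlt_th[OF y(3)] by (simp add: eval_nat_numeral)
  ultimately have "tp 2 ?x \<in> h.I" by (rule c.leading_in_I[OF LLo zz])
  then have "theta (tp 2 ?x) \<in> gM.good" by (rule theta_I_good)
  then have "tp 2 y \<in> gM.good" unfolding tp_th[symmetric] theta_inv[OF y(1)] .
  moreover have "gM.cf (tp 2 y) = gM.cf y" by (simp add: gM.cf_def lk_top)
  ultimately show ?thesis unfolding y(4) gM.good_def by simp
qed

text \<open>In a splitting \<open>Q = V + W\<close> given by the hypothesis, \<open>Cp\<close>
  annihilates \<open>Q\<close> and \<open>V\<close> and fixes \<open>W\<close>; hence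
  \<open>W = 0\<close> and \<open>Q\<close> itself is a symbol of the ideal.\<close>

lemma lift_ker:
  assumes zz: "E 0 1 ^ 2 \<notin> LL K"
    and dec: "{(\<lambda>a b c d. V a b c d + W a b c d) | V W. V \<in> gr2 m K \<and> W \<in> cartan1 m n gm} = sym2g m n"
    and Q: "Q \<in> sym2g m n" "gM.Cp Q = zero4"
  shows "\<exists>g. Dlt 2 g \<and> x \<cdot> e2 N Q + g \<in> fS K"
proof -
  have "Q \<in> {(\<lambda>a b c d. V a b c d + W a b c d) | V W. V \<in> gr2 m K \<and> W \<in> cartan1 m n gm}" using Q(1) dec by simp
  then obtain V W where VW: "Q = (\<lambda>a b c d. V a b c d + W a b c d)" "V \<in> gr2 m K" "W \<in> cartan1 m n gm" by blast
  have "gM.Cp Q = (\<lambda>a b c d. gM.Cp V a b c d + gM.Cp W a b c d)" using gM.Cp_lin[of 1 V 1 W] unfolding VW(1) by simp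
  then have "W = zero4" unfolding gr2_Cp[OF zz VW(2)] gM.Cp_id[OF VW(3)] Q(2) by (simp add: zero4_def fun_eq_iff)
  then have "Q = V" unfolding VW(1) by (simp add: zero4_def)
  then obtain y where y: "y \<in> g.Nsp" "y \<in> fS K" "Dlt 3 y" "Q = gM.sy (gM.cf y)" using gr2_ex[OF VW(2)] by blast
  obtain g where g: "Dlt 2 g" "e2 N Q + g \<in> fS K" using gM.symbol_lift[OF sp Sy_in y(1,3,2)] unfolding y(4) by blast
  have "x \<cdot> e2 N Q + x \<cdot> g \<in> fS K" using subsp_sm[OF sp g(2), of x] by (simp add: fr.scale_right_distrib)
  then show ?thesis using Dlt_sm[OF g(1)] by blast
qed

text \<open>The symbol of \<open>z ^ 2\<close> is the square of the bivector \<open>A\<close>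
  spanned by the isotropic columns \<open>u\<close> and \<open>v\<close> of \<open>P\<close>, so it
  lies in the Cartan product. If \<open>z ^ 2\<close> were in the ideal, it would also lie in the
  graded piece and vanish, and \<open>A = 0\<close> contradicts the independence of the
  columns.\<close>

lemma z2_notin: assumes "gr2 m K \<inter> cartan1 m n gm = {zero4}" shows "E 0 1 ^ 2 \<notin> LL K"
proof
  assume zL: "E 0 1 ^ 2 \<in> LL K"
  define u where "u = (\<lambda>i. P i 0)"
  define v where "v = (\<lambda>i. P i 1)"
  define B where "B = (\<lambda>i j k l. u i * v j * u k * v l)"
  define A where "A = (\<lambda>i j. (1/2) * (u i * v j - v i * u j))"
  have mN: "0 < m" "1 < m" "0 < N" "1 < N" using c.m7 by (simp_all add: dimN_def)
  have u0: "u i = 0" "v i = 0" if "par m i" for i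
  proof -
    have "g.pr i \<or> \<not> i < N" using that by (auto simp: g.pr_def par_def)
    moreover have "\<not> g.pr 0" "\<not> g.pr 1" using mN by (simp_all add: g.pr_def)
    ultimately show "u i = 0" "v i = 0" using P_par[of i 0] P_par[of i 1] P_supp'[of i] unfolding u_def v_def by blast+
  qed
  have supp: "supp4 N B" unfolding supp4_def B_def using P_supp' by (auto simp: not_less u_def v_def)
  have "theta (E 0 1 ^ 2) = theta (g.W 0 1 0 1)" by (simp add: g.W_def power2_eq_square)
  also have "\<dots> = T4 g.W 0 1 0 1" using thf_W unfolding thf_def by simp
  also have "\<dots> = e2 N B" unfolding T4_def Tm_def e2_def B_def g.W_def u_def v_def by (simp add: fr.scale_sum_right mult.assoc)
  finally have th: "e2 N B \<in> fS K" using zL by (simp add: LL_def)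
  have BA: "gM.sy B = (\<lambda>a b c d. A a b * A c d)"
  proof (intro ext)
    fix a b c d show "gM.sy B a b c d = A a b * A c d"
      unfolding gM.sy_def gM.t1_def gM.t3_def gM.ht_def B_def A_def
      by (cases "par m a"; cases "par m b"; cases "par m c"; cases "par m d") (simp_all add: u0 algebra_simps)
  qed
  have "gM.sy B \<in> gr2 m K"
  proof -
    have "lk (e2 N B) \<in> {f \<in> K. deg_le 2 f}" using th by (simp add: fS_def lk_e2[OF supp] deg_le_def emb2_def)
    moreover have "symbol2 m (lk (e2 N B)) = gM.sy B" by (simp add: gM.symbol2_cf gM.cf_e2[OF supp])
    ultimately show ?thesis unfolding gr2_def using imageI[of "lk (e2 N B)" _ "symbol2 m"] by simp
  qed
  moreover have "gM.sy B \<in> cartan1 m n gm"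
  proof -
    have gz: "(\<Sum>b<N. \<Sum>c<N. gm b c * (P c x * P b y)) = 0" if "x \<in> {0,1}" "y \<in> {0,1}" for x y
    proof -
      have "(\<Sum>b<N. \<Sum>c<N. gm b c * (P c x * P b y)) = (\<Sum>c<N. \<Sum>b<N. P c x * P b y * gm b c)"
        by (subst sum.swap) (simp add: mult_ac)
      also have "\<dots> = h y x" using that mN by (intro Pgh) auto
      also have "\<dots> = 0" using that mN by (auto simp: c.hcan tw_def)
      finally show ?thesis .
    qed
    have "(\<Sum>b<N. \<Sum>c<N. gm b c * gM.sy B a c b d) = 0" for a d
    proof -
      have "(\<Sum>b<N. \<Sum>c<N. gm b c * gM.sy B a c b d) = (\<Sum>b<N. \<Sum>c<N. ((1/4) * (u a * v d)) * (gm b c * (v c * u b))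
         - ((1/4) * (u a * u d)) * (gm b c * (v c * v b)) - ((1/4) * (v a * v d)) * (gm b c * (u c * u b)) + ((1/4) * (v a * u d)) * (gm b c * (u c * v b)))"
        unfolding BA A_def by (intro sum.cong refl) (simp add: algebra_simps)
      also have "\<dots> = ((1/4) * (u a * v d)) * 0 - ((1/4) * (u a * u d)) * 0 - ((1/4) * (v a * v d)) * 0 + ((1/4) * (v a * u d)) * 0"
        unfolding sum.distrib sum_subtractf sum_distrib_left[symmetric] using gz[of 1 0] gz[of 1 1] gz[of 0 0] gz[of 0 1] unfolding u_def v_def by simp
      finally show ?thesis by simp
    qed
    moreover have "qmap m (gM.sy B) = zero4"
    proof (intro ext)
      fix a b c d show "qmap m (gM.sy B) a b c d = zero4 a b c d"
        unfolding BA qmap_def A_def zero4_def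
        by (cases "par m a"; cases "par m b"; cases "par m c"; cases "par m d") (simp_all add: u0 algebra_simps)
    qed
    ultimately show ?thesis using gM.sy_sym2g[OF supp] unfolding cartan1_def by simp
  qed
  ultimately have "gM.sy B = zero4" using assms by blast
  then have "A a b * A a b = 0" for a b unfolding BA zero4_def by (meson)
  then have e: "v a * u b = u a * v b" for a b by (simp add: A_def)
  have vz: "v b = 0" for b
  proof -
    have "v b = (\<Sum>a<N. R 0 a * u a) * v b" using RP[of 0 0] mN by (simp add: u_def)
    also have "\<dots> = (\<Sum>a<N. R 0 a * (u a * v b))" by (simp add: sum_distrib_right mult.assoc)
    also have "\<dots> = (\<Sum>a<N. R 0 a * v a) * u b" unfolding e[symmetric] by (simp add: sum_distrib_right mult.assoc)
    also have "(\<Sum>a<N. R 0 a * v a) = 0" using RP[of 0 1] mN by (simp add: v_def)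
    finally show ?thesis by simp
  qed
  have "(\<Sum>a<N. R 1 a * v a) = 1" using RP[of 1 1] mN by (simp add: v_def)
  then show False unfolding vz by simp
qed

lemma inf_LL: assumes inf: "inf_codim N K" shows "\<exists>f. \<forall>g. Dlt l g \<longrightarrow> f - g \<notin> LL K"
proof (rule ccontr)
  assume neg: "\<not> (\<exists>f. \<forall>g. Dlt l g \<longrightarrow> f - g \<notin> LL K)"
  let ?k = "\<lambda>w. lk (wd w)"
  define Wd where "Wd = {w. set w \<subseteq> {..<N} \<times> {..<N} \<and> length w \<le> l}"
  have finW: "finite Wd" unfolding Wd_def by (rule finite_lists_length_le) simp
  have inN: "g.inN w \<longleftrightarrow> set w \<subseteq> {..<N} \<times> {..<N}" for w by (auto simp: g.inN_def)
  \<comment> \<open>\<open>cspan\<close> indexes its coefficients by the spanning functions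
    themselves, so the word has to be recovered from its function.\<close>
  have inj: "inj ?k"
  proof (rule injI)
    fix u v assume "?k u = ?k v"
    then have "?k u u = ?k v u" by simp
    then show "u = v" by (simp add: lookup_wd split: if_splits)
  qed
  have "\<exists>y\<in>cspan (?k ` Wd). \<exists>k\<in>K. x = tadd y k" if x: "x \<in> talg_carrier N" for x
  proof -
    obtain y where y: "y \<in> g.Nsp" "lk y = x" using g.carrier_ex[OF x] by blast
    obtain g where g: "Dlt l g" "th N R y - g \<in> LL K" using neg by blast
    have k: "y - theta g \<in> fS K" using g(2) by (simp add: LL_def flinD[OF flin_th] theta_inv[OF y(1)])
    have "lk (theta g) w = (\<Sum>p\<in>?k ` Wd. lk (theta g) (inv ?k p) * p w)" for w
    proof -
      have z: "lk (theta g) w = 0" if "w \<notin> Wd"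
      proof (rule ccontr)
        assume "lk (theta g) w \<noteq> 0"
        then have "g.inN w" "length w < l" using g.Nsp_th[of P g] Dlt_th[OF g(1), of N P] unfolding g.Nsp_lk Dlt_def by blast+
        then show False using that by (simp add: Wd_def inN)
      qed
      have "(\<Sum>p\<in>?k ` Wd. lk (theta g) (inv ?k p) * p w) = (\<Sum>v\<in>Wd. lk (theta g) v * ?k v w)"
        by (subst sum.reindex[OF inj_on_subset[OF inj subset_UNIV]]) (simp add: inv_f_f[OF inj])
      also have "\<dots> = (\<Sum>v\<in>Wd. if v = w then lk (theta g) w else 0)" by (intro sum.cong) (auto simp: lookup_wd)
      also have "\<dots> = lk (theta g) w" using finW z by simp
      finally show ?thesis by simp
    qed
    then have "lk (theta g) \<in> cspan (?k ` Wd)"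
      unfolding cspan_def mem_Collect_eq by (intro exI[of _ "\<lambda>p. lk (theta g) (inv ?k p)"] ext)
    moreover have "x = tadd (lk (theta g)) (lk (y - theta g))" by (simp add: tadd_def lk_simps y(2))
    ultimately show ?thesis using k by (auto simp: fS_def)
  qed
  moreover have "?k ` Wd \<subseteq> talg_carrier N" using g.Nsp_wd g.Nsp_carrier by (auto simp: Wd_def inN)
  ultimately show False using inf finW unfolding inf_codim_def by blast
qed

text \<open>The exact relations are established in canonical coordinates. Both are tensorial, the
  constant included since the metric transforms with the indices, so inverse substitution index by
  index brings them back.\<close>

lemma exact_in:
  assumes zz: "E 0 1 ^ 2 \<notin> LL K"
    and PL: "\<And>a b c d. \<exists>g. Dlt 2 g \<and> h.PL a b c d + g \<in> LL K"
    and TR: "\<And>a d. \<exists>g. Dlt 2 g \<and> h.TR a d + g \<in> LL K"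
  shows "\<lbrakk>i < N; j < N; k < N; l < N\<rbrakk> \<Longrightarrow> g.PL i j k l \<in> fS K"
    "\<lbrakk>i < N; l < N\<rbrakk> \<Longrightarrow> g.TR i l - ((4 - gM.MM) * gm l i) \<cdot> 1 \<in> fS K"
proof -
  show "g.PL i j k l \<in> fS K" if "i < N" "j < N" "k < N" "l < N"
  proof (rule T4_inv_in[OF sp _ that])
    fix a b c d assume "a < N" "b < N" "c < N" "d < N"
    then have "theta (h.PL a b c d) \<in> fS K" using c.PL_in[OF LLo zz PL TR] by (simp add: LL_def)
    then show "T4 g.PL a b c d \<in> fS K" using thf_PL unfolding thf_def by simp
  qed
  show "g.TR i l - ((4 - gM.MM) * gm l i) \<cdot> 1 \<in> fS K" if "i < N" "l < N"
  proof (rule T2_inv_in[OF sp _ that, where G="\<lambda>i l. g.TR i l - ((4 - gM.MM) * gm l i) \<cdot> 1"])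
    fix a d assume "a < N" "d < N"
    then have "h.TR a d - ((4 - c.M) * h d a) \<cdot> 1 \<in> LL K" by (rule c.TR_in[OF LLo zz PL TR])
    then have "theta (h.TR a d) - ((4 - gM.MM) * h d a) \<cdot> 1 \<in> fS K"
      by (simp add: LL_def flinD[OF flin_th] th_1 c.M_def gM.MM_def)
    also have "theta (h.TR a d) - ((4 - gM.MM) * h d a) \<cdot> 1 = T a (\<lambda>i. T d (\<lambda>l. g.TR i l - ((4 - gM.MM) * gm l i) \<cdot> 1))"
    proof -
      have "T a (\<lambda>i. T d (\<lambda>l. ((4 - gM.MM) * gm l i) \<cdot> 1)) = (4 - gM.MM) \<cdot> T a (\<lambda>i. T d (\<lambda>l. gm l i \<cdot> 1))"
        unfolding Tm_sm[symmetric] fr.scale_scale ..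
      then show ?thesis unfolding Tm_diff th_TR T_contract by simp
    qed
    finally show "T a (\<lambda>i. T d (\<lambda>l. g.TR i l - ((4 - gM.MM) * gm l i) \<cdot> 1)) \<in> fS K" .
  qed
qed

end

lemma tideal_gen_props:
  assumes K: "is_tideal k K" "S \<subseteq> K" shows "is_tideal k (tideal_gen k S)" "S \<subseteq> tideal_gen k S" "tideal_gen k S \<subseteq> K"
proof -
  have mem: "x \<in> tideal_gen k S \<longleftrightarrow> (\<forall>I. is_tideal k I \<and> S \<subseteq> I \<longrightarrow> x \<in> I)" for x
    unfolding tideal_gen_def by simp
  show sub: "tideal_gen k S \<subseteq> K" "S \<subseteq> tideal_gen k S" using K mem by blast+
  have d: "(\<lambda>w. 0) \<in> I" "x \<in> I \<Longrightarrow> y \<in> I \<Longrightarrow> tadd x y \<in> I" "x \<in> I \<Longrightarrow> tsc a x \<in> I"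
    "x \<in> I \<Longrightarrow> r \<in> talg_carrier k \<Longrightarrow> tmul r x \<in> I" "x \<in> I \<Longrightarrow> r \<in> talg_carrier k \<Longrightarrow> tmul x r \<in> I"
    if "is_tideal k I" for I x y a r using that unfolding is_tideal_def by simp_all
  have "tideal_gen k S \<subseteq> talg_carrier k" using sub(1) K(1) unfolding is_tideal_def by (elim conjE) (rule subset_trans)
  moreover have "(\<lambda>w. 0) \<in> tideal_gen k S" by (simp add: mem d(1))
  moreover have "x \<in> tideal_gen k S \<Longrightarrow> y \<in> tideal_gen k S \<Longrightarrow> tadd x y \<in> tideal_gen k S" for x y by (simp add: mem d(2))
  moreover have "x \<in> tideal_gen k S \<Longrightarrow> tsc a x \<in> tideal_gen k S" for x a by (simp add: mem d(3))
  moreover have "x \<in> tideal_gen k S \<Longrightarrow> r \<in> talg_carrier k \<Longrightarrow> tmul r x \<in> tideal_gen k S" for x r by (simp add: mem d(4))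
  moreover have "x \<in> tideal_gen k S \<Longrightarrow> r \<in> talg_carrier k \<Longrightarrow> tmul x r \<in> tideal_gen k S" for x r by (simp add: mem d(5))
  ultimately show "is_tideal k (tideal_gen k S)" unfolding is_tideal_def by (intro conjI ballI allI)
qed

theorem eq_joseph:
  assumes K: "is_tideal N K" "tideal_gen N (U_rels m n gm) \<subseteq> K" and inf: "inf_codim N K"
    and cap: "gr2 m K \<inter> cartan1 m n gm = {zero4}"
    and dec: "{(\<lambda>a b c d. V a b c d + W a b c d) | V W. V \<in> gr2 m K \<and> W \<in> cartan1 m n gm} = sym2g m n"
  shows "K = joseph_T m n gm"
proof -
  let ?J = "joseph_T m n gm"
  have U: "U_rels m n gm \<subseteq> K" using K(2) unfolding tideal_gen_def by blast
  note K' = K(1) U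
  note zz = z2_notin[OF K' cap]
  have KP: "\<exists>g. Dlt 2 g \<and> h.PL a b c d + g \<in> LL K" for a b c d
  proof (rule lift_PL[OF K'])
    fix i j k l assume i: "i < N" "j < N" "k < N" "l < N"
    show "\<exists>g. Dlt 2 g \<and> g.PL i j k l + g \<in> fS K"
      unfolding gM.PL_e2[OF i] by (intro lift_ker[OF K' zz dec] gM.Cp_q qmap_sym2g gM.sy_sym2g gM.d4_supp i)
  qed
  have KT: "\<exists>g. Dlt 2 g \<and> h.TR a d + g \<in> LL K" for a d
  proof (rule lift_TR[OF K'])
    fix i l assume i: "i < N" "l < N"
    show "\<exists>g. Dlt 2 g \<and> g.TR i l + g \<in> fS K"
      unfolding gM.TR_e2[OF i] by (intro lift_ker[OF K' zz dec] gM.Cp_phi gM.phi_sym2g gM.ssym_half i)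
  qed
  have "joseph_gens m n gm \<subseteq> K" by (rule gM.gens_in[OF sp[OF K'] exact_in[OF K' zz KP KT]])
  then have "U_rels m n gm \<union> joseph_gens m n gm \<subseteq> K" using U by blast
  note J = tideal_gen_props[OF K(1) this, folded joseph_T_def]
  have J': "is_tideal N ?J" "U_rels m n gm \<subseteq> ?J" "joseph_gens m n gm \<subseteq> ?J" using J by blast+
  note JL = gM.lifts_J[OF J'(1,3) sp[OF J'(1,2)]]
  have "LL K = LL ?J"
  proof (rule c.core_eq[OF LLo[OF K'] zz LLo[OF J'(1,2)] _ KP KT lift_PL[OF J'(1,2) JL(1)] lift_TR[OF J'(1,2) JL(2)] inf_LL[OF K' inf]])
    show "LL ?J \<subseteq> LL K" using J(3) by (auto simp: LL_def fS_def)
  qed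
  have "f \<in> ?J" if f: "f \<in> K" for f
  proof -
    obtain y where y: "y \<in> g.Nsp" "y \<in> fS K" "lk y = f" using lk_ex[OF K' f] by blast
    then have "th N R y \<in> LL K" by (simp add: LL_def theta_inv)
    then have "y \<in> fS ?J" unfolding \<open>LL K = LL ?J\<close> by (simp add: LL_def theta_inv y(1))
    then show ?thesis using y(3) by (simp add: fS_def)
  qed
  then show ?thesis using J(3) by blast
qed

end

subsection \<open>Change to a canonical basis\<close>

definition mm :: "nat \<Rightarrow> tensor2 \<Rightarrow> tensor2 \<Rightarrow> tensor2" where "mm k A B = (\<lambda>i j. \<Sum>l<k. A i l * B l j)"

lemma mm_assoc: "mm k (mm k A B) C = mm k A (mm k B C)"
proof (intro ext)
  fix i j
  have "mm k (mm k A B) C i j = (\<Sum>l<k. \<Sum>p<k. A i p * (B p l * C l j))"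
    unfolding mm_def by (simp add: sum_distrib_right mult.assoc)
  also have "\<dots> = (\<Sum>p<k. \<Sum>l<k. A i p * (B p l * C l j))" by (rule sum.swap)
  also have "\<dots> = mm k A (mm k B C) i j" unfolding mm_def by (simp add: sum_distrib_left)
  finally show "mm k (mm k A B) C i j = mm k A (mm k B C) i j" .
qed
lemma mm_add: "mm k (\<lambda>i j. A i j + B i j) C = (\<lambda>i j. mm k A C i j + mm k B C i j)"
  "mm k C (\<lambda>i j. A i j + B i j) = (\<lambda>i j. mm k C A i j + mm k C B i j)"
  unfolding mm_def by (simp_all add: distrib_left distrib_right sum.distrib)
lemma mm_scale: "mm k (\<lambda>i j. x * A i j) C = (\<lambda>i j. x * mm k A C i j)"
  "mm k C (\<lambda>i j. x * A i j) = (\<lambda>i j. x * mm k C A i j)"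
  unfolding mm_def by (simp_all add: sum_distrib_left mult_ac)
lemma mm_cross: "(\<And>i l. \<not> l < m \<Longrightarrow> X i l = 0) \<Longrightarrow> (\<And>l j. l < m \<Longrightarrow> Y l j = 0) \<Longrightarrow> mm k X Y = (\<lambda>i j. 0)"
proof (intro ext)
  fix i j assume X: "\<And>i l. \<not> l < m \<Longrightarrow> X i l = 0" and Y: "\<And>l j. l < m \<Longrightarrow> Y l j = 0"
  have "X i l * Y l j = 0" for l by (cases "l < m") (simp_all add: X Y)
  then show "mm k X Y i j = 0" unfolding mm_def by (intro sum.neutral ballI)
qed
lemma mm_cross': "(\<And>i l. l < m \<Longrightarrow> X i l = 0) \<Longrightarrow> (\<And>l j. \<not> l < m \<Longrightarrow> Y l j = 0) \<Longrightarrow> mm k X Y = (\<lambda>i j. 0)"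
proof (intro ext)
  fix i j assume X: "\<And>i l. l < m \<Longrightarrow> X i l = 0" and Y: "\<And>l j. \<not> l < m \<Longrightarrow> Y l j = 0"
  have "X i l * Y l j = 0" for l by (cases "l < m") (simp_all add: X Y)
  then show "mm k X Y i j = 0" unfolding mm_def by (intro sum.neutral ballI)
qed

text \<open>Linear polynomials in an involution \<open>G\<close> with unit \<open>I\<close>; since
  \<open>G^2 = I\<close>, they are closed under multiplication (\<open>pol_mult\<close>).\<close>

definition pol :: "tensor2 \<Rightarrow> tensor2 \<Rightarrow> complex \<Rightarrow> complex \<Rightarrow> tensor2" where
  "pol I G u v = (\<lambda>i j. u * I i j + v * G i j)"
lemma pol_mult:
  assumes "mm k I I = I" "mm k I G = G" "mm k G I = G" "mm k G G = I"
  shows "mm k (pol I G u v) (pol I G u' v') = pol I G (u * u' + v * v') (u * v' + v * u')"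
  unfolding pol_def mm_add mm_scale assms by (intro ext) (simp add: algebra_simps)

context ospl
begin

text \<open>Units and metric are split into an even and an odd block, padded by zeros. The base
  change acts on the even block only.\<close>

definition Ie :: tensor2 where "Ie = (\<lambda>i j. if i = j \<and> i < m then 1 else 0)"
definition Io :: tensor2 where "Io = (\<lambda>i j. if i = j \<and> m \<le> i \<and> i < N then 1 else 0)"
definition He :: tensor2 where "He = (\<lambda>i j. if i < m \<and> j < m then h i j else 0)"
definition Ho :: tensor2 where "Ho = (\<lambda>i j. if i < m \<and> j < m then 0 else h i j)"

lemma mN: "i < m \<Longrightarrow> i < N" by (simp add: dimN_def)
lemma Ie_out: "\<not> i < m \<Longrightarrow> Ie i j = 0" "\<not> j < m \<Longrightarrow> Ie i j = 0" by (auto simp: Ie_def)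
lemma He_out: "\<not> i < m \<Longrightarrow> He i j = 0" "\<not> j < m \<Longrightarrow> He i j = 0" by (auto simp: He_def)
lemma Io_in: "i < m \<Longrightarrow> Io i j = 0" "j < m \<Longrightarrow> Io i j = 0" by (auto simp: Io_def)
lemma metD: "par m i \<noteq> par m j \<Longrightarrow> h i j = 0" "h j i = sgn_b (par m i \<and> par m j) * h i j"
  "N \<le> i \<or> N \<le> j \<Longrightarrow> h i j = 0"
  "i < N \<Longrightarrow> j < N \<Longrightarrow> (\<Sum>a<N. h a j * h a i) = (if i = j then 1 else 0)"
  using met unfolding osp_metric_def supp2_def by blast+
lemma Ho_in: "i < m \<Longrightarrow> Ho i j = 0" "j < m \<Longrightarrow> Ho i j = 0"
  using metD(1)[of i j] by (auto simp: Ho_def par_def not_le)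
lemma Ho_out: "\<not> i < N \<Longrightarrow> Ho i j = 0" "\<not> j < N \<Longrightarrow> Ho i j = 0"
  using metD(3)[of i j] by (auto simp: Ho_def not_less)
lemma mm_Ie: "(\<And>i j. \<not> i < m \<Longrightarrow> X i j = 0) \<Longrightarrow> mm N Ie X = X" "(\<And>i j. \<not> j < m \<Longrightarrow> X i j = 0) \<Longrightarrow> mm N X Ie = X"
proof -
  have "Ie i l * X l j = (if l = i then if i < m then X i j else 0 else 0)" for i l j by (auto simp: Ie_def)
  then show "(\<And>i j. \<not> i < m \<Longrightarrow> X i j = 0) \<Longrightarrow> mm N Ie X = X" unfolding mm_def by (intro ext) (auto simp: mN)
  have "X i l * Ie l j = (if l = j then if j < m then X i j else 0 else 0)" for i l j by (auto simp: Ie_def)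
  then show "(\<And>i j. \<not> j < m \<Longrightarrow> X i j = 0) \<Longrightarrow> mm N X Ie = X" unfolding mm_def by (intro ext) (auto simp: mN)
qed
lemma mm_Io: "(\<And>i j. \<not> (m \<le> i \<and> i < N) \<Longrightarrow> X i j = 0) \<Longrightarrow> mm N Io X = X" "(\<And>i j. \<not> (m \<le> j \<and> j < N) \<Longrightarrow> X i j = 0) \<Longrightarrow> mm N X Io = X"
proof -
  have "Io i l * X l j = (if l = i then if m \<le> i \<and> i < N then X i j else 0 else 0)" for i l j by (auto simp: Io_def)
  then show "(\<And>i j. \<not> (m \<le> i \<and> i < N) \<Longrightarrow> X i j = 0) \<Longrightarrow> mm N Io X = X" unfolding mm_def by (intro ext) auto
  have "X i l * Io l j = (if l = j then if m \<le> j \<and> j < N then X i j else 0 else 0)" for i l j by (auto simp: Io_def)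
  then show "(\<And>i j. \<not> (m \<le> j \<and> j < N) \<Longrightarrow> X i j = 0) \<Longrightarrow> mm N X Io = X" unfolding mm_def by (intro ext) auto
qed
lemma mm_IoIo: "mm N Io Io = Io" by (rule mm_Io) (auto simp: Io_def)
lemma mm_Ho: "mm N Io Ho = Ho" "mm N Ho Io = Ho"
  by (rule mm_Io; metis Ho_in Ho_out not_le)+
text \<open>On even indices the metric is symmetric, so the normalisation
  \<open>g^{ab} = g_{ab}\<close> makes its matrix an involution.\<close>

lemma He_sq: "mm N He He = Ie"
proof (intro ext)
  fix i j
  show "mm N He He i j = Ie i j"
  proof (cases "i < m \<and> j < m")
    case True
    have "He i l * He l j = h l i * h l j" for l
    proof (cases "l < m")
      case l: True
      have "h i l = sgn_b (par m l \<and> par m i) * h l i" by (rule metD(2))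
      then show ?thesis using True l by (simp add: He_def par_def sgn_b_def)
    next
      case False
      then have "h l i = 0" using True metD(1)[of l i] by (simp add: par_def)
      then show ?thesis using False by (simp add: He_def)
    qed
    then have "mm N He He i j = (\<Sum>l<N. h l i * h l j)" unfolding mm_def by simp
    also have "\<dots> = (if j = i then 1 else 0)" using True mN by (intro metD(4)) auto
    finally show ?thesis using True by (auto simp: Ie_def)
  next
    case False
    then have "mm N He He i j = 0" unfolding mm_def by (intro sum.neutral ballI) (auto simp: He_def)
    then show ?thesis using False by (auto simp: Ie_def)
  qed
qed
lemma polHe: "mm N (pol Ie He u v) (pol Ie He u' v') = pol Ie He (u * u' + v * v') (u * v' + v * u')"
  by (rule pol_mult) (intro mm_Ie He_sq Ie_out He_out; assumption)+
lemma pol_out: "\<not> i < m \<Longrightarrow> pol Ie He u v i j = 0" "\<not> j < m \<Longrightarrow> pol Ie He u v i j = 0"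
  by (simp_all add: pol_def Ie_out He_out)
lemma pol_sym: "pol Ie He u v j i = pol Ie He u v i j"
proof -
  have "He j i = He i j" using metD(2)[of j i] by (simp add: He_def par_def sgn_b_def)
  moreover have "Ie j i = Ie i j" by (auto simp: Ie_def)
  ultimately show ?thesis by (simp add: pol_def)
qed

end

context
  fixes m n :: nat and gm :: tensor2
  assumes met: "osp_metric m n gm" and m7: "m \<ge> 7"
begin

text \<open>The even block becomes two hyperbolic planes plus an orthonormal rest, and the odd block
  is kept. The new block is again an involution because \<open>tw\<close> is one, as the
  normalisation of the metric demands.\<close>

definition hc :: tensor2 where
  "hc a b = (if a < m \<and> b < m then if b = tw a then 1 else 0 else gm a b)"

lemma hc_metric: "osp_metric m n hc"
proof -
  have gs: "supp2 (dimN m n) gm" and gp: "\<And>a b. par m a \<noteq> par m b \<Longrightarrow> gm a b = 0"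
    and gy: "\<And>a b. gm b a = sgn_b (par m a \<and> par m b) * gm a b"
    and gi: "\<And>b c. b < dimN m n \<Longrightarrow> c < dimN m n \<Longrightarrow> (\<Sum>a<dimN m n. gm a c * gm a b) = (if b = c then 1 else 0)"
    using met unfolding osp_metric_def by blast+
  have tw: "tw (tw a) = a" for a by (simp add: tw_def)
  have twm: "a < m \<Longrightarrow> tw a < m" for a using m7 by (auto simp: tw_def)
  have "supp2 (dimN m n) hc" using gs unfolding supp2_def hc_def by (auto simp: dimN_def)
  moreover have "hc a b = 0" if "par m a \<noteq> par m b" for a b using that gp[OF that] by (auto simp: hc_def par_def)
  moreover have "hc b a = sgn_b (par m a \<and> par m b) * hc a b" for a b
  proof (cases "a < m \<and> b < m")
    case True
    then show ?thesis using tw by (auto simp: hc_def par_def sgn_b_def)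
  next
    case False
    then have "hc b a = gm b a" "hc a b = gm a b" by (auto simp: hc_def)
    then show ?thesis using gy[of b a] by simp
  qed
  moreover have "(\<Sum>a<dimN m n. hc a c * hc a b) = (if b = c then 1 else 0)" if b: "b < dimN m n" "c < dimN m n" for b c
  proof (cases "b < m")
    case bm: True
    show ?thesis
    proof (cases "c < m")
      case cm: True
      have "hc a c * hc a b = (if a = tw c then if b = c then 1 else 0 else 0)" for a
      proof (cases "a < m")
        case True
        have "(c = tw a) = (a = tw c)" "b = tw a \<Longrightarrow> c = tw a \<Longrightarrow> b = c" using tw by metis+
        then show ?thesis using True bm cm tw by (auto simp: hc_def)
      next
        case False
        then have "hc a c = 0" "a \<noteq> tw c" using cm gp[of a c] twm[OF cm] by (auto simp: hc_def par_def)
        then show ?thesis by simp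
      qed
      then show ?thesis using twm[OF cm] by (simp add: dimN_def)
    next
      case cm: False
      have "hc a c * hc a b = 0" for a using bm cm gp[of a c] gp[of a b] by (cases "a < m") (auto simp: hc_def par_def)
      then show ?thesis using bm cm by (auto intro!: sum.neutral)
    qed
  next
    case bm: False
    show ?thesis
    proof (cases "c < m")
      case cm: True
      have "hc a c * hc a b = 0" for a using bm cm gp[of a c] gp[of a b] by (cases "a < m") (auto simp: hc_def par_def)
      then show ?thesis using bm cm by (auto intro!: sum.neutral)
    next
      case cm: False
      then have "hc a c * hc a b = gm a c * gm a b" for a using bm by (simp add: hc_def)
      then show ?thesis using gi[OF b] by simp
    qed
  qed
  ultimately show ?thesis unfolding osp_metric_def by (intro conjI allI impI)
qed

interpretation g: ospl m n gm by unfold_locales (rule met)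
interpretation h: ospl m n hc by unfold_locales (rule hc_metric)

text \<open>For an involution \<open>g\<close> the matrix \<open>\<beta> + \<alpha> g\<close> is a square root of \<open>g\<close> with inverse \<open>\<alpha> + \<beta> g\<close>; combining
  the square roots of two symmetric involutions transforms one symmetric form into the other.\<close>
definition \<alpha> :: complex where "\<alpha> = (1 - \<i>) / 2"
definition \<beta> :: complex where "\<beta> = (1 + \<i>) / 2"
lemma ab: "\<alpha> * \<beta> = 1/2" "\<beta> * \<alpha> = 1/2" "\<alpha> * \<alpha> + \<beta> * \<beta> = 0" "\<beta> * \<beta> + \<alpha> * \<alpha> = 0"
  by (simp_all add: \<alpha>_def \<beta>_def complex_eq_iff)

abbreviation (input) "pg \<equiv> pol g.Ie g.He"
abbreviation (input) "ph \<equiv> pol g.Ie h.He"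

lemma Ho_eq: "h.Ho = g.Ho"
  by (simp add: g.Ho_def h.Ho_def hc_def fun_eq_iff)

text \<open>On the even block this is \<open>G^{1/2} H^{1/2}\<close>, with \<open>G\<close> and
  \<open>H\<close> the even blocks of \<open>gm\<close> and \<open>hc\<close>, and it is the
  identity on the odd block. The roots are symmetric, so
  \<open>P^T G P = H^{1/2} G^2 H^{1/2} = H\<close>, using \<open>G^2 = 1\<close>. \<open>Pt\<close>
  is the transpose and \<open>Rm\<close> the inverse.\<close>

definition Pm :: tensor2 where "Pm = (\<lambda>i j. mm (dimN m n) (pg \<beta> \<alpha>) (ph \<alpha> \<beta>) i j + g.Io i j)"
definition Pt :: tensor2 where "Pt = (\<lambda>i j. mm (dimN m n) (ph \<alpha> \<beta>) (pg \<beta> \<alpha>) i j + g.Io i j)"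
definition Rm :: tensor2 where "Rm = (\<lambda>i j. mm (dimN m n) (ph \<beta> \<alpha>) (pg \<alpha> \<beta>) i j + g.Io i j)"

lemma Pt: "Pt j i = Pm i j"
proof -
  have "mm (dimN m n) (ph \<alpha> \<beta>) (pg \<beta> \<alpha>) j i = mm (dimN m n) (pg \<beta> \<alpha>) (ph \<alpha> \<beta>) i j"
    unfolding mm_def
  proof (intro sum.cong refl)
    fix l show "ph \<alpha> \<beta> j l * pg \<beta> \<alpha> l i = pg \<beta> \<alpha> i l * ph \<alpha> \<beta> l j"
      unfolding g.pol_sym[of _ _ l i] h.pol_sym[of _ _ j l] by (rule mult.commute)
  qed
  moreover have "g.Io j i = g.Io i j" by (auto simp: g.Io_def)
  ultimately show ?thesis by (simp add: Pt_def Pm_def)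
qed

definition ev :: "tensor2 \<Rightarrow> bool" where "ev X \<longleftrightarrow> (\<forall>i j. \<not> i < m \<or> \<not> j < m \<longrightarrow> X i j = 0)"
lemma evI: "(\<And>i j. \<not> i < m \<Longrightarrow> X i j = 0) \<Longrightarrow> (\<And>i j. \<not> j < m \<Longrightarrow> X i j = 0) \<Longrightarrow> ev X"
  unfolding ev_def by blast
lemma ev_p: "ev (pg u v)" "ev (ph u v)" "ev g.He" "ev h.He" "ev g.Ie"
  by (rule evI; simp add: g.pol_out h.pol_out g.He_out h.He_out g.Ie_out)+
lemma ev_mm: "ev X \<Longrightarrow> ev Y \<Longrightarrow> ev (mm k X Y)" unfolding ev_def mm_def by (intro allI impI sum.neutral ballI) auto
lemma cross: assumes "ev X"
  shows "mm k X g.Io = (\<lambda>i j. 0)" "mm k g.Io X = (\<lambda>i j. 0)" "mm k X g.Ho = (\<lambda>i j. 0)" "mm k g.Ho X = (\<lambda>i j. 0)"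
proof -
  have "\<not> i < m \<Longrightarrow> X i j = 0" "\<not> j < m \<Longrightarrow> X i j = 0" for i j using assms unfolding ev_def by blast+
  then show "mm k X g.Io = (\<lambda>i j. 0)" "mm k g.Io X = (\<lambda>i j. 0)" "mm k X g.Ho = (\<lambda>i j. 0)" "mm k g.Ho X = (\<lambda>i j. 0)"
    using mm_cross[where m=m] mm_cross'[where m=m] by (simp_all add: g.Io_in g.Ho_in)
qed
lemma block: assumes "ev X" "ev Y"
  shows "mm k (\<lambda>i j. X i j + g.Io i j) (\<lambda>i j. Y i j + B i j) = (\<lambda>i j. mm k X Y i j + mm k X B i j + mm k g.Io B i j)"
  unfolding mm_add cross[OF assms(2)] by (intro ext) simp

lemma polg: "mm (dimN m n) (pg u v) (pg u' v') = pg (u * u' + v * v') (u * v' + v * u')" by (rule g.polHe)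
lemma polh: "mm (dimN m n) (ph u v) (ph u' v') = ph (u * u' + v * v') (u * v' + v * u')" by (rule h.polHe)
lemma p10: "pg 1 0 = g.Ie" "ph 1 0 = g.Ie" "pg 0 1 = g.He" "ph 0 1 = h.He" by (simp_all add: pol_def)
lemma gsplit: "gm = (\<lambda>i j. g.He i j + g.Ho i j)" "hc = (\<lambda>i j. h.He i j + g.Ho i j)"
proof -
  show "gm = (\<lambda>i j. g.He i j + g.Ho i j)" by (auto simp: g.He_def g.Ho_def fun_eq_iff)
  have "hc = (\<lambda>i j. h.He i j + h.Ho i j)" by (auto simp: h.He_def h.Ho_def fun_eq_iff)
  then show "hc = (\<lambda>i j. h.He i j + g.Ho i j)" unfolding Ho_eq .
qed
lemma mIe: "ev X \<Longrightarrow> mm (dimN m n) g.Ie X = X" "ev X \<Longrightarrow> mm (dimN m n) X g.Ie = X"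
  by (rule g.mm_Ie; simp add: ev_def)+

lemma half: "(1/2) + (1/2) = (1::complex)" by simp
lemma inv1: "mm (dimN m n) (pg \<beta> \<alpha>) (pg \<alpha> \<beta>) = g.Ie" "mm (dimN m n) (ph \<alpha> \<beta>) (ph \<beta> \<alpha>) = g.Ie"
  "mm (dimN m n) (pg \<alpha> \<beta>) (pg \<beta> \<alpha>) = g.Ie" "mm (dimN m n) (ph \<beta> \<alpha>) (ph \<alpha> \<beta>) = g.Ie"
  unfolding polg polh ab half p10 by (rule refl)+
lemma sq: "mm (dimN m n) (ph \<alpha> \<beta>) (ph \<alpha> \<beta>) = h.He" "mm (dimN m n) (pg \<beta> \<alpha>) (pg \<beta> \<alpha>) = g.He"
  unfolding polg polh ab half p10 by (rule refl)+
lemma swp: "mm (dimN m n) g.He (pg \<beta> \<alpha>) = pg \<alpha> \<beta>" "mm (dimN m n) h.He (ph \<alpha> \<beta>) = ph \<beta> \<alpha>"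
  using polg[of 0 1 \<beta> \<alpha>] polh[of 0 1 \<alpha> \<beta>] unfolding p10 by simp_all

lemma PR_id: "mm (dimN m n) Pm Rm = (\<lambda>i j. g.Ie i j + g.Io i j)" "mm (dimN m n) Rm Pm = (\<lambda>i j. g.Ie i j + g.Io i j)"
proof -
  have "mm (dimN m n) (mm (dimN m n) (pg \<beta> \<alpha>) (ph \<alpha> \<beta>)) (mm (dimN m n) (ph \<beta> \<alpha>) (pg \<alpha> \<beta>)) =
      mm (dimN m n) (pg \<beta> \<alpha>) (mm (dimN m n) (mm (dimN m n) (ph \<alpha> \<beta>) (ph \<beta> \<alpha>)) (pg \<alpha> \<beta>))" by (simp only: mm_assoc)
  also have "\<dots> = g.Ie" unfolding inv1 mIe[OF ev_p(1)] ..
  finally show "mm (dimN m n) Pm Rm = (\<lambda>i j. g.Ie i j + g.Io i j)"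
    unfolding Pm_def Rm_def block[OF ev_mm[OF ev_p(1,2)] ev_mm[OF ev_p(2,1)]] cross[OF ev_mm[OF ev_p(1,2)]] g.mm_IoIo by simp
  have "mm (dimN m n) (mm (dimN m n) (ph \<beta> \<alpha>) (pg \<alpha> \<beta>)) (mm (dimN m n) (pg \<beta> \<alpha>) (ph \<alpha> \<beta>)) =
      mm (dimN m n) (ph \<beta> \<alpha>) (mm (dimN m n) (mm (dimN m n) (pg \<alpha> \<beta>) (pg \<beta> \<alpha>)) (ph \<alpha> \<beta>))" by (simp only: mm_assoc)
  also have "\<dots> = g.Ie" unfolding inv1 mIe[OF ev_p(2)] ..
  finally show "mm (dimN m n) Rm Pm = (\<lambda>i j. g.Ie i j + g.Io i j)"
    unfolding Pm_def Rm_def block[OF ev_mm[OF ev_p(2,1)] ev_mm[OF ev_p(1,2)]] cross[OF ev_mm[OF ev_p(2,1)]] g.mm_IoIo by simp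
qed

lemma PgP: "mm (dimN m n) Pt (mm (dimN m n) gm Pm) = hc"
proof -
  let ?M = "mm (dimN m n)"
  let ?B = "?M (pg \<beta> \<alpha>) (ph \<alpha> \<beta>)"
  have "?M gm Pm = ?M (\<lambda>i j. g.He i j + g.Ho i j) Pm" by (rule arg_cong[OF gsplit(1), of "\<lambda>X. ?M X Pm"])
  also have "\<dots> = (\<lambda>i j. ?M g.He ?B i j + g.Ho i j)"
    unfolding Pm_def mm_add cross[OF ev_p(3)] cross[OF ev_mm[OF ev_p(1,2)]] g.mm_Ho by simp
  also have "?M g.He ?B = ?M (pg \<alpha> \<beta>) (ph \<alpha> \<beta>)" unfolding mm_assoc[symmetric] swp ..
  finally have 1: "?M gm Pm = (\<lambda>i j. ?M (pg \<alpha> \<beta>) (ph \<alpha> \<beta>) i j + g.Ho i j)" .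
  have "?M (?M (ph \<alpha> \<beta>) (pg \<beta> \<alpha>)) (?M (pg \<alpha> \<beta>) (ph \<alpha> \<beta>)) = ?M (ph \<alpha> \<beta>) (?M (?M (pg \<beta> \<alpha>) (pg \<alpha> \<beta>)) (ph \<alpha> \<beta>))"
    by (simp only: mm_assoc)
  also have "\<dots> = h.He" unfolding inv1 mIe[OF ev_p(2)] sq ..
  finally have 2: "?M (?M (ph \<alpha> \<beta>) (pg \<beta> \<alpha>)) (?M (pg \<alpha> \<beta>) (ph \<alpha> \<beta>)) = h.He" .
  show ?thesis unfolding 1 Pt_def block[OF ev_mm[OF ev_p(2,1)] ev_mm[OF ev_p(1,2)]] 2 cross[OF ev_mm[OF ev_p(2,1)]] g.mm_Ho by (simp add: gsplit(2)[symmetric])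
qed
lemma PhP: "mm (dimN m n) Pm (mm (dimN m n) hc Pt) = gm"
proof -
  let ?M = "mm (dimN m n)"
  let ?B = "?M (ph \<alpha> \<beta>) (pg \<beta> \<alpha>)"
  have "?M hc Pt = ?M (\<lambda>i j. h.He i j + g.Ho i j) Pt" by (rule arg_cong[OF gsplit(2), of "\<lambda>X. ?M X Pt"])
  also have "\<dots> = (\<lambda>i j. ?M h.He ?B i j + g.Ho i j)"
    unfolding Pt_def mm_add cross[OF ev_p(4)] cross[OF ev_mm[OF ev_p(2,1)]] g.mm_Ho by simp
  also have "?M h.He ?B = ?M (ph \<beta> \<alpha>) (pg \<beta> \<alpha>)" unfolding mm_assoc[symmetric] swp ..
  finally have 1: "?M hc Pt = (\<lambda>i j. ?M (ph \<beta> \<alpha>) (pg \<beta> \<alpha>) i j + g.Ho i j)" .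
  have "?M (?M (pg \<beta> \<alpha>) (ph \<alpha> \<beta>)) (?M (ph \<beta> \<alpha>) (pg \<beta> \<alpha>)) = ?M (pg \<beta> \<alpha>) (?M (?M (ph \<alpha> \<beta>) (ph \<beta> \<alpha>)) (pg \<beta> \<alpha>))"
    by (simp only: mm_assoc)
  also have "\<dots> = g.He" unfolding inv1 mIe[OF ev_p(1)] sq ..
  finally have 2: "?M (?M (pg \<beta> \<alpha>) (ph \<alpha> \<beta>)) (?M (ph \<beta> \<alpha>) (pg \<beta> \<alpha>)) = g.He" .
  show ?thesis unfolding 1 Pm_def block[OF ev_mm[OF ev_p(1,2)] ev_mm[OF ev_p(2,1)]] 2 cross[OF ev_mm[OF ev_p(1,2)]] g.mm_Ho by (simp add: gsplit(1)[symmetric])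
qed

lemma canonical_basis:
  assumes M: "int m - 2 * int n > 2" shows "full m n gm hc Pm Rm"
proof -
  have Pe: "mm (dimN m n) (pg \<beta> \<alpha>) (ph \<alpha> \<beta>) i a \<noteq> 0 \<Longrightarrow> i < m \<and> a < m" for i a
    using ev_mm[OF ev_p(1,2)] unfolding ev_def by blast
  have nz: "(i < m \<and> a < m) \<or> (i = a \<and> m \<le> i \<and> i < dimN m n)" if "Pm i a \<noteq> 0" for i a
    using that Pe[of i a] unfolding Pm_def g.Io_def by (auto split: if_splits)
  have 1: "ospl.pr m n i = ospl.pr m n a" if "Pm i a \<noteq> 0" for i a using nz[OF that] by (auto simp: g.pr_def)
  have 2: "\<not> a < dimN m n \<Longrightarrow> Pm i a = 0" "\<not> i < dimN m n \<Longrightarrow> Pm i a = 0" for i a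
    using nz[of i a] by (auto simp: dimN_def)
  have 3: "(\<Sum>j<dimN m n. \<Sum>k<dimN m n. Pm j b * Pm k c * gm k j) = hc c b" for b c
  proof -
    have "(\<Sum>j<dimN m n. \<Sum>k<dimN m n. Pm j b * Pm k c * gm k j) = (\<Sum>k<dimN m n. \<Sum>j<dimN m n. Pm j b * Pm k c * gm k j)" by (rule sum.swap)
    also have "\<dots> = mm (dimN m n) Pt (mm (dimN m n) gm Pm) c b" unfolding mm_def Pt by (simp add: sum_distrib_left mult_ac)
    finally show ?thesis unfolding PgP .
  qed
  have 4: "(\<Sum>b<dimN m n. \<Sum>c<dimN m n. hc b c * (Pm j b * Pm k c)) = gm j k" for j k
  proof -
    have "(\<Sum>b<dimN m n. \<Sum>c<dimN m n. hc b c * (Pm j b * Pm k c)) = mm (dimN m n) Pm (mm (dimN m n) hc Pt) j k"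
      unfolding mm_def Pt by (simp add: sum_distrib_left mult_ac)
    then show ?thesis unfolding PhP .
  qed
  have id: "g.Ie i j + g.Io i j = (if i = j then 1 else 0)" if "i < dimN m n" for i j using that by (auto simp: g.Ie_def g.Io_def)
  have 5: "(\<Sum>a<dimN m n. Pm k a * Rm a i) = (if k = i then 1 else 0)" "(\<Sum>a<dimN m n. Rm k a * Pm a i) = (if k = i then 1 else 0)" if "k < dimN m n" for k i
    using PR_id[THEN fun_cong, THEN fun_cong, of k i] id[OF that] unfolding mm_def by simp_all
  interpret canon m n hc using m7 M by unfold_locales (auto simp: hc_def)
  show ?thesis by unfold_locales ((rule 3 4 | (rule 1 2 5; assumption))+)
qed

end

theorem theorem5p4:
  fixes m n :: nat and gm :: tensor2 and K :: "talg set"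
  assumes "m > 4" and "n > 1" and "int m - 2 * int n > 2"
    and "osp_metric m n gm"
    and "is_tideal (dimN m n) K"
    and "tideal_gen (dimN m n) (U_rels m n gm) \<subseteq> K"
    and "inf_codim (dimN m n) K"
    and "gr2 m K \<inter> cartan1 m n gm = {zero4}"
    and "{(\<lambda>a b c d. V a b c d + W a b c d) | V W. V \<in> gr2 m K \<and> W \<in> cartan1 m n gm}
           = sym2g m n"
  shows "K = joseph_T m n gm"
proof -
  \<comment> \<open>From \<open>2 * n \<ge> 4\<close> and \<open>m - 2 * n \<ge> 3\<close>.\<close>
  have "m \<ge> 7" using assms(2,3) by simp
  then show ?thesis by (rule full.eq_joseph[OF canonical_basis[OF assms(4) _ assms(3)] assms(5-9)])
qed

end
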